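(* Let $K=\mathbf Q(\sqrt{-3})$ and let $f^k_\alpha$ be as in the context. Fix $k\ge2$ and $\alpha\in\mathbf Q^\times$. Then $\delta_3(f^k_\alpha)=1$ if $\alpha\in\mathbf Q^{\times 3}$, and $\delta_3(f^k_\alpha)=\tfrac59$ if $\alpha\notin\mathbf Q^{\times3}$.
   Context: For a newform $f=\sum a_nq^n$ with rational coefficients and $m\ge2$, $\delta_m(f)$ is the Dirichlet density of $\{p\equiv 1\pmod m: a_p \text{ is a nonzero } m\text{-th power mod } p\}$ divided by the Dirichlet density of $\{p\equiv 1\pmod m: a_p\not\equiv 0\pmod p\}$. Let $\mathcal O=\mathbf Z[\mu_6]$; for a prime $\mathfrak q$ of $\mathcal O$ with residue field of order $q\equiv 1\pmod 6$, $(x/\mathfrak q)_6$ is the unique sixth root of unity congruent to $x^{(q-1)/6}$ mod $\mathfrak q$. $\psi$ is the Hecke character of $K$, unramified away from $3$, with $\psi(\mathfrak q)$ the unique generator of $\mathfrak q$ congruent to $1$ mod $3$ for primes $\mathfrak q$ prime to $3$. $\psi^k_\alpha$ is the Hecke character unramified away from $3$ and $\alpha$ with $\psi^k_\alpha(\mathfrak q)=\psi(\mathfrak q)^{k-1}(-1/\mathfrak q)_6^{k-1}(\alpha/\mathfrak q)_6$ for primes $\mathfrak q$ prime to $3\alpha$. The series $g^k_\alpha=\sum_{(\mathfrak a,3)=(\mathfrak a,\alpha)=1}\psi^k_\alpha(\mathfrak a)q^{N\mathfrak a}$ is a weight $k$ cusp form and eigenform for $T_n$, $n$ prime to $3\alpha$;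 $f^k_\alpha$ is the associated normalized newform (same coefficients at $n$ prime to $3\alpha$), with rational coefficients. *)

theory Defs
  imports "HOL-Complex_Analysis.Complex_Analysis" "HOL-Algebra.Ideal_Product" "HOL-Algebra.QuotRing"
    "HOL-Number_Theory.Cong"
begin

section \<open>Cusp forms and newforms\<close>

definition upper_half_plane :: "complex set" where
  "upper_half_plane = {z. Im z > 0}"

text \<open>The tuple \<open>(a, b, c, d)\<close> is the matrix with rows \<open>(a, b)\<close> and \<open>(c, d)\<close>.\<close>

type_synonym mat2 = "int \<times> int \<times> int \<times> int"

definition SL2Z :: "mat2 set" where
  "SL2Z = {(a, b, c, d). a * d - b * c = 1}"

definition Gamma0 :: "nat \<Rightarrow> mat2 set" where
  "Gamma0 N = {(a, b, c, d). (a, b, c, d) \<in> SL2Z \<and> [c = 0] (mod int N)}"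

definition Gamma1 :: "nat \<Rightarrow> mat2 set" where
  "Gamma1 N = {(a, b, c, d). (a, b, c, d) \<in> SL2Z \<and>
     [a = 1] (mod int N) \<and> [d = 1] (mod int N) \<and> [c = 0] (mod int N)}"

fun mat2_mult :: "mat2 \<Rightarrow> mat2 \<Rightarrow> mat2" where
  "mat2_mult (a, b, c, d) (a', b', c', d') =
     (a * a' + b * c', a * b' + b * d', c * a' + d * c', c * b' + d * d')"

fun slash :: "nat \<Rightarrow> mat2 \<Rightarrow> (complex \<Rightarrow> complex) \<Rightarrow> complex \<Rightarrow> complex" where
  "slash k (a, b, c, d) f z =
     f ((of_int a * z + of_int b) / (of_int c * z + of_int d)) / (of_int c * z + of_int d) ^ k"

text \<open>Vanishing at a cusp is the condition that the slash translates tend to 0 as the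
  imaginary part tends to infinity, uniformly in the real part.\<close>

definition cusp_form :: "nat \<Rightarrow> nat \<Rightarrow> (complex \<Rightarrow> complex) \<Rightarrow> bool" where
  "cusp_form k N f \<longleftrightarrow>
     f holomorphic_on upper_half_plane \<and>
     (\<forall>g\<in>Gamma1 N. \<forall>z\<in>upper_half_plane. slash k g f z = f z) \<and>
     (\<forall>g\<in>SL2Z. (slash k g f \<longlongrightarrow> 0) (filtercomap Im at_top))"

definition qcoeff :: "(complex \<Rightarrow> complex) \<Rightarrow> nat \<Rightarrow> complex" where
  "qcoeff f = (THE a. \<forall>z\<in>upper_half_plane.
     (\<lambda>n. a n * exp (2 * of_real pi * \<i> * of_nat n * z)) sums f z)"

definition fund_domain :: "complex set" where
  "fund_domain = {z. Im z > 0 \<and> \<bar>Re z\<bar> \<le> 1 / 2 \<and> norm z \<ge> 1}"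

text \<open>The Petersson product on \<open>\<Gamma>\<^sub>1(N)\<close>, up to a positive normalising constant: a fundamental
  domain is assembled from translates of that of \<open>SL\<^sub>2(\<int>)\<close>, one for each right coset of
  \<open>\<Gamma>\<^sub>1(N)\<close>. The summand does not depend on the representative.\<close>

definition petersson ::
    "nat \<Rightarrow> nat \<Rightarrow> (complex \<Rightarrow> complex) \<Rightarrow> (complex \<Rightarrow> complex) \<Rightarrow> complex" where
  "petersson k N f g =
     (\<Sum>C\<in>(\<lambda>s. (\<lambda>h. mat2_mult h s) ` Gamma1 N) ` SL2Z.
        let s = (SOME s. s \<in> C) in
        LINT z:fund_domain|lborel.
          slash k s f z * cnj (slash k s g z) * of_real (Im z ^ k / (Im z)\<^sup>2))"

text \<open>Generators of the space of oldforms of level \<open>N\<close>.\<close>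

definition oldform_generators :: "nat \<Rightarrow> nat \<Rightarrow> (complex \<Rightarrow> complex) set" where
  "oldform_generators k N =
     {(\<lambda>z. g (of_nat d * z)) | g M d. M * d dvd N \<and> M \<noteq> N \<and> cusp_form k M g}"

definition diamond_op :: "nat \<Rightarrow> nat \<Rightarrow> nat \<Rightarrow> (complex \<Rightarrow> complex) \<Rightarrow> complex \<Rightarrow> complex" where
  "diamond_op k N n f =
     slash k (SOME g. g \<in> Gamma0 N \<and> (case g of (a, b, c, d) \<Rightarrow> [d = int n] (mod int N))) f"

definition hecke_op :: "nat \<Rightarrow> nat \<Rightarrow> nat \<Rightarrow> (complex \<Rightarrow> complex) \<Rightarrow> complex \<Rightarrow> complex" where
  "hecke_op k N p f z =
     (\<Sum>b<p. f ((z + of_nat b) / of_nat p)) / of_nat p +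
     (if p dvd N then 0 else of_nat p ^ (k - 1) * diamond_op k N p f (of_nat p * z))"

text \<open>The operators \<open>T\<^sub>n\<close> are polynomials in the \<open>T\<^sub>p\<close> (\<open>p\<close> prime) and the diamond operators.\<close>

definition hecke_eigenform :: "nat \<Rightarrow> nat \<Rightarrow> (complex \<Rightarrow> complex) \<Rightarrow> bool" where
  "hecke_eigenform k N f \<longleftrightarrow>
     (\<forall>p. prime p \<longrightarrow> (\<exists>c. \<forall>z\<in>upper_half_plane. hecke_op k N p f z = c * f z)) \<and>
     (\<forall>n. coprime n N \<longrightarrow> (\<exists>c. \<forall>z\<in>upper_half_plane. diamond_op k N n f z = c * f z))"

definition newform :: "nat \<Rightarrow> nat \<Rightarrow> (complex \<Rightarrow> complex) \<Rightarrow> bool" where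
  "newform k N f \<longleftrightarrow>
     N > 0 \<and> cusp_form k N f \<and> hecke_eigenform k N f \<and> qcoeff f 1 = 1 \<and>
     (\<forall>g\<in>oldform_generators k N. petersson k N f g = 0)"


section \<open>Dirichlet density and the ratio \<open>\<delta>\<^sub>m\<close>\<close>

definition has_dirichlet_density :: "nat set \<Rightarrow> real \<Rightarrow> bool" where
  "has_dirichlet_density S d \<longleftrightarrow>
     ((\<lambda>s. (\<Sum>\<^sub>\<infinity>p\<in>{p\<in>S. prime p}. real p powr (- s)) /
           (\<Sum>\<^sub>\<infinity>p\<in>{p. prime p}. real p powr (- s))) \<longlongrightarrow> d) (at_right 1)"

text \<open>\<open>x\<close> is a \<open>p\<close>-integral rational number (as a complex number) and is congruent to the
  integer \<open>y\<close> modulo \<open>p\<close>.\<close>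

definition rat_cong :: "nat \<Rightarrow> complex \<Rightarrow> int \<Rightarrow> bool" where
  "rat_cong p x y \<longleftrightarrow>
     (\<exists>a b :: int. \<not> int p dvd b \<and> x = of_int a / of_int b \<and> [a = b * y] (mod int p))"

text \<open>\<open>\<delta>\<^sub>m(f)\<close> exists and equals \<open>d\<close>; both densities are required to exist.\<close>

definition has_delta :: "nat \<Rightarrow> (complex \<Rightarrow> complex) \<Rightarrow> real \<Rightarrow> bool" where
  "has_delta m f d \<longleftrightarrow>
     (\<exists>d1 d2.
        has_dirichlet_density
          {p. prime p \<and> [p = 1] (mod m) \<and> (\<exists>x. \<not> int p dvd x \<and> rat_cong p (qcoeff f p) (x ^ m))} d1 \<and>
        has_dirichlet_density
          {p. prime p \<and> [p = 1] (mod m) \<and> \<not> rat_cong p (qcoeff f p) 0} d2 \<and>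
        d2 \<noteq> 0 \<and> d = d1 / d2)"


section \<open>Ideals of \<open>\<int>[\<mu>\<^sub>6]\<close>\<close>

definition Zmu6 :: "complex ring" where
  "Zmu6 = \<lparr>carrier = {of_int a + of_int b * cis (pi / 3) | a b :: int. True},
           mult = (*), one = 1, zero = 0, add = (+)\<rparr>"

definition nz_ideal :: "complex set \<Rightarrow> bool" where
  "nz_ideal I \<longleftrightarrow> ideal I Zmu6 \<and> I \<noteq> {0}"

definition nz_prime :: "complex set \<Rightarrow> bool" where
  "nz_prime Q \<longleftrightarrow> primeideal Q Zmu6 \<and> Q \<noteq> {0}"

definition idl_norm :: "complex set \<Rightarrow> nat" where
  "idl_norm I = card (carrier (Zmu6 Quot I))"

definition idl_coprime :: "complex set \<Rightarrow> complex set \<Rightarrow> bool" where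
  "idl_coprime I J \<longleftrightarrow> I <+>\<^bsub>Zmu6\<^esub> J = carrier Zmu6"

definition princ :: "complex \<Rightarrow> complex set" where
  "princ x = genideal Zmu6 {x}"

text \<open>The primes occurring in the fractional ideal \<open>(\<alpha>)\<close> are those dividing this integer
  (numerator times denominator), both in \<open>\<int>\<close> and in \<open>\<int>[\<mu>\<^sub>6]\<close>.\<close>

definition rat_supp :: "rat \<Rightarrow> int" where
  "rat_supp \<alpha> = fst (quotient_of \<alpha>) * snd (quotient_of \<alpha>)"


section \<open>Hecke characters\<close>

text \<open>Hecke characters of \<open>\<rat>(\<surd>-3)\<close> as functions on nonzero integral ideals, extended by zero to
  ideals not prime to the modulus \<open>M\<close>. The function of \<open>x\<close> on the right is the general
  continuous character of the multiplicative group of complex numbers.\<close>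

definition hecke_character :: "complex set \<Rightarrow> (complex set \<Rightarrow> complex) \<Rightarrow> bool" where
  "hecke_character M h \<longleftrightarrow>
     nz_ideal M \<and>
     (\<forall>I. nz_ideal I \<longrightarrow> (h I \<noteq> 0 \<longleftrightarrow> idl_coprime I M)) \<and>
     (\<forall>I J. nz_ideal I \<longrightarrow> nz_ideal J \<longrightarrow> h (ideal_prod Zmu6 I J) = h I * h J) \<and>
     (\<exists>(u::int) (s::complex). \<forall>x\<in>carrier Zmu6. x \<noteq> 0 \<longrightarrow> x - 1 \<in> M \<longrightarrow>
        h (princ x) = sgn x powi u * complex_of_real (norm x) powr s)"

text \<open>\<open>(x/Q)\<^sub>6\<close> for \<open>x\<close> in the localisation of \<open>\<int>[\<mu>\<^sub>6]\<close> at \<open>Q\<close>; meaningful when the norm of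
  \<open>Q\<close> is 1 mod 6 and \<open>x\<close> is a unit at \<open>Q\<close>.\<close>

definition sextic :: "complex \<Rightarrow> complex set \<Rightarrow> complex" where
  "sextic x Q = (THE z. z ^ 6 = 1 \<and>
     (\<exists>a\<in>carrier Zmu6. \<exists>b\<in>carrier Zmu6. b \<notin> Q \<and> x = a / b \<and>
        a ^ ((idl_norm Q - 1) div 6) - z * b ^ ((idl_norm Q - 1) div 6) \<in> Q))"

definition psi :: "complex set \<Rightarrow> complex" where
  "psi Q = (THE x. x \<in> carrier Zmu6 \<and> Q = princ x \<and> x - 1 \<in> princ 3)"

text \<open>\<open>h\<close> is the Hecke character \<open>\<psi>\<^sup>k\<^sub>\<alpha>\<close>. The prime \<open>(2)\<close> has norm 4, so the sextic symbol is not
  defined there, and the character may ramify at 2 even if \<open>\<alpha>\<close> is odd (for instance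
  \<open>k = 2\<close>, \<open>\<alpha> = 1\<close>). Hence the formula is imposed at the primes not dividing \<open>6\<alpha>\<close>, which
  determine the character, and the modulus may involve 2.\<close>

definition is_psi_twist :: "nat \<Rightarrow> rat \<Rightarrow> (complex set \<Rightarrow> complex) \<Rightarrow> bool" where
  "is_psi_twist k \<alpha> h \<longleftrightarrow>
     (\<exists>M. hecke_character M h \<and>
        (\<forall>Q. nz_prime Q \<longrightarrow> M \<subseteq> Q \<longrightarrow> of_int (6 * rat_supp \<alpha>) \<in> Q)) \<and>
     (\<forall>Q. nz_prime Q \<longrightarrow> of_int (6 * rat_supp \<alpha>) \<notin> Q \<longrightarrow>
        h Q = psi Q ^ (k - 1) * sextic (-1) Q ^ (k - 1) * sextic (of_rat \<alpha>) Q)"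

text \<open>The coefficients of the series \<open>g\<^sup>k\<^sub>\<alpha>\<close>, with \<open>h\<close> in the role of \<open>\<psi>\<^sup>k\<^sub>\<alpha>\<close>.\<close>

definition g_coeff :: "rat \<Rightarrow> (complex set \<Rightarrow> complex) \<Rightarrow> nat \<Rightarrow> complex" where
  "g_coeff \<alpha> h n =
     (\<Sum>I\<in>{I. nz_ideal I \<and> idl_norm I = n \<and> idl_coprime I (princ (of_int (3 * rat_supp \<alpha>)))}. h I)"

definition is_f :: "nat \<Rightarrow> rat \<Rightarrow> (complex \<Rightarrow> complex) \<Rightarrow> bool" where
  "is_f k \<alpha> f \<longleftrightarrow>
     (\<exists>N. newform k N f) \<and>
     (\<exists>h. is_psi_twist k \<alpha> h \<and>
        (\<forall>n. coprime (int n) (3 * rat_supp \<alpha>) \<longrightarrow> qcoeff f n = g_coeff \<alpha> h n))"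

end

theory Submission
  imports Defs "HOL-Number_Theory.Number_Theory" "HOL-Real_Asymp.Real_Asymp"
begin

text \<open>Let \<open>p \<equiv> 1 (mod 3)\<close> be prime to the conductor, \<open>p = q q'\<close> with \<open>q \<equiv> q' \<equiv> 1 (mod 3)\<close> conjugate. Then
  \<open>a\<^sub>p = h(q) + h(q') \<equiv> h(q') (mod q)\<close>, and \<open>h(q')\<close> is a power of \<open>q'\<close> times a unit. The factor \<open>q'\<close> is a cube
  modulo \<open>q\<close>, because \<open>q\<close> is up to sign a cubic Jacobi sum. Hence \<open>p\<close> does not divide \<open>a\<^sub>p\<close>, and \<open>a\<^sub>p\<close> is a cube modulo
  \<open>p\<close> iff the unit is, that is, iff \<open>p \<equiv> 1 (mod 9)\<close> or \<open>\<alpha>\<close> is a cube modulo \<open>q\<close>: one of two cubic characters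
  of \<open>\<int>[\<mu>\<^sub>6]\<close> is trivial at \<open>q\<close>. If \<open>\<alpha>\<close> is a cube, this always holds. Otherwise the characters are independent,
  their \<open>L\<close>-functions do not vanish at 1, and the density is \<open>1 - (2/3)\<^sup>2 = 5/9\<close>. That the second character is
  nontrivial for \<open>\<alpha>\<close> not a cube is seen by counting ideals of the pure cubic order: a set of primes modulo which a
  noncube has three cube roots has density at most 1/3, whereas the split primes have density 1/2.\<close>

section \<open>Eisenstein integers\<close>

text \<open>The weight drops out because the conjugate generator is itself a cube modulo
  \<open>q\<close>, and the signs because \<open>(p - 1) div 3\<close> is even. At every unramified
  split prime \<open>p\<close> does not divide the coefficient, so the denominator of the ratio is
  the density 1/2 of the split primes; the numerators are 1/2 and 5/18.

  Two obstacles shape the rest. The L-functions are handled for real \<open>s > 1\<close> only: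
  logarithms of their norms are known up to errors bounded uniformly in \<open>s\<close>, and a
  Lipschitz bound in \<open>s\<close> replaces continuation to 1. Hence the working notion is an
  asymptotic with bounded error, which survives the linear combinations of a Fourier expansion on
  pairs of cube roots of unity.

  The second character is read off from the Hecke character, so the only values known in advance are
  those at rational integers, where it is 1. This settles the products that involve the first
  character, since an integer suffices as a witness, but says nothing about the second character
  alone. There the pure cubic order enters, and an upper bound for a density is all that it has to
  supply.\<close>

text \<open>\<open>Eis a b\<close> stands for \<open>a + b\<omega>\<close> with \<open>\<omega> = exp(\<pi>i/3)\<close>, so that \<open>\<omega>\<^sup>2 = \<omega> - 1\<close>.\<close>

datatype eis = Eis (eis_fst: int) (eis_snd: int)

instantiation eis :: comm_ring_1
begin

definition "0 = Eis 0 0"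
definition "1 = Eis 1 0"
definition "x + y = Eis (eis_fst x + eis_fst y) (eis_snd x + eis_snd y)"
definition "- x = Eis (- eis_fst x) (- eis_snd x)"
definition "x - y = Eis (eis_fst x - eis_fst y) (eis_snd x - eis_snd y)"
definition "x * y = Eis (eis_fst x * eis_fst y - eis_snd x * eis_snd y)
  (eis_fst x * eis_snd y + eis_snd x * eis_fst y + eis_snd x * eis_snd y)"

instance
  by standard (auto simp: zero_eis_def one_eis_def plus_eis_def uminus_eis_def minus_eis_def
      times_eis_def algebra_simps)

end

lemma eis_simps [simp]:
  "Eis a b + Eis c d = Eis (a + c) (b + d)"
  "Eis a b - Eis c d = Eis (a - c) (b - d)"
  "- Eis a b = Eis (- a) (- b)"
  "Eis a b * Eis c d = Eis (a * c - b * d) (a * d + b * c + b * d)"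
  "Eis a b = 0 \<longleftrightarrow> a = 0 \<and> b = 0"
  "Eis a b = 1 \<longleftrightarrow> a = 1 \<and> b = 0"
  by (auto simp: zero_eis_def one_eis_def plus_eis_def uminus_eis_def minus_eis_def times_eis_def)

lemma eis_sel_simps [simp]:
  "eis_fst 0 = 0" "eis_snd 0 = 0" "eis_fst 1 = 1" "eis_snd 1 = 0"
  "eis_fst (x + y) = eis_fst x + eis_fst y" "eis_snd (x + y) = eis_snd x + eis_snd y"
  "eis_fst (x - y) = eis_fst x - eis_fst y" "eis_snd (x - y) = eis_snd x - eis_snd y"
  "eis_fst (- x) = - eis_fst x" "eis_snd (- x) = - eis_snd x"
  by (auto simp: zero_eis_def one_eis_def plus_eis_def minus_eis_def uminus_eis_def)

lemma of_nat_eis: "of_nat n = Eis (int n) 0"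
  by (induction n) (auto simp: zero_eis_def one_eis_def)

lemma of_int_eis: "of_int n = Eis n 0"
  by (cases n) (auto simp: of_nat_eis zero_eis_def one_eis_def)

lemma numeral_eis: "numeral n = Eis (numeral n) 0"
  using of_int_eis[of "numeral n"] by simp

definition eis_norm :: "eis \<Rightarrow> int" where
  "eis_norm x = eis_fst x ^ 2 + eis_fst x * eis_snd x + eis_snd x ^ 2"

definition eis_cnj :: "eis \<Rightarrow> eis" where
  "eis_cnj x = Eis (eis_fst x + eis_snd x) (- eis_snd x)"

lemma eis_norm_Eis: "eis_norm (Eis a b) = a\<^sup>2 + a * b + b\<^sup>2"
  by (simp add: eis_norm_def)

lemma eis_norm_max: "4 * eis_norm x \<ge> 3 * (eis_fst x)\<^sup>2" "4 * eis_norm x \<ge> 3 * (eis_snd x)\<^sup>2"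
proof -
  have "4 * eis_norm x = (eis_fst x + 2 * eis_snd x)\<^sup>2 + 3 * (eis_fst x)\<^sup>2"
    "4 * eis_norm x = (2 * eis_fst x + eis_snd x)\<^sup>2 + 3 * (eis_snd x)\<^sup>2"
    by (simp_all add: eis_norm_def power2_eq_square algebra_simps)
  then show "4 * eis_norm x \<ge> 3 * (eis_fst x)\<^sup>2" "4 * eis_norm x \<ge> 3 * (eis_snd x)\<^sup>2"
    by (metis add.commute le_add_same_cancel1 zero_le_power2)+
qed

lemma eis_norm_nonneg [simp]: "eis_norm x \<ge> 0"
  using eis_norm_max(1)[of x] zero_le_power2[of "eis_fst x"] by linarith

lemma eis_norm_eq_0_iff [simp]: "eis_norm x = 0 \<longleftrightarrow> x = 0"
proof
  assume "eis_norm x = 0"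
  then have "(eis_fst x)\<^sup>2 \<le> 0" "(eis_snd x)\<^sup>2 \<le> 0" using eis_norm_max[of x] by auto
  then show "x = 0" by (cases x) auto
qed (simp add: eis_norm_def)

lemma eis_norm_pos [simp]: "eis_norm x > 0 \<longleftrightarrow> x \<noteq> 0"
  using eis_norm_nonneg[of x] eis_norm_eq_0_iff[of x] by linarith

lemma eis_norm_0 [simp]: "eis_norm 0 = 0" and eis_norm_1 [simp]: "eis_norm 1 = 1"
  by (simp_all add: eis_norm_def)

lemma eis_norm_mult: "eis_norm (x * y) = eis_norm x * eis_norm y"
  by (cases x; cases y) (simp add: eis_norm_Eis power2_eq_square algebra_simps)

lemma eis_norm_power: "eis_norm (x ^ n) = eis_norm x ^ n"
  by (induction n) (simp_all add: eis_norm_mult)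

lemma eis_norm_of_int [simp]: "eis_norm (of_int n) = n\<^sup>2"
  by (simp add: of_int_eis eis_norm_Eis)

lemma eis_mult_cnj: "x * eis_cnj x = of_int (eis_norm x)"
  by (cases x) (simp add: eis_norm_Eis eis_cnj_def of_int_eis power2_eq_square algebra_simps)

lemma eis_cnj_simps [simp]:
  "eis_cnj (x + y) = eis_cnj x + eis_cnj y" "eis_cnj (x - y) = eis_cnj x - eis_cnj y"
  "eis_cnj (- x) = - eis_cnj x" "eis_cnj (x * y) = eis_cnj x * eis_cnj y"
  "eis_cnj 0 = 0" "eis_cnj 1 = 1" "eis_cnj (eis_cnj x) = x" "eis_cnj (of_int n) = of_int n"
  "eis_norm (eis_cnj x) = eis_norm x"
  by (cases x; cases y; simp add: eis_cnj_def eis_norm_Eis of_int_eis zero_eis_def one_eis_def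
      power2_eq_square algebra_simps)+

lemma eis_cnj_power [simp]: "eis_cnj (x ^ n) = eis_cnj x ^ n"
  by (induction n) simp_all

lemma eis_cnj_eq_iff [simp]: "eis_cnj x = eis_cnj y \<longleftrightarrow> x = y"
  by (metis eis_cnj_simps(7))

lemma eis_cnj_dvd_iff: "eis_cnj x dvd eis_cnj y \<longleftrightarrow> x dvd y"
proof -
  have "eis_cnj x dvd eis_cnj y" if "x dvd y" for x y using that by (auto simp: dvd_def)
  from this[of x y] this[of "eis_cnj x" "eis_cnj y"] show ?thesis by auto
qed

lemma eis_norm_dvd: "x dvd y \<Longrightarrow> eis_norm x dvd eis_norm y"
  by (auto simp: dvd_def eis_norm_mult)

lemma eis_dvd_norm: "x dvd of_int (eis_norm x)"
  by (metis dvd_triv_left eis_mult_cnj)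

lemma of_int_dvd_eis_iff:
  "of_int n dvd x \<longleftrightarrow> n dvd eis_fst x \<and> n dvd eis_snd x"
proof
  assume "n dvd eis_fst x \<and> n dvd eis_snd x"
  then obtain a b where "eis_fst x = n * a" "eis_snd x = n * b" by (auto simp: dvd_def)
  then have "x = of_int n * Eis a b" by (cases x) (simp add: of_int_eis)
  then show "of_int n dvd x" by simp
qed (auto simp: dvd_def of_int_eis times_eis_def)

section \<open>Euclidean division and units\<close>

instantiation eis :: "{idom_modulo, normalization_semidom, euclidean_ring}"
begin

text \<open>The integer nearest to \<open>a / n\<close>, written as floor(a/n + 1/2). Rounding to
  the nearest integer keeps both coordinates of the remainder within n/2, which makes the division
  Euclidean.\<close>

definition eis_round :: "int \<Rightarrow> int \<Rightarrow> int" where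
  "eis_round a n = (2 * a + n) div (2 * n)"

definition "x div y = (if y = 0 then 0 else
  Eis (eis_round (eis_fst (x * eis_cnj y)) (eis_norm y)) (eis_round (eis_snd (x * eis_cnj y)) (eis_norm y)))"
definition "x mod (y :: eis) = x - x div y * y"
definition "euclidean_size x = nat (eis_norm x)"

text \<open>The units are the powers of \<open>\<omega>\<close>; the normalised elements are \<open>0\<close> and the \<open>a + b\<omega>\<close> with
  \<open>a > 0\<close> and \<open>b \<ge> 0\<close>, a sector of angle \<open>\<pi>/3\<close>.\<close>

definition "unit_factor x = (let a = eis_fst x; b = eis_snd x in
  if x = 0 then 0
  else if a > 0 \<and> b \<ge> 0 then 1
  else if a \<le> 0 \<and> a + b > 0 then Eis 0 1
  else if a + b \<le> 0 \<and> b > 0 then Eis (-1) 1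
  else if a < 0 \<and> b \<le> 0 then - 1
  else if a \<ge> 0 \<and> a + b < 0 then Eis 0 (-1)
  else Eis 1 (-1))"
definition "normalize x = eis_cnj (unit_factor x) * x"

lemma eis_round_exact: "n > 0 \<Longrightarrow> eis_round (n * c) n = c"
  unfolding eis_round_def
  by (rule int_div_pos_eq[where r = n]) (simp_all add: algebra_simps)

lemma eis_round_bound:
  assumes n: "n > 0"
  shows "2 * \<bar>a - n * eis_round a n\<bar> \<le> n"
proof -
  define r where "r = (2 * a + n) mod (2 * n)"
  have "2 * a + n = 2 * (n * eis_round a n) + r" unfolding r_def eis_round_def
    using mult_div_mod_eq[of "2 * n" "2 * a + n"] by (simp only: mult.assoc)
  moreover have "0 \<le> r" "r < 2 * n" using n unfolding r_def by simp_all
  ultimately show ?thesis unfolding abs_if by (simp split: if_splits)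
qed

lemma eis_units: "(x :: eis) dvd 1 \<longleftrightarrow> x \<in> {1, Eis 0 1, Eis (-1) 1, - 1, Eis 0 (-1), Eis 1 (-1)}"
proof
  assume "x dvd 1"
  then have "eis_norm x dvd 1" using eis_norm_dvd by fastforce
  then have N: "eis_norm x = 1" using eis_norm_nonneg[of x] by simp
  obtain a b where x: "x = Eis a b" by (cases x)
  have "3 * a\<^sup>2 \<le> 4" "3 * b\<^sup>2 \<le> 4" using eis_norm_max[of x] N x by simp_all
  have bd: "c \<in> {-1, 0, 1}" if "3 * c\<^sup>2 \<le> 4" for c :: int
  proof (rule ccontr)
    assume "c \<notin> {-1, 0, 1}"
    then have "2 \<le> \<bar>c\<bar>" by auto
    then have "2\<^sup>2 \<le> \<bar>c\<bar>\<^sup>2" by (intro power_mono) auto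
    with that show False by simp
  qed
  from bd[OF \<open>3 * a\<^sup>2 \<le> 4\<close>] bd[OF \<open>3 * b\<^sup>2 \<le> 4\<close>] N
  show "x \<in> {1, Eis 0 1, Eis (-1) 1, - 1, Eis 0 (-1), Eis 1 (-1)}"
    by (auto simp: x eis_norm_Eis one_eis_def)
next
  assume "x \<in> {1, Eis 0 1, Eis (-1) 1, - 1, Eis 0 (-1), Eis 1 (-1)}"
  then have "x * eis_cnj x = 1" by (auto simp: eis_cnj_def one_eis_def)
  then show "x dvd 1" by (metis dvd_triv_left)
qed

lemma unit_factor_eis_unit: "x \<noteq> 0 \<Longrightarrow> unit_factor (x :: eis) \<in> {1, Eis 0 1, Eis (-1) 1, - 1, Eis 0 (-1), Eis 1 (-1)}"
  by (auto simp: unit_factor_eis_def Let_def)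

instance
proof
  fix a b c :: eis
  show "a * b \<noteq> 0" if "a \<noteq> 0" "b \<noteq> 0"
  proof -
    have "eis_norm (a * b) \<noteq> 0" using that by (simp add: eis_norm_mult)
    then show ?thesis by auto
  qed
  show "a * b div b = a" if "b \<noteq> 0"
  proof -
    have "a * b * eis_cnj b = a * of_int (eis_norm b)" by (simp add: mult.assoc eis_mult_cnj)
    then have "eis_fst (a * b * eis_cnj b) = eis_norm b * eis_fst a"
      "eis_snd (a * b * eis_cnj b) = eis_norm b * eis_snd a"
      by (simp_all add: of_int_eis times_eis_def)
    with that show ?thesis by (simp add: divide_eis_def eis_round_exact)
  qed
  show "a div 0 = 0" by (simp add: divide_eis_def)
  show "a div b * b + a mod b = a" by (simp add: modulo_eis_def)
  show "euclidean_size (0::eis) = 0" by (simp add: euclidean_size_eis_def)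
  show "euclidean_size a \<le> euclidean_size (a * b)" if "b \<noteq> 0"
  proof -
    have "eis_norm b \<ge> 1" using that eis_norm_pos[of b] by linarith
    then have "eis_norm a * 1 \<le> eis_norm a * eis_norm b" by (intro mult_left_mono) auto
    then show ?thesis by (simp add: euclidean_size_eis_def eis_norm_mult)
  qed
  show "euclidean_size (a mod b) < euclidean_size b" if "b \<noteq> 0"
  proof -
    define n where "n = eis_norm b"
    have n: "n > 0" using that n_def by simp
    define q where "q = a div b"
    \<comment> \<open>The remainder times the conjugate of \<open>b\<close>, which clears
      denominators. Its coordinates are at most n/2 in absolute value, so its norm is at most 3/4
      n^2, while it equals n times the norm of the remainder.\<close>
    define e where "e = a * eis_cnj b - q * of_int n"
    obtain u v where uv: "e = Eis u v" by (cases e)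
    have "u = eis_fst (a * eis_cnj b) - n * eis_round (eis_fst (a * eis_cnj b)) n"
      "v = eis_snd (a * eis_cnj b) - n * eis_round (eis_snd (a * eis_cnj b)) n"
      using uv that unfolding e_def q_def divide_eis_def n_def
      by (simp_all add: of_int_eis minus_eis_def times_eis_def mult.commute)
    then have bd: "2 * \<bar>u\<bar> \<le> n" "2 * \<bar>v\<bar> \<le> n" using eis_round_bound[OF n] by simp_all
    have sq: "4 * u\<^sup>2 \<le> n\<^sup>2" "4 * v\<^sup>2 \<le> n\<^sup>2"
      using power_mono[OF bd(1), of 2] power_mono[OF bd(2), of 2] by (simp_all add: power_mult_distrib)
    have "0 \<le> (u - v)\<^sup>2" by simp
    then have "2 * (u * v) \<le> u\<^sup>2 + v\<^sup>2" by (simp add: power2_eq_square algebra_simps)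
    then have "8 * eis_norm e \<le> 6 * n\<^sup>2" using sq by (simp add: uv eis_norm_Eis)
    moreover have "n\<^sup>2 > 0" using n by simp
    ultimately have "eis_norm e < n\<^sup>2" by linarith
    moreover have "e = (a mod b) * eis_cnj b"
      unfolding e_def modulo_eis_def q_def n_def eis_mult_cnj[symmetric]
      by (simp only: left_diff_distrib mult.assoc)
    then have "eis_norm e = eis_norm (a mod b) * n" by (simp only: eis_norm_mult eis_cnj_simps n_def)
    ultimately have "eis_norm (a mod b) * n < n * n" by (simp only: power2_eq_square)
    with n have "eis_norm (a mod b) < n" by (simp only: mult_less_cancel_right_pos)
    with n show ?thesis unfolding euclidean_size_eis_def n_def by linarith
  qed
  show uf1: "unit_factor a dvd 1" if "a \<noteq> 0" for a :: eis
    using unit_factor_eis_unit[OF that] eis_units by blast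
  show "unit_factor (0::eis) = 0" by (simp add: unit_factor_eis_def)
  show "unit_factor a = a" if "a dvd 1"
    using that unfolding eis_units by (auto simp: unit_factor_eis_def one_eis_def)
  show "unit_factor (a * b) = a * unit_factor b" if "a dvd 1"
  proof (cases "b = 0")
    case False
    obtain u v where uv: "b = Eis u v" by (cases b)
    \<comment> \<open>Multiplication by \<omega> moves each of the six sectors to the next one.
      Since every unit is a power of \<omega>, this case gives the general one by induction.\<close>
    have rot: "unit_factor (Eis 0 1 * b) = Eis 0 1 * unit_factor b" if nz: "b \<noteq> 0" for b :: eis
    proof -
      obtain u v where uv: "b = Eis u v" by (cases b)
      consider "u > 0" "v \<ge> 0" | "u \<le> 0" "u + v > 0" | "u + v \<le> 0" "v > 0" | "u < 0" "v \<le> 0"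
        | "u \<ge> 0" "u + v < 0" | "u + v \<ge> 0" "v < 0"
        using nz[unfolded uv eis_simps] by linarith
      then show ?thesis
        by cases (simp_all add: unit_factor_eis_def Let_def one_eis_def uv)
    qed
    have "unit_factor (Eis 0 1 ^ n * b) = Eis 0 1 ^ n * unit_factor b" for n
    proof (induction n)
      case (Suc n)
      have "Eis 0 1 ^ n * b \<noteq> 0"
      proof -
        have "eis_norm (Eis 0 1 ^ n * b) = eis_norm b"
          by (simp add: eis_norm_mult eis_norm_power eis_norm_Eis)
        with False show ?thesis by (metis eis_norm_eq_0_iff)
      qed
      from rot[OF this] Suc show ?case by (simp add: mult.assoc)
    qed simp
    moreover have "\<exists>n. a = Eis 0 1 ^ n"
    proof -
      have "Eis 0 1 ^ 0 = 1" "Eis 0 1 ^ 1 = Eis 0 1" "Eis 0 1 ^ 2 = Eis (-1) 1" "Eis 0 1 ^ 3 = - 1"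
        "Eis 0 1 ^ 4 = Eis 0 (-1)" "Eis 0 1 ^ 5 = Eis 1 (-1)"
        by (simp_all add: numeral_eq_Suc one_eis_def)
      then show ?thesis using that unfolding eis_units insert_iff empty_iff by metis
    qed
    ultimately show ?thesis by blast
  qed (simp add: unit_factor_eis_def)
  show "unit_factor a * normalize a = a"
  proof (cases "a = 0")
    case False
    have "unit_factor a * eis_cnj (unit_factor a) = 1"
      using unit_factor_eis_unit[OF False] by (auto simp: eis_cnj_def one_eis_def)
    then show ?thesis by (metis mult.assoc mult_1 normalize_eis_def)
  qed (simp add: normalize_eis_def unit_factor_eis_def)
  show "normalize (0::eis) = 0" by (simp add: normalize_eis_def)
qed

end

instance eis :: normalization_euclidean_semiring ..

instantiation eis :: euclidean_ring_gcd
begin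
definition gcd_eis :: "eis \<Rightarrow> eis \<Rightarrow> eis" where "gcd_eis = Euclidean_Algorithm.gcd"
definition lcm_eis :: "eis \<Rightarrow> eis \<Rightarrow> eis" where "lcm_eis = Euclidean_Algorithm.lcm"
definition Gcd_eis :: "eis set \<Rightarrow> eis" where "Gcd_eis = Euclidean_Algorithm.Gcd"
definition Lcm_eis :: "eis set \<Rightarrow> eis" where "Lcm_eis = Euclidean_Algorithm.Lcm"
instance
  by standard (simp_all add: gcd_eis_def lcm_eis_def Gcd_eis_def Lcm_eis_def)
end

lemma eis_unit_iff_norm: "is_unit (x :: eis) \<longleftrightarrow> eis_norm x = 1"
proof
  assume "is_unit x"
  then have "eis_norm x dvd eis_norm 1" by (rule eis_norm_dvd)
  then show "eis_norm x = 1" using eis_norm_nonneg[of x] by simp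
next
  assume "eis_norm x = 1"
  then have "x * eis_cnj x = 1" by (simp add: eis_mult_cnj)
  then show "is_unit x" by (metis dvd_triv_left)
qed

lemma card_eis_units: "card {x :: eis. is_unit x} = 6"
proof -
  have "{x :: eis. is_unit x} = {1, Eis 0 1, Eis (-1) 1, - 1, Eis 0 (-1), Eis 1 (-1)}"
    using eis_units by blast
  then show ?thesis by (simp add: one_eis_def)
qed

no_notation Infinite_Set_Sum.abs_summable_on (infix \<open>abs'_summable'_on\<close> 50)

section \<open>Euler products\<close>

text \<open>The logarithm of an Euler factor is Re x + O(|x|^2). It is obtained from the real
  logarithm of |1 - x|^2 = 1 + t, so no branch of the complex logarithm occurs. With t - 4t^2 \<le>
  ln(1 + t) \<le> t and t^2 \<le> 25/4 |x|^2, the constant 13 leaves room.\<close>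

lemma norm_inverse_one_minus_bounds:
  fixes x :: complex
  assumes "norm x \<le> 1 / 2"
  shows "exp (Re x - 13 * (norm x)\<^sup>2) \<le> norm (1 / (1 - x))"
    and "norm (1 / (1 - x)) \<le> exp (Re x + 13 * (norm x)\<^sup>2)"
proof -
  define r where "r = norm x"
  define t where "t = r\<^sup>2 - 2 * Re x"
  have r: "0 \<le> r" "r \<le> 1 / 2" using assms by (auto simp: r_def)
  have Rex: "\<bar>Re x\<bar> \<le> r" unfolding r_def by (rule abs_Re_le_cmod)
  have sq: "(norm (1 - x))\<^sup>2 = 1 + t"
    unfolding t_def r_def cmod_power2 by (simp add: power2_eq_square algebra_simps)
  have "norm (1 - x) \<ge> norm (1 :: complex) - norm x" by (rule norm_triangle_ineq2)
  then have n1: "norm (1 - x) \<ge> 1 / 2" using r by (simp add: r_def)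
  have "(1 / 2)\<^sup>2 \<le> (norm (1 - x))\<^sup>2" by (rule power_mono[OF n1]) simp
  then have t1: "1 / 4 \<le> 1 + t" unfolding sq by (simp add: power2_eq_square)
  have rr: "r\<^sup>2 \<le> r / 2" using r mult_left_mono[OF r(2) r(1)] by (simp add: power2_eq_square)
  have "\<bar>t\<bar> \<le> 5 / 2 * r" unfolding t_def using Rex rr zero_le_power2[of r] by linarith
  then have "t\<^sup>2 \<le> (5 / 2 * r)\<^sup>2" using r by (intro power2_le_iff_abs_le[THEN iffD2]) auto
  then have t2: "t\<^sup>2 \<le> 25 / 4 * r\<^sup>2" by (simp add: power2_eq_square)
  have "ln (1 + t) \<le> t" using ln_le_minus_one[of "1 + t"] t1 by simp
  moreover have "ln (1 + t) \<ge> t - 4 * t\<^sup>2"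
  proof -
    have "ln (1 / (1 + t)) \<le> 1 / (1 + t) - 1" by (rule ln_le_minus_one) (use t1 in simp)
    moreover have "ln (1 / (1 + t)) = - ln (1 + t)" using t1 by (simp add: ln_div)
    moreover have "1 / (1 + t) - 1 = - t + t\<^sup>2 / (1 + t)"
      using t1 by (simp add: field_simps power2_eq_square)
    moreover have "t\<^sup>2 / (1 + t) \<le> t\<^sup>2 / (1 / 4)"
      by (rule divide_left_mono) (use t1 in auto)
    ultimately show ?thesis by simp
  qed
  moreover have "ln (1 + t) = 2 * ln (norm (1 - x))"
    unfolding sq[symmetric] using n1 by (simp add: ln_realpow)
  ultimately have "Re x - 13 * r\<^sup>2 \<le> - ln (norm (1 - x))" "- ln (norm (1 - x)) \<le> Re x + 13 * r\<^sup>2"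
    using t2 zero_le_power2[of r] unfolding t_def by linarith+
  moreover have "norm (1 / (1 - x)) = exp (- ln (norm (1 - x)))"
  proof -
    have "norm (1 - x) > 0" using n1 by linarith
    then show ?thesis by (simp only: exp_minus exp_ln norm_divide norm_one inverse_eq_divide)
  qed
  ultimately show "exp (Re x - 13 * (norm x)\<^sup>2) \<le> norm (1 / (1 - x))"
    and "norm (1 / (1 - x)) \<le> exp (Re x + 13 * (norm x)\<^sup>2)"
    by (simp_all add: r_def)
qed

text \<open>A multiset over \<open>insert q P\<close> either avoids \<open>q\<close> or arises by
  adding one \<open>q\<close> to such a multiset. The second kind contributes \<open>x q\<close>
  times the whole sum, which is the geometric series in closed form.\<close>

lemma infsum_multisets_insert:
  fixes x :: "'a \<Rightarrow> complex"
  assumes "(\<lambda>m. \<Prod>p\<in>#m. x p) summable_on {m. set_mset m \<subseteq> insert q P}" and "q \<notin> P"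
  shows "(1 - x q) * infsum (\<lambda>m. \<Prod>p\<in>#m. x p) {m. set_mset m \<subseteq> insert q P} =
         infsum (\<lambda>m. \<Prod>p\<in>#m. x p) {m. set_mset m \<subseteq> P}"
proof -
  let ?f = "\<lambda>m. \<Prod>p\<in>#m. x p" and ?A = "{m. set_mset m \<subseteq> insert q P}"
  let ?B = "{m. set_mset m \<subseteq> P}"
  have split: "?A = ?B \<union> add_mset q ` ?A"
  proof (intro equalityI subsetI)
    fix m assume m: "m \<in> ?A"
    show "m \<in> ?B \<union> add_mset q ` ?A"
    proof (cases "q \<in># m")
      case True
      then obtain m' where "m = add_mset q m'" by (meson multi_member_split)
      with m show ?thesis by auto
    qed (use m in auto)
  qed auto
  have disj: "?B \<inter> add_mset q ` ?A = {}" using assms(2) by auto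
  have "infsum ?f (add_mset q ` ?A) = infsum (?f \<circ> add_mset q) ?A"
    by (rule infsum_reindex) (auto simp: inj_on_def)
  also have "\<dots> = x q * infsum ?f ?A" by (simp add: o_def infsum_cmult_right')
  finally have 1: "infsum ?f (add_mset q ` ?A) = x q * infsum ?f ?A" .
  have "infsum ?f (?B \<union> add_mset q ` ?A) = infsum ?f ?B + infsum ?f (add_mset q ` ?A)"
  proof (rule infsum_Un_disjoint)
    show "?f summable_on ?B" "?f summable_on add_mset q ` ?A"
      by (rule summable_on_subset_banach[OF assms(1)]; auto)+
  qed (use disj in auto)
  then have "infsum ?f ?A = infsum ?f ?B + x q * infsum ?f ?A" unfolding split[symmetric] 1 .
  then show ?thesis by (simp add: left_diff_distrib diff_eq_eq)
qed

lemma infsum_multisets_finite: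
  fixes x :: "'a \<Rightarrow> complex"
  assumes "finite F" "(\<lambda>m. \<Prod>p\<in>#m. x p) summable_on {m. set_mset m \<subseteq> F}"
    and "\<And>p. p \<in> F \<Longrightarrow> x p \<noteq> 1"
  shows "infsum (\<lambda>m. \<Prod>p\<in>#m. x p) {m. set_mset m \<subseteq> F} = (\<Prod>p\<in>F. 1 / (1 - x p))"
  using assms
proof (induction F rule: finite_induct)
  case empty
  have "{m :: 'a multiset. set_mset m \<subseteq> {}} = {{#}}" by auto
  then show ?case by simp
next
  case (insert q F)
  have "(\<lambda>m. \<Prod>p\<in>#m. x p) summable_on {m. set_mset m \<subseteq> F}"
    by (rule summable_on_subset_banach[OF insert.prems(1)]) auto
  with insert infsum_multisets_insert[OF insert.prems(1) insert.hyps(2)]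
  have "(1 - x q) * infsum (\<lambda>m. \<Prod>p\<in>#m. x p) {m. set_mset m \<subseteq> insert q F} =
        (\<Prod>p\<in>F. 1 / (1 - x p))" by simp
  moreover have "1 - x q \<noteq> 0" using insert.prems(2)[of q] by simp
  ultimately show ?case using insert.hyps by (simp add: field_simps)
qed

text \<open>Unique factorisation is encoded by multisets of primes. Finite products converge to the
  full sum by absolute convergence, and the bounds for single factors pass to the limit. Only the
  norm is controlled, and only up to a bounded factor, because logarithmic densities see no
  more.\<close>

lemma euler_product_bounds:
  fixes x :: "'a \<Rightarrow> complex"
  assumes half: "\<And>p. p \<in> P \<Longrightarrow> norm (x p) \<le> 1 / 2"
    and summ: "(\<lambda>m. \<Prod>p\<in>#m. x p) abs_summable_on {m. set_mset m \<subseteq> P}"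
  shows "exp (Re (infsum x P) - 13 * infsum (\<lambda>p. (norm (x p))\<^sup>2) P)
           \<le> norm (infsum (\<lambda>m. \<Prod>p\<in>#m. x p) {m. set_mset m \<subseteq> P})" (is ?lower)
    and "norm (infsum (\<lambda>m. \<Prod>p\<in>#m. x p) {m. set_mset m \<subseteq> P})
           \<le> exp (Re (infsum x P) + 13 * infsum (\<lambda>p. (norm (x p))\<^sup>2) P)" (is ?upper)
proof -
  let ?f = "\<lambda>m. \<Prod>p\<in>#m. x p" and ?A = "{m. set_mset m \<subseteq> P}"
  have fs: "?f summable_on ?A" by (rule abs_summable_summable[OF summ])
  have xabs: "x abs_summable_on P"
  proof -
    have "(\<lambda>m. norm (?f m)) summable_on (\<lambda>p. {#p#}) ` P"
      by (rule summable_on_subset_banach[OF summ]) auto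
    then have "((\<lambda>m. norm (?f m)) \<circ> (\<lambda>p. {#p#})) summable_on P"
      by (subst (asm) summable_on_reindex) (auto simp: inj_on_def)
    then show ?thesis by (simp add: o_def)
  qed
  have xs: "x summable_on P" by (rule abs_summable_summable[OF xabs])
  have x2: "(\<lambda>p. (norm (x p))\<^sup>2) summable_on P"
  proof (rule summable_on_comparison_test[OF xabs])
    show "(norm (x p))\<^sup>2 \<le> norm (x p)" if "p \<in> P" for p
      using mult_left_mono[of "norm (x p)" 1 "norm (x p)"] half[OF that] by (simp add: power2_eq_square)
  qed auto
  have fF: "infsum ?f {m. set_mset m \<subseteq> F} = (\<Prod>p\<in>F. 1 / (1 - x p))" if "finite F" "F \<subseteq> P" for F
  proof (rule infsum_multisets_finite[OF that(1)])
    show "?f summable_on {m. set_mset m \<subseteq> F}"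
      by (rule summable_on_subset_banach[OF fs]) (use that in auto)
    show "x p \<noteq> 1" if "p \<in> F" for p using half[of p] that \<open>F \<subseteq> P\<close> by auto
  qed
  have lim: "((\<lambda>F. norm (\<Prod>p\<in>F. 1 / (1 - x p))) \<longlongrightarrow> norm (infsum ?f ?A)) (finite_subsets_at_top P)"
  proof (rule tendsto_norm, rule tendstoI)
    fix e :: real assume e: "e > 0"
    let ?g = "\<lambda>m. norm (?f m)"
    \<comment> \<open>Finitely many multisets carry all but e/2 of the absolute sum. Once
      \<open>F\<close> contains every prime that occurs in them, the error of the finite product is
      at most the remaining tail.\<close>
    obtain G where G: "finite G" "G \<subseteq> ?A" "dist (sum ?g G) (infsum ?g ?A) \<le> e / 2"
      using infsum_finite_approximation[OF summ, of "e / 2"] e by auto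
    define F0 where "F0 = (\<Union>m\<in>G. set_mset m)"
    have F0: "finite F0" "F0 \<subseteq> P" using G by (auto simp: F0_def)
    show "\<forall>\<^sub>F F in finite_subsets_at_top P. dist (\<Prod>p\<in>F. 1 / (1 - x p)) (infsum ?f ?A) < e"
      unfolding eventually_finite_subsets_at_top
    proof (intro exI[of _ F0] conjI allI impI)
      fix F assume "finite F \<and> F0 \<subseteq> F \<and> F \<subseteq> P"
      then have F: "finite F" "F0 \<subseteq> F" "F \<subseteq> P" by auto
      let ?B = "{m. set_mset m \<subseteq> F}"
      have GB: "G \<subseteq> ?B" using F(2) by (auto simp: F0_def)
      have BA: "?B \<subseteq> ?A" using F by auto
      have s1: "?f summable_on ?B" "?f summable_on (?A - ?B)" "?g summable_on (?A - ?B)"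
        "?g summable_on (?A - G)" "?g summable_on G"
        using fs summ BA G by (auto intro: summable_on_subset_banach)
      have "infsum ?f (?B \<union> (?A - ?B)) = infsum ?f ?B + infsum ?f (?A - ?B)"
        by (rule infsum_Un_disjoint) (use s1 in auto)
      moreover have "?B \<union> (?A - ?B) = ?A" using BA by auto
      ultimately have "dist (infsum ?f ?B) (infsum ?f ?A) = norm (infsum ?f (?A - ?B))"
        by (simp add: dist_norm)
      also have "\<dots> \<le> infsum ?g (?A - ?B)" by (rule norm_infsum_bound) (use s1 in auto)
      also have "\<dots> \<le> infsum ?g (?A - G)"
        by (rule infsum_mono2) (use s1 GB in auto)
      also have "\<dots> = infsum ?g ?A - sum ?g G"
      proof -
        have "infsum ?g (G \<union> (?A - G)) = infsum ?g G + infsum ?g (?A - G)"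
          by (rule infsum_Un_disjoint) (use s1 in auto)
        moreover have "G \<union> (?A - G) = ?A" using G by auto
        ultimately show ?thesis using G by simp
      qed
      also have "\<dots> \<le> e / 2" using G(3) unfolding dist_real_def by linarith
      also have "\<dots> < e" using e by simp
      finally show "dist (\<Prod>p\<in>F. 1 / (1 - x p)) (infsum ?f ?A) < e" using fF F by simp
    qed (use F0 in auto)
  qed
  have l1: "((\<lambda>F. exp (Re (sum x F) - 13 * sum (\<lambda>p. (norm (x p))\<^sup>2) F)) \<longlongrightarrow>
      exp (Re (infsum x P) - 13 * infsum (\<lambda>p. (norm (x p))\<^sup>2) P)) (finite_subsets_at_top P)"
    by (intro tendsto_intros infsum_tendsto xs x2)
  have l2: "((\<lambda>F. exp (Re (sum x F) + 13 * sum (\<lambda>p. (norm (x p))\<^sup>2) F)) \<longlongrightarrow>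
      exp (Re (infsum x P) + 13 * infsum (\<lambda>p. (norm (x p))\<^sup>2) P)) (finite_subsets_at_top P)"
    by (intro tendsto_intros infsum_tendsto xs x2)
  have e1: "exp (Re (sum x F) - 13 * sum (\<lambda>p. (norm (x p))\<^sup>2) F) \<le> norm (\<Prod>p\<in>F. 1 / (1 - x p))"
    if "finite F" "F \<subseteq> P" for F
  proof -
    have "exp (Re (sum x F) - 13 * sum (\<lambda>p. (norm (x p))\<^sup>2) F) =
        (\<Prod>p\<in>F. exp (Re (x p) - 13 * (norm (x p))\<^sup>2))"
      using that by (simp add: exp_sum[symmetric] sum_subtractf sum_distrib_left)
    also have "\<dots> \<le> (\<Prod>p\<in>F. norm (1 / (1 - x p)))"
      by (rule prod_mono) (use that half norm_inverse_one_minus_bounds in auto)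
    finally show ?thesis by (simp only: prod_norm)
  qed
  have e2: "norm (\<Prod>p\<in>F. 1 / (1 - x p)) \<le> exp (Re (sum x F) + 13 * sum (\<lambda>p. (norm (x p))\<^sup>2) F)"
    if "finite F" "F \<subseteq> P" for F
  proof -
    have "(\<Prod>p\<in>F. norm (1 / (1 - x p))) \<le> (\<Prod>p\<in>F. exp (Re (x p) + 13 * (norm (x p))\<^sup>2))"
      by (rule prod_mono) (use that half norm_inverse_one_minus_bounds in auto)
    also have "\<dots> = exp (Re (sum x F) + 13 * sum (\<lambda>p. (norm (x p))\<^sup>2) F)"
      using that by (simp add: exp_sum[symmetric] sum.distrib sum_distrib_left)
    finally show ?thesis by (simp only: prod_norm)
  qed
  have ev: "\<forall>\<^sub>F F in finite_subsets_at_top P. finite F \<and> F \<subseteq> P"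
    by (rule eventually_finite_subsets_at_top_weakI) auto
  show ?lower
    by (rule tendsto_le[OF _ lim l1]) (use ev e1 in \<open>auto elim!: eventually_mono\<close>)
  show ?upper
    by (rule tendsto_le[OF _ l2 lim]) (use ev e2 in \<open>auto elim!: eventually_mono\<close>)
qed

lemma bij_betw_prime_multisets:
  "bij_betw (\<lambda>m. normalize (prod_mset m)) {m. set_mset m \<subseteq> {p :: 'a :: factorial_semiring. prime p}}
     {x. x \<noteq> 0 \<and> normalize x = x}"
proof (rule bij_betw_byWitness[where f' = prime_factorization])
  show "\<forall>m\<in>{m. set_mset m \<subseteq> {p :: 'a. prime p}}. prime_factorization (normalize (prod_mset m)) = m"
    by (auto intro: prime_factorization_prod_mset_primes)
  show "\<forall>x\<in>{x. x \<noteq> 0 \<and> normalize x = x}. normalize (prod_mset (prime_factorization x)) = (x :: 'a)"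
    by (simp add: prod_mset_prime_factorization_weak)
  show "(\<lambda>m. normalize (prod_mset m)) ` {m. set_mset m \<subseteq> {p :: 'a. prime p}} \<subseteq> {x. x \<noteq> 0 \<and> normalize x = x}"
    by auto
  show "prime_factorization ` {x. x \<noteq> 0 \<and> normalize x = x} \<subseteq> {m. set_mset m \<subseteq> {p :: 'a. prime p}}"
    by (auto simp: in_prime_factors_iff)
qed

text \<open>Normalised nonzero elements stand for ideals. The generality serves two applications:
  natural numbers, for the sum over all rational primes, and \<int>[\<omega>], for the
  L-functions.\<close>

lemma multiplicative_sum_bounds:
  fixes F :: "'a :: factorial_semiring \<Rightarrow> complex"
  assumes mult: "\<And>x y. F (x * y) = F x * F y" and one: "F 1 = 1"
    and norm: "\<And>x. F (normalize x) = F x"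
    and half: "\<And>p. prime p \<Longrightarrow> norm (F p) \<le> 1 / 2"
    and summ: "F abs_summable_on {x. x \<noteq> 0 \<and> normalize x = x}"
  shows "exp (Re (infsum F {p. prime p}) - 13 * infsum (\<lambda>p. (norm (F p))\<^sup>2) {p. prime p})
           \<le> norm (infsum F {x. x \<noteq> 0 \<and> normalize x = x})"
    and "norm (infsum F {x. x \<noteq> 0 \<and> normalize x = x})
           \<le> exp (Re (infsum F {p. prime p}) + 13 * infsum (\<lambda>p. (norm (F p))\<^sup>2) {p. prime p})"
proof -
  have prod: "F (normalize (prod_mset m)) = (\<Prod>p\<in>#m. F p)" for m
    unfolding norm by (induction m) (simp_all add: one mult)
  have "(\<lambda>m. norm (F (normalize (prod_mset m)))) summable_on {m. set_mset m \<subseteq> {p. prime p}}"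
    using summable_on_reindex_bij_betw[OF bij_betw_prime_multisets, of "\<lambda>x. norm (F x)"] summ by simp
  then have s: "(\<lambda>m. \<Prod>p\<in>#m. F p) abs_summable_on {m. set_mset m \<subseteq> {p. prime p}}"
    unfolding prod .
  have "infsum (\<lambda>m. F (normalize (prod_mset m))) {m. set_mset m \<subseteq> {p. prime p}} =
      infsum F {x. x \<noteq> 0 \<and> normalize x = x}"
    by (rule infsum_reindex_bij_betw[OF bij_betw_prime_multisets])
  then have eq: "infsum (\<lambda>m. \<Prod>p\<in>#m. F p) {m. set_mset m \<subseteq> {p. prime p}} =
      infsum F {x. x \<noteq> 0 \<and> normalize x = x}"
    unfolding prod .
  show "exp (Re (infsum F {p. prime p}) - 13 * infsum (\<lambda>p. (norm (F p))\<^sup>2) {p. prime p})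
           \<le> norm (infsum F {x. x \<noteq> 0 \<and> normalize x = x})"
    and "norm (infsum F {x. x \<noteq> 0 \<and> normalize x = x})
           \<le> exp (Re (infsum F {p. prime p}) + 13 * infsum (\<lambda>p. (norm (F p))\<^sup>2) {p. prime p})"
    using euler_product_bounds[of "{p. prime p}" F, OF _ s] half unfolding eq by auto
qed

section \<open>Sums over lattice points\<close>

text \<open>The mean value theorem compares n^-a with the increment over [n, n+1] of an
  antiderivative of x^-a; summing over n then telescopes.\<close>

lemma powr_telescope:
  fixes a :: real
  assumes "a > 1" "n \<ge> 1"
  shows "real n powr - a \<ge> (real n powr (1 - a) - real (n + 1) powr (1 - a)) / (a - 1)"
    and "real (n + 1) powr - a \<le> (real n powr (1 - a) - real (n + 1) powr (1 - a)) / (a - 1)"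
proof -
  have "\<exists>z. real n < z \<and> z < real (n + 1) \<and>
      real (n + 1) powr (1 - a) - real n powr (1 - a) = (real (n + 1) - real n) * ((1 - a) * z powr (1 - a - 1))"
  proof (rule MVT2)
    fix x assume "real n \<le> x" "x \<le> real (n + 1)"
    then have "x > 0" using assms(2) by linarith
    then show "((\<lambda>x. x powr (1 - a)) has_real_derivative (1 - a) * x powr (1 - a - 1)) (at x)"
      by (rule has_real_derivative_powr)
  qed simp
  then obtain z where z: "real n < z" "z < real (n + 1)"
      "real (n + 1) powr (1 - a) - real n powr (1 - a) = (1 - a) * z powr - a"
    by auto
  then have e: "(real n powr (1 - a) - real (n + 1) powr (1 - a)) / (a - 1) = z powr - a"
    using assms by (simp add: field_simps)
  show "real n powr - a \<ge> (real n powr (1 - a) - real (n + 1) powr (1 - a)) / (a - 1)"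
    unfolding e using z assms by (intro powr_mono2') auto
  show "real (n + 1) powr - a \<le> (real n powr (1 - a) - real (n + 1) powr (1 - a)) / (a - 1)"
    unfolding e using z assms by (intro powr_mono2') auto
qed

lemma sum_powr_bounds:
  fixes a :: real
  assumes "a > 1"
  shows "(\<Sum>n=1..N. real n powr - a) \<le> 1 + 1 / (a - 1)"
    and "(\<Sum>n=1..N. real n powr - a) \<ge> (1 - real (N + 1) powr (1 - a)) / (a - 1)"
proof -
  have "(\<Sum>n=1..N. real n powr - a) \<le> 1 + (1 - real N powr (1 - a)) / (a - 1)" if "N \<ge> 1" for N
    using that
  proof (induction N rule: nat_induct_at_least)
    case (Suc N)
    then show ?case
      using powr_telescope(2)[OF assms, of N] by (simp add: diff_divide_distrib)
  qed auto
  moreover have "1 + (1 - real N powr (1 - a)) / (a - 1) \<le> 1 + 1 / (a - 1)"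
    using assms by (simp add: divide_right_mono)
  ultimately have "(\<Sum>n=1..N. real n powr - a) \<le> 1 + 1 / (a - 1)" if "N \<ge> 1"
    using that order_trans by blast
  moreover have "(\<Sum>n=1..N. real n powr - a) = 0" if "N = 0" using that by simp
  moreover have "1 / (a - 1) \<ge> 0" using assms by simp
  ultimately show "(\<Sum>n=1..N. real n powr - a) \<le> 1 + 1 / (a - 1)"
    by (metis One_nat_def add_increasing leI less_one zero_le_one)
  show "(\<Sum>n=1..N. real n powr - a) \<ge> (1 - real (N + 1) powr (1 - a)) / (a - 1)"
  proof (induction N)
    case (Suc N)
    then show ?case
      using powr_telescope(1)[OF assms, of "Suc N"] by (simp add: diff_divide_distrib)
  qed (use assms in auto)
qed

text \<open>Summation by shells: if the shell of radius R has O(R^j) points, the sum is bounded by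
  that of R^(j-t). The radius function is arbitrary so that integers (j = 0), \<int>[\<omega>] (j =
  1) and integer triples (j = 2) are all covered.\<close>

lemma shell_sum_upper:
  fixes r :: "'a \<Rightarrow> nat" and t :: real
  assumes pos: "\<And>v. v \<in> S \<Longrightarrow> r v \<ge> 1"
    and fin: "\<And>R. finite {v \<in> S. r v = R}"
    and card: "\<And>R. R \<ge> 1 \<Longrightarrow> real (card {v \<in> S. r v = R}) \<le> C * real R ^ j"
    and t: "t > real j + 1"
  shows "(\<lambda>v. real (r v) powr - t) summable_on S"
    and "infsum (\<lambda>v. real (r v) powr - t) S \<le> C * (1 + 1 / (t - real j - 1))"
proof -
  have "0 \<le> C * real 1 ^ j" using card[of 1] by (meson of_nat_0_le_iff order_trans order_refl)
  then have C: "C \<ge> 0" by simp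
  have b: "sum (\<lambda>v. real (r v) powr - t) F \<le> C * (1 + 1 / (t - real j - 1))"
    if F: "finite F" "F \<subseteq> S" for F
  proof -
    define N where "N = Max (insert 0 (r ` F))"
    have N: "r v \<in> {1..N}" if "v \<in> F" for v using that F pos by (auto simp: N_def)
    have "sum (\<lambda>v. real (r v) powr - t) F = (\<Sum>R=1..N. \<Sum>v\<in>{v\<in>F. r v = R}. real (r v) powr - t)"
      by (rule sum.group[symmetric]) (use F N in auto)
    also have "\<dots> \<le> (\<Sum>R=1..N. C * real R powr - (t - real j))"
    proof (rule sum_mono)
      fix R assume R: "R \<in> {1..N}"
      have "(\<Sum>v\<in>{v\<in>F. r v = R}. real (r v) powr - t) = real (card {v\<in>F. r v = R}) * real R powr - t"
        by simp
      also have "\<dots> \<le> (C * real R ^ j) * real R powr - t"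
      proof (rule mult_right_mono)
        have "card {v\<in>F. r v = R} \<le> card {v\<in>S. r v = R}" by (rule card_mono[OF fin]) (use F in auto)
        then show "real (card {v\<in>F. r v = R}) \<le> C * real R ^ j" using card[of R] R by simp
      qed auto
      also have "\<dots> = C * real R powr - (t - real j)"
        using R by (simp add: powr_diff powr_minus powr_realpow field_simps)
      finally show "(\<Sum>v\<in>{v\<in>F. r v = R}. real (r v) powr - t) \<le> C * real R powr - (t - real j)" .
    qed
    also have "\<dots> = C * (\<Sum>R=1..N. real R powr - (t - real j))" by (simp add: sum_distrib_left)
    also have "\<dots> \<le> C * (1 + 1 / (t - real j - 1))"
      by (rule mult_left_mono[OF sum_powr_bounds(1) C]) (use t in auto)
    finally show ?thesis .
  qed
  show s: "(\<lambda>v. real (r v) powr - t) summable_on S"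
    by (rule nonneg_bdd_above_summable_on) (use b in \<open>auto intro!: bdd_aboveI2\<close>)
  show "infsum (\<lambda>v. real (r v) powr - t) S \<le> C * (1 + 1 / (t - real j - 1))"
    by (rule infsum_le_finite_sums[OF s b])
qed

lemma shell_sum_lower:
  fixes r :: "'a \<Rightarrow> nat" and t :: real
  assumes fin: "\<And>R. finite {v \<in> S. r v = R}"
    and card: "\<And>R. R \<ge> 1 \<Longrightarrow> real (card {v \<in> S. r v = R}) \<ge> c * real R ^ j" and c: "c \<ge> 0"
    and t: "t > real j + 1"
    and s: "(\<lambda>v. real (r v) powr - t) summable_on S"
  shows "infsum (\<lambda>v. real (r v) powr - t) S \<ge> c / (t - real j - 1)"
proof -
  define a where "a = t - real j"
  have a: "a > 1" using t by (simp add: a_def)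
  have b: "c * ((1 - real (N + 1) powr (1 - a)) / (a - 1)) \<le> infsum (\<lambda>v. real (r v) powr - t) S" for N
  proof -
    let ?F = "\<Union>R\<in>{1..N}. {v \<in> S. r v = R}"
    have "c * ((1 - real (N + 1) powr (1 - a)) / (a - 1)) \<le> c * (\<Sum>R=1..N. real R powr - a)"
      by (rule mult_left_mono[OF sum_powr_bounds(2)[OF a] c])
    also have "\<dots> = (\<Sum>R=1..N. c * real R powr - a)" by (simp add: sum_distrib_left)
    also have "\<dots> \<le> (\<Sum>R=1..N. \<Sum>v\<in>{v\<in>S. r v = R}. real (r v) powr - t)"
    proof (rule sum_mono)
      fix R assume R: "R \<in> {1..N}"
      have "c * real R powr - a = (c * real R ^ j) * real R powr - t"
        using R by (simp add: a_def powr_diff powr_minus powr_realpow field_simps)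
      also have "\<dots> \<le> real (card {v\<in>S. r v = R}) * real R powr - t"
        by (rule mult_right_mono) (use card[of R] R in auto)
      also have "\<dots> = (\<Sum>v\<in>{v\<in>S. r v = R}. real (r v) powr - t)" by simp
      finally show "c * real R powr - a \<le> (\<Sum>v\<in>{v\<in>S. r v = R}. real (r v) powr - t)" .
    qed
    also have "\<dots> = sum (\<lambda>v. real (r v) powr - t) ?F"
      by (rule sum.UNION_disjoint[symmetric]) (use fin in auto)
    also have "\<dots> \<le> infsum (\<lambda>v. real (r v) powr - t) S"
      by (rule finite_sum_le_infsum[OF s]) (use fin in auto)
    finally show ?thesis .
  qed
  have "(\<lambda>N. real (N + 1) powr (1 - a)) \<longlonglongrightarrow> 0"
    using a by real_asymp
  then have "(\<lambda>N. c * ((1 - real (N + 1) powr (1 - a)) / (a - 1))) \<longlonglongrightarrow> c * ((1 - 0) / (a - 1))"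
    by (intro tendsto_intros) (use a in auto)
  then have "c * ((1 - 0) / (a - 1)) \<le> infsum (\<lambda>v. real (r v) powr - t) S"
    by (rule LIMSEQ_le_const2) (use b in auto)
  then show ?thesis by (simp add: a_def)
qed

section \<open>Logarithmic densities of sets of primes\<close>

definition prime_sum :: "nat set \<Rightarrow> real \<Rightarrow> real" where
  "prime_sum S s = (\<Sum>\<^sub>\<infinity>p\<in>{p\<in>S. prime p}. real p powr - s)"

text \<open>Stronger than a Dirichlet density, as the error is bounded rather than merely of smaller
  order than the logarithm. Bounded errors add up, and a limit has to be taken only once, at the
  end.\<close>

definition log_density :: "nat set \<Rightarrow> real \<Rightarrow> bool" where
  "log_density S d \<longleftrightarrow>
     (\<exists>C. \<forall>s. 1 < s \<longrightarrow> s < 2 \<longrightarrow> \<bar>prime_sum S s - d * ln (1 / (s - 1))\<bar> \<le> C)"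

lemma nat_zeta_bounds:
  assumes "s > 1"
  shows "(\<lambda>n. real n powr - s) summable_on {1..}"
    and "infsum (\<lambda>n. real n powr - s) {1..} \<le> 1 + 1 / (s - 1)"
    and "infsum (\<lambda>n. real n powr - s) {1..} \<ge> 1 / (s - 1)"
proof -
  have eq: "{v \<in> {1..}. v = R} = (if R \<ge> 1 then {R} else {})" for R :: nat by auto
  have fin: "finite {v \<in> {1..}. v = R}" for R :: nat unfolding eq by simp
  have card: "real (card {v \<in> {1..}. v = R}) = 1 * real R ^ 0" if "R \<ge> 1" for R :: nat
    unfolding eq using that by simp
  note * = shell_sum_upper[of "{1..}" "\<lambda>n. n" 1 0 s, OF _ fin eq_refl[OF card]]
  show s: "(\<lambda>n. real n powr - s) summable_on {1..}" using *(1) assms by simp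
  show "infsum (\<lambda>n. real n powr - s) {1..} \<le> 1 + 1 / (s - 1)" using *(2) assms by simp
  show "infsum (\<lambda>n. real n powr - s) {1..} \<ge> 1 / (s - 1)"
    using shell_sum_lower[of "{1..}" "\<lambda>n. n" 1 0 s, OF fin eq_refl[OF card[symmetric]] _ _ s] assms by simp
qed

lemma prime_powr_summable:
  assumes "s > 1" "\<And>p. p \<in> A \<Longrightarrow> prime p"
  shows "(\<lambda>p. real p powr - s) summable_on A"
  by (rule summable_on_subset_banach[OF nat_zeta_bounds(1)[OF assms(1)]])
     (use assms(2) prime_ge_1_nat in auto)

lemma infsum_of_real_complex:
  assumes "f summable_on A"
  shows "infsum (\<lambda>x. complex_of_real (f x)) A = complex_of_real (infsum f A)"
  by (rule infsumI, rule has_sum_of_real) (use assms in simp)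

text \<open>The bounds 1/(s-1) \<le> zeta(s) \<le> 1 + 1/(s-1) give ln zeta(s) up to a bounded
  error, and the Euler product turns it into the sum over primes. The squares in the error term are
  dominated by the sum of n^-2.\<close>

lemma log_density_primes: "log_density UNIV 1"
proof -
  define B where "B = infsum (\<lambda>n. real n powr - 2) {1..}"
  have "\<bar>prime_sum UNIV s - 1 * ln (1 / (s - 1))\<bar> \<le> 13 * B + ln 2" if s: "1 < s" "s < 2" for s
  proof -
    define F where "F = (\<lambda>n :: nat. complex_of_real (real n powr - s))"
    define Z where "Z = infsum (\<lambda>n. real n powr - s) {1..}"
    have N: "{x :: nat. x \<noteq> 0 \<and> normalize x = x} = {1..}" by auto
    have nF: "norm (F n) = real n powr - s" for n by (simp add: F_def)
    have F2: "infsum (\<lambda>p. (norm (F p))\<^sup>2) {p. prime p} \<le> B" (is "infsum ?g _ \<le> _")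
    proof -
      have le: "(real n powr - s)\<^sup>2 \<le> real n powr - 2" if "n \<ge> 1" for n
      proof -
        have "(real n powr - s)\<^sup>2 = real n powr (- s * 2)"
          by (simp add: power2_eq_square powr_add[symmetric] mult.commute)
        also have "\<dots> \<le> real n powr - 2" by (rule powr_mono) (use that s in auto)
        finally show ?thesis .
      qed
      have s2: "(\<lambda>n. real n powr - 2) summable_on {1..}" using nat_zeta_bounds(1)[of 2] by simp
      have "?g summable_on {p. prime p}"
        by (rule summable_on_comparison_test[OF prime_powr_summable[of 2]])
           (use le prime_ge_1_nat in \<open>auto simp: nF\<close>)
      then show ?thesis unfolding B_def nF
        by (rule infsum_mono_neutral[OF _ s2]) (use le prime_ge_1_nat in \<open>auto simp: nF\<close>)
    qed
    have ps: "infsum F {p. prime p} = complex_of_real (prime_sum UNIV s)"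
      unfolding F_def prime_sum_def
      by (subst infsum_of_real_complex) (use s in \<open>auto intro!: prime_powr_summable\<close>)
    have z: "infsum F {1..} = complex_of_real Z"
      unfolding F_def Z_def by (rule infsum_of_real_complex) (use nat_zeta_bounds(1) s in auto)
    have Zb: "1 / (s - 1) \<le> Z" "Z \<le> 1 + 1 / (s - 1)"
      unfolding Z_def using nat_zeta_bounds[of s] s by auto
    have pos: "1 / (s - 1) > 0" using s by simp
    have nZ: "norm (infsum F {1..}) = Z" unfolding z norm_of_real using Zb pos by linarith
    have half: "norm (F p) \<le> 1 / 2" if "prime p" for p
    proof -
      have "real p powr - s \<le> real p powr - 1" by (rule powr_mono) (use s prime_ge_1_nat[OF that] in auto)
      also have "\<dots> = 1 / real p" using prime_gt_0_nat[OF that] by (simp add: powr_minus_divide)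
      also have "\<dots> \<le> 1 / 2" using prime_ge_2_nat[OF that] by (simp add: field_simps)
      finally show ?thesis by (simp add: nF)
    qed
    have "F (x * y) = F x * F y" for x y by (simp add: F_def powr_mult)
    moreover have "F 1 = 1" by (simp add: F_def)
    moreover have "F abs_summable_on {x. x \<noteq> 0 \<and> normalize x = x}"
      unfolding N nF using nat_zeta_bounds(1) s by simp
    ultimately have "exp (Re (infsum F {p. prime p}) - 13 * infsum (\<lambda>p. (norm (F p))\<^sup>2) {p. prime p}) \<le> Z"
        "Z \<le> exp (Re (infsum F {p. prime p}) + 13 * infsum (\<lambda>p. (norm (F p))\<^sup>2) {p. prime p})"
      using multiplicative_sum_bounds[of F] half unfolding N nZ by auto
    then have e: "exp (prime_sum UNIV s - 13 * infsum (\<lambda>p. (norm (F p))\<^sup>2) {p. prime p}) \<le> Z"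
        "Z \<le> exp (prime_sum UNIV s + 13 * infsum (\<lambda>p. (norm (F p))\<^sup>2) {p. prime p})"
      unfolding ps by simp_all
    have Z0: "Z > 0" using Zb pos by linarith
    have l: "prime_sum UNIV s - 13 * infsum (\<lambda>p. (norm (F p))\<^sup>2) {p. prime p} \<le> ln Z"
        "ln Z \<le> prime_sum UNIV s + 13 * infsum (\<lambda>p. (norm (F p))\<^sup>2) {p. prime p}"
    proof -
      show "prime_sum UNIV s - 13 * infsum (\<lambda>p. (norm (F p))\<^sup>2) {p. prime p} \<le> ln Z"
        using e(1) ln_ge_iff[OF Z0] by blast
      have "ln Z \<le> ln (exp (prime_sum UNIV s + 13 * infsum (\<lambda>p. (norm (F p))\<^sup>2) {p. prime p}))"
        using e(2) Z0 by (subst ln_le_cancel_iff) auto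
      then show "ln Z \<le> prime_sum UNIV s + 13 * infsum (\<lambda>p. (norm (F p))\<^sup>2) {p. prime p}"
        by (simp only: ln_exp)
    qed
    have "Z \<le> 2 * (1 / (s - 1))"
    proof -
      have "1 \<le> 1 / (s - 1)" using s by simp
      then show ?thesis using Zb by linarith
    qed
    then have "ln Z \<le> ln (2 * (1 / (s - 1)))" using Z0 pos by (subst ln_le_cancel_iff) auto
    also have "\<dots> = ln 2 + ln (1 / (s - 1))" by (rule ln_mult_pos) (use pos in auto)
    finally have u: "ln Z \<le> ln 2 + ln (1 / (s - 1))" .
    have v: "ln (1 / (s - 1)) \<le> ln Z" using Z0 pos Zb(1) ln_le_cancel_iff by blast
    have "ln (2::real) \<ge> 0" by simp
    then show ?thesis using l u v F2 by linarith
  qed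
  then show ?thesis unfolding log_density_def by blast
qed

lemma filterlim_ln_at_right_1: "filterlim (\<lambda>s. ln (1 / (s - 1))) at_top (at_right (1 :: real))"
  by real_asymp

text \<open>The numerator is \<open>d\<close> times the denominator up to a bounded error, and the
  denominator tends to infinity.\<close>

lemma log_density_imp_dirichlet_density:
  assumes "log_density S d"
  shows "has_dirichlet_density S d"
proof -
  obtain C1 where C1: "\<And>s. 1 < s \<Longrightarrow> s < 2 \<Longrightarrow> \<bar>prime_sum S s - d * ln (1 / (s - 1))\<bar> \<le> C1"
    using assms unfolding log_density_def by blast
  obtain C2 where C2: "\<And>s. 1 < s \<Longrightarrow> s < 2 \<Longrightarrow> \<bar>prime_sum UNIV s - 1 * ln (1 / (s - 1))\<bar> \<le> C2"
    using log_density_primes unfolding log_density_def by blast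
  define K where "K = C1 + \<bar>d\<bar> * C2"
  have "((\<lambda>s. prime_sum S s / prime_sum UNIV s) \<longlongrightarrow> d) (at_right 1)"
  proof (rule Lim_null[THEN iffD2], rule Lim_null_comparison)
    have ev: "\<forall>\<^sub>F s in at_right (1::real). 1 < s \<and> s < 2 \<and> ln (1 / (s - 1)) > C2"
    proof (intro eventually_conj)
      show "\<forall>\<^sub>F s in at_right (1::real). s > 1" by (simp add: eventually_at_right_less)
      show "\<forall>\<^sub>F s in at_right (1::real). s < 2"
        by (rule eventually_at_rightI[of 1 2]) auto
      show "\<forall>\<^sub>F s in at_right (1::real). ln (1 / (s - 1)) > C2"
        using filterlim_ln_at_right_1 unfolding filterlim_at_top_dense by blast
    qed
    show "\<forall>\<^sub>F s in at_right 1. norm (prime_sum S s / prime_sum UNIV s - d) \<le> K / (ln (1 / (s - 1)) - C2)"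
      using ev
    proof eventually_elim
      case (elim s)
      define L P1 P2 where "L = ln (1 / (s - 1))" and "P1 = prime_sum S s" and "P2 = prime_sum UNIV s"
      have 1: "\<bar>P1 - d * L\<bar> \<le> C1" "\<bar>P2 - L\<bar> \<le> C2" "L > C2"
        using C1[of s] C2[of s] elim by (auto simp: L_def P1_def P2_def)
      then have P2: "P2 \<ge> L - C2" "P2 > 0" by linarith+
      have "\<bar>P1 - d * P2\<bar> = \<bar>(P1 - d * L) - d * (P2 - L)\<bar>" by (simp add: algebra_simps)
      also have "\<dots> \<le> \<bar>P1 - d * L\<bar> + \<bar>d\<bar> * \<bar>P2 - L\<bar>"
        by (metis abs_mult abs_triangle_ineq4)
      also have "\<dots> \<le> K" unfolding K_def using 1 by (intro add_mono mult_left_mono) auto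
      finally have K: "\<bar>P1 - d * P2\<bar> \<le> K" .
      have "norm (P1 / P2 - d) = \<bar>P1 - d * P2\<bar> / P2"
        using P2 by (simp add: field_simps abs_divide[symmetric] abs_mult[symmetric])
      also have "\<dots> \<le> K / (L - C2)"
        by (rule frac_le) (use K P2 1 in auto)
      finally show ?case by (simp add: L_def P1_def P2_def)
    qed
    have "filterlim (\<lambda>s. - C2 + ln (1 / (s - 1))) at_top (at_right (1 :: real))"
      by (rule filterlim_tendsto_add_at_top[OF tendsto_const filterlim_ln_at_right_1])
    then have "((\<lambda>s. K / (- C2 + ln (1 / (s - 1)))) \<longlongrightarrow> 0) (at_right 1)"
      by (intro tendsto_divide_0[OF tendsto_const] filterlim_at_top_imp_at_infinity)
    then show "((\<lambda>s. K / (ln (1 / (s - 1)) - C2)) \<longlongrightarrow> 0) (at_right 1)"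
      by (simp add: algebra_simps)
  qed
  then show ?thesis unfolding has_dirichlet_density_def prime_sum_def by simp
qed

text \<open>Each term p^-s is at most 1, so the primes up to \<open>n\<close> contribute at most n +
  1, uniformly in \<open>s\<close>. Primes dividing a modulus are discarded in this way.\<close>

lemma log_density_cong:
  assumes "log_density S d" and eq: "\<And>p. prime p \<Longrightarrow> p > n \<Longrightarrow> p \<in> S \<longleftrightarrow> p \<in> T"
  shows "log_density T d"
proof -
  obtain C1 where C1: "\<And>s. 1 < s \<Longrightarrow> s < 2 \<Longrightarrow> \<bar>prime_sum S s - d * ln (1 / (s - 1))\<bar> \<le> C1"
    using assms unfolding log_density_def by blast
  define Q where "Q = {p \<in> S. prime p \<and> p > n}"
  have split: "\<exists>y. 0 \<le> y \<and> y \<le> real (n + 1) \<and> prime_sum U s = y + infsum (\<lambda>p. real p powr - s) Q"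
    if U: "{p \<in> U. prime p \<and> p > n} = Q" and s: "1 < s" for U s
  proof -
    let ?V = "{p \<in> U. prime p \<and> p \<le> n}"
    have fin: "finite ?V" by (rule finite_subset[of _ "{..n}"]) auto
    have "{p \<in> U. prime p} = ?V \<union> Q" unfolding U[symmetric] by auto
    then have "prime_sum U s = infsum (\<lambda>p. real p powr - s) (?V \<union> Q)" by (simp add: prime_sum_def)
    also have "\<dots> = infsum (\<lambda>p. real p powr - s) ?V + infsum (\<lambda>p. real p powr - s) Q"
      by (rule infsum_Un_disjoint) (use s in \<open>auto intro!: prime_powr_summable simp: Q_def\<close>)
    also have "infsum (\<lambda>p. real p powr - s) ?V = sum (\<lambda>p. real p powr - s) ?V" using fin by simp
    finally have e: "prime_sum U s = sum (\<lambda>p. real p powr - s) ?V + infsum (\<lambda>p. real p powr - s) Q" .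
    have "sum (\<lambda>p. real p powr - s) ?V \<le> sum (\<lambda>p. 1) ?V"
    proof (rule sum_mono)
      fix p assume "p \<in> ?V"
      then have "real p \<ge> 1" using prime_ge_1_nat by auto
      then have "real p powr - s \<le> real p powr 0" by (intro powr_mono) (use s in auto)
      then show "real p powr - s \<le> 1" using \<open>real p \<ge> 1\<close> by simp
    qed
    also have "\<dots> = real (card ?V)" by simp
    also have "\<dots> \<le> real (card {..n})" by (subst of_nat_le_iff, rule card_mono) auto
    finally have "sum (\<lambda>p. real p powr - s) ?V \<le> real (n + 1)" by simp
    then show ?thesis using e by (intro exI[of _ "sum (\<lambda>p. real p powr - s) ?V"]) (auto intro: sum_nonneg)
  qed
  have "\<bar>prime_sum T s - d * ln (1 / (s - 1))\<bar> \<le> C1 + real (n + 1)" if s: "1 < s" "s < 2" for s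
  proof -
    have QT: "{p \<in> T. prime p \<and> p > n} = Q" using eq by (auto simp: Q_def)
    have QS: "{p \<in> S. prime p \<and> p > n} = Q" by (simp add: Q_def)
    from split[OF QT s(1)] split[OF QS s(1)] C1[OF s] show ?thesis by (auto simp: abs_le_iff)
  qed
  then show ?thesis unfolding log_density_def by blast
qed

section \<open>Zeta function of the Eisenstein integers\<close>

text \<open>Comparable to the square root of \<open>eis_norm\<close>, but with squares as balls: a
  shell has exactly 8R points, whereas the norm form would require counting lattice points in
  ellipses.\<close>

definition eis_max :: "eis \<Rightarrow> nat" where
  "eis_max x = nat (max \<bar>eis_fst x\<bar> \<bar>eis_snd x\<bar>)"

lemma eis_max_eq_0_iff [simp]: "eis_max x = 0 \<longleftrightarrow> x = 0"
  by (cases x) (auto simp: eis_max_def)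

lemma eis_max_0 [simp]: "eis_max 0 = 0"
  by (simp add: eis_max_def)

lemma eis_max_pos [simp]: "0 < eis_max x \<longleftrightarrow> x \<noteq> 0"
  using eis_max_eq_0_iff[of x] by (simp only: neq0_conv[symmetric])

lemma eis_max_bounds: "\<bar>eis_fst x\<bar> \<le> int (eis_max x)" "\<bar>eis_snd x\<bar> \<le> int (eis_max x)"
  by (auto simp: eis_max_def)

lemma eis_norm_ge_max: "3 * (int (eis_max x))\<^sup>2 \<le> 4 * eis_norm x"
proof -
  have "int (eis_max x) = \<bar>eis_fst x\<bar> \<or> int (eis_max x) = \<bar>eis_snd x\<bar>" by (auto simp: eis_max_def max_def)
  then have "(int (eis_max x))\<^sup>2 = (eis_fst x)\<^sup>2 \<or> (int (eis_max x))\<^sup>2 = (eis_snd x)\<^sup>2" by auto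
  then show ?thesis using eis_norm_max[of x] by auto
qed

lemma eis_norm_le_max: "eis_norm x \<le> 3 * (int (eis_max x))\<^sup>2"
proof -
  have 1: "(eis_fst x)\<^sup>2 \<le> (int (eis_max x))\<^sup>2" "(eis_snd x)\<^sup>2 \<le> (int (eis_max x))\<^sup>2"
    using eis_max_bounds[of x] by (auto simp: abs_le_square_iff[symmetric])
  have "\<bar>eis_fst x\<bar> * \<bar>eis_snd x\<bar> \<le> int (eis_max x) * int (eis_max x)"
    by (rule mult_mono) (use eis_max_bounds[of x] in auto)
  then have "eis_fst x * eis_snd x \<le> (int (eis_max x))\<^sup>2"
    by (simp add: power2_eq_square abs_mult[symmetric])
  with 1 show ?thesis by (simp add: eis_norm_def)
qed

lemma eis_box: "{x. eis_max x \<le> R} = (\<lambda>(a, b). Eis a b) ` ({- int R..int R} \<times> {- int R..int R})"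
proof (intro equalityI subsetI)
  fix x assume "x \<in> {x. eis_max x \<le> R}"
  then have "x = (\<lambda>(a, b). Eis a b) (eis_fst x, eis_snd x)"
    "(eis_fst x, eis_snd x) \<in> {- int R..int R} \<times> {- int R..int R}"
    using eis_max_bounds[of x] by (auto simp: abs_le_iff)
  then show "x \<in> (\<lambda>(a, b). Eis a b) ` ({- int R..int R} \<times> {- int R..int R})" by blast
qed (auto simp: eis_max_def)

lemma finite_eis_box: "finite {x. eis_max x \<le> R}"
  unfolding eis_box by simp

lemma card_eis_box: "card {x. eis_max x \<le> R} = (2 * R + 1)\<^sup>2"
proof -
  have "card {- int R..int R} = 2 * R + 1" by simp
  then show ?thesis unfolding eis_box
    by (subst card_image) (auto simp: inj_on_def card_cartesian_product power2_eq_square simp del: card_atLeastAtMost_int)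
qed

lemma card_eis_shell:
  assumes "R \<ge> 1" shows "card {x. eis_max x = R} = 8 * R"
proof -
  have "{x. eis_max x = R} = {x. eis_max x \<le> R} - {x. eis_max x \<le> R - 1}" using assms by auto
  then have "card {x. eis_max x = R} = card ({x. eis_max x \<le> R} - {x. eis_max x \<le> R - 1})" by (rule arg_cong)
  also have "\<dots> = card {x. eis_max x \<le> R} - card {x. eis_max x \<le> R - 1}"
    by (rule card_Diff_subset[OF finite_eis_box]) auto
  also have "\<dots> = (2 * R + 1)\<^sup>2 - (2 * (R - 1) + 1)\<^sup>2" by (simp only: card_eis_box)
  also have "\<dots> = 8 * R" using assms by (cases R) (simp_all add: power2_eq_square algebra_simps)
  finally show ?thesis .
qed

lemma eis_max_sum:
  assumes "t > 2"
  shows "(\<lambda>x. real (eis_max x) powr - t) summable_on {x. x \<noteq> 0}"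
    and "infsum (\<lambda>x. real (eis_max x) powr - t) {x. x \<noteq> 0} \<le> 8 * (1 + 1 / (t - 2))"
    and "infsum (\<lambda>x. real (eis_max x) powr - t) {x. x \<noteq> 0} \<ge> 8 / (t - 2)"
proof -
  have eq: "{v \<in> {x. x \<noteq> 0}. eis_max v = R} = {x. eis_max x = R}" if "R \<ge> 1" for R
    using that by auto
  have fin: "finite {v \<in> {x. x \<noteq> 0}. eis_max v = R}" for R
    by (rule finite_subset[OF _ finite_eis_box[of R]]) auto
  have card: "real (card {v \<in> {x. x \<noteq> 0}. eis_max v = R}) = 8 * real R ^ 1" if "R \<ge> 1" for R
    unfolding eq[OF that] card_eis_shell[OF that] by simp
  note up = shell_sum_upper[of "{x. x \<noteq> 0}" eis_max 8 1 t, OF _ fin eq_refl[OF card]]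
  show s: "(\<lambda>x. real (eis_max x) powr - t) summable_on {x. x \<noteq> 0}"
    using up(1) assms by (simp add: Suc_le_eq)
  show "infsum (\<lambda>x. real (eis_max x) powr - t) {x. x \<noteq> 0} \<le> 8 * (1 + 1 / (t - 2))"
    using up(2) assms by (simp add: Suc_le_eq)
  show "infsum (\<lambda>x. real (eis_max x) powr - t) {x. x \<noteq> 0} \<ge> 8 / (t - 2)"
    using shell_sum_lower[of "{x. x \<noteq> 0}" eis_max 8 1 t, OF fin eq_refl[OF card[symmetric]] _ _ s] assms
    by simp
qed

abbreviation eis_pow :: "real \<Rightarrow> eis \<Rightarrow> real" where
  "eis_pow s x \<equiv> real_of_int (eis_norm x) powr - s"

lemma eis_pow_max:
  assumes "x \<noteq> 0" "1 < s" "s \<le> 2"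
  shows "eis_pow s x \<le> 2 * real (eis_max x) powr - (2 * s)"
    and "real (eis_max x) powr - (2 * s) \<le> 9 * eis_pow s x"
proof -
  define m where "m = real (eis_max x)"
  have "eis_max x \<noteq> 0" using assms by simp
  then have m: "m > 0" by (simp add: m_def)
  have "real_of_int (3 * (int (eis_max x))\<^sup>2) \<le> real_of_int (4 * eis_norm x)"
    "real_of_int (eis_norm x) \<le> real_of_int (3 * (int (eis_max x))\<^sup>2)"
    using eis_norm_ge_max[of x] eis_norm_le_max[of x] by (simp_all only: of_int_le_iff)
  then have b: "3 / 4 * m\<^sup>2 \<le> real_of_int (eis_norm x)" "real_of_int (eis_norm x) \<le> 3 * m\<^sup>2"
    by (simp_all add: m_def)
  have m2: "(m\<^sup>2) powr - s = m powr - (2 * s)"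
    using powr_realpow[OF m, of 2] powr_powr[of m 2 "- s"] by simp
  have N0: "real_of_int (eis_norm x) > 0" using assms by simp
  have "eis_pow s x \<le> (3 / 4 * m\<^sup>2) powr - s"
    by (rule powr_mono2') (use b m assms in auto)
  also have "\<dots> = (3 / 4) powr - s * m powr - (2 * s)" unfolding m2[symmetric] by (rule powr_mult)
  also have "(3 / 4 :: real) powr - s = (4 / 3) powr s" by (simp add: powr_minus_divide powr_divide)
  also have "(4 / 3 :: real) powr s \<le> (4 / 3) powr 2" by (rule powr_mono) (use assms in auto)
  also have "(4 / 3 :: real) powr 2 \<le> 2" by (simp add: power2_eq_square)
  finally show "eis_pow s x \<le> 2 * real (eis_max x) powr - (2 * s)"
    by (simp add: m_def mult_right_mono)
  have "3 powr - s * m powr - (2 * s) = (3 * m\<^sup>2) powr - s" unfolding m2[symmetric] by (rule powr_mult[symmetric])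
  also have "\<dots> \<le> eis_pow s x" by (rule powr_mono2') (use b N0 assms in auto)
  finally have 1: "3 powr - s * m powr - (2 * s) \<le> eis_pow s x" .
  have "(3::real) powr - 2 \<le> 3 powr - s" by (rule powr_mono) (use assms in auto)
  then have "1 / 9 * m powr - (2 * s) \<le> 3 powr - s * m powr - (2 * s)"
    by (intro mult_right_mono) (simp_all add: powr_minus_divide)
  with 1 show "real (eis_max x) powr - (2 * s) \<le> 9 * eis_pow s x" by (simp add: m_def)
qed

text \<open>The order of the pole is what matters. The constants 24 and 4/9 come from comparing the
  norm with the maximum norm and are not the residue; after taking logarithms they only shift a
  bounded error.\<close>

lemma eis_zeta:
  assumes "1 < s" "s \<le> 2"
  shows "eis_pow s summable_on {x. x \<noteq> 0}"
    and "infsum (eis_pow s) {x. x \<noteq> 0} \<le> 24 / (s - 1)"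
    and "infsum (eis_pow s) {x. x \<noteq> 0} \<ge> 4 / 9 / (s - 1)"
proof -
  have t: "2 * s > 2" using assms by simp
  note m = eis_max_sum[OF t]
  have s2: "(\<lambda>x. 2 * real (eis_max x) powr - (2 * s)) summable_on {x. x \<noteq> 0}"
    by (rule summable_on_cmult_right[OF m(1)])
  show s: "eis_pow s summable_on {x. x \<noteq> 0}"
    by (rule summable_on_comparison_test[OF s2]) (use eis_pow_max assms in auto)
  have "infsum (eis_pow s) {x. x \<noteq> 0} \<le> infsum (\<lambda>x. 2 * real (eis_max x) powr - (2 * s)) {x. x \<noteq> 0}"
    by (rule infsum_mono[OF s s2]) (use eis_pow_max assms in auto)
  also have "\<dots> = 2 * infsum (\<lambda>x. real (eis_max x) powr - (2 * s)) {x. x \<noteq> 0}"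
    by (rule infsum_cmult_right')
  also have "\<dots> \<le> 2 * (8 * (1 + 1 / (2 * s - 2)))" using m(2) by simp
  also have "\<dots> = 16 + 8 * (1 / (s - 1))" using assms by (simp add: field_simps)
  also have "\<dots> \<le> 16 * (1 / (s - 1)) + 8 * (1 / (s - 1))"
  proof -
    have "1 \<le> 1 / (s - 1)" using assms by simp
    then show ?thesis by linarith
  qed
  also have "\<dots> = 24 / (s - 1)" by simp
  finally show "infsum (eis_pow s) {x. x \<noteq> 0} \<le> 24 / (s - 1)" .
  have "8 / (2 * s - 2) \<le> infsum (\<lambda>x. real (eis_max x) powr - (2 * s)) {x. x \<noteq> 0}" by (rule m(3))
  also have "\<dots> \<le> infsum (\<lambda>x. 9 * eis_pow s x) {x. x \<noteq> 0}"
    by (rule infsum_mono[OF m(1) summable_on_cmult_right[OF s]]) (use eis_pow_max assms in auto)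
  also have "\<dots> = 9 * infsum (eis_pow s) {x. x \<noteq> 0}" by (rule infsum_cmult_right')
  finally show "infsum (eis_pow s) {x. x \<noteq> 0} \<ge> 4 / 9 / (s - 1)" using assms by (simp add: field_simps)
qed

text \<open>Units act freely, with the normalised elements as representatives. Sums over ideals thus
  become sums over lattice points, to which counting in boxes applies.\<close>

lemma infsum_eis_units:
  fixes F :: "eis \<Rightarrow> complex"
  assumes summ: "F summable_on {x. x \<noteq> 0}" and unit: "\<And>u x. is_unit u \<Longrightarrow> F (u * x) = F x"
  shows "infsum F {x. x \<noteq> 0} = 6 * infsum F {x. x \<noteq> 0 \<and> normalize x = x}"
proof -
  let ?U = "{u :: eis. is_unit u}" and ?N = "{x :: eis. x \<noteq> 0 \<and> normalize x = x}"
  have bij: "bij_betw (\<lambda>(u, x). u * x) (?U \<times> ?N) {x. x \<noteq> 0}"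
  proof (rule bij_betw_byWitness[where f' = "\<lambda>x. (unit_factor x, normalize x)"])
    have "unit_factor (u * x) = u \<and> normalize (u * x) = x" if "is_unit u" "x \<noteq> 0" "normalize x = x" for u x :: eis
    proof -
      have "unit_factor x * x = x" using unit_factor_mult_normalize[of x] that(3) by simp
      then have "unit_factor x = 1" using that(2) by simp
      with that show ?thesis by (simp add: unit_factor_mult_unit_left normalize_mult_unit_left)
    qed
    then show "\<forall>z\<in>?U \<times> ?N. (unit_factor (case z of (u, x) \<Rightarrow> u * x), normalize (case z of (u, x) \<Rightarrow> u * x)) = z"
      by auto
    show "(\<lambda>(u, x). u * x) ` (?U \<times> ?N) \<subseteq> {x. x \<noteq> 0}" by auto
  qed (auto simp: unit_factor_is_unit)
  have "infsum F {x. x \<noteq> 0} = infsum (\<lambda>z. F ((\<lambda>(u, x). u * x) z)) (?U \<times> ?N)"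
    by (rule infsum_reindex_bij_betw[OF bij, symmetric])
  also have "\<dots> = infsum (\<lambda>u. infsum (\<lambda>x. F (u * x)) ?N) ?U"
  proof -
    have s: "(\<lambda>z. F ((\<lambda>(u, x). u * x) z)) summable_on (?U \<times> ?N)"
      using summable_on_reindex_bij_betw[OF bij] summ by blast
    then show ?thesis
      using infsum_Sigma'_banach[of "\<lambda>u x. F (u * x)" ?U "\<lambda>_. ?N"] by (simp add: case_prod_unfold)
  qed
  also have "\<dots> = infsum (\<lambda>u. infsum F ?N) ?U"
    by (rule infsum_cong) (simp add: unit)
  also have "\<dots> = 6 * infsum F ?N"
  proof -
    have "finite ?U" by (rule card_ge_0_finite) (simp add: card_eis_units)
    then show ?thesis by (simp add: card_eis_units)
  qed
  finally show ?thesis .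
qed

section \<open>L-functions of cubic characters\<close>

text \<open>A mixed second difference of t^-s, bounded by applying the mean value theorem in t and
  then in s. The mixed derivative has size ln t / t^2; the bound ln t \<le> 4 t^(1/4) turns this
  into the exponent 7/4, and 1 + 2 * 4 is the constant 9.\<close>

lemma powr_double_diff_bound:
  fixes s s' t t0 m :: real
  assumes s: "1 < s" "s < 2" "1 < s'" "s' < 2" and m: "1 \<le> m" "m \<le> t" "m \<le> t0"
  shows "\<bar>(t powr - s - t0 powr - s) - (t powr - s' - t0 powr - s')\<bar>
           \<le> 9 * m powr (- (7 / 4)) * \<bar>t - t0\<bar> * \<bar>s - s'\<bar>"
proof -
  let ?B = "9 * m powr (- (7 / 4))"
  define g where "g = (\<lambda>\<xi> \<tau> :: real. ln \<tau> * \<tau> powr - \<xi>)"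
  have g: "\<bar>g \<xi> t - g \<xi> t0\<bar> \<le> ?B * \<bar>t - t0\<bar>" if \<xi>: "1 < \<xi>" "\<xi> < 2" for \<xi>
  proof -
    have "norm (g \<xi> t - g \<xi> t0) \<le> ?B * norm (t - t0)"
    proof (rule field_differentiable_bound[of "{m..}"])
      fix \<tau> assume "\<tau> \<in> {m..}"
      then have \<tau>: "\<tau> \<ge> m" "\<tau> \<ge> 1" using m by auto
      have "(g \<xi> has_real_derivative (1 - \<xi> * ln \<tau>) * \<tau> powr (- \<xi> - 1)) (at \<tau>)"
        unfolding g_def using \<tau>
        by (auto intro!: derivative_eq_intros simp: powr_diff powr_minus field_simps)
      then show "(g \<xi> has_real_derivative (1 - \<xi> * ln \<tau>) * \<tau> powr (- \<xi> - 1)) (at \<tau> within {m..})"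
        by (rule has_field_derivative_at_within)
      have ln: "0 \<le> ln \<tau>" "ln \<tau> \<le> 4 * \<tau> powr (1 / 4)"
        using \<tau> ln_powr_bound[of \<tau> "1 / 4"] by auto
      have p1: "\<tau> powr (1 / 4) \<ge> 1" using \<tau> by (simp add: ge_one_powr_ge_zero)
      have "\<xi> * ln \<tau> \<le> 2 * ln \<tau>" "0 \<le> \<xi> * ln \<tau>" using \<xi> ln by (auto intro: mult_right_mono)
      then have "\<bar>1 - \<xi> * ln \<tau>\<bar> \<le> 9 * \<tau> powr (1 / 4)" using ln p1 by linarith
      moreover have "\<tau> powr (- \<xi> - 1) \<le> \<tau> powr - 2" by (rule powr_mono) (use \<xi> \<tau> in auto)
      ultimately have "\<bar>1 - \<xi> * ln \<tau>\<bar> * \<tau> powr (- \<xi> - 1) \<le> 9 * \<tau> powr (1 / 4) * \<tau> powr - 2"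
        by (intro mult_mono) auto
      also have "\<dots> = 9 * \<tau> powr (- (7 / 4))" by (simp add: powr_add[symmetric])
      also have "\<tau> powr (- (7 / 4)) \<le> m powr (- (7 / 4))" by (rule powr_mono2') (use \<tau> m in auto)
      finally show "norm ((1 - \<xi> * ln \<tau>) * \<tau> powr (- \<xi> - 1)) \<le> ?B"
        by (simp add: abs_mult)
    qed (use m in auto)
    then show ?thesis by simp
  qed
  define \<phi> where "\<phi> = (\<lambda>\<xi>. t powr - \<xi> - t0 powr - \<xi>)"
  have "norm (\<phi> s - \<phi> s') \<le> (?B * \<bar>t - t0\<bar>) * norm (s - s')"
  proof (rule field_differentiable_bound[of "{1<..<2}"])
    fix \<xi> :: real assume "\<xi> \<in> {1<..<2}"
    then have \<xi>: "1 < \<xi>" "\<xi> < 2" by auto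
    have "(\<phi> has_real_derivative (g \<xi> t0 - g \<xi> t)) (at \<xi>)"
      unfolding \<phi>_def g_def using m by (auto intro!: derivative_eq_intros)
    then show "(\<phi> has_real_derivative (g \<xi> t0 - g \<xi> t)) (at \<xi> within {1<..<2})"
      by (rule has_field_derivative_at_within)
    show "norm (g \<xi> t0 - g \<xi> t) \<le> ?B * \<bar>t - t0\<bar>" using g[OF \<xi>] by (simp add: abs_minus_commute)
  qed (use s in auto)
  then show ?thesis by (simp add: \<phi>_def)
qed

lemma powr_lipschitz:
  fixes s s' t :: real
  assumes "1 < s" "1 < s'" and t: "1 \<le> t"
  shows "\<bar>t powr - s - t powr - s'\<bar> \<le> ln t * \<bar>s - s'\<bar>"
proof -
  have "norm (t powr - s - t powr - s') \<le> ln t * norm (s - s')"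
  proof (rule field_differentiable_bound[of "{1<..}"])
    fix \<xi> :: real assume "\<xi> \<in> {1<..}"
    then have \<xi>: "1 < \<xi>" by auto
    have "((\<lambda>\<xi>. t powr - \<xi>) has_real_derivative - (ln t * t powr - \<xi>)) (at \<xi>)"
      using t by (auto intro!: derivative_eq_intros)
    then show "((\<lambda>\<xi>. t powr - \<xi>) has_real_derivative - (ln t * t powr - \<xi>)) (at \<xi> within {1<..})"
      by (rule has_field_derivative_at_within)
    have "t powr - \<xi> \<le> t powr 0" by (rule powr_mono) (use t \<xi> in auto)
    then have "ln t * t powr - \<xi> \<le> ln t * 1" using t by (intro mult_left_mono) auto
    then show "norm (- (ln t * t powr - \<xi>)) \<le> ln t" using t by (simp add: abs_mult)
  qed (use assms in auto)
  then show ?thesis by simp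
qed

section \<open>Sums with periodic weights, grouped into blocks\<close>

definition eis_residues :: "nat \<Rightarrow> eis set" where
  "eis_residues f = (\<lambda>(a, b). Eis a b) ` ({0..<int f} \<times> {0..<int f})"

definition eis_mod :: "nat \<Rightarrow> eis \<Rightarrow> eis" where
  "eis_mod f x = Eis (eis_fst x mod int f) (eis_snd x mod int f)"

lemma finite_eis_residues [simp]: "finite (eis_residues f)"
  by (simp add: eis_residues_def)

lemma eis_mod_in_residues [simp]: "f > 0 \<Longrightarrow> eis_mod f x \<in> eis_residues f"
  by (auto simp: eis_mod_def eis_residues_def)

lemma eis_mod_residue: "r \<in> eis_residues f \<Longrightarrow> eis_mod f r = r"
  by (auto simp: eis_mod_def eis_residues_def)

lemma eis_mod_eq_iff: "eis_mod f x = eis_mod f y \<longleftrightarrow> of_nat f dvd x - y"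
  using of_int_dvd_eis_iff[of "int f" "x - y"] by (simp add: eis_mod_def mod_eq_dvd_iff)

lemma eis_mod_dvd: "of_nat f dvd x - eis_mod f x"
proof -
  have "eis_mod f x = eis_mod f (eis_mod f x)" by (simp add: eis_mod_def)
  then show ?thesis by (simp only: eis_mod_eq_iff)
qed

lemma bij_betw_eis_blocks:
  assumes "f > 0"
  shows "bij_betw (\<lambda>(u, r). of_nat f * u + r) (UNIV \<times> eis_residues f) UNIV"
proof (rule bij_betwI')
  fix z z' :: "eis \<times> eis" assume z: "z \<in> UNIV \<times> eis_residues f" "z' \<in> UNIV \<times> eis_residues f"
  obtain u r u' r' :: eis where uv: "z = (u, r)" "z' = (u', r')" by (cases z, cases z')
  have "u = u' \<and> r = r'" if e: "of_nat f * u + r = of_nat f * u' + r'"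
  proof -
    have "r - r' = of_nat f * (u' - u)" using e by (simp add: algebra_simps)
    then have "eis_mod f r = eis_mod f r'" unfolding eis_mod_eq_iff by simp
    then have "r = r'" using z uv by (simp add: eis_mod_residue)
    moreover have "(of_nat f :: eis) \<noteq> 0" using assms by (simp add: of_nat_eis)
    ultimately show ?thesis using e by simp
  qed
  then show "((case z of (u, r) \<Rightarrow> of_nat f * u + r) = (case z' of (u, r) \<Rightarrow> of_nat f * u + r)) = (z = z')"
    using uv by auto
next
  fix x :: eis
  obtain u where "x - eis_mod f x = of_nat f * u" using eis_mod_dvd[of f x] by (auto simp: dvd_def)
  then have "x = (case (u, eis_mod f x) of (u, r) \<Rightarrow> of_nat f * u + r)" by (simp add: algebra_simps)
  then show "\<exists>z\<in>UNIV \<times> eis_residues f. x = (case z of (u, r) \<Rightarrow> of_nat f * u + r)"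
    using assms by (intro bexI[of _ "(u, eis_mod f x)"]) auto
qed auto

text \<open>Within a block the norm varies by O(|u|), one power of |u| less than its size. This gain
  makes the blockwise estimate summable.\<close>

lemma eis_norm_shift_bound:
  assumes r: "r \<in> eis_residues f" and R: "eis_max u \<ge> 1"
  shows "\<bar>real_of_int (eis_norm (of_nat f * u + r)) - real_of_int (eis_norm (of_nat f * u))\<bar>
           \<le> 9 * (real f)\<^sup>2 * real (eis_max u)"
proof -
  obtain a b where ab: "r = Eis a b" "0 \<le> a" "a < int f" "0 \<le> b" "b < int f"
    using r by (auto simp: eis_residues_def)
  obtain c d where cd: "u = Eis c d" by (cases u)
  define F M where "F = int f" and "M = int (eis_max u)"
  have cb: "\<bar>c\<bar> \<le> M" "\<bar>d\<bar> \<le> M" using eis_max_bounds[of u] cd by (auto simp: M_def)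
  have M: "M \<ge> 1" and F: "F \<ge> 0" using R by (auto simp: M_def F_def)
  have e: "eis_norm (of_nat f * u + r) - eis_norm (of_nat f * u) =
      F * c * (2 * a + b) + F * d * (a + 2 * b) + (a\<^sup>2 + a * b + b\<^sup>2)"
    by (simp add: ab cd of_nat_eis eis_norm_Eis F_def power2_eq_square algebra_simps)
  have m: "\<bar>F * c * (2 * a + b)\<bar> \<le> F * M * (3 * F)" "\<bar>F * d * (a + 2 * b)\<bar> \<le> F * M * (3 * F)"
    unfolding abs_mult using cb F ab by (intro mult_mono; auto simp: F_def)+
  have sq: "a\<^sup>2 \<le> F * F" "b\<^sup>2 \<le> F * F" "a * b \<le> F * F" "0 \<le> a\<^sup>2" "0 \<le> b\<^sup>2" "0 \<le> a * b"
    unfolding power2_eq_square using ab by (auto intro!: mult_mono simp: F_def)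
  have "F * F * 1 \<le> F * F * M" using M F by (intro mult_left_mono) auto
  have "\<bar>eis_norm (of_nat f * u + r) - eis_norm (of_nat f * u)\<bar> \<le> 9 * (F * F * M)"
  proof -
    define P Q S W where "P = F * c * (2 * a + b)" and "Q = F * d * (a + 2 * b)"
      and "S = a\<^sup>2 + a * b + b\<^sup>2" and "W = F * F * M"
    have "F * M * (3 * F) = 3 * W" by (simp add: W_def)
    then have "\<bar>P\<bar> \<le> 3 * W" "\<bar>Q\<bar> \<le> 3 * W" using m unfolding P_def Q_def by metis+
    moreover have "0 \<le> S" "S \<le> 3 * (F * F)" "F * F \<le> W"
      using sq \<open>F * F * 1 \<le> F * F * M\<close> by (simp_all add: S_def W_def)
    ultimately have "\<bar>P + Q + S\<bar> \<le> 9 * W" by linarith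
    then show ?thesis unfolding e P_def Q_def S_def W_def .
  qed
  then have "real_of_int \<bar>eis_norm (of_nat f * u + r) - eis_norm (of_nat f * u)\<bar> \<le> real_of_int (9 * (F * F * M))"
    by (simp only: of_int_le_iff)
  then show ?thesis by (simp add: F_def M_def power2_eq_square)
qed

text \<open>For a coordinate with |c| \<ge> 2, a shift by less than f cannot bring f c near 0,
  because f (|c| - 1) \<ge> |c| - 1 \<ge> |c| / 2. Blocks with smaller \<open>u\<close> may contain
  the origin and need a separate bound.\<close>

lemma eis_max_shift:
  assumes r: "r \<in> eis_residues f" and f: "f > 0" and R: "eis_max u \<ge> 2"
  shows "2 * eis_max (of_nat f * u + r) \<ge> eis_max u"
proof -
  obtain a b where ab: "r = Eis a b" "0 \<le> a" "a < int f" "0 \<le> b" "b < int f"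
    using r by (auto simp: eis_residues_def)
  obtain c d where cd: "u = Eis c d" by (cases u)
  have key: "2 * \<bar>int f * c + a\<bar> \<ge> \<bar>c\<bar>" if c: "\<bar>c\<bar> \<ge> 2" and a: "0 \<le> a" "a < int f" for a c
  proof -
    have "\<bar>int f * c\<bar> \<ge> int f * \<bar>c\<bar>" by (simp add: abs_mult)
    then have "\<bar>int f * c + a\<bar> \<ge> int f * \<bar>c\<bar> - int f" using a by linarith
    also have "int f * \<bar>c\<bar> - int f = int f * (\<bar>c\<bar> - 1)" by (simp add: algebra_simps)
    finally have A: "int f * (\<bar>c\<bar> - 1) \<le> \<bar>int f * c + a\<bar>" .
    have B: "1 * (\<bar>c\<bar> - 1) \<le> int f * (\<bar>c\<bar> - 1)" using f c by (intro mult_right_mono) auto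
    define x where "x = \<bar>int f * c + a\<bar>"
    have "\<bar>c\<bar> - 1 \<le> x" using order_trans[OF B A] by (simp add: x_def)
    then have "\<bar>c\<bar> \<le> 2 * x" using c by linarith
    then show ?thesis by (simp add: x_def)
  qed
  have "eis_max u = nat \<bar>c\<bar> \<or> eis_max u = nat \<bar>d\<bar>" by (auto simp: eis_max_def cd max_def)
  then show ?thesis
  proof
    assume "eis_max u = nat \<bar>c\<bar>"
    with R key[of c a] ab have "2 * \<bar>int f * c + a\<bar> \<ge> int (eis_max u)" by auto
    then show ?thesis using eis_max_bounds(1)[of "of_nat f * u + r"]
      by (simp add: ab(1) cd of_nat_eis)
  next
    assume "eis_max u = nat \<bar>d\<bar>"
    with R key[of d b] ab have "2 * \<bar>int f * d + b\<bar> \<ge> int (eis_max u)" by auto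
    then show ?thesis using eis_max_bounds(2)[of "of_nat f * u + r"]
      by (simp add: ab(1) cd of_nat_eis)
  qed
qed

lemma eis_pow_summable_UNIV:
  assumes "1 < s" "s \<le> 2"
  shows "eis_pow s summable_on UNIV"
proof -
  have "eis_pow s summable_on {x. x \<noteq> 0} \<union> {0}"
    by (rule summable_on_union[OF eis_zeta(1)[OF assms]]) simp
  moreover have "{x :: eis. x \<noteq> 0} \<union> {0} = UNIV" by auto
  ultimately show ?thesis by simp
qed

text \<open>The weights of a block cancel, so the value at its corner \<open>of_nat f * u\<close>
  can be subtracted from every term without changing the block sum. What remains is a mixed
  difference of order |u|^(-5/2) |s - s'|, summable over a lattice of rank 2. Hence the sum has a
  limit as \<open>s\<close> tends to 1, approached at a linear rate.\<close>

lemma periodic_sum_lipschitz: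
  fixes \<eta> :: "eis \<Rightarrow> complex"
  assumes f: "f > 0" and bound: "\<And>x. norm (\<eta> x) \<le> 1"
    and period: "\<And>x y. \<eta> (of_nat f * y + x) = \<eta> x"
    and mean: "(\<Sum>r\<in>eis_residues f. \<eta> r) = 0"
  obtains K where "K \<ge> 0"
    "\<And>s s'. 1 < s \<Longrightarrow> s < 2 \<Longrightarrow> 1 < s' \<Longrightarrow> s' < 2 \<Longrightarrow>
       norm (infsum (\<lambda>x. \<eta> x * eis_pow s x) UNIV - infsum (\<lambda>x. \<eta> x * eis_pow s' x) UNIV) \<le> K * \<bar>s - s'\<bar>"
proof -
  let ?R = "eis_residues f"
  define D where "D = (\<lambda>s u. \<Sum>r\<in>?R. \<eta> r * eis_pow s (of_nat f * u + r))"
  have LD: "infsum (\<lambda>x. \<eta> x * eis_pow s x) UNIV = infsum (D s) UNIV \<and> D s summable_on UNIV"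
    if s: "1 < s" "s < 2" for s
  proof -
    have "(\<lambda>x. \<eta> x * eis_pow s x) abs_summable_on UNIV"
    proof (rule Infinite_Sum.abs_summable_on_comparison_test'[OF eis_pow_summable_UNIV])
      show "norm (\<eta> x * eis_pow s x) \<le> eis_pow s x" for x
        using mult_right_mono[OF bound[of x], of "eis_pow s x"] by (simp add: norm_mult)
    qed (use s in auto)
    then have summ: "(\<lambda>x. \<eta> x * eis_pow s x) summable_on UNIV" by (rule abs_summable_summable)
    have s2: "(\<lambda>z. \<eta> (case z of (u, r) \<Rightarrow> of_nat f * u + r) * eis_pow s (case z of (u, r) \<Rightarrow> of_nat f * u + r))
        summable_on UNIV \<times> ?R"
      using summable_on_reindex_bij_betw[OF bij_betw_eis_blocks[OF f], of "\<lambda>x. \<eta> x * eis_pow s x"] summ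
      by blast
    have e: "(\<lambda>z. \<eta> (case z of (u, r) \<Rightarrow> of_nat f * u + r) * eis_pow s (case z of (u, r) \<Rightarrow> of_nat f * u + r)) =
        (\<lambda>(u, r). \<eta> r * eis_pow s (of_nat f * u + r))"
      by (auto simp: fun_eq_iff period)
    have "infsum (\<lambda>x. \<eta> x * eis_pow s x) UNIV =
        infsum (\<lambda>z. \<eta> (case z of (u, r) \<Rightarrow> of_nat f * u + r) * eis_pow s (case z of (u, r) \<Rightarrow> of_nat f * u + r))
          (UNIV \<times> ?R)"
      by (rule infsum_reindex_bij_betw[OF bij_betw_eis_blocks[OF f], symmetric])
    also have "\<dots> = infsum (\<lambda>u. infsum (\<lambda>r. \<eta> r * eis_pow s (of_nat f * u + r)) ?R) UNIV"
      unfolding e using infsum_Sigma'_banach[of "\<lambda>u r. \<eta> r * eis_pow s (of_nat f * u + r)" UNIV "\<lambda>_. ?R"]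
        s2[unfolded e] by simp
    also have "\<dots> = infsum (D s) UNIV" by (simp add: D_def)
    finally have 1: "infsum (\<lambda>x. \<eta> x * eis_pow s x) UNIV = infsum (D s) UNIV" .
    have "(\<lambda>u. infsum (\<lambda>r. \<eta> r * eis_pow s (of_nat f * u + r)) ?R) summable_on UNIV"
      using summable_on_Sigma_banach[of "\<lambda>u r. \<eta> r * eis_pow s (of_nat f * u + r)" UNIV "\<lambda>_. ?R"]
        s2[unfolded e] by simp
    then have "D s summable_on UNIV" by (simp add: D_def)
    with 1 show ?thesis by simp
  qed
  \<comment> \<open>With M = \<open>eis_max u\<close>, norms in the block are at least 3/4 (M/2)^2 =
    3/16 M^2 and deviate from the corner by at most 9 f^2 M. Inserted into the mixed difference
    bound this gives M^(-7/2) M = M^(-5/2). The nine blocks next to the origin receive a crude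
    logarithmic bound instead.\<close>
  define c where "c = 9 * (3 / 16) powr (- (7 / 4)) * (9 * (real f)\<^sup>2) * real (card ?R)"
  define K where "K = (\<lambda>u. if eis_max u \<le> 1 then (\<Sum>r\<in>?R. ln (max 1 (real_of_int (eis_norm (of_nat f * u + r)))))
      else c * real (eis_max u) powr (- (5 / 2)))"
  have c: "c \<ge> 0" by (simp add: c_def)
  have K0: "K u \<ge> 0" for u unfolding K_def using c by (auto intro!: sum_nonneg)
  have Ks: "K summable_on UNIV"
  proof -
    have "(\<lambda>u. c * real (eis_max u) powr (- (5 / 2))) summable_on {x. x \<noteq> 0}"
      by (rule summable_on_cmult_right) (use eis_max_sum(1)[of "5 / 2"] in simp)
    then have "(\<lambda>u. c * real (eis_max u) powr (- (5 / 2))) summable_on {u. eis_max u > 1}"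
      by (rule summable_on_subset_banach) auto
    then have "K summable_on {u. eis_max u > 1}"
      by (rule summable_on_cong[THEN iffD1, rotated]) (auto simp: K_def)
    moreover have "K summable_on {u. eis_max u \<le> 1}" by (rule summable_on_finite[OF finite_eis_box])
    ultimately have "K summable_on {u. eis_max u > 1} \<union> {u. eis_max u \<le> 1}" by (rule summable_on_union)
    moreover have "{u. eis_max u > 1} \<union> {u. eis_max u \<le> 1} = UNIV" by auto
    ultimately show ?thesis by simp
  qed
  have main: "norm (D s u - D s' u) \<le> K u * \<bar>s - s'\<bar>"
    if s: "1 < s" "s < 2" "1 < s'" "s' < 2" for s s' u
  proof (cases "eis_max u \<le> 1")
    case True
    have "norm (D s u - D s' u) = norm (\<Sum>r\<in>?R. \<eta> r * (eis_pow s (of_nat f * u + r) - eis_pow s' (of_nat f * u + r)))"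
      by (simp add: D_def sum_subtractf[symmetric] right_diff_distrib)
    also have "\<dots> \<le> (\<Sum>r\<in>?R. ln (max 1 (real_of_int (eis_norm (of_nat f * u + r)))) * \<bar>s - s'\<bar>)"
    proof (rule sum_norm_le)
      fix r assume "r \<in> ?R"
      let ?y = "of_nat f * u + r"
      have a: "\<bar>eis_pow s ?y - eis_pow s' ?y\<bar> \<le> ln (max 1 (real_of_int (eis_norm ?y))) * \<bar>s - s'\<bar>"
      proof (cases "?y = 0")
        case False
        then have "eis_norm ?y \<ge> 1" using eis_norm_pos[of ?y] by linarith
        then have "real_of_int (eis_norm ?y) \<ge> 1" by simp
        then show ?thesis using powr_lipschitz[of s s' "real_of_int (eis_norm ?y)"] s by (simp add: max_def)
      qed simp
      have b: "norm (\<eta> r * complex_of_real (eis_pow s ?y - eis_pow s' ?y)) \<le> \<bar>eis_pow s ?y - eis_pow s' ?y\<bar>"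
        using mult_right_mono[OF bound[of r], of "\<bar>eis_pow s ?y - eis_pow s' ?y\<bar>"]
        unfolding norm_mult norm_of_real mult_1 by simp
      show "norm (\<eta> r * complex_of_real (eis_pow s ?y - eis_pow s' ?y)) \<le> ln (max 1 (real_of_int (eis_norm ?y))) * \<bar>s - s'\<bar>"
        by (rule order_trans[OF b a])
    qed
    also have "\<dots> = K u * \<bar>s - s'\<bar>" using True by (simp add: K_def sum_distrib_right)
    finally show ?thesis .
  next
    case False
    then have R: "eis_max u \<ge> 2" by simp
    define y0 where "y0 = of_nat f * u"
    define M where "M = real (eis_max u)"
    have M: "M \<ge> 2" using R by (simp add: M_def)
    define m where "m = max 1 (3 / 16 * M\<^sup>2)"
    have low: "m \<le> real_of_int (eis_norm y)" if "2 * eis_max y \<ge> eis_max u" for y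
    proof -
      have "y \<noteq> 0" using that R by auto
      then have "eis_norm y \<ge> 1" using eis_norm_pos[of y] by linarith
      then have 1: "real_of_int (eis_norm y) \<ge> 1" by simp
      have "M \<le> 2 * real (eis_max y)" using that by (simp add: M_def)
      then have "M\<^sup>2 \<le> (2 * real (eis_max y))\<^sup>2" using M by (intro power_mono) auto
      moreover have "real_of_int (3 * (int (eis_max y))\<^sup>2) \<le> real_of_int (4 * eis_norm y)"
        using eis_norm_ge_max[of y] by (simp only: of_int_le_iff)
      ultimately have "3 / 16 * M\<^sup>2 \<le> real_of_int (eis_norm y)" by (simp add: power_mult_distrib)
      with 1 show ?thesis by (simp add: m_def)
    qed
    have y0: "m \<le> real_of_int (eis_norm y0)"
    proof (rule low)
      have "0 \<in> ?R" using f unfolding eis_residues_def zero_eis_def by force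
      from eis_max_shift[OF this f R] show "2 * eis_max y0 \<ge> eis_max u" by (simp add: y0_def)
    qed
    define E where "E = (\<lambda>r. (eis_pow s (y0 + r) - eis_pow s y0) - (eis_pow s' (y0 + r) - eis_pow s' y0))"
    define W where "W = 9 * m powr (- (7 / 4)) * (9 * (real f)\<^sup>2 * M) * \<bar>s - s'\<bar>"
    \<comment> \<open>The place where mean zero is used: the corner terms carry the factor
      \<open>\<Sum>r\<in>?R. \<eta> r\<close>.\<close>
    have "(\<Sum>r\<in>?R. \<eta> r * complex_of_real (E r)) =
        (\<Sum>r\<in>?R. (\<eta> r * eis_pow s (y0 + r) - \<eta> r * eis_pow s' (y0 + r)) - \<eta> r * complex_of_real (eis_pow s y0 - eis_pow s' y0))"
      by (rule sum.cong) (simp_all add: E_def algebra_simps)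
    also have "\<dots> = D s u - D s' u - (\<Sum>r\<in>?R. \<eta> r) * complex_of_real (eis_pow s y0 - eis_pow s' y0)"
      by (simp only: sum_subtractf sum_distrib_right D_def y0_def)
    finally have eq: "D s u - D s' u = (\<Sum>r\<in>?R. \<eta> r * complex_of_real (E r))" using mean by simp
    have bnd: "norm (\<eta> r * complex_of_real (E r)) \<le> W" if r: "r \<in> ?R" for r
    proof -
      have "norm (\<eta> r * complex_of_real (E r)) \<le> \<bar>E r\<bar>"
        using mult_right_mono[OF bound[of r], of "\<bar>E r\<bar>"] unfolding norm_mult norm_of_real mult_1 by simp
      also have "\<dots> \<le> 9 * m powr (- (7 / 4)) *
          \<bar>real_of_int (eis_norm (y0 + r)) - real_of_int (eis_norm y0)\<bar> * \<bar>s - s'\<bar>"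
        unfolding E_def
        by (rule powr_double_diff_bound) (use s y0 low[OF eis_max_shift[OF r f R, folded y0_def]] in \<open>auto simp: m_def\<close>)
      also have "\<dots> \<le> W"
        using eis_norm_shift_bound[OF r, of u] R unfolding y0_def M_def W_def
        by (intro mult_right_mono mult_left_mono) auto
      finally show ?thesis .
    qed
    have "norm (D s u - D s' u) \<le> (\<Sum>r\<in>?R. W)" unfolding eq by (rule sum_norm_le) (rule bnd)
    also have "\<dots> = real (card ?R) * (9 * m powr (- (7 / 4)) * (9 * (real f)\<^sup>2 * M) * \<bar>s - s'\<bar>)" by (simp add: W_def)
    also have "\<dots> \<le> real (card ?R) * (9 * ((3 / 16) powr (- (7 / 4)) * M powr (- (7 / 2))) * (9 * (real f)\<^sup>2 * M) * \<bar>s - s'\<bar>)"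
    proof -
      have "m powr (- (7 / 4)) \<le> (3 / 16 * M\<^sup>2) powr (- (7 / 4))"
        by (rule powr_mono2') (use M in \<open>auto simp: m_def\<close>)
      also have "\<dots> = (3 / 16) powr (- (7 / 4)) * (M\<^sup>2) powr (- (7 / 4))" by (rule powr_mult)
      also have "(M\<^sup>2) powr (- (7 / 4)) = M powr (- (7 / 2))"
        using powr_realpow[of M 2] powr_powr[of M 2 "- (7 / 4)"] M by simp
      finally have "m powr (- (7 / 4)) \<le> (3 / 16) powr (- (7 / 4)) * M powr (- (7 / 2))" .
      then show ?thesis using M by (intro mult_left_mono mult_right_mono) auto
    qed
    also have "\<dots> = K u * \<bar>s - s'\<bar>"
    proof -
      have "M powr (- (7 / 2)) * M = M powr (- (7 / 2)) * M powr 1" using M by simp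
      also have "\<dots> = M powr (- (5 / 2))" by (simp only: powr_add[symmetric]) simp
      finally have "M powr (- (7 / 2)) * M = M powr (- (5 / 2))" .
      then have "K u = c * (M powr (- (7 / 2)) * M)" using False by (simp add: K_def M_def)
      then show ?thesis by (simp add: c_def)
    qed
    finally show ?thesis .
  qed
  show ?thesis
  proof (rule that[of "infsum K UNIV"])
    show "infsum K UNIV \<ge> 0" by (rule infsum_nonneg) (rule K0)
    fix s s' :: real assume s: "1 < s" "s < 2" "1 < s'" "s' < 2"
    have "(D s has_sum infsum (D s) UNIV) UNIV" "((\<lambda>u. - D s' u) has_sum - infsum (D s') UNIV) UNIV"
      using LD[of s] LD[of s'] s by (auto simp: has_sum_uminus)
    from has_sum_add[OF this] have hs: "((\<lambda>u. D s u - D s' u) has_sum (infsum (D s) UNIV - infsum (D s') UNIV)) UNIV"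
      by simp
    have "norm (infsum (\<lambda>x. \<eta> x * eis_pow s x) UNIV - infsum (\<lambda>x. \<eta> x * eis_pow s' x) UNIV) =
        norm (infsum (D s) UNIV - infsum (D s') UNIV)"
      using LD[of s] LD[of s'] s by simp
    also have "\<dots> \<le> infsum (\<lambda>u. K u * \<bar>s - s'\<bar>) UNIV"
      by (rule norm_infsum_le[OF hs has_sum_infsum[OF summable_on_cmult_left[OF Ks]]]) (use main s in auto)
    also have "\<dots> = infsum K UNIV * \<bar>s - s'\<bar>" by (rule infsum_cmult_left')
    finally show "norm (infsum (\<lambda>x. \<eta> x * eis_pow s x) UNIV - infsum (\<lambda>x. \<eta> x * eis_pow s' x) UNIV) \<le> infsum K UNIV * \<bar>s - s'\<bar>" .
  qed
qed

text \<open>The value 1 on units makes this a character of ideals. The modulus is a rational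
  integer, so that a square box is a residue system. The trivial character is allowed; where
  nontriviality matters, a witness is passed along.\<close>

definition cubic_character :: "nat \<Rightarrow> (eis \<Rightarrow> complex) \<Rightarrow> bool" where
  "cubic_character f \<eta> \<longleftrightarrow> f > 0 \<and> (\<forall>x y. \<eta> (x * y) = \<eta> x * \<eta> y) \<and> (\<forall>u. is_unit u \<longrightarrow> \<eta> u = 1) \<and>
     (\<forall>x. coprime x (of_nat f) \<longrightarrow> \<eta> x ^ 3 = 1) \<and> (\<forall>x. \<not> coprime x (of_nat f) \<longrightarrow> \<eta> x = 0) \<and>
     (\<forall>x y. \<eta> (of_nat f * y + x) = \<eta> x)"

lemma cube_root_of_unity:
  fixes z :: complex
  assumes "z ^ 3 = 1"
  shows "norm z = 1" and "z \<noteq> 1 \<Longrightarrow> Re z = - (1 / 2)" and "z \<noteq> 1 \<Longrightarrow> z\<^sup>2 + z + 1 = 0" and "z\<^sup>2 = cnj z"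
proof -
  have "norm z ^ 3 = 1" using assms by (metis norm_one norm_power)
  then show n: "norm z = 1" using power_eq_imp_eq_base[of "norm z" 3 1] by simp
  have "z * z\<^sup>2 = 1" using assms by (simp add: power3_eq_cube power2_eq_square mult.assoc)
  moreover have "z * cnj z = 1" using n complex_norm_square[of z] by simp
  ultimately have "z * z\<^sup>2 = z * cnj z" by simp
  moreover have "z \<noteq> 0" using n by auto
  ultimately show c: "z\<^sup>2 = cnj z" by simp
  assume z: "z \<noteq> 1"
  have "(z - 1) * (z\<^sup>2 + z + 1) = z ^ 3 - 1" by (simp add: power3_eq_cube power2_eq_square algebra_simps)
  then show e: "z\<^sup>2 + z + 1 = 0" using z assms by simp
  then have "Re (cnj z + z + 1) = 0" unfolding c by simp
  then show "Re z = - (1 / 2)" by simp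
qed

lemma cubic_character_norm: "cubic_character f \<eta> \<Longrightarrow> norm (\<eta> x) \<le> 1"
  using cube_root_of_unity(1)[of "\<eta> x"] by (cases "coprime x (of_nat f)") (auto simp: cubic_character_def)

text \<open>The value is 3 or 0, and 1 where \<eta> vanishes. It is the sum of 1, \<eta> and its
  conjugate, and its sign is the positivity behind nonvanishing at 1.\<close>

lemma cubic_character_Re: "cubic_character f \<eta> \<Longrightarrow> 1 + 2 * Re (\<eta> x) \<ge> 0"
  using cube_root_of_unity(2)[of "\<eta> x"]
  by (cases "coprime x (of_nat f)"; cases "\<eta> x = 1") (auto simp: cubic_character_def)

lemma cubic_character_mod: "cubic_character f \<eta> \<Longrightarrow> \<eta> (eis_mod f x) = \<eta> x"
proof -
  assume c: "cubic_character f \<eta>"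
  obtain u where "x - eis_mod f x = of_nat f * u" using eis_mod_dvd[of f x] by (auto simp: dvd_def)
  then have "x = of_nat f * u + eis_mod f x" by (simp add: algebra_simps)
  then show ?thesis using c unfolding cubic_character_def by metis
qed

lemma cubic_character_mean:
  assumes c: "cubic_character f \<eta>" and y: "coprime y (of_nat f)" "\<eta> y \<noteq> 1"
  shows "(\<Sum>r\<in>eis_residues f. \<eta> r) = 0"
proof -
  let ?R = "eis_residues f" and ?g = "\<lambda>r. eis_mod f (y * r)"
  have f: "f > 0" using c by (simp add: cubic_character_def)
  have inj: "inj_on ?g ?R"
  proof (rule inj_onI)
    fix r r' assume r: "r \<in> ?R" "r' \<in> ?R" "?g r = ?g r'"
    then have "of_nat f dvd y * (r - r')" by (simp add: eis_mod_eq_iff right_diff_distrib)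
    then have "of_nat f dvd r - r'" using y by (simp add: coprime_dvd_mult_right_iff coprime_commute)
    then have "eis_mod f r = eis_mod f r'" by (simp add: eis_mod_eq_iff)
    then show "r = r'" using r by (simp add: eis_mod_residue)
  qed
  have "?g ` ?R = ?R" by (rule endo_inj_surj) (use inj f in auto)
  then have "(\<Sum>r\<in>?R. \<eta> r) = (\<Sum>r\<in>?g ` ?R. \<eta> r)" by simp
  also have "\<dots> = (\<Sum>r\<in>?R. \<eta> (?g r))" using sum.reindex[OF inj, of \<eta>] by simp
  also have "\<dots> = (\<Sum>r\<in>?R. \<eta> y * \<eta> r)"
    unfolding cubic_character_mod[OF c] using c by (simp add: cubic_character_def)
  also have "\<dots> = \<eta> y * (\<Sum>r\<in>?R. \<eta> r)" by (simp add: sum_distrib_left)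
  finally have "(1 - \<eta> y) * (\<Sum>r\<in>?R. \<eta> r) = 0" by (simp add: algebra_simps)
  then show ?thesis using y by simp
qed

section \<open>Euler products over \<int>[\<omega>] and nonvanishing at 1\<close>

definition eis_prime_sum :: "(eis \<Rightarrow> real) \<Rightarrow> real \<Rightarrow> real" where
  "eis_prime_sum w s = infsum (\<lambda>q. w q * eis_pow s q) {q. prime q}"

lemma eis_prime_sum_summable:
  assumes "1 < s" "s \<le> 2" "\<And>q. \<bar>w q\<bar> \<le> B"
  shows "(\<lambda>q. w q * eis_pow s q) summable_on {q. prime q}"
proof -
  have "eis_pow s summable_on {q. prime q}"
    by (rule summable_on_subset_banach[OF eis_zeta(1)[OF assms(1,2)]]) auto
  then have "(\<lambda>q. B * eis_pow s q) summable_on {q. prime q}" by (rule summable_on_cmult_right)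
  then have "(\<lambda>q. norm (w q * eis_pow s q)) summable_on {q. prime q}"
    by (rule Infinite_Sum.abs_summable_on_comparison_test') (auto simp: abs_mult assms(3) mult_right_mono)
  then show ?thesis by (rule abs_summable_summable)
qed

lemma eis_prime_norm_ge_2: "prime (q :: eis) \<Longrightarrow> eis_norm q \<ge> 2"
proof -
  assume q: "prime q"
  then have "eis_norm q \<noteq> 1" using eis_unit_iff_norm[of q] not_prime_unit by blast
  moreover have "eis_norm q > 0" using q by (simp only: eis_norm_pos) auto
  ultimately show ?thesis by linarith
qed

text \<open>The sum over all nonzero elements counts each ideal six times, hence
  \<open>norm L / 6\<close>. The error \<open>B\<close> depends neither on \<open>s\<close> nor on
  \<eta>, since squares of Euler terms are dominated by N^-2.\<close>

lemma eis_euler_bounds: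
  fixes \<eta> :: "eis \<Rightarrow> complex"
  assumes mult: "\<And>x y. \<eta> (x * y) = \<eta> x * \<eta> y" and unit: "\<And>u. is_unit u \<Longrightarrow> \<eta> u = 1"
    and bound: "\<And>x. norm (\<eta> x) \<le> 1" and s: "1 < s" "s < 2"
  defines "L \<equiv> infsum (\<lambda>x. \<eta> x * eis_pow s x) {x. x \<noteq> 0}"
    and "B \<equiv> 13 * infsum (eis_pow 2) {x. x \<noteq> 0}"
  shows "L \<noteq> 0" "\<bar>eis_prime_sum (\<lambda>q. Re (\<eta> q)) s - ln (norm L / 6)\<bar> \<le> B"
proof -
  define F where "F = (\<lambda>x. \<eta> x * complex_of_real (eis_pow s x))"
  let ?N = "{x :: eis. x \<noteq> 0 \<and> normalize x = x}"
  have nF: "norm (F x) \<le> eis_pow s x" for x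
    using mult_right_mono[OF bound[of x], of "eis_pow s x"] by (simp add: norm_mult F_def)
  have Fabs: "F abs_summable_on {x. x \<noteq> 0}"
    by (rule Infinite_Sum.abs_summable_on_comparison_test'[OF eis_zeta(1)]) (use s nF in auto)
  have Fs: "F summable_on {x. x \<noteq> 0}" by (rule abs_summable_summable[OF Fabs])
  have Fmult: "F (x * y) = F x * F y" for x y
    by (simp add: F_def mult eis_norm_mult powr_mult)
  have Fu: "F u = 1" if "is_unit u" for u
    using that unit[OF that] eis_unit_iff_norm[of u] by (simp add: F_def)
  have "F (normalize x) = F x" for x
  proof (cases "x = 0")
    case False
    have "F x = F (unit_factor x) * F (normalize x)" by (simp add: Fmult[symmetric])
    then show ?thesis using Fu[of "unit_factor x"] False by simp
  qed simp
  moreover have "norm (F q) \<le> 1 / 2" if q: "prime q" for q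
  proof -
    have N: "real_of_int (eis_norm q) \<ge> 2" using eis_prime_norm_ge_2[OF q] by simp
    have "eis_pow s q \<le> real_of_int (eis_norm q) powr - 1" by (rule powr_mono) (use N s in auto)
    also have "\<dots> = 1 / real_of_int (eis_norm q)" using N by (simp add: powr_minus_divide)
    also have "\<dots> \<le> 1 / 2" by (rule frac_le) (use N in auto)
    finally show ?thesis using nF[of q] by linarith
  qed
  moreover have "F 1 = 1" by (rule Fu) simp
  moreover have "F abs_summable_on ?N"
    by (rule summable_on_subset_banach[OF Fabs]) auto
  ultimately have b: "exp (Re (infsum F {p. prime p}) - 13 * infsum (\<lambda>p. (norm (F p))\<^sup>2) {p. prime p}) \<le> norm (infsum F ?N)"
     "norm (infsum F ?N) \<le> exp (Re (infsum F {p. prime p}) + 13 * infsum (\<lambda>p. (norm (F p))\<^sup>2) {p. prime p})"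
    using multiplicative_sum_bounds[of F, OF Fmult] by blast+
  have LN: "L = 6 * infsum F ?N"
  proof -
    have "L = infsum F {x. x \<noteq> 0}" by (simp add: L_def F_def)
    also have "\<dots> = 6 * infsum F ?N" by (rule infsum_eis_units[OF Fs]) (simp add: Fu Fmult)
    finally show ?thesis .
  qed
  have Re: "Re (infsum F {p. prime p}) = eis_prime_sum (\<lambda>q. Re (\<eta> q)) s"
  proof -
    have "F summable_on {p. prime p}" by (rule summable_on_subset_banach[OF Fs]) auto
    then have "Re (infsum F {p. prime p}) = infsum (\<lambda>q. Re (F q)) {p. prime p}"
      using infsum_Re by metis
    then show ?thesis by (simp add: eis_prime_sum_def F_def)
  qed
  have z2: "eis_pow 2 summable_on {x. x \<noteq> 0}" by (rule eis_zeta(1)) auto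
  have F2: "(norm (F p))\<^sup>2 \<le> eis_pow 2 p" if "p \<noteq> 0" for p
  proof -
    have "real_of_int (eis_norm p) \<ge> 1"
    proof -
      have "eis_norm p \<ge> 1" using that eis_norm_pos[of p] by linarith
      then show ?thesis by simp
    qed
    then have le: "eis_pow s p \<le> eis_pow 1 p" by (intro powr_mono) (use s in auto)
    have "(norm (F p))\<^sup>2 \<le> (eis_pow 1 p)\<^sup>2" using nF[of p] le by (intro power_mono) auto
    also have "\<dots> = real_of_int (eis_norm p) powr (- 1 + - 1)" by (simp only: power2_eq_square powr_add)
    also have "- 1 + - 1 = (- 2 :: real)" by simp
    finally show ?thesis .
  qed
  have "(\<lambda>p. (norm (F p))\<^sup>2) summable_on {x. x \<noteq> 0}"
    by (rule summable_on_comparison_test[OF z2]) (use F2 in auto)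
  then have "(\<lambda>p. (norm (F p))\<^sup>2) summable_on {p. prime p}"
    by (rule summable_on_subset_banach) auto
  then have "infsum (\<lambda>p. (norm (F p))\<^sup>2) {p. prime p} \<le> infsum (eis_pow 2) {x. x \<noteq> 0}"
    by (rule infsum_mono_neutral[OF _ z2]) (use F2 in auto)
  then have B: "13 * infsum (\<lambda>p. (norm (F p))\<^sup>2) {p. prime p} \<le> B" by (simp add: B_def)
  have n6: "norm L / 6 = norm (infsum F ?N)" by (simp add: LN norm_mult)
  have pos: "norm (infsum F ?N) > 0" using b(1) by (meson exp_gt_zero less_le_trans)
  then show "L \<noteq> 0" using LN by auto
  have "eis_prime_sum (\<lambda>q. Re (\<eta> q)) s - 13 * infsum (\<lambda>p. (norm (F p))\<^sup>2) {p. prime p} \<le> ln (norm L / 6)"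
    using b(1) ln_ge_iff[OF pos] unfolding Re n6 by blast
  moreover have "ln (norm L / 6) \<le> ln (exp (eis_prime_sum (\<lambda>q. Re (\<eta> q)) s + 13 * infsum (\<lambda>p. (norm (F p))\<^sup>2) {p. prime p}))"
    using b(2) pos unfolding Re n6 by (subst ln_le_cancel_iff) auto
  then have "ln (norm L / 6) \<le> eis_prime_sum (\<lambda>q. Re (\<eta> q)) s + 13 * infsum (\<lambda>p. (norm (F p))\<^sup>2) {p. prime p}"
    by (simp only: ln_exp)
  ultimately show "\<bar>eis_prime_sum (\<lambda>q. Re (\<eta> q)) s - ln (norm L / 6)\<bar> \<le> B" using B by linarith
qed

lemma eis_prime_sum_one:
  obtains C where "\<And>s. 1 < s \<Longrightarrow> s < 2 \<Longrightarrow> \<bar>eis_prime_sum (\<lambda>q. 1) s - ln (1 / (s - 1))\<bar> \<le> C"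
proof -
  define B where "B = 13 * infsum (eis_pow 2) {x. x \<noteq> 0}"
  have "\<bar>eis_prime_sum (\<lambda>q. 1) s - ln (1 / (s - 1))\<bar> \<le> B + ln 4 + ln (27 / 2)" if s: "1 < s" "s < 2" for s
  proof -
    define Z where "Z = infsum (eis_pow s) {x. x \<noteq> 0}"
    have "infsum (\<lambda>x. 1 * complex_of_real (eis_pow s x)) {x. x \<noteq> 0} = complex_of_real Z"
      unfolding Z_def mult_1 by (rule infsum_of_real_complex) (use eis_zeta(1) s in auto)
    then have e: "\<bar>eis_prime_sum (\<lambda>q. 1) s - ln (\<bar>Z\<bar> / 6)\<bar> \<le> B"
      using eis_euler_bounds(2)[of "\<lambda>_. 1" s] s by (simp add: B_def)
    have Zb: "4 / 9 * (1 / (s - 1)) \<le> Z" "Z \<le> 24 * (1 / (s - 1))"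
      using eis_zeta[of s] s unfolding Z_def by simp_all
    have p: "0 < 1 / (s - 1)" using s by simp
    \<comment> \<open>The constants 4/9 and 24 of \<open>eis_zeta\<close>, divided by the six
      units.\<close>
    have lo: "2 / 27 * (1 / (s - 1)) \<le> \<bar>Z\<bar> / 6" and hi: "\<bar>Z\<bar> / 6 \<le> 4 * (1 / (s - 1))"
      using Zb p by linarith+
    have pos: "0 < 2 / 27 * (1 / (s - 1))" using p by simp
    have "ln (2 / 27 * (1 / (s - 1))) \<le> ln (\<bar>Z\<bar> / 6)" "ln (\<bar>Z\<bar> / 6) \<le> ln (4 * (1 / (s - 1)))"
      using lo hi pos less_le_trans[OF pos lo] less_le_trans[OF less_le_trans[OF pos lo] hi]
      by (meson ln_le_cancel_iff)+
    moreover have "ln (2 / 27 * (1 / (s - 1))) = ln (2 / 27) + ln (1 / (s - 1))" by (rule ln_mult_pos) (use p in auto)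
    moreover have "ln (4 * (1 / (s - 1))) = ln 4 + ln (1 / (s - 1))" by (rule ln_mult_pos) (use p in auto)
    moreover have "ln (2 / 27 :: real) = - ln (27 / 2)" by (simp add: ln_div)
    moreover have "ln (4 :: real) \<ge> 0" "ln (27 / 2 :: real) \<ge> 0" by auto
    ultimately show ?thesis using e by linarith
  qed
  then show ?thesis using that by blast
qed

text \<open>Nonvanishing at 1: otherwise \<open>\<zeta>(s) |L(s, \<eta>)|\<^sup>2\<close> would tend to 0, while its logarithm is up to a bounded
  error the sum of \<open>(1 + 2 Re \<eta>(q)) N(q)\<^sup>-\<^sup>s\<close>, whose terms are nonnegative.\<close>

lemma cubic_character_prime_sum:
  assumes c: "cubic_character f \<eta>" and y: "coprime y (of_nat f)" "\<eta> y \<noteq> 1"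
  obtains C where "\<And>s. 1 < s \<Longrightarrow> s < 2 \<Longrightarrow> \<bar>eis_prime_sum (\<lambda>q. Re (\<eta> q)) s\<bar> \<le> C"
proof -
  define B where "B = 13 * infsum (eis_pow 2) {x. x \<noteq> 0}"
  define L where "L = (\<lambda>s. infsum (\<lambda>x. \<eta> x * eis_pow s x) UNIV)"
  define T where "T = eis_prime_sum (\<lambda>q. Re (\<eta> q))"
  have bound: "norm (\<eta> x) \<le> 1" for x by (rule cubic_character_norm[OF c])
  obtain K where K: "K \<ge> 0" "\<And>s s'. 1 < s \<Longrightarrow> s < 2 \<Longrightarrow> 1 < s' \<Longrightarrow> s' < 2 \<Longrightarrow> norm (L s - L s') \<le> K * \<bar>s - s'\<bar>"
    unfolding L_def
  proof (rule periodic_sum_lipschitz[of f \<eta>])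
    show "f > 0" "\<And>x y. \<eta> (of_nat f * y + x) = \<eta> x" using c by (auto simp: cubic_character_def)
    show "(\<Sum>r\<in>eis_residues f. \<eta> r) = 0" by (rule cubic_character_mean[OF c y])
  qed (use bound in auto)
  have LT: "L s \<noteq> 0" "\<bar>T s - ln (norm (L s) / 6)\<bar> \<le> B" if s: "1 < s" "s < 2" for s
  proof -
    have "L s = infsum (\<lambda>x. \<eta> x * eis_pow s x) {x. x \<noteq> 0}"
      unfolding L_def by (rule infsum_cong_neutral) auto
    then show "L s \<noteq> 0" "\<bar>T s - ln (norm (L s) / 6)\<bar> \<le> B"
      using eis_euler_bounds[of \<eta> s] bound s c by (auto simp: B_def T_def cubic_character_def)
  qed
  obtain C1 where C1: "\<And>s. 1 < s \<Longrightarrow> s < 2 \<Longrightarrow> \<bar>eis_prime_sum (\<lambda>q. 1) s - ln (1 / (s - 1))\<bar> \<le> C1"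
    using eis_prime_sum_one by blast
  \<comment> \<open>Nonnegativity of 1 + 2 Re \<eta> gives T \<ge> -1/2 ln(1/(s-1)) up to a
    constant: the L-function cannot vanish to order 1.\<close>
  have low: "2 * T s \<ge> - ln (1 / (s - 1)) - C1" if s: "1 < s" "s < 2" for s
  proof -
    have b: "\<bar>Re (\<eta> q)\<bar> \<le> 1" for q using bound[of q] abs_Re_le_cmod[of "\<eta> q"] by linarith
    have s1: "(\<lambda>q. 1 * eis_pow s q) summable_on {q. prime q}" "(\<lambda>q. Re (\<eta> q) * eis_pow s q) summable_on {q. prime q}"
      by (rule eis_prime_sum_summable[where B = 1]; use s b in simp)+
    have "0 \<le> infsum (\<lambda>q. (1 + 2 * Re (\<eta> q)) * eis_pow s q) {q. prime q}"
      by (rule infsum_nonneg) (use cubic_character_Re[OF c] in auto)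
    also have "\<dots> = infsum (\<lambda>q. 1 * eis_pow s q + 2 * (Re (\<eta> q) * eis_pow s q)) {q. prime q}"
      by (simp add: algebra_simps)
    also have "\<dots> = eis_prime_sum (\<lambda>q. 1) s + 2 * T s"
      unfolding eis_prime_sum_def T_def
      by (subst infsum_add) (use s1 in \<open>auto intro: summable_on_cmult_right simp: infsum_cmult_right'\<close>)
    finally show ?thesis using C1[OF s] by linarith
  qed
  define \<sigma> where "\<sigma> = (\<lambda>n :: nat. 1 + 1 / (real n + 2))"
  have \<sigma>: "1 < \<sigma> n" "\<sigma> n < 2" for n by (auto simp: \<sigma>_def field_simps)
  have \<sigma>lim: "\<sigma> \<longlonglongrightarrow> 1" unfolding \<sigma>_def by real_asymp
  have "Cauchy (\<lambda>n. L (\<sigma> n))"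
  proof (rule CauchyI)
    fix e :: real assume e: "e > 0"
    have "Cauchy \<sigma>" using \<sigma>lim LIMSEQ_imp_Cauchy by blast
    then obtain M where M: "\<And>m n. m \<ge> M \<Longrightarrow> n \<ge> M \<Longrightarrow> norm (\<sigma> m - \<sigma> n) < e / (K + 1)"
      using CauchyD[of \<sigma> "e / (K + 1)"] e K(1) by (metis add_nonneg_pos divide_pos_pos zero_less_one)
    have "norm (L (\<sigma> m) - L (\<sigma> n)) < e" if "m \<ge> M" "n \<ge> M" for m n
    proof -
      have "norm (L (\<sigma> m) - L (\<sigma> n)) \<le> K * \<bar>\<sigma> m - \<sigma> n\<bar>" using K(2) \<sigma> by blast
      also have "\<dots> \<le> (K + 1) * \<bar>\<sigma> m - \<sigma> n\<bar>" by (simp add: mult_right_mono)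
      also have "\<dots> < (K + 1) * (e / (K + 1))" using M[OF that] K by (intro mult_strict_left_mono) auto
      also have "\<dots> = e" using K by simp
      finally show ?thesis .
    qed
    then show "\<exists>M. \<forall>m\<ge>M. \<forall>n\<ge>M. norm (L (\<sigma> m) - L (\<sigma> n)) < e" by blast
  qed
  then obtain L1 where L1: "(\<lambda>n. L (\<sigma> n)) \<longlonglongrightarrow> L1" using Cauchy_convergent convergent_def by blast
  have dist: "norm (L s - L1) \<le> K * (s - 1)" if s: "1 < s" "s < 2" for s
  proof (rule tendsto_le[OF _ _ tendsto_norm[OF tendsto_diff[OF tendsto_const L1]]])
    show "(\<lambda>n. K * \<bar>s - \<sigma> n\<bar>) \<longlonglongrightarrow> K * (s - 1)"
    proof -
      have "(\<lambda>n. K * \<bar>s - \<sigma> n\<bar>) \<longlonglongrightarrow> K * \<bar>s - 1\<bar>" by (intro tendsto_intros \<sigma>lim)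
      then show ?thesis using s by simp
    qed
    show "\<forall>\<^sub>F n in sequentially. norm (L s - L (\<sigma> n)) \<le> K * \<bar>s - \<sigma> n\<bar>" using K(2) \<sigma> s by simp
  qed simp
  \<comment> \<open>A zero would give |L(s)| \<le> K (s - 1), so T would be at most -ln(1/(s-1))
    plus a constant, against the coefficient -1/2 in \<open>low\<close>. The constant K + 1 keeps
    the argument of the logarithm positive.\<close>
  have "L1 \<noteq> 0"
  proof
    assume "L1 = 0"
    define D where "D = 2 * ln ((K + 1) / 6) + 2 * B + C1"
    have D: "ln (1 / (s - 1)) \<le> D" if s: "1 < s" "s < 2" for s
    proof -
      have "norm (L s) / 6 \<le> (K + 1) / 6 * (s - 1)" using dist[OF s] s \<open>L1 = 0\<close> by (simp add: algebra_simps)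
      then have "ln (norm (L s) / 6) \<le> ln ((K + 1) / 6 * (s - 1))"
        using LT(1)[OF s] K s by (subst ln_le_cancel_iff) auto
      also have "\<dots> = ln ((K + 1) / 6) + ln (s - 1)" by (rule ln_mult_pos) (use K s in auto)
      also have "ln (s - 1) = - ln (1 / (s - 1))" using s by (simp add: ln_div)
      finally have "T s \<le> ln ((K + 1) / 6) - ln (1 / (s - 1)) + B" using LT(2)[OF s] by linarith
      with low[OF s] show ?thesis unfolding D_def by linarith
    qed
    have "\<forall>\<^sub>F s in at_right (1::real). ln (1 / (s - 1)) > D"
      using filterlim_ln_at_right_1 unfolding filterlim_at_top_dense by blast
    moreover have "\<forall>\<^sub>F s in at_right (1::real). s > 1" by (simp add: eventually_at_right_less)
    moreover have "\<forall>\<^sub>F s in at_right (1::real). s < 2" by (rule eventually_at_rightI[of 1 2]) auto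
    ultimately have "\<forall>\<^sub>F s in at_right (1::real). False"
      by eventually_elim (use D in force)
    then show False by simp
  qed
  \<comment> \<open>Within \<delta> of 1 the norm of L stays above half that of L1. Farther away
    ln(1/(s-1)) is bounded, and \<open>low\<close> suffices.\<close>
  define \<delta> where "\<delta> = norm L1 / (2 * (K + 1))"
  have \<delta>: "\<delta> > 0" using \<open>L1 \<noteq> 0\<close> K by (simp add: \<delta>_def)
  define C where "C = \<bar>ln ((norm L1 + K) / 6)\<bar> + B + \<bar>ln (norm L1 / 12)\<bar> + \<bar>ln (1 / \<delta>)\<bar> + \<bar>C1\<bar>"
  have B0: "B \<ge> 0" using LT(2)[of "3 / 2"] by linarith
  have "\<bar>T s\<bar> \<le> C" if s: "1 < s" "s < 2" for s
  proof -
    have "K * (s - 1) \<le> K * 1" using K s by (intro mult_left_mono) auto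
    then have "norm (L s) \<le> norm L1 + K" using dist[OF s] norm_triangle_ineq2[of "L s" L1] by linarith
    then have "ln (norm (L s) / 6) \<le> ln ((norm L1 + K) / 6)"
      using LT(1)[OF s] \<open>L1 \<noteq> 0\<close> K by (subst ln_le_cancel_iff) (auto intro: add_pos_nonneg divide_right_mono)
    then have up: "T s \<le> C" using LT(2)[OF s] unfolding C_def by linarith
    have "T s \<ge> - C"
    proof (cases "s - 1 < \<delta>")
      case True
      have "K * (s - 1) \<le> (K + 1) * (s - 1)" using s by (intro mult_right_mono) auto
      also have "\<dots> \<le> (K + 1) * \<delta>" using True K by (intro mult_left_mono) auto
      also have "\<dots> = norm L1 / 2" using K(1) by (simp add: \<delta>_def field_simps)
      finally have "norm (L s) \<ge> norm L1 / 2"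
        using dist[OF s] norm_triangle_ineq2[of L1 "L s"] by (simp add: norm_minus_commute)
      then have "ln (norm L1 / 12) \<le> ln (norm (L s) / 6)"
        using LT(1)[OF s] \<open>L1 \<noteq> 0\<close> by (subst ln_le_cancel_iff) auto
      then show ?thesis using LT(2)[OF s] unfolding C_def by linarith
    next
      case False
      then have "1 / (s - 1) \<le> 1 / \<delta>" using \<delta> s by (intro divide_left_mono) auto
      then have "ln (1 / (s - 1)) \<le> ln (1 / \<delta>)" using \<delta> s by (subst ln_le_cancel_iff) auto
      with low[OF s] B0 show ?thesis unfolding C_def by linarith
    qed
    with up show ?thesis by linarith
  qed
  then show ?thesis using that unfolding T_def by blast
qed

section \<open>Integers that are cubes modulo many primes\<close>

text \<open>The norm of x + y\<theta> + z\<theta>^2, where \<theta>^3 = n.\<close>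

definition pure_cubic_norm :: "int \<Rightarrow> int \<Rightarrow> int \<Rightarrow> int \<Rightarrow> int" where
  "pure_cubic_norm n x y z = x ^ 3 + n * y ^ 3 + n\<^sup>2 * z ^ 3 - 3 * n * x * y * z"

text \<open>With t the real cube root of n, a = x, b = y t and c = z t^2, the form is a^3 + b^3 +
  c^3 - 3abc. It factors over the reals into a + b + c and a multiple of a sum of squares of
  differences. A zero of either factor for a nonzero vector contradicts the irrationality of
  t.\<close>

lemma pure_cubic_norm_nonzero:
  assumes n: "\<nexists>q :: rat. of_int n = q ^ 3" and v: "(x, y, z) \<noteq> (0, 0, 0)"
  shows "pure_cubic_norm n x y z \<noteq> 0"
proof
  assume N: "pure_cubic_norm n x y z = 0"
  have irr: False if "of_int a * t = of_int b" "a \<noteq> 0" "t ^ 3 = of_int n" for a b :: int and t :: real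
  proof -
    have "t = of_rat (of_int b / of_int a)" using that(1,2) by (simp add: of_rat_divide field_simps)
    then have "(of_rat (of_int n) :: real) = of_rat ((of_int b / of_int a) ^ 3)"
      using that(3) by (simp add: of_rat_power)
    then have "(of_int n :: rat) = (of_int b / of_int a) ^ 3" by (simp only: of_rat_eq_iff)
    then show False using n by blast
  qed
  define t where "t = root 3 (real_of_int n)"
  have t3: "t ^ 3 = of_int n" unfolding t_def by (rule odd_real_root_pow) simp
  have n0: "n \<noteq> 0" using n by (metis of_int_0 power_zero_numeral)
  then have t0: "t \<noteq> 0" using t3 by auto
  define a b c :: real where "a = of_int x" and "b = of_int y * t" and "c = of_int z * t\<^sup>2"
  have "real_of_int (pure_cubic_norm n x y z) = a ^ 3 + b ^ 3 + c ^ 3 - 3 * a * b * c"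
  proof -
    have "(t\<^sup>2) ^ 3 = (real_of_int n)\<^sup>2" unfolding t3[symmetric] by (simp add: power_mult[symmetric])
    moreover have "t * t\<^sup>2 = of_int n" using t3 by (simp add: power3_eq_cube power2_eq_square)
    ultimately show ?thesis using t3
      by (simp add: pure_cubic_norm_def a_def b_def c_def power_mult_distrib algebra_simps)
  qed
  also have "\<dots> = (a + b + c) * ((a - b)\<^sup>2 + (b - c)\<^sup>2 + (a - c)\<^sup>2) / 2"
    by (simp add: power3_eq_cube power2_eq_square algebra_simps)
  finally have "a + b + c = 0 \<or> (a - b)\<^sup>2 + (b - c)\<^sup>2 + (a - c)\<^sup>2 = 0" using N by auto
  then show False
  proof
    assume "(a - b)\<^sup>2 + (b - c)\<^sup>2 + (a - c)\<^sup>2 = 0"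
    then have "(a - b)\<^sup>2 = 0" "(a - c)\<^sup>2 = 0"
      using zero_le_power2[of "a - b"] zero_le_power2[of "b - c"] zero_le_power2[of "a - c"] by linarith+
    then have ab: "a = b" "a = c" by auto
    then have "y = 0" using irr[of y t x] t3 by (auto simp: a_def b_def)
    then have "a = 0" using ab by (simp add: b_def)
    then have "x = 0" "z = 0" using ab t0 by (auto simp: a_def c_def)
    then show False using v \<open>y = 0\<close> by simp
  next
    assume "a + b + c = 0"
    then have e: "of_int x + of_int y * t + of_int z * t\<^sup>2 = 0" by (simp add: a_def b_def c_def)
    show False
    proof (cases "z = 0")
      case True
      then have "of_int y * t = of_int (- x)" using e by simp
      then have "y = 0" using irr[of y t "- x"] t3 by auto
      then show False using e True v by simp
    next
      \<comment> \<open>The quadratic relation and its multiple by t are combined so that t^2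
        cancels. Irrationality kills the coefficient of t, and y^2 = x z together with n z^2 = x y
        makes n a cube.\<close>
      case False
      have "of_int (y\<^sup>2 - x * z) * t - of_int (n * z\<^sup>2 - x * y) =
          - of_int z * (of_int x * t + of_int y * t\<^sup>2 + of_int z * of_int n) + of_int y * (of_int x + of_int y * t + of_int z * t\<^sup>2)"
        by (simp add: power2_eq_square algebra_simps)
      also have "of_int x * t + of_int y * t\<^sup>2 + of_int z * of_int n = t * (of_int x + of_int y * t + of_int z * t\<^sup>2)"
        unfolding t3[symmetric] by (simp add: power2_eq_square power3_eq_cube algebra_simps)
      finally have l: "of_int (y\<^sup>2 - x * z) * t = of_int (n * z\<^sup>2 - x * y)" using e by simp
      then have yz: "y\<^sup>2 = x * z" using irr[OF l] t3 by auto
      then have nz: "n * z\<^sup>2 = x * y" 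
      proof -
        have "real_of_int (n * z\<^sup>2 - x * y) = 0" using l yz by simp
        then show ?thesis unfolding of_int_eq_0_iff by simp
      qed
      have "n * z ^ 3 = (n * z\<^sup>2) * z" by (simp add: power2_eq_square power3_eq_cube)
      also have "\<dots> = y * y\<^sup>2" unfolding nz yz by simp
      finally have "n * z ^ 3 = y ^ 3" by (simp add: power2_eq_square power3_eq_cube)
      then have "(of_int n :: rat) * of_int z ^ 3 = of_int y ^ 3" by (metis of_int_mult of_int_power)
      then have "(of_int n :: rat) = (of_int y / of_int z) ^ 3" using False by (simp add: power_divide field_simps)
      then show False using n by blast
    qed
  qed
qed

lemma pure_cubic_norm_bound:
  assumes "\<bar>x\<bar> \<le> B" "\<bar>y\<bar> \<le> B" "\<bar>z\<bar> \<le> B"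
  shows "\<bar>pure_cubic_norm n x y z\<bar> \<le> (1 + 4 * \<bar>n\<bar> + n\<^sup>2) * B ^ 3"
proof -
  have B: "B \<ge> 0" using assms(1) by linarith
  have c: "\<bar>u ^ 3\<bar> \<le> B ^ 3" if "\<bar>u\<bar> \<le> B" for u
    unfolding power_abs using that by (intro power_mono) auto
  have "\<bar>x * y * z\<bar> \<le> B * B * B" unfolding abs_mult using assms B by (intro mult_mono) auto
  then have m: "\<bar>x * y * z\<bar> \<le> B ^ 3" by (simp add: power3_eq_cube)
  have 1: "\<bar>n * y ^ 3\<bar> \<le> \<bar>n\<bar> * B ^ 3" unfolding abs_mult using c[OF assms(2)] by (intro mult_left_mono) auto
  have 2: "\<bar>n\<^sup>2 * z ^ 3\<bar> \<le> n\<^sup>2 * B ^ 3" unfolding abs_mult using c[OF assms(3)] by (simp add: mult_left_mono)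
  have 3: "\<bar>n * (x * y * z)\<bar> \<le> \<bar>n\<bar> * B ^ 3" unfolding abs_mult[of n] using m by (intro mult_left_mono) auto
  have "pure_cubic_norm n x y z = x ^ 3 + n * y ^ 3 + n\<^sup>2 * z ^ 3 - 3 * (n * (x * y * z))"
    by (simp add: pure_cubic_norm_def)
  moreover have "(1 + 4 * \<bar>n\<bar> + n\<^sup>2) * B ^ 3 = B ^ 3 + 4 * (\<bar>n\<bar> * B ^ 3) + n\<^sup>2 * B ^ 3"
    by (simp add: algebra_simps)
  ultimately show ?thesis using c[OF assms(1)] 1 2 3 by linarith
qed

text \<open>Sending \<theta> to r is a ring homomorphism modulo p. The second factor of the identity
  is the adjugate element, whose product with x + y\<theta> + z\<theta>^2 is the norm; the multiple
  of r^3 - n corrects for the substitution.\<close>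

lemma root_dvd_pure_cubic_norm:
  fixes p r n :: int
  assumes "p dvd x + y * r + z * r\<^sup>2" "p dvd r ^ 3 - n"
  shows "p dvd pure_cubic_norm n x y z"
proof -
  have "pure_cubic_norm n x y z = (x + y * r + z * r\<^sup>2) *
      (x\<^sup>2 - n * y * z + (n * z\<^sup>2 - x * y) * r + (y\<^sup>2 - x * z) * r\<^sup>2) -
      (r ^ 3 - n) * ((y * (y\<^sup>2 - x * z) + z * (n * z\<^sup>2 - x * y)) + z * (y\<^sup>2 - x * z) * r)"
    by (simp add: pure_cubic_norm_def power2_eq_square power3_eq_cube algebra_simps)
  then show ?thesis using assms by simp
qed

text \<open>The determinant of multiplication by \<open>x + y\<theta> + z\<theta>\<^sup>2\<close> in a basis that starts with the two
  eigenvectors \<open>(1, r, r\<^sup>2)\<close> and \<open>(1, r', r'\<^sup>2)\<close> modulo \<open>p\<close>.\<close>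

lemma two_roots_dvd_pure_cubic_norm:
  fixes p r r' n :: int
  assumes p: "prime p" and r: "p dvd x + y * r + z * r\<^sup>2" "p dvd r ^ 3 - n"
    and r': "p dvd x + y * r' + z * r'\<^sup>2" "p dvd r' ^ 3 - n" and d: "\<not> p dvd r' - r"
  shows "p\<^sup>2 dvd pure_cubic_norm n x y z"
proof -
  define A where "A = (\<lambda>r. x + y * r + z * r\<^sup>2)"
  define A2 where "A2 = (\<lambda>r. n * z + x * r + y * r\<^sup>2)"
  define A3 where "A3 = (\<lambda>r. n * y + n * z * r + x * r\<^sup>2)"
  have dvd: "p dvd A s" "p dvd A2 s" "p dvd A3 s" if "p dvd x + y * s + z * s\<^sup>2" "p dvd s ^ 3 - n" for s
  proof -
    have "A2 s = s * (x + y * s + z * s\<^sup>2) - z * (s ^ 3 - n)"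
      "A3 s = s\<^sup>2 * (x + y * s + z * s\<^sup>2) - (s ^ 3 - n) * (y + z * s)"
      by (simp_all add: A2_def A3_def power2_eq_square power3_eq_cube algebra_simps)
    then show "p dvd A s" "p dvd A2 s" "p dvd A3 s" using that by (simp_all add: A_def)
  qed
  have "pure_cubic_norm n x y z * (r' - r) =
      A r * (A2 r' * x - A3 r' * y) - A r' * (A2 r * x - A3 r * y) + z * (A2 r * A3 r' - A3 r * A2 r')"
    by (simp add: pure_cubic_norm_def A_def A2_def A3_def power2_eq_square power3_eq_cube algebra_simps)
  moreover have "p * p dvd A r * (A2 r' * x - A3 r' * y)" "p * p dvd A r' * (A2 r * x - A3 r * y)"
    "p * p dvd z * (A2 r * A3 r' - A3 r * A2 r')"
    using dvd[OF r] dvd[OF r'] by (intro mult_dvd_mono dvd_diff dvd_mult[of "p * p" _ z]; simp)+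
  ultimately have "p\<^sup>2 dvd pure_cubic_norm n x y z * (r' - r)" by (simp add: power2_eq_square)
  moreover have "coprime (p\<^sup>2) (r' - r)" using p d by (simp add: prime_imp_coprime)
  ultimately show ?thesis using coprime_dvd_mult_left_iff by blast
qed

text \<open>The other roots are r t and r t^2, with t a primitive cube root of unity modulo p. They
  are distinct because p divides neither 3 nor n.\<close>

lemma three_roots:
  fixes p r t n :: int
  assumes p: "prime p" "p \<noteq> 3" and t: "p dvd t\<^sup>2 + t + 1" and r: "p dvd r ^ 3 - n" and n: "\<not> p dvd n"
  shows "\<exists>\<rho>. \<rho> \<subseteq> {0..<p} \<and> card \<rho> = 3 \<and> (\<forall>r\<in>\<rho>. p dvd r ^ 3 - n)"
proof -
  have p0: "p > 0" using p prime_gt_0_int by blast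
  have t1: "\<not> p dvd t - 1"
  proof
    assume "p dvd t - 1"
    then have "p dvd (t\<^sup>2 + t + 1) - (t + 2) * (t - 1)" using t by simp
    then have "p dvd 3" by (simp add: power2_eq_square algebra_simps)
    moreover have "prime (3 :: int)" by simp
    ultimately show False using p primes_dvd_imp_eq by blast
  qed
  have r0: "\<not> p dvd r"
  proof
    assume "p dvd r"
    then have "p dvd r ^ 3" by (simp add: power3_eq_cube)
    from dvd_diff[OF this r] have "p dvd r ^ 3 - (r ^ 3 - n)" .
    then show False using n by simp
  qed
  have t0: "\<not> p dvd t"
  proof
    assume "p dvd t"
    then have "p dvd (t\<^sup>2 + t + 1) - t * (t + 1)" using t by (intro dvd_diff) auto
    then have "p dvd 1" by (simp add: power2_eq_square algebra_simps)
    then show False using p by (meson not_prime_unit)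
  qed
  have t3: "p dvd (r * s) ^ 3 - n" if "p dvd s ^ 3 - 1" for s
  proof -
    have "(r * s) ^ 3 - n = r ^ 3 * (s ^ 3 - 1) + (r ^ 3 - n)" by (simp add: power_mult_distrib algebra_simps)
    then show ?thesis using dvd_add[OF dvd_mult[OF that, of "r ^ 3"] r] by metis
  qed
  have "t ^ 3 - 1 = (t - 1) * (t\<^sup>2 + t + 1)" by (simp add: power2_eq_square power3_eq_cube algebra_simps)
  then have c1: "p dvd t ^ 3 - 1" using t by simp
  have "(t\<^sup>2) ^ 3 - 1 = (t ^ 3 - 1) * (t ^ 3 + 1)" by (simp add: power2_eq_square power3_eq_cube algebra_simps)
  then have c2: "p dvd (t\<^sup>2) ^ 3 - 1" using c1 by simp
  have md: "p dvd (u mod p) ^ 3 - n" if "p dvd u ^ 3 - n" for u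
    using that by (simp add: mod_eq_dvd_iff[symmetric] power_mod)
  have d: "a mod p \<noteq> b mod p" if "\<not> p dvd a - b" for a b using that by (simp add: mod_eq_dvd_iff)
  have pm: "p dvd a * b \<longleftrightarrow> p dvd a \<or> p dvd b" for a b using p by (simp add: prime_dvd_mult_iff)
  have "\<not> p dvd r * t - r" "\<not> p dvd r * t\<^sup>2 - r * t" "\<not> p dvd r * t\<^sup>2 - r"
  proof -
    have "r * t - r = r * (t - 1)" "r * t\<^sup>2 - r * t = r * (t * (t - 1))"
      by (simp_all add: power2_eq_square algebra_simps)
    then show "\<not> p dvd r * t - r" "\<not> p dvd r * t\<^sup>2 - r * t" using t1 r0 t0 by (simp_all add: pm)
    have "\<not> p dvd t + 1"
    proof
      assume "p dvd t + 1"
      then have "p dvd (t\<^sup>2 + t + 1) - t * (t + 1)" using t by (intro dvd_diff) auto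
      then have "p dvd 1" by (simp add: power2_eq_square algebra_simps)
      then show False using p by (meson not_prime_unit)
    qed
    moreover have "r * t\<^sup>2 - r = r * ((t - 1) * (t + 1))" by (simp add: power2_eq_square algebra_simps)
    ultimately show "\<not> p dvd r * t\<^sup>2 - r" using t1 r0 by (simp add: pm)
  qed
  from d[OF this(1)] d[OF this(2)] d[OF this(3)]
  have "card {r mod p, (r * t) mod p, (r * t\<^sup>2) mod p} = 3" by (simp add: card_insert_if)
  moreover have "{r mod p, (r * t) mod p, (r * t\<^sup>2) mod p} \<subseteq> {0..<p}" using p0 by auto
  moreover have "\<forall>u\<in>{r mod p, (r * t) mod p, (r * t\<^sup>2) mod p}. p dvd u ^ 3 - n"
    using md[OF r] md[OF t3[OF c1]] md[OF t3[OF c2]] by auto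
  ultimately show ?thesis by blast
qed

lemma prod_primes_dvd:
  assumes "finite T" "\<And>p. p \<in> T \<Longrightarrow> prime p" "\<And>p. p \<in> T \<Longrightarrow> int p dvd N"
  shows "(\<Prod>p\<in>T. int p) dvd N"
  using assms
proof (induction T rule: finite_induct)
  case (insert p T)
  have "coprime (int p) (\<Prod>q\<in>T. int q)"
  proof (rule prod_coprime_right)
    fix q assume "q \<in> T"
    then have "prime p" "prime q" "p \<noteq> q" using insert by auto
    then show "coprime (int p) (int q)" by (simp add: primes_coprime)
  qed
  moreover have "int p dvd N" "(\<Prod>q\<in>T. int q) dvd N" using insert by auto
  ultimately show ?case using insert.hyps by (simp add: divides_mult)
qed simp

section \<open>Lattice points of rank three and squarefree ideals of the cubic order\<close>

definition triple_max :: "int \<times> int \<times> int \<Rightarrow> nat" where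
  "triple_max = (\<lambda>(x, y, z). nat (max \<bar>x\<bar> (max \<bar>y\<bar> \<bar>z\<bar>)))"

lemma triple_max_le_iff: "triple_max (x, y, z) \<le> R \<longleftrightarrow> \<bar>x\<bar> \<le> int R \<and> \<bar>y\<bar> \<le> int R \<and> \<bar>z\<bar> \<le> int R"
  by (simp add: triple_max_def nat_le_iff)

lemma triple_max_bounds:
  "\<bar>fst v\<bar> \<le> int (triple_max v)" "\<bar>fst (snd v)\<bar> \<le> int (triple_max v)" "\<bar>snd (snd v)\<bar> \<le> int (triple_max v)"
  using triple_max_le_iff[of "fst v" "fst (snd v)" "snd (snd v)" "triple_max v"] by simp_all

lemma triple_max_eq_0_iff: "triple_max v = 0 \<longleftrightarrow> v = (0, 0, 0)"
  using triple_max_le_iff[of "fst v" "fst (snd v)" "snd (snd v)" 0] by (cases v) auto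

text \<open>A shell has at most (2R + 1)^3 - (2R - 1)^3 = 24 R^2 + 2 points, hence the constant 26;
  the abscissa 3 is the rank.\<close>

lemma triple_max_sum:
  assumes "t > 3"
  shows "(\<lambda>v. real (triple_max v) powr - t) summable_on {v. v \<noteq> (0, 0, 0)}"
    and "infsum (\<lambda>v. real (triple_max v) powr - t) {v. v \<noteq> (0, 0, 0)} \<le> 26 * (1 + 1 / (t - 3))"
proof -
  have box: "{v. triple_max v \<le> R} = {- int R..int R} \<times> {- int R..int R} \<times> {- int R..int R}" for R
    by (auto simp: triple_max_le_iff abs_le_iff)
  have fin: "finite {v. triple_max v \<le> R}" for R unfolding box by simp
  have fin': "finite {v \<in> {v. v \<noteq> (0, 0, 0)}. triple_max v = R}" for R
    by (rule finite_subset[OF _ fin[of R]]) auto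
  have cb: "card {v. triple_max v \<le> R} = (2 * R + 1) ^ 3" for R
  proof -
    have "card {- int R..int R} = 2 * R + 1" by simp
    then show ?thesis unfolding box card_cartesian_product by (simp only: power3_eq_cube mult.assoc)
  qed
  have card: "real (card {v \<in> {v. v \<noteq> (0, 0, 0)}. triple_max v = R}) \<le> 26 * real R ^ 2" if R: "R \<ge> 1" for R
  proof -
    obtain m where m: "R = Suc m" using R by (cases R) auto
    have "{v \<in> {v. v \<noteq> (0, 0, 0)}. triple_max v = R} \<subseteq> {v. triple_max v \<le> R} - {v. triple_max v \<le> m}"
      using m by auto
    then have "card {v \<in> {v. v \<noteq> (0, 0, 0)}. triple_max v = R} \<le> card ({v. triple_max v \<le> R} - {v. triple_max v \<le> m})"
      by (rule card_mono[OF finite_Diff[OF fin]])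
    also have "\<dots> = (2 * R + 1) ^ 3 - (2 * m + 1) ^ 3"
      unfolding cb[symmetric] by (rule card_Diff_subset[OF fin]) (use m in auto)
    also have "\<dots> \<le> 26 * R\<^sup>2" unfolding m by (simp add: power2_eq_square power3_eq_cube algebra_simps)
    finally have "real (card {v \<in> {v. v \<noteq> (0, 0, 0)}. triple_max v = R}) \<le> real (26 * R\<^sup>2)" by (simp only: of_nat_le_iff)
    then show ?thesis by simp
  qed
  have pos: "triple_max v \<ge> 1" if "v \<in> {v. v \<noteq> (0, 0, 0)}" for v
    using that triple_max_eq_0_iff[of v] by (simp add: Suc_le_eq)
  note * = shell_sum_upper[of "{v. v \<noteq> (0, 0, 0)}" triple_max 26 2 t, OF pos fin' card]
  show "(\<lambda>v. real (triple_max v) powr - t) summable_on {v. v \<noteq> (0, 0, 0)}" using *(1) assms by simp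
  show "infsum (\<lambda>v. real (triple_max v) powr - t) {v. v \<noteq> (0, 0, 0)} \<le> 26 * (1 + 1 / (t - 3))"
    using *(2) assms by simp
qed

text \<open>With B least such that (B + 1)^3 exceeds the product of \<open>T\<close>, the box of
  side B has more vectors than there are residue tuples. A difference of two vectors with equal
  residues has entries at most B, and B^3 is at most the product by minimality. This takes the role
  of Minkowski's theorem.\<close>

lemma pigeonhole_vector:
  fixes c :: "nat \<Rightarrow> int"
  assumes T: "finite T" "\<And>p. p \<in> T \<Longrightarrow> p > 0"
  obtains x y z where "(x, y, z) \<noteq> (0, 0, 0)" "triple_max (x, y, z) ^ 3 \<le> \<Prod>T"
    "\<And>p. p \<in> T \<Longrightarrow> int p dvd x + y * c p + z * (c p)\<^sup>2"
proof -
  define m where "m = \<Prod>T"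
  define B where "B = (LEAST k. m < (k + 1) ^ 3)"
  have "m < (m + 1) ^ 3" by (simp add: power3_eq_cube algebra_simps)
  then have B1: "m < (B + 1) ^ 3" unfolding B_def by (rule LeastI)
  have B2: "B ^ 3 \<le> m"
  proof (cases B)
    case (Suc k)
    then have "\<not> m < (k + 1) ^ 3" unfolding B_def by (metis lessI not_less_Least)
    then show ?thesis using Suc by simp
  qed simp
  define D where "D = {0..int B} \<times> {0..int B} \<times> {0..int B}"
  let ?E = "PiE T (\<lambda>p. {0..<int p})"
  define g where "g = (\<lambda>(x, y, z). \<lambda>p\<in>T. (x + y * c p + z * (c p)\<^sup>2) mod int p)"
  have gE: "g ` D \<subseteq> ?E" using T(2) by (auto simp: g_def D_def)
  have "card ?E = m" using T(1) by (simp add: card_PiE m_def)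
  moreover have "card D = (B + 1) ^ 3"
  proof -
    have "card {0..int B} = B + 1" by simp
    then show ?thesis unfolding D_def card_cartesian_product by (simp only: power3_eq_cube mult.assoc)
  qed
  moreover have "finite ?E" using T(1) by (intro finite_PiE) auto
  ultimately have "\<not> inj_on g D" using card_inj_on_le[of g D ?E] gE B1 by linarith
  then obtain v v' where v: "v \<in> D" "v' \<in> D" "v \<noteq> v'" "g v = g v'" unfolding inj_on_def by blast
  obtain x y z x' y' z' where e: "v = (x, y, z)" "v' = (x', y', z')" by (cases v, cases v')
  show ?thesis
  proof (rule that[of "x - x'" "y - y'" "z - z'"])
    show "(x - x', y - y', z - z') \<noteq> (0, 0, 0)" using v e by auto
    have "triple_max (x - x', y - y', z - z') \<le> B" using v(1,2) e by (simp add: triple_max_le_iff D_def abs_le_iff)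
    then show "triple_max (x - x', y - y', z - z') ^ 3 \<le> \<Prod>T"
      using B2 power_mono[of "triple_max (x - x', y - y', z - z')" B 3] unfolding m_def by linarith
    fix p assume p: "p \<in> T"
    have "g v p = g v' p" using v(4) by simp
    then have "(x + y * c p + z * (c p)\<^sup>2) mod int p = (x' + y' * c p + z' * (c p)\<^sup>2) mod int p"
      using p e by (simp add: g_def)
    then show "int p dvd (x - x') + (y - y') * c p + (z - z') * (c p)\<^sup>2"
      by (simp add: mod_eq_dvd_iff algebra_simps)
  qed
qed

text \<open>A squarefree \<open>m\<close> and a root of \<open>X\<^sup>3 - n\<close> modulo \<open>m\<close> amount to an ideal of norm \<open>m\<close> of the cubic order
  \<open>\<int>[\<theta>]\<close>. By the pigeonhole principle it contains an element \<open>v\<close> of norm \<open>mj\<close> with \<open>j\<close>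
  bounded, and \<open>(v, j)\<close> determines the ideal.\<close>

lemma product_over_roots_bound:
  fixes n :: int and s :: real
  assumes n: "\<nexists>q :: rat. of_int n = q ^ 3" and F: "finite F" and s: "1 < s"
    and primes: "\<And>p. p \<in> F \<Longrightarrow> prime p \<and> int p > 1 + 4 * \<bar>n\<bar> + n\<^sup>2"
    and roots: "\<And>p. p \<in> F \<Longrightarrow> \<exists>\<rho>. \<rho> \<subseteq> {0..<int p} \<and> card \<rho> = 3 \<and> (\<forall>r\<in>\<rho>. int p dvd r ^ 3 - n)"
  shows "(\<Prod>p\<in>F. 1 + 3 * real p powr - s) \<le> real_of_int (1 + 4 * \<bar>n\<bar> + n\<^sup>2) * (26 * (1 + 1 / (3 * s - 3)))"
proof -
  define C0 where "C0 = 1 + 4 * \<bar>n\<bar> + n\<^sup>2"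
  have C0: "C0 \<ge> 1" by (simp add: C0_def)
  obtain \<rho> where \<rho>: "\<And>p. p \<in> F \<Longrightarrow> \<rho> p \<subseteq> {0..<int p}" "\<And>p. p \<in> F \<Longrightarrow> card (\<rho> p) = 3"
    "\<And>p r. p \<in> F \<Longrightarrow> r \<in> \<rho> p \<Longrightarrow> int p dvd r ^ 3 - n"
    using roots by metis
  \<comment> \<open>An index is a set of primes with a chosen root for each, that is, a squarefree
    ideal of norm \<open>w\<close>. A set T carries 3^|T| choices, so the product of 1 + 3 p^-s
    expands into the sum of w^-s over \<open>I\<close>.\<close>
  define I where "I = Sigma (Pow F) (\<lambda>T. PiE T \<rho>)"
  define w where "w = (\<lambda>i :: nat set \<times> (nat \<Rightarrow> int). \<Prod>(fst i))"
  have pr: "prime p" if "p \<in> F" for p using primes that by blast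
  have ex: "\<exists>v. v \<noteq> (0, 0, 0) \<and> triple_max v ^ 3 \<le> w i \<and>
      (\<forall>p\<in>fst i. int p dvd fst v + fst (snd v) * snd i p + snd (snd v) * (snd i p)\<^sup>2)" if i: "i \<in> I" for i
  proof -
    have fi: "finite (fst i)" "\<And>p. p \<in> fst i \<Longrightarrow> p > 0"
      using i finite_subset[OF _ F] pr prime_gt_0_nat by (auto simp: I_def)
    show ?thesis unfolding w_def by (rule pigeonhole_vector[OF fi, of "snd i"]) fastforce+
  qed
  then obtain v where v: "\<And>i. i \<in> I \<Longrightarrow> v i \<noteq> (0, 0, 0)" "\<And>i. i \<in> I \<Longrightarrow> triple_max (v i) ^ 3 \<le> w i"
      "\<And>i p. i \<in> I \<Longrightarrow> p \<in> fst i \<Longrightarrow> int p dvd fst (v i) + fst (snd (v i)) * snd i p + snd (snd (v i)) * (snd i p)\<^sup>2"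
    by metis
  define N where "N = (\<lambda>v :: int \<times> int \<times> int. pure_cubic_norm n (fst v) (fst (snd v)) (snd (snd v)))"
  have N0: "N (v i) \<noteq> 0" if "i \<in> I" for i
    unfolding N_def by (rule pure_cubic_norm_nonzero[OF n]) (use v(1)[OF that] in auto)
  have w0: "w i > 0" if "i \<in> I" for i
    using that pr prime_gt_0_nat unfolding w_def I_def by (intro prod_pos) auto
  have sub: "fst i \<subseteq> F" "finite (fst i)" "\<And>p. p \<in> fst i \<Longrightarrow> snd i p \<in> \<rho> p" if "i \<in> I" for i
    using that finite_subset[OF _ F] by (auto simp: I_def)
  have wdvd: "int (w i) dvd N (v i)" if i: "i \<in> I" for i
  proof -
    have "int (w i) = (\<Prod>p\<in>fst i. int p)" by (simp add: w_def)
    also have "\<dots> dvd N (v i)"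
    proof (rule prod_primes_dvd[OF sub(2)[OF i]])
      fix p assume p: "p \<in> fst i"
      show "prime p" using p sub(1)[OF i] pr by blast
      show "int p dvd N (v i)"
        unfolding N_def by (rule root_dvd_pure_cubic_norm[OF v(3)[OF i p]]) (use sub[OF i] p \<rho>(3) in auto)
    qed
    finally show ?thesis .
  qed
  \<comment> \<open>The cofactor of \<open>w\<close> in the norm. It lies between 1 and C0, while
    every prime of \<open>F\<close> exceeds C0, so none of them divides it.\<close>
  define j where "j = (\<lambda>i. \<bar>N (v i)\<bar> div int (w i))"
  have Nj: "\<bar>N (v i)\<bar> = int (w i) * j i" if "i \<in> I" for i using wdvd[OF that] by (simp add: j_def)
  have jb: "j i \<in> {1..C0}" if i: "i \<in> I" for i
  proof -
    have "\<bar>N (v i)\<bar> \<le> C0 * int (triple_max (v i)) ^ 3"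
      unfolding N_def C0_def by (rule pure_cubic_norm_bound) (rule triple_max_bounds)+
    also have "\<dots> \<le> C0 * int (w i)" using v(2)[OF i] C0 by (intro mult_left_mono) (auto simp flip: of_nat_power)
    finally have "int (w i) * j i \<le> int (w i) * C0" using Nj[OF i] by (simp add: mult.commute)
    then have "j i \<le> C0" using w0[OF i] by simp
    moreover have "int (w i) * j i > 0" using Nj[OF i] N0[OF i] by linarith
    then have "j i > 0" using w0[OF i] by (simp add: zero_less_mult_iff)
    ultimately show ?thesis by simp
  qed
  \<comment> \<open>The pair determines \<open>w\<close>, as the quotient of the norm by
    \<open>j\<close>, and hence the set of primes. Two roots at one p for the same vector would put
    p^2 into the norm, but \<open>w\<close> contains p once and \<open>j\<close> not at all.\<close>
  have inj: "inj_on (\<lambda>i. (v i, j i)) I"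
  proof (rule inj_onI)
    fix i i' assume i: "i \<in> I" "i' \<in> I" and "(v i, j i) = (v i', j i')"
    then have e: "v i = v i'" "j i = j i'" by auto
    have "int (w i) * j i = int (w i') * j i" using Nj[OF i(1)] Nj[OF i(2)] e by metis
    then have ww: "w i = w i'" using jb[OF i(1)] by auto
    have mem: "p \<in> fst i \<longleftrightarrow> p dvd w i" if iI: "i \<in> I" and pp: "prime p" for p i
    proof
      assume "p dvd w i"
      then obtain q where "q \<in> fst i" "p dvd q"
        using pp sub(2)[OF iI] unfolding w_def by (auto simp: prime_dvd_prod_iff)
      then show "p \<in> fst i" using sub(1)[OF iI] pr pp by (metis primes_dvd_imp_eq subsetD)
    next
      assume "p \<in> fst i"
      then show "p dvd w i" unfolding w_def using sub(2)[OF iI] dvd_prodI by blast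
    qed
    have T: "fst i = fst i'"
    proof (intro equalityI subsetI)
      show "p \<in> fst i'" if "p \<in> fst i" for p using mem[OF i(1)] mem[OF i(2)] ww that sub(1)[OF i(1)] pr by auto
      show "p \<in> fst i" if "p \<in> fst i'" for p using mem[OF i(1)] mem[OF i(2)] ww that sub(1)[OF i(2)] pr by auto
    qed
    have "snd i p = snd i' p" if p: "p \<in> fst i" for p
    proof (rule ccontr)
      assume ne: "snd i p \<noteq> snd i' p"
      have pF: "p \<in> F" and p': "p \<in> fst i'" using sub(1)[OF i(1)] p T by auto
      have pp: "prime (int p)" using pr[OF pF] by simp
      have r: "snd i p \<in> \<rho> p" "snd i' p \<in> \<rho> p" using sub(3)[OF i(1) p] sub(3)[OF i(2) p'] by auto
      have "\<not> int p dvd snd i' p - snd i p"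
      proof
        assume "int p dvd snd i' p - snd i p"
        then have "snd i' p mod int p = snd i p mod int p" by (simp add: mod_eq_dvd_iff)
        moreover have "snd i p \<in> {0..<int p}" "snd i' p \<in> {0..<int p}" using r \<rho>(1)[OF pF] by auto
        ultimately show False using ne by simp
      qed
      then have "(int p)\<^sup>2 dvd N (v i)"
        unfolding N_def
        by (intro two_roots_dvd_pure_cubic_norm[OF pp v(3)[OF i(1) p] \<rho>(3)[OF pF r(1)] _ \<rho>(3)[OF pF r(2)]])
           (use v(3)[OF i(2) p'] e in simp_all)
      then have "int p * int p dvd int (w i) * j i" using Nj[OF i(1)] by (simp add: power2_eq_square flip: Nj[OF i(1)])
      moreover have "w i = p * \<Prod>(fst i - {p})"
        unfolding w_def by (rule prod.remove[OF sub(2)[OF i(1)] p])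
      ultimately have "int p * int p dvd int p * (int (\<Prod>(fst i - {p})) * j i)" by (simp add: mult.assoc)
      then have "int p dvd int (\<Prod>(fst i - {p})) * j i" using pp by simp
      moreover have "\<not> int p dvd int (\<Prod>(fst i - {p}))"
      proof
        assume "int p dvd int (\<Prod>(fst i - {p}))"
        then have "p dvd \<Prod>(fst i - {p})" by (simp only: int_dvd_int_iff)
        then obtain q where "q \<in> fst i - {p}" "p dvd q"
          using pr[OF pF] sub(2)[OF i(1)] by (auto simp: prime_dvd_prod_iff)
        then show False using sub(1)[OF i(1)] pr pF by (metis Diff_iff insertCI primes_dvd_imp_eq subsetD)
      qed
      ultimately have "int p dvd j i" using pp prime_dvd_mult_iff by blast
      then have "int p \<le> j i" using jb[OF i(1)] by (intro zdvd_imp_le) auto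
      then show False using primes[OF pF] jb[OF i(1)] by (auto simp: C0_def)
    qed
    then have "snd i = snd i'"
      using i T by (intro PiE_ext[of "snd i" "fst i" \<rho>]) (auto simp: I_def)
    with T show "i = i'" by (simp add: prod_eq_iff)
  qed
  have vI: "v ` I \<subseteq> {v. v \<noteq> (0, 0, 0)}" by (rule image_subsetI, rule CollectI, rule v(1))
  define g where "g = (\<lambda>v. real (triple_max v) powr - (3 * s))"
  have fin\<rho>: "finite (\<rho> p)" if "p \<in> F" for p
    by (rule card_ge_0_finite) (simp add: \<rho>(2)[OF that])
  have finP: "finite (PiE T \<rho>)" if "T \<in> Pow F" for T
  proof (rule finite_PiE)
    show "finite T" using that finite_subset[OF _ F] by blast
    show "finite (\<rho> p)" if "p \<in> T" for p using that \<open>T \<in> Pow F\<close> fin\<rho> by blast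
  qed
  have fI: "finite I" unfolding I_def by (rule finite_SigmaI) (use F finP in auto)
  have "(\<Prod>p\<in>F. 1 + 3 * real p powr - s) = (\<Sum>T\<in>Pow F. (\<Prod>p\<in>F - T. 1) * (\<Prod>p\<in>T. 3 * real p powr - s))"
    using prod_add[OF F, of "\<lambda>p. 3 * real p powr - s" "\<lambda>_. 1"] by (simp add: add.commute)
  also have "\<dots> = (\<Sum>T\<in>Pow F. \<Sum>c\<in>PiE T \<rho>. real (w (T, c)) powr - s)"
  proof (rule sum.cong[OF refl])
    fix T assume T: "T \<in> Pow F"
    then have fT: "finite T" using F by (auto intro: finite_subset)
    have c: "card (PiE T \<rho>) = 3 ^ card T"
      using T \<rho>(2) by (subst card_PiE[OF fT]) (simp add: subset_iff)
    have "(\<Prod>p\<in>T. 3 * real p powr - s) = 3 ^ card T * (\<Prod>p\<in>T. real p powr - s)" by (simp add: prod.distrib)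
    also have "(\<Prod>p\<in>T. real p powr - s) = real (\<Prod>T) powr - s"
      using fT by (induction T rule: finite_induct) (simp_all add: powr_mult)
    finally show "(\<Prod>p\<in>F - T. 1) * (\<Prod>p\<in>T. 3 * real p powr - s) = (\<Sum>c\<in>PiE T \<rho>. real (w (T, c)) powr - s)"
      by (simp add: c w_def)
  qed
  also have "\<dots> = (\<Sum>i\<in>I. real (w i) powr - s)"
    unfolding I_def by (subst sum.Sigma) (use F finP in auto)
  also have "\<dots> \<le> (\<Sum>i\<in>I. g (v i))"
  proof (rule sum_mono)
    fix i assume i: "i \<in> I"
    have "triple_max (v i) \<noteq> 0" using v(1)[OF i] by (simp add: triple_max_eq_0_iff)
    then have t: "real (triple_max (v i)) > 0" by simp
    have "real (triple_max (v i)) ^ 3 \<le> real (w i)" using v(2)[OF i] by (metis of_nat_le_iff of_nat_power)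
    then have "real (w i) powr - s \<le> (real (triple_max (v i)) ^ 3) powr - s"
      by (intro powr_mono2') (use t s in auto)
    also have "\<dots> = g (v i)"
      using powr_realpow[OF t, of 3] powr_powr[of "real (triple_max (v i))" 3 "- s"] by (simp add: g_def)
    finally show "real (w i) powr - s \<le> g (v i)" .
  qed
  also have "\<dots> = (\<Sum>z\<in>(\<lambda>i. (v i, j i)) ` I. g (fst z))" by (subst sum.reindex[OF inj]) simp
  also have "\<dots> \<le> (\<Sum>z\<in>v ` I \<times> {1..C0}. g (fst z))"
    by (rule sum_mono2) (use fI jb in \<open>auto simp: g_def\<close>)
  also have "\<dots> = real_of_int C0 * (\<Sum>v\<in>v ` I. g v)"
  proof -
    have "(\<Sum>z\<in>v ` I \<times> {1..C0}. g (fst z)) = (\<Sum>x\<in>v ` I. \<Sum>y\<in>{1..C0}. g x)"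
      unfolding sum.cartesian_product by (simp add: split_beta)
    then show ?thesis using C0 by (simp add: sum_distrib_left)
  qed
  also have "(\<Sum>v\<in>v ` I. g v) \<le> infsum g {v. v \<noteq> (0, 0, 0)}"
    unfolding g_def by (rule finite_sum_le_infsum[OF triple_max_sum(1)]) (use s fI vI in simp_all)
  also have "\<dots> \<le> 26 * (1 + 1 / (3 * s - 3))" unfolding g_def by (rule triple_max_sum(2)) (use s in simp)
  finally show ?thesis using C0 unfolding C0_def by (simp add: mult_left_mono)
qed

text \<open>The product of 1 + 3 p^-s is O(1/(s-1)). Taking logarithms bounds three times the sum of
  p^-s by ln(1/(s-1)) plus a constant, hence three times the density by 1.\<close>

theorem cube_mod_primes_density:
  fixes n :: int
  assumes n: "\<nexists>q :: rat. of_int n = q ^ 3" and S: "log_density S d"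
    and roots: "\<And>p. p \<in> S \<Longrightarrow> prime p \<Longrightarrow> \<exists>\<rho>. \<rho> \<subseteq> {0..<int p} \<and> card \<rho> = 3 \<and> (\<forall>r\<in>\<rho>. int p dvd r ^ 3 - n)"
  shows "d \<le> 1 / 3"
proof (rule ccontr)
  assume d: "\<not> d \<le> 1 / 3"
  define C0 where "C0 = 1 + 4 * \<bar>n\<bar> + n\<^sup>2"
  have C0: "C0 \<ge> 1" by (simp add: C0_def)
  define S' where "S' = {p \<in> S. prime p \<and> int p > C0}"
  have "log_density S' d"
    by (rule log_density_cong[OF S, of "nat C0"]) (use C0 in \<open>auto simp: S'_def\<close>)
  then obtain C1 where C1: "\<And>s. 1 < s \<Longrightarrow> s < 2 \<Longrightarrow> \<bar>prime_sum S' s - d * ln (1 / (s - 1))\<bar> \<le> C1"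
    unfolding log_density_def by blast
  define K where "K = real_of_int C0 * 52"
  \<comment> \<open>The 18 is 9 * 2: from ln(1 + t) \<ge> t - t^2 at t = 3 p^-s, with the sum of the
    squares p^(-2s) at most 2. The 52 in \<open>K\<close> comes from 26 (1 + 1/(3s - 3)) \<le> 52/(s
    - 1).\<close>
  have main: "3 * prime_sum S' s \<le> ln K + ln (1 / (s - 1)) + 18" if s: "1 < s" "s < 2" for s
  proof -
    have K: "K > 0" using C0 by (simp add: K_def)
    have fin: "(\<Sum>p\<in>F. real p powr - s) \<le> (ln K + ln (1 / (s - 1)) + 18) / 3" if F: "finite F" "F \<subseteq> S'" for F
    proof -
      have "(\<Prod>p\<in>F. 1 + 3 * real p powr - s) \<le> real_of_int C0 * (26 * (1 + 1 / (3 * s - 3)))"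
        unfolding C0_def by (rule product_over_roots_bound[OF n F(1) s(1)]) (use F roots in \<open>auto simp: S'_def C0_def\<close>)
      also have "26 * (1 + 1 / (3 * s - 3)) \<le> 52 * (1 / (s - 1))"
      proof -
        define u where "u = 1 / (s - 1)"
        have "1 \<le> u" using s by (simp add: u_def)
        moreover have "1 / (3 * s - 3) = u / 3" using s by (simp add: u_def field_simps)
        ultimately have "26 * (1 + 1 / (3 * s - 3)) \<le> 52 * u" by simp
        then show ?thesis unfolding u_def .
      qed
      finally have P: "(\<Prod>p\<in>F. 1 + 3 * real p powr - s) \<le> K * (1 / (s - 1))"
        using C0 by (simp add: K_def mult_left_mono)
      have pos: "1 + 3 * real p powr - s > 0" for p by (simp add: add_pos_nonneg)
      have lnge: "ln (1 + t) \<ge> t - t\<^sup>2" if "t \<ge> 0" for t :: real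
      proof -
        have "ln (1 / (1 + t)) \<le> 1 / (1 + t) - 1" by (rule ln_le_minus_one) (use that in simp)
        moreover have "ln (1 / (1 + t)) = - ln (1 + t)" using that by (simp add: ln_div)
        moreover have "1 / (1 + t) - 1 \<le> - t + t\<^sup>2"
        proof -
          have "1 / (1 + t) - 1 = - t + t\<^sup>2 / (1 + t)" using that by (simp add: field_simps power2_eq_square)
          moreover have "t\<^sup>2 / (1 + t) \<le> t\<^sup>2 / 1" by (rule divide_left_mono) (use that in auto)
          ultimately show ?thesis by simp
        qed
        ultimately show ?thesis by linarith
      qed
      have sq: "(\<Sum>p\<in>F. (real p powr - s)\<^sup>2) \<le> 2"
      proof -
        have "(\<Sum>p\<in>F. (real p powr - s)\<^sup>2) \<le> (\<Sum>p\<in>F. real p powr - 2)"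
        proof (rule sum_mono)
          fix p assume "p \<in> F"
          then have "prime p" using F by (auto simp: S'_def)
          then have "real p \<ge> 1" using prime_ge_1_nat by auto
          then have "real p powr (- s + - s) \<le> real p powr - 2" by (intro powr_mono) (use s in auto)
          then show "(real p powr - s)\<^sup>2 \<le> real p powr - 2" by (simp only: power2_eq_square powr_add)
        qed
        also have "\<dots> \<le> infsum (\<lambda>n. real n powr - 2) {1..}"
          by (rule finite_sum_le_infsum[OF nat_zeta_bounds(1)])
             (use F prime_ge_1_nat in \<open>auto simp: S'_def subset_iff\<close>)
        also have "\<dots> \<le> 2" using nat_zeta_bounds(2)[of 2] by simp
        finally show ?thesis .
      qed
      have "3 * (\<Sum>p\<in>F. real p powr - s) - 9 * (\<Sum>p\<in>F. (real p powr - s)\<^sup>2) =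
          (\<Sum>p\<in>F. 3 * real p powr - s - (3 * real p powr - s)\<^sup>2)"
        by (simp add: sum_subtractf sum_distrib_left power_mult_distrib)
      also have "\<dots> \<le> (\<Sum>p\<in>F. ln (1 + 3 * real p powr - s))" by (rule sum_mono, rule lnge) simp
      also have "\<dots> = ln (\<Prod>p\<in>F. 1 + 3 * real p powr - s)" by (rule ln_prod[symmetric]) (use less_imp_neq[OF pos] F in fastforce)+
      also have "\<dots> \<le> ln (K * (1 / (s - 1)))"
        using P K s pos by (subst ln_le_cancel_iff) (auto intro!: prod_pos)
      also have "\<dots> = ln K + ln (1 / (s - 1))" by (rule ln_mult_pos) (use K s in auto)
      finally show ?thesis using sq by simp
    qed
    have "prime_sum S' s \<le> (ln K + ln (1 / (s - 1)) + 18) / 3"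
      unfolding prime_sum_def
      by (rule infsum_le_finite_sums[OF prime_powr_summable]) (use s fin in \<open>auto simp: S'_def\<close>)
    then show ?thesis by simp
  qed
  define D where "D = (ln K + 18 + 3 * C1) / (3 * d - 1)"
  have "\<forall>\<^sub>F s in at_right (1::real). ln (1 / (s - 1)) > D"
    using filterlim_ln_at_right_1 unfolding filterlim_at_top_dense by blast
  moreover have "\<forall>\<^sub>F s in at_right (1::real). s > 1" by (simp add: eventually_at_right_less)
  moreover have "\<forall>\<^sub>F s in at_right (1::real). s < 2" by (rule eventually_at_rightI[of 1 2]) auto
  ultimately have "\<forall>\<^sub>F s in at_right (1::real). False"
  proof eventually_elim
    case (elim s)
    define l where "l = ln (1 / (s - 1))"
    have "prime_sum S' s \<ge> d * l - C1" using C1[of s] elim unfolding l_def by linarith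
    with main[of s] elim have "3 * (d * l) - l \<le> ln K + 18 + 3 * C1" unfolding l_def by linarith
    then have "(3 * d - 1) * l \<le> ln K + 18 + 3 * C1" by (simp add: algebra_simps)
    moreover have "3 * d - 1 > 0" using d by simp
    ultimately have "l \<le> D" by (simp add: D_def field_simps)
    then show ?case using elim by (simp add: l_def)
  qed
  then show False by simp
qed

section \<open>Split primes and the cubic residue character\<close>

abbreviation eis_omega :: eis where "eis_omega \<equiv> Eis (-1) 1"

lemma eis_cube_eq_1_iff: "z ^ 3 = 1 \<longleftrightarrow> z \<in> {1, eis_omega, Eis 0 (-1)}"
proof -
  have "z ^ 3 - 1 = (z - 1) * ((z - eis_omega) * (z - Eis 0 (-1)))"
    by (cases z) (simp add: one_eis_def power3_eq_cube algebra_simps)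
  then have "z ^ 3 = 1 \<longleftrightarrow> (z - 1) * ((z - eis_omega) * (z - Eis 0 (-1))) = 0"
    by (metis eq_iff_diff_eq_0)
  then show ?thesis by (simp only: mult_eq_0_iff eq_iff_diff_eq_0[symmetric] insert_iff empty_iff simp_thms)
qed

lemma eis_cube_root_distinct:
  assumes "z ^ 3 = 1" "z' ^ 3 = 1" "z \<noteq> z'" shows "eis_norm (z - z') = 3"
  using assms unfolding eis_cube_eq_1_iff by (auto simp: one_eis_def eis_norm_Eis)

lemma eis_cube_root_cnj: "z ^ 3 = 1 \<Longrightarrow> eis_cnj z = z\<^sup>2"
  unfolding eis_cube_eq_1_iff by (auto simp: one_eis_def eis_cnj_def power2_eq_square)

text \<open>Every orbit of \<sigma> has three elements and contributes 3 \<open>g x\<close>; orbits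
  are removed one at a time.\<close>

lemma three_dvd_orbit_sum:
  fixes g :: "'a \<Rightarrow> 'b :: comm_ring_1"
  assumes "finite S" "\<And>x. x \<in> S \<Longrightarrow> \<sigma> x \<in> S" "\<And>x. x \<in> S \<Longrightarrow> \<sigma> (\<sigma> (\<sigma> x)) = x"
    "\<And>x. x \<in> S \<Longrightarrow> \<sigma> x \<noteq> x" "\<And>x. x \<in> S \<Longrightarrow> g (\<sigma> x) = g x"
  shows "3 dvd sum g S"
  using assms
proof (induction "card S" arbitrary: S rule: less_induct)
  case less
  show ?case
  proof (cases "S = {}")
    case False
    then obtain x where x: "x \<in> S" by blast
    let ?O = "{x, \<sigma> x, \<sigma> (\<sigma> x)}"
    have O: "?O \<subseteq> S" using x less.prems(2) by blast
    have d: "\<sigma> x \<noteq> x" "\<sigma> (\<sigma> x) \<noteq> \<sigma> x" "\<sigma> (\<sigma> x) \<noteq> x"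
      using less.prems(3,4)[OF x] less.prems(4)[of "\<sigma> x"] less.prems(2)[OF x] by metis+
    have "3 dvd sum g (S - ?O)"
    proof (rule less.hyps)
      show "card (S - ?O) < card S" using x less.prems(1) by (intro psubset_card_mono) auto
      fix y assume y: "y \<in> S - ?O"
      then have yS: "y \<in> S" by simp
      have "\<sigma> y \<notin> ?O"
      proof
        assume "\<sigma> y \<in> ?O"
        then have "\<sigma> (\<sigma> (\<sigma> y)) \<in> ?O" using less.prems(3)[OF x] by auto
        then show False using y less.prems(3)[OF yS] by simp
      qed
      then show "\<sigma> y \<in> S - ?O" using less.prems(2)[OF yS] by simp
    qed (use less.prems in auto)
    moreover have "sum g S = sum g ?O + sum g (S - ?O)"
      using sum.subset_diff[OF O less.prems(1), of g] by (simp add: add.commute)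
    moreover have "sum g ?O = 3 * g x"
      using d less.prems(5)[OF x] less.prems(5)[of "\<sigma> x"] less.prems(2)[OF x] by (simp add: algebra_simps)
    ultimately show ?thesis by simp
  qed simp
qed

section \<open>Powers modulo a rational prime\<close>

lemma diff_dvd_power_diff: "x - y dvd x ^ n - (y :: 'a :: comm_ring_1) ^ n"
  by (simp add: power_diff_sumr2)

lemma fermat_theorem_int:
  assumes p: "prime p" and "\<not> int p dvd a" shows "int p dvd a ^ (p - 1) - 1"
proof -
  define b where "b = nat (a mod int p)"
  have b: "int b = a mod int p" using p prime_gt_0_nat by (simp add: b_def)
  have "\<not> p dvd b"
  proof
    assume "p dvd b"
    then have "int p dvd a mod int p" using b by (metis int_dvd_int_iff)
    then show False using assms(2) by (simp add: dvd_mod_iff)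
  qed
  then have "[b ^ (p - 1) = 1] (mod p)" by (rule fermat_theorem[OF p])
  then have "[int (b ^ (p - 1)) = int 1] (mod int p)" by (simp only: cong_int_iff)
  moreover have "[int b = a] (mod int p)" by (simp add: b cong_def)
  then have "[int b ^ (p - 1) = a ^ (p - 1)] (mod int p)" by (rule cong_pow)
  ultimately have "[a ^ (p - 1) = 1] (mod int p)" by (metis cong_sym cong_trans of_nat_1 of_nat_power)
  then show ?thesis by (simp add: cong_iff_dvd_diff)
qed

lemma prime_primitive_root_int:
  assumes p: "prime p"
  shows "\<exists>g :: int. \<not> int p dvd g \<and> (\<forall>k :: nat. int p dvd g ^ k - 1 \<longrightarrow> (p - 1) dvd k)"
proof -
  obtain g where g: "residue_primroot p g" using prime_primitive_root_exists[OF prime_gt_1_nat[OF p] p] by blast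
  then have cop: "coprime p g" and ord: "ord p g = totient p" by (auto simp: residue_primroot_def)
  have "(p - 1) dvd k" if "int p dvd int g ^ k - 1" for k :: nat
  proof -
    have "[int (g ^ k) = int 1] (mod int p)" using that by (simp add: cong_iff_dvd_diff)
    then have "[g ^ k = 1] (mod p)" by (simp only: cong_int_iff)
    then have "ord p g dvd k" by (simp only: ord_divides)
    then show ?thesis using ord p by (simp add: totient_prime)
  qed
  moreover have "\<not> int p dvd int g"
    using cop p by (metis coprime_absorb_left int_dvd_int_iff not_prime_unit)
  ultimately show ?thesis by blast
qed

text \<open>The witness is g^((p-1)/3) for a primitive root g: its cube is 1 by Fermat, and the
  order of g excludes the value 1.\<close>

lemma cube_root_of_unity_mod:
  assumes p: "prime p" "p mod 3 = 1"
  shows "\<exists>t. int p dvd t\<^sup>2 + t + 1"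
proof -
  obtain g where g: "\<not> int p dvd g" "\<And>k. int p dvd g ^ k - 1 \<Longrightarrow> (p - 1) dvd k"
    using prime_primitive_root_int[OF p(1)] by blast
  obtain m where m: "p = 3 * m + 1" using p(2) by (metis mod_mult_div_eq mult.commute add.commute)
  have m0: "m > 0" using m p(1) by (cases m) auto
  define t where "t = g ^ m"
  have "t ^ 3 = g ^ (p - 1)" by (simp add: t_def m power_mult[symmetric] mult.commute)
  then have "int p dvd t ^ 3 - 1" using fermat_theorem_int[OF p(1) g(1)] by simp
  moreover have "t ^ 3 - 1 = (t - 1) * (t\<^sup>2 + t + 1)" by (simp add: power2_eq_square power3_eq_cube algebra_simps)
  moreover have "\<not> int p dvd t - 1"
  proof
    assume "int p dvd t - 1"
    then have "(p - 1) dvd m" unfolding t_def by (rule g(2))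
    then show False using m m0 by (auto dest: dvd_imp_le)
  qed
  ultimately have "int p dvd t\<^sup>2 + t + 1" using p(1) prime_dvd_mult_iff[of "int p"] by simp
  then show ?thesis by blast
qed

text \<open>Write q = c + d\<omega>. If p divided d it would divide c, and p^2 would divide p. So d
  is invertible modulo p, \<omega> is congruent to -c/d modulo q, and every class contains an
  integer.\<close>

lemma prime_norm_congruent_to_int:
  assumes p: "prime p" and N: "eis_norm q = int p"
  shows "\<exists>a :: int. q dvd x - of_int a" "q dvd of_int a \<longleftrightarrow> int p dvd a"
proof -
  have ip: "prime (int p)" using p by simp
  have qp: "q dvd of_nat p" using eis_dvd_norm[of q] N by simp
  show "q dvd of_int a \<longleftrightarrow> int p dvd a"
  proof
    assume "q dvd of_int a"
    then have "int p dvd a\<^sup>2" using eis_norm_dvd[of q "of_int a"] N by simp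
    then show "int p dvd a" using prime_dvd_power[OF ip, of a 2] by simp
  next
    assume "int p dvd a"
    then obtain b where "a = int p * b" by (auto simp: dvd_def)
    then show "q dvd of_int a" using qp by simp
  qed
  obtain c d where cd: "q = Eis c d" by (cases q)
  have N: "c\<^sup>2 + c * d + d\<^sup>2 = int p" using N cd by (simp add: eis_norm_Eis)
  have "\<not> int p dvd d"
  proof
    assume d: "int p dvd d"
    then have "int p dvd int p - c * d - d\<^sup>2" by (intro dvd_diff) (auto simp: power2_eq_square)
    moreover have "int p - c * d - d\<^sup>2 = c\<^sup>2" using N by linarith
    ultimately have "int p dvd c\<^sup>2" by simp
    then have "int p dvd c" using prime_dvd_power[OF ip, of c 2] by simp
    then obtain c' d' where "c = int p * c'" "d = int p * d'" using d by (auto simp: dvd_def)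
    then have "int p * (int p * (c'\<^sup>2 + c' * d' + d'\<^sup>2)) = int p * 1"
      using N by (simp add: power2_eq_square algebra_simps)
    then have "int p * (c'\<^sup>2 + c' * d' + d'\<^sup>2) = 1" using p by simp
    then have "int p dvd 1" by (metis dvd_triv_left)
    then show False using ip by simp
  qed
  then have "coprime d (int p)" using ip prime_imp_coprime coprime_commute by blast
  then obtain e where "[d * e = 1] (mod int p)" using cong_solve_coprime_int by blast
  then obtain k where k: "d * e = 1 + int p * k" by (metis cong_iff_lin cong_sym)
  obtain u v where uv: "x = Eis u v" by (cases x)
  have "Eis (c * e) 1 = of_int e * q - of_nat p * of_int k * Eis 0 1"
    using k by (simp add: cd of_int_eis of_nat_eis algebra_simps)
  then have "q dvd Eis (c * e) 1" using qp by (simp add: mult.assoc)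
  then have "q dvd of_int v * Eis (c * e) 1" by simp
  also have "of_int v * Eis (c * e) 1 = x - of_int (u - v * (c * e))" by (simp add: uv of_int_eis)
  finally show "\<exists>a :: int. q dvd x - of_int a" by blast
qed

section \<open>The cubic residue symbol at a prime of norm \<open>p\<close>\<close>

locale split_prime =
  fixes p :: nat and q :: eis
  assumes p: "prime p" and p1: "p mod 3 = 1" and Nq: "eis_norm q = int p"
begin

definition m where "m = (p - 1) div 3"

lemma pm: "p = 3 * m + 1"
proof -
  have "3 dvd p - 1" using p1 by (simp add: mod_eq_dvd_iff_nat prime_ge_1_nat[OF p] dvd_eq_mod_eq_0) presburger
  then show ?thesis using prime_ge_1_nat[OF p] by (simp add: m_def)
qed

lemma m_even: "even m"
proof (rule ccontr)
  assume "odd m"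
  then have "even p" by (subst pm) simp
  then have "p = 2" using p primes_dvd_imp_eq two_is_prime_nat by blast
  then show False using p1 by simp
qed

lemma p_minus_1: "p - 1 = 3 * m"
  using pm by simp

lemma m_pos: "m > 0"
  using pm p by (cases m) auto

lemma p_gt: "p > 3" using pm m_pos by simp

lemma not_dvd_small: "eis_norm x < int p \<Longrightarrow> x \<noteq> 0 \<Longrightarrow> \<not> q dvd x"
  using eis_norm_dvd[of q x] Nq zdvd_imp_le[of "int p" "eis_norm x"] by auto

lemma prime_elem_q: "prime_elem q"
proof (rule irreducible_imp_prime_elem, rule irreducibleI)
  show "q \<noteq> 0" using Nq p by auto
  show "\<not> is_unit q" using Nq p by (auto simp: eis_unit_iff_norm)
  fix a b assume "q = a * b"
  then have "int p = eis_norm a * eis_norm b" using Nq by (simp add: eis_norm_mult)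
  then have "prime (eis_norm a * eis_norm b)" using p by (metis prime_nat_int_transfer)
  then have "is_unit (eis_norm a) \<or> is_unit (eis_norm b)"
    by (metis irreducible_def prime_elem_imp_irreducible prime_elem_iff_prime_abs prime_imp_prime_elem)
  then show "is_unit a \<or> is_unit b"
    using eis_norm_nonneg[of a] eis_norm_nonneg[of b] by (auto simp: eis_unit_iff_norm)
qed

lemma q_dvd_mult_iff: "q dvd x * y \<longleftrightarrow> q dvd x \<or> q dvd y"
  using prime_elem_q by (rule prime_elem_dvd_mult_iff)

lemma q_dvd_p: "q dvd of_nat p"
  using eis_dvd_norm[of q] Nq by simp

lemma q_dvd_of_int_iff: "q dvd of_int a \<longleftrightarrow> int p dvd a"
  by (rule prime_norm_congruent_to_int(2)[OF p Nq])

lemma congruent_to_int: "\<exists>a :: int. q dvd x - of_int a"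
  by (rule prime_norm_congruent_to_int(1)[OF p Nq])

lemmas fermat_int = fermat_theorem_int[OF p]

lemma fermat: "\<not> q dvd x \<Longrightarrow> q dvd x ^ (p - 1) - 1"
proof -
  assume x: "\<not> q dvd x"
  obtain a where a: "q dvd x - of_int a" using congruent_to_int by blast
  have d: "q dvd x ^ n - of_int a ^ n" for n
  proof -
    have "x - of_int a dvd x ^ n - of_int a ^ n" by (rule diff_dvd_power_diff)
    then show ?thesis using a dvd_trans by blast
  qed
  have "\<not> int p dvd a"
  proof
    assume "int p dvd a"
    then have "q dvd of_int a" by (simp add: q_dvd_of_int_iff)
    then have "q dvd (x - of_int a) + of_int a" using a by (rule dvd_add[rotated])
    then show False using x by simp
  qed
  then have "q dvd of_int (a ^ (p - 1) - 1)" unfolding q_dvd_of_int_iff by (rule fermat_int)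
  then have "q dvd (x ^ (p - 1) - of_int a ^ (p - 1)) + (of_int a ^ (p - 1) - 1)" using d by (intro dvd_add) auto
  then show ?thesis by simp
qed

lemma cube_root_unique:
  assumes "z ^ 3 = 1" "z' ^ 3 = 1" "q dvd z - z'" shows "z = z'"
  using eis_cube_root_distinct[OF assms(1,2)] not_dvd_small[of "z - z'"] assms(3) p_gt by force

lemma cube_root_exists:
  assumes "\<not> q dvd x" shows "\<exists>z. z ^ 3 = 1 \<and> q dvd x ^ m - z"
proof -
  define y where "y = x ^ m"
  have "y ^ 3 - 1 = (y - 1) * ((y - eis_omega) * (y - Eis 0 (-1)))"
    by (cases y) (simp add: one_eis_def power3_eq_cube algebra_simps)
  moreover have "q dvd y ^ 3 - 1"
    using fermat[OF assms] unfolding p_minus_1 y_def by (simp add: power_mult[symmetric] mult.commute)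
  ultimately have "q dvd y - 1 \<or> q dvd y - eis_omega \<or> q dvd y - Eis 0 (-1)" by (simp only: q_dvd_mult_iff)
  then show ?thesis unfolding y_def eis_cube_eq_1_iff by blast
qed

text \<open>The cubic residue symbol modulo \<open>q\<close>, extended by 0. Its value is unique
  because distinct cube roots of unity differ by an element of norm 3, which is smaller than
  p.\<close>

definition cres :: "eis \<Rightarrow> eis" where
  "cres x = (if q dvd x then 0 else THE z. z ^ 3 = 1 \<and> q dvd x ^ m - z)"

lemma cres:
  assumes "\<not> q dvd x" shows "cres x ^ 3 = 1" "q dvd x ^ m - cres x"
proof -
  have "\<exists>!z. z ^ 3 = 1 \<and> q dvd x ^ m - z"
  proof (rule ex_ex1I[OF cube_root_exists[OF assms]])
    fix z z' assume z: "z ^ 3 = 1 \<and> q dvd x ^ m - z" "z' ^ 3 = 1 \<and> q dvd x ^ m - z'"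
    have "q dvd (x ^ m - z') - (x ^ m - z)" by (rule dvd_diff) (use z in blast)+
    moreover have "(x ^ m - z') - (x ^ m - z) = z - z'" by simp
    ultimately have "q dvd z - z'" by metis
    then show "z = z'" using z cube_root_unique by blast
  qed
  from theI'[OF this] show "cres x ^ 3 = 1" "q dvd x ^ m - cres x" using assms by (auto simp: cres_def)
qed

lemma cres_0: "q dvd x \<Longrightarrow> cres x = 0"
  by (simp add: cres_def)

lemma cres_eqI: "z ^ 3 = 1 \<Longrightarrow> q dvd x ^ m - z \<Longrightarrow> \<not> q dvd x \<Longrightarrow> cres x = z"
proof -
  assume z: "z ^ 3 = 1" "q dvd x ^ m - z" "\<not> q dvd x"
  have "q dvd (x ^ m - z) - (x ^ m - cres x)" using z(2) cres(2)[OF z(3)] by (rule dvd_diff)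
  moreover have "(x ^ m - z) - (x ^ m - cres x) = cres x - z" by simp
  ultimately have "q dvd cres x - z" by metis
  then show ?thesis using z cres(1)[OF z(3)] cube_root_unique by blast
qed

lemma cres_congruent: "q dvd x ^ m - cres x"
proof (cases "q dvd x")
  case True
  then have "q dvd x ^ m" using m_pos by (simp add: dvd_power dvd_trans[OF True])
  then show ?thesis using True by (simp add: cres_0)
qed (rule cres(2))

lemma cres_mult: "cres (x * y) = cres x * cres y"
proof (cases "q dvd x \<or> q dvd y")
  case False
  then have xy: "\<not> q dvd x" "\<not> q dvd y" "\<not> q dvd x * y" by (auto simp: q_dvd_mult_iff)
  have "(x * y) ^ m - cres x * cres y = x ^ m * (y ^ m - cres y) + cres y * (x ^ m - cres x)"
    by (simp add: power_mult_distrib algebra_simps)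
  then have "q dvd (x * y) ^ m - cres x * cres y" using cres(2)[OF xy(1)] cres(2)[OF xy(2)] by simp
  then show ?thesis
    using cres(1)[OF xy(1)] cres(1)[OF xy(2)] xy(3) by (intro cres_eqI) (auto simp: power_mult_distrib)
qed (auto simp: cres_0)

lemma cres_cong: "q dvd x - y \<Longrightarrow> cres x = cres y"
proof (cases "q dvd y")
  case True
  assume "q dvd x - y"
  then have "q dvd (x - y) + y" using True by (rule dvd_add)
  then show ?thesis using True by (simp add: cres_0)
next
  case False
  assume d: "q dvd x - y"
  have x: "\<not> q dvd x"
  proof
    assume "q dvd x"
    then have "q dvd x - (x - y)" using d by (rule dvd_diff)
    then show False using False by simp
  qed
  have "x - y dvd x ^ m - y ^ m" by (rule diff_dvd_power_diff)
  then have "q dvd (x ^ m - y ^ m) + (y ^ m - cres y)" using d cres(2)[OF False] by (meson dvd_add dvd_trans)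
  then show ?thesis using x cres(1)[OF False] by (intro cres_eqI) auto
qed

lemma cres_1: "cres 1 = 1"
  by (rule cres_eqI) (use prime_elem_q in \<open>auto simp: prime_elem_def\<close>)

lemma cres_minus_1: "cres (-1) = 1"
  by (rule cres_eqI) (use prime_elem_q m_even in \<open>auto simp: prime_elem_def\<close>)

lemma cres_cnj: "eis_cnj (cres x) = (cres x)\<^sup>2"
  by (cases "q dvd x") (auto simp: cres_0 eis_cube_root_cnj cres(1))

definition ch :: "int \<Rightarrow> eis" where "ch i = cres (of_int i)"

lemma ch_mult: "ch (a * b) = ch a * ch b" by (simp add: ch_def cres_mult)
lemma ch_cong: "int p dvd a - b \<Longrightarrow> ch a = ch b"
  unfolding ch_def by (rule cres_cong) (simp add: q_dvd_of_int_iff flip: of_int_diff)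
lemma ch_mod: "ch (a mod int p) = ch a"
  by (rule ch_cong) (metis mod_eq_dvd_iff mod_mod_trivial)
lemma ch_0: "int p dvd a \<Longrightarrow> ch a = 0" by (simp add: ch_def cres_0 q_dvd_of_int_iff)
lemma ch_cube: "\<not> int p dvd a \<Longrightarrow> ch a ^ 3 = 1" by (simp add: ch_def cres(1) q_dvd_of_int_iff)
lemma ch_cnj_mult: "\<not> int p dvd a \<Longrightarrow> ch a * eis_cnj (ch a) = 1"
  using ch_cube[of a] cres_cnj[of "of_int a"] by (simp add: ch_def power3_eq_cube power2_eq_square mult.assoc)
lemma ch_1: "ch 1 = 1" by (simp add: ch_def cres_1)
lemma ch_uminus: "ch (- a) = ch a"
  using ch_mult[of "-1" a] cres_minus_1 by (simp add: ch_def)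

lemma sum_residues_reindex:
  fixes g :: "int \<Rightarrow> 'b :: comm_monoid_add"
  assumes per: "\<And>i. g (i mod int p) = g i"
    and inj: "\<And>i j. int p dvd \<sigma> i - \<sigma> j \<Longrightarrow> int p dvd i - j"
  shows "(\<Sum>i\<in>{0..<int p}. g (\<sigma> i)) = (\<Sum>i\<in>{0..<int p}. g i)"
proof -
  have p0: "int p > 0" using p prime_gt_0_nat by simp
  have inj': "inj_on (\<lambda>i. \<sigma> i mod int p) {0..<int p}"
  proof (rule inj_onI)
    fix i j assume i: "i \<in> {0..<int p}" "j \<in> {0..<int p}" and "\<sigma> i mod int p = \<sigma> j mod int p"
    then have "int p dvd i - j" using inj by (simp add: mod_eq_dvd_iff)
    then have "i mod int p = j mod int p" by (simp add: mod_eq_dvd_iff)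
    then show "i = j" using i by simp
  qed
  have "(\<lambda>i. \<sigma> i mod int p) ` {0..<int p} = {0..<int p}"
    by (rule endo_inj_surj) (use inj' p0 in auto)
  then have "(\<Sum>i\<in>{0..<int p}. g i) = (\<Sum>i\<in>(\<lambda>i. \<sigma> i mod int p) ` {0..<int p}. g i)" by simp
  also have "\<dots> = (\<Sum>i\<in>{0..<int p}. g (\<sigma> i mod int p))" using sum.reindex[OF inj'] by simp
  finally show ?thesis by (simp add: per)
qed

lemma p_dvd_mult_iff: "int p dvd a * b \<longleftrightarrow> int p dvd a \<or> int p dvd b"
  using p by (simp add: prime_dvd_mult_iff)

lemma sum_residues_mult:
  fixes g :: "int \<Rightarrow> 'b :: comm_monoid_add"
  assumes "\<And>i. g (i mod int p) = g i" "\<not> int p dvd a"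
  shows "(\<Sum>i\<in>{0..<int p}. g (a * i)) = (\<Sum>i\<in>{0..<int p}. g i)"
proof (rule sum_residues_reindex)
  fix i j assume "int p dvd a * i - a * j"
  then show "int p dvd i - j" using assms(2) by (simp add: p_dvd_mult_iff right_diff_distrib[symmetric])
qed (simp add: assms(1))

lemma sum_residues_shift:
  fixes g :: "int \<Rightarrow> 'b :: comm_monoid_add"
  assumes "\<And>i. g (i mod int p) = g i"
  shows "(\<Sum>i\<in>{0..<int p}. g (i + a)) = (\<Sum>i\<in>{0..<int p}. g i)"
  by (rule sum_residues_reindex) (simp_all add: assms)

lemma sum_residues_neg:
  fixes g :: "int \<Rightarrow> 'b :: comm_monoid_add"
  assumes "\<And>i. g (i mod int p) = g i"
  shows "(\<Sum>i\<in>{0..<int p}. g (a - i)) = (\<Sum>i\<in>{0..<int p}. g i)"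
  by (rule sum_residues_reindex) (simp_all add: assms dvd_diff_commute)

lemmas primitive_root = prime_primitive_root_int[OF p]

text \<open>Euler's criterion for cubes. In the nontrivial direction a is written as g^k for a
  primitive root g, and a^m = 1 makes 3m divide k m.\<close>

lemma cube_iff: "\<not> int p dvd a \<Longrightarrow> (\<exists>x. int p dvd x ^ 3 - a) \<longleftrightarrow> int p dvd a ^ m - 1"
proof -
  assume a: "\<not> int p dvd a"
  have ip: "prime (int p)" using p by simp
  have fer: "int p dvd x ^ (p - 1) - 1" if "\<not> int p dvd x" for x
    using that by (rule fermat_int)
  show ?thesis
  proof
    assume "\<exists>x. int p dvd x ^ 3 - a"
    then obtain x where x: "int p dvd x ^ 3 - a" by blast
    have "\<not> int p dvd x"
    proof
      assume "int p dvd x"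
      then have "int p dvd x ^ 3" by (simp add: power3_eq_cube)
      then have "int p dvd x ^ 3 - (x ^ 3 - a)" using x by (rule dvd_diff)
      then show False using a by simp
    qed
    then have 1: "int p dvd (x ^ 3) ^ m - 1" using fer[of x] unfolding p_minus_1 by (simp add: power_mult)
    have "x ^ 3 - a dvd (x ^ 3) ^ m - a ^ m" by (rule diff_dvd_power_diff)
    then have "int p dvd (x ^ 3) ^ m - a ^ m" using x dvd_trans by blast
    from dvd_diff[OF 1 this] show "int p dvd a ^ m - 1" by simp
  next
    assume am: "int p dvd a ^ m - 1"
    obtain g where g: "\<not> int p dvd g" "\<And>k. int p dvd g ^ k - 1 \<Longrightarrow> (p - 1) dvd k" using primitive_root by blast
    let ?R = "{0..<int p} - {0}" and ?K = "{..<p - 1}"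
    have inj: "inj_on (\<lambda>k. g ^ k mod int p) ?K"
    proof (rule linorder_inj_onI)
      fix k l assume kl: "k < l" "k \<in> ?K" "l \<in> ?K"
      show "g ^ k mod int p \<noteq> g ^ l mod int p"
      proof
        assume "g ^ k mod int p = g ^ l mod int p"
        then have "int p dvd g ^ l - g ^ k" by (metis mod_eq_dvd_iff)
        also have "g ^ l - g ^ k = g ^ k * (g ^ (l - k) - 1)"
          using kl by (simp add: algebra_simps power_add[symmetric])
        finally have "int p dvd g ^ (l - k) - 1" 
          using g(1) ip prime_dvd_power[OF ip, of g k] by (auto simp: p_dvd_mult_iff)
        then have "(p - 1) dvd (l - k)" by (rule g(2))
        then show False using kl by (auto dest: dvd_imp_le)
      qed
    qed auto
    have "(\<lambda>k. g ^ k mod int p) ` ?K \<subseteq> ?R"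
    proof (rule image_subsetI)
      fix k
      have "\<not> int p dvd g ^ k" using g(1) ip prime_dvd_power by blast
      then have "g ^ k mod int p \<noteq> 0" by (simp add: dvd_eq_mod_eq_0)
      moreover have "int p > 0" using p prime_gt_0_nat by simp
      ultimately show "g ^ k mod int p \<in> ?R" by simp
    qed
    moreover have "card ?R = card ?K" using p prime_gt_0_nat by simp
    ultimately have img: "(\<lambda>k. g ^ k mod int p) ` ?K = ?R"
      using inj by (intro card_subset_eq) (auto simp: card_image)
    have "a mod int p \<in> ?R" using a p prime_gt_0_nat by (auto simp: dvd_eq_mod_eq_0)
    then have "a mod int p \<in> (\<lambda>k. g ^ k mod int p) ` ?K" unfolding img .
    then obtain k where k: "a mod int p = g ^ k mod int p" by (rule imageE)
    then have k': "int p dvd a - g ^ k" by (simp add: mod_eq_dvd_iff)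
    have "a - g ^ k dvd a ^ m - (g ^ k) ^ m" by (rule diff_dvd_power_diff)
    then have "int p dvd a ^ m - (g ^ k) ^ m" using k' dvd_trans by blast
    from dvd_diff[OF am this] have "int p dvd g ^ (k * m) - 1" by (simp add: power_mult)
    then have "(p - 1) dvd k * m" by (rule g(2))
    then have "3 * m dvd k * m" unfolding p_minus_1 .
    then have "3 dvd k" using m_pos by simp
    then obtain l where l: "k = l * 3" by (auto simp: dvd_def)
    have "int p dvd (g ^ l) ^ 3 - a" using k' by (simp add: l power_mult dvd_diff_commute)
    then show "\<exists>x. int p dvd x ^ 3 - a" by blast
  qed
qed

lemma sum_ch: "(\<Sum>i\<in>{0..<int p}. ch i) = 0"
proof -
  obtain g where g: "\<not> int p dvd g" "\<And>k. int p dvd g ^ k - 1 \<Longrightarrow> (p - 1) dvd k" using primitive_root by blast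
  have "ch g \<noteq> 1"
  proof
    assume "ch g = 1"
    then have "q dvd of_int (g ^ m - 1)" using cres_congruent[of "of_int g"] by (simp add: ch_def)
    then have "int p dvd g ^ m - 1" by (simp only: q_dvd_of_int_iff)
    then have "(p - 1) dvd m" by (rule g(2))
    then show False unfolding p_minus_1 using m_pos by (auto dest: dvd_imp_le)
  qed
  have "(\<Sum>i\<in>{0..<int p}. ch i) = (\<Sum>i\<in>{0..<int p}. ch (g * i))"
    by (rule sum_residues_mult[symmetric]) (use ch_mod g in auto)
  also have "\<dots> = ch g * (\<Sum>i\<in>{0..<int p}. ch i)" by (simp add: ch_mult sum_distrib_left)
  finally have "(1 - ch g) * (\<Sum>i\<in>{0..<int p}. ch i) = 0" by (simp add: left_diff_distrib)
  then show ?thesis using \<open>ch g \<noteq> 1\<close> by simp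
qed

end

section \<open>The Jacobi sum\<close>

lemma eis_cnj_sum: "eis_cnj (sum g A) = (\<Sum>i\<in>A. eis_cnj (g i))"
  by (induction A rule: infinite_finite_induct) simp_all

context split_prime
begin

abbreviation R :: "int set" where "R \<equiv> {0..<int p}"

text \<open>The Jacobi sum J(\<chi>, \<chi>) of the cubic symbol, formed inside \<int>[\<omega>] so
  that it can be compared with \<open>q\<close> by divisibility.\<close>

definition J :: eis where "J = (\<Sum>i\<in>R. ch i * ch (1 - i))"

lemma R_split: "sum g R = g 0 + sum g (R - {0})"
  by (rule sum.remove) (use p prime_gt_0_nat in auto)

lemma R_nonzero: "i \<in> R - {0} \<Longrightarrow> \<not> int p dvd i"
  using zdvd_imp_le[of "int p" i] by auto

lemma card_R_nonzero: "card (R - {0}) = p - 1"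
  using p prime_gt_0_nat by simp

section \<open>The Jacobi sum modulo \<open>q\<close>\<close>

lemma power_sum_dvd:
  assumes "\<not> (p - 1) dvd k"
  shows "int p dvd (\<Sum>i\<in>R. i ^ k)"
proof -
  obtain g where g: "\<not> int p dvd g" "\<And>k. int p dvd g ^ k - 1 \<Longrightarrow> (p - 1) dvd k" using primitive_root by blast
  have "(\<Sum>i\<in>R. (g * i) ^ k mod int p) = (\<Sum>i\<in>R. i ^ k mod int p)"
    by (rule sum_residues_mult[of "\<lambda>i. i ^ k mod int p"]) (simp_all add: power_mod g(1))
  then have "(\<Sum>i\<in>R. (g * i) ^ k mod int p) mod int p = (\<Sum>i\<in>R. i ^ k mod int p) mod int p" by (rule arg_cong)
  then have "(\<Sum>i\<in>R. (g * i) ^ k) mod int p = (\<Sum>i\<in>R. i ^ k) mod int p" by (simp only: mod_sum_eq)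
  then have "int p dvd (\<Sum>i\<in>R. (g * i) ^ k) - (\<Sum>i\<in>R. i ^ k)" by (simp only: mod_eq_dvd_iff)
  also have "(\<Sum>i\<in>R. (g * i) ^ k) - (\<Sum>i\<in>R. i ^ k) = (g ^ k - 1) * (\<Sum>i\<in>R. i ^ k)"
    by (simp add: power_mult_distrib sum_distrib_left left_diff_distrib sum_subtractf)
  finally show ?thesis using g(2)[of k] assms by (auto simp only: p_dvd_mult_iff)
qed

lemma power_sum_top: "int p dvd (\<Sum>i\<in>R. i ^ (p - 1)) + 1"
proof -
  have "int p dvd (\<Sum>i\<in>R - {0}. i ^ (p - 1) - 1)"
    by (rule dvd_sum) (use fermat_int R_nonzero in blast)
  moreover have "(\<Sum>i\<in>R. i ^ (p - 1)) + 1 = (\<Sum>i\<in>R - {0}. i ^ (p - 1) - 1) + int p"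
    unfolding R_split[of "\<lambda>i. i ^ (p - 1)"] sum_subtractf using card_R_nonzero p_gt
    by (simp add: of_nat_diff)
  ultimately show ?thesis by simp
qed

lemma binomial_power_sum:
  "(\<Sum>i\<in>R. i ^ a * (1 - i) ^ a) = (\<Sum>j\<le>a. int (a choose j) * (- 1) ^ j * (\<Sum>i\<in>R. i ^ (a + j)))"
proof -
  have "i ^ a * (1 - i) ^ a = (\<Sum>j\<le>a. int (a choose j) * (- 1) ^ j * i ^ (a + j))" for i :: int
  proof -
    have "(1 - i) ^ a = (\<Sum>j\<le>a. int (a choose j) * (- i) ^ j * 1 ^ (a - j))"
      using binomial_ring[of "- i" 1 a] by simp
    also have "\<dots> = (\<Sum>j\<le>a. int (a choose j) * (- 1) ^ j * i ^ j)"
      by (intro sum.cong refl) (subst power_minus, simp)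
    finally show ?thesis by (simp add: sum_distrib_left power_add mult.assoc mult.left_commute)
  qed
  then have "(\<Sum>i\<in>R. i ^ a * (1 - i) ^ a) = (\<Sum>i\<in>R. \<Sum>j\<le>a. int (a choose j) * (- 1) ^ j * i ^ (a + j))" by simp
  also have "\<dots> = (\<Sum>j\<le>a. \<Sum>i\<in>R. int (a choose j) * (- 1) ^ j * i ^ (a + j))" by (rule sum.swap)
  finally show ?thesis by (simp add: sum_distrib_left)
qed

text \<open>Only exponents between m and 2m occur. They are positive and below p - 1 = 3m, so all
  these power sums vanish modulo p.\<close>

lemma sum_m_dvd: "int p dvd (\<Sum>i\<in>R. i ^ m * (1 - i) ^ m)"
  unfolding binomial_power_sum
proof (rule dvd_sum)
  fix j assume "j \<in> {..m}"
  have "\<not> (p - 1) dvd m + j"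
  proof
    assume "(p - 1) dvd m + j"
    then have "3 * m \<le> m + j" unfolding p_minus_1 using m_pos by (intro dvd_imp_le) auto
    then show False using \<open>j \<in> {..m}\<close> m_pos by auto
  qed
  from power_sum_dvd[OF this] show "int p dvd int (m choose j) * (- 1) ^ j * (\<Sum>i\<in>R. i ^ (m + j))" by simp
qed

text \<open>The exponents run from 2m to 4m, and 3m = p - 1 is the only one divisible by p - 1. It
  carries the middle binomial coefficient, with positive sign as m is even, and its power sum is -1
  modulo p.\<close>

lemma sum_2m_dvd: "int p dvd (\<Sum>i\<in>R. i ^ (2 * m) * (1 - i) ^ (2 * m)) + int (2 * m choose m)"
proof -
  define g where "g = (\<lambda>j. int (2 * m choose j) * (- 1) ^ j * (\<Sum>i\<in>R. i ^ (2 * m + j)))"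
  have "int p dvd sum g ({..2 * m} - {m})"
  proof (rule dvd_sum)
    fix j assume j: "j \<in> {..2 * m} - {m}"
    have "\<not> (p - 1) dvd 2 * m + j"
    proof
      assume "(p - 1) dvd 2 * m + j"
      then obtain k where k: "2 * m + j = 3 * m * k" unfolding p_minus_1 by (auto simp: dvd_def)
      have "k = 1"
      proof (rule ccontr)
        assume "k \<noteq> 1"
        moreover have "k \<noteq> 0" using k m_pos by (cases k) auto
        ultimately have "3 * m * 2 \<le> 3 * m * k" by (intro mult_left_mono) auto
        then have "6 * m \<le> 2 * m + j" unfolding k by simp
        then show False using j m_pos by auto
      qed
      then show False using k j by simp
    qed
    from power_sum_dvd[OF this] show "int p dvd g j" by (simp add: g_def)
  qed
  moreover have "int p dvd g m + int (2 * m choose m)"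
  proof -
    have "2 * m + m = p - 1" using p_minus_1 by simp
    then have "g m + int (2 * m choose m) = int (2 * m choose m) * ((\<Sum>i\<in>R. i ^ (p - 1)) + 1)"
      using m_even by (simp add: g_def distrib_left)
    then show ?thesis using power_sum_top by simp
  qed
  moreover have "(\<Sum>i\<in>R. i ^ (2 * m) * (1 - i) ^ (2 * m)) = g m + sum g ({..2 * m} - {m})"
    unfolding binomial_power_sum g_def[symmetric] by (rule sum.remove) auto
  ultimately show ?thesis by (metis add.assoc add.commute dvd_add)
qed

lemma q_dvd_J: "q dvd J"
proof -
  have "q dvd (\<Sum>i\<in>R. of_int (i ^ m * (1 - i) ^ m) - ch i * ch (1 - i))"
  proof (rule dvd_sum)
    fix i
    have "ch i * ch (1 - i) = cres (of_int (i * (1 - i)))" by (simp only: ch_mult[symmetric], simp only: ch_def)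
    then show "q dvd of_int (i ^ m * (1 - i) ^ m) - ch i * ch (1 - i)"
      using cres_congruent[of "of_int (i * (1 - i))"] by (simp only: of_int_power power_mult_distrib of_int_mult)
  qed
  then have "q dvd of_int (\<Sum>i\<in>R. i ^ m * (1 - i) ^ m) - J" by (simp only: sum_subtractf J_def of_int_sum)
  moreover have "q dvd of_int (\<Sum>i\<in>R. i ^ m * (1 - i) ^ m)" using sum_m_dvd q_dvd_of_int_iff by blast
  ultimately have "q dvd of_int (\<Sum>i\<in>R. i ^ m * (1 - i) ^ m) - (of_int (\<Sum>i\<in>R. i ^ m * (1 - i) ^ m) - J)"
    by (rule dvd_diff[rotated])
  then show ?thesis by (simp only: diff_diff_eq2 add_diff_cancel_left')
qed

text \<open>Conjugation squares a cube root of unity, so modulo \<open>q\<close> the conjugate of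
  \<open>J\<close> is the analogous power sum with exponent 2m in place of m.\<close>

lemma q_dvd_cnj_J: "q dvd eis_cnj J + of_nat (2 * m choose m)"
proof -
  have "q dvd (\<Sum>i\<in>R. of_int (i ^ (2 * m) * (1 - i) ^ (2 * m)) - eis_cnj (ch i * ch (1 - i)))"
  proof (rule dvd_sum)
    fix i
    define y :: eis where "y = of_int (i * (1 - i))"
    have c: "ch i * ch (1 - i) = cres y" by (simp only: ch_mult[symmetric], simp only: ch_def y_def)
    have "q dvd (y ^ m)\<^sup>2 - (cres y)\<^sup>2" using cres_congruent[of y] diff_dvd_power_diff dvd_trans by blast
    moreover have "of_int (i ^ (2 * m) * (1 - i) ^ (2 * m)) = (y ^ m)\<^sup>2"
      by (simp only: y_def of_int_power of_int_mult power_mult_distrib power_mult[symmetric] mult.commute)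
    ultimately show "q dvd of_int (i ^ (2 * m) * (1 - i) ^ (2 * m)) - eis_cnj (ch i * ch (1 - i))"
      unfolding c cres_cnj by simp
  qed
  then have a: "q dvd of_int (\<Sum>i\<in>R. i ^ (2 * m) * (1 - i) ^ (2 * m)) - eis_cnj J"
    by (simp only: sum_subtractf J_def of_int_sum eis_cnj_sum)
  define T where "T = (\<Sum>i\<in>R. i ^ (2 * m) * (1 - i) ^ (2 * m))"
  have "q dvd of_int (T + int (2 * m choose m))" using sum_2m_dvd q_dvd_of_int_iff unfolding T_def by blast
  then have "q dvd of_int T + of_nat (2 * m choose m)" by (simp only: of_int_add of_int_of_nat_eq)
  from dvd_diff[OF this a[folded T_def]]
  have "q dvd of_int T + of_nat (2 * m choose m) - (of_int T - eis_cnj J)" .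
  moreover have "of_int T + of_nat (2 * m choose m) - (of_int T - eis_cnj J) = eis_cnj J + of_nat (2 * m choose m)"
    by simp
  ultimately show ?thesis by metis
qed

section \<open>The absolute value of the Jacobi sum\<close>

definition A :: "int \<Rightarrow> eis" where "A d = (\<Sum>i\<in>R. ch i * eis_cnj (ch (i - d)))"

lemma ch_mod_shift: "ch (i mod int p - a) = ch (i - a)" "ch (a - i mod int p) = ch (a - i)"
  "ch (i mod int p + a) = ch (i + a)"
  by (rule ch_cong; simp add: mod_eq_dvd_iff[symmetric] mod_diff_left_eq mod_diff_right_eq mod_add_left_eq)+

lemma sum_ch_norm: "(\<Sum>i\<in>R. ch i * eis_cnj (ch i)) = of_nat (p - 1)"
proof -
  have "(\<Sum>i\<in>R - {0}. ch i * eis_cnj (ch i)) = (\<Sum>i\<in>R - {0}. 1)"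
    by (rule sum.cong[OF refl]) (use ch_cnj_mult R_nonzero in blast)
  then show ?thesis
    unfolding R_split[of "\<lambda>i. ch i * eis_cnj (ch i)"] by (simp add: ch_0 card_R_nonzero del: card_Diff_insert)
qed

lemma A_0: "int p dvd d \<Longrightarrow> A d = of_nat (p - 1)"
proof -
  assume d: "int p dvd d"
  have "ch (i - d) = ch i" for i by (rule ch_cong) (use d in simp)
  then show ?thesis by (simp add: A_def sum_ch_norm)
qed

lemma A_scale: "\<not> int p dvd d \<Longrightarrow> A d = A 1"
proof -
  assume d: "\<not> int p dvd d"
  have "A d = (\<Sum>i\<in>R. ch (d * i) * eis_cnj (ch (d * i - d)))"
    unfolding A_def
    by (rule sum_residues_mult[OF _ d, symmetric, of "\<lambda>i. ch i * eis_cnj (ch (i - d))"])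
       (simp only: ch_mod ch_mod_shift)
  also have "\<dots> = (\<Sum>i\<in>R. (ch d * eis_cnj (ch d)) * (ch i * eis_cnj (ch (i - 1))))"
  proof (rule sum.cong[OF refl])
    fix i
    have "ch (d * i - d) = ch d * ch (i - 1)" unfolding ch_mult[symmetric] by (simp only: right_diff_distrib mult_1_right)
    then show "ch (d * i) * eis_cnj (ch (d * i - d)) = (ch d * eis_cnj (ch d)) * (ch i * eis_cnj (ch (i - 1)))"
      by (simp only: ch_mult eis_cnj_simps mult_ac)
  qed
  finally show ?thesis by (simp add: ch_cnj_mult[OF d] A_def)
qed

lemma A_1: "A 1 = - 1"
proof -
  have "(\<Sum>d\<in>R. A d) = (\<Sum>i\<in>R. \<Sum>d\<in>R. ch i * eis_cnj (ch (i - d)))"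
    unfolding A_def by (rule sum.swap)
  also have "\<dots> = (\<Sum>i\<in>R. ch i * eis_cnj (\<Sum>d\<in>R. ch (i - d)))"
    by (simp only: sum_distrib_left eis_cnj_sum)
  also have "\<dots> = 0"
    by (rule sum.neutral) (simp add: sum_residues_neg[of ch, OF ch_mod] sum_ch)
  finally have "0 = A 0 + (\<Sum>d\<in>R - {0}. A d)" unfolding R_split[of A] by simp
  also have "(\<Sum>d\<in>R - {0}. A d) = (\<Sum>d\<in>R - {0}. A 1)"
    by (rule sum.cong[OF refl]) (use A_scale R_nonzero in blast)
  also have "A 0 + \<dots> = of_nat (p - 1) * (1 + A 1)"
    by (simp only: A_0 dvd_0_right sum_constant card_R_nonzero distrib_left mult_1_right)
  finally have "of_nat (p - 1) * (1 + A 1) = 0" by simp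
  moreover have "(of_nat (p - 1) :: eis) \<noteq> 0" using p_gt by (simp add: of_nat_eis)
  ultimately have "1 + A 1 = 0" by (simp only: mult_eq_0_iff simp_thms)
  then show ?thesis by (simp add: eq_neg_iff_add_eq_0 add.commute)
qed

text \<open>The convolution of the symbol with itself, with \<open>J\<close> as its value at 1.
  Letting c vary makes the sum of |Jc c|^2 computable from the autocorrelations
  \<open>A\<close>.\<close>

definition Jc :: "int \<Rightarrow> eis" where "Jc c = (\<Sum>i\<in>R. ch i * ch (c - i))"

lemma Jc_0: "Jc 0 = 0"
proof -
  have "Jc 0 = (\<Sum>i\<in>R. eis_cnj (ch i))"
    unfolding Jc_def by (rule sum.cong[OF refl])
      (simp only: diff_0 ch_uminus, simp only: ch_def cres_cnj power2_eq_square)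
  also have "\<dots> = eis_cnj (\<Sum>i\<in>R. ch i)" by (simp only: eis_cnj_sum)
  finally show ?thesis by (simp add: sum_ch)
qed

lemma Jc_norm:
  assumes c: "\<not> int p dvd c" shows "Jc c * eis_cnj (Jc c) = J * eis_cnj J"
proof -
  have "Jc c = (\<Sum>i\<in>R. ch (c * i) * ch (c - c * i))"
    unfolding Jc_def
    by (rule sum_residues_mult[OF _ c, symmetric, of "\<lambda>i. ch i * ch (c - i)"])
       (simp only: ch_mod ch_mod_shift)
  also have "\<dots> = (\<Sum>i\<in>R. (ch c * ch c) * (ch i * ch (1 - i)))"
  proof (rule sum.cong[OF refl])
    fix i
    have "ch (c - c * i) = ch c * ch (1 - i)" unfolding ch_mult[symmetric] by (simp only: right_diff_distrib mult_1_right)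
    then show "ch (c * i) * ch (c - c * i) = (ch c * ch c) * (ch i * ch (1 - i))"
      by (simp only: ch_mult mult_ac)
  qed
  also have "\<dots> = (ch c * ch c) * J" by (simp only: J_def sum_distrib_left)
  finally have "Jc c * eis_cnj (Jc c) = (ch c * eis_cnj (ch c)) * (ch c * eis_cnj (ch c)) * (J * eis_cnj J)"
    by (simp only: eis_cnj_simps mult_ac)
  then show ?thesis by (simp add: ch_cnj_mult[OF c])
qed

text \<open>In the double sum for |Jc c|^2 over i and k, the substitution k = i - d separates the
  variables: summing over c gives \<open>A (- d)\<close>, and summing over i then gives
  \<open>A d\<close>.\<close>

lemma sum_Jc_norm: "(\<Sum>c\<in>R. Jc c * eis_cnj (Jc c)) = (\<Sum>d\<in>R. A d * A (- d))"
proof -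
  have "(\<Sum>c\<in>R. Jc c * eis_cnj (Jc c)) =
      (\<Sum>c\<in>R. \<Sum>i\<in>R. \<Sum>d\<in>R. ch i * ch (c - i) * (eis_cnj (ch (i - d)) * eis_cnj (ch (c - i + d))))"
  proof (rule sum.cong[OF refl])
    fix c
    have inner: "eis_cnj (Jc c) = (\<Sum>d\<in>R. eis_cnj (ch (i - d)) * eis_cnj (ch (c - i + d)))" for i
    proof -
      have "eis_cnj (Jc c) = (\<Sum>k\<in>R. eis_cnj (ch k) * eis_cnj (ch (c - k)))"
        by (simp only: Jc_def eis_cnj_sum eis_cnj_simps)
      also have "\<dots> = (\<Sum>d\<in>R. eis_cnj (ch (i - d)) * eis_cnj (ch (c - (i - d))))"
        by (rule sum_residues_neg[symmetric, of "\<lambda>k. eis_cnj (ch k) * eis_cnj (ch (c - k))"])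
           (simp only: ch_mod ch_mod_shift)
      finally show ?thesis by (simp only: diff_diff_eq2 diff_add_eq)
    qed
    have "Jc c * eis_cnj (Jc c) = (\<Sum>i\<in>R. ch i * ch (c - i) * eis_cnj (Jc c))"
      by (simp only: Jc_def[of c] sum_distrib_right)
    also have "\<dots> = (\<Sum>i\<in>R. \<Sum>d\<in>R. ch i * ch (c - i) * (eis_cnj (ch (i - d)) * eis_cnj (ch (c - i + d))))"
    proof (rule sum.cong[OF refl])
      fix i
      show "ch i * ch (c - i) * eis_cnj (Jc c) =
          (\<Sum>d\<in>R. ch i * ch (c - i) * (eis_cnj (ch (i - d)) * eis_cnj (ch (c - i + d))))"
        unfolding inner[of i] by (rule sum_distrib_left)
    qed
    finally show "Jc c * eis_cnj (Jc c) =
        (\<Sum>i\<in>R. \<Sum>d\<in>R. ch i * ch (c - i) * (eis_cnj (ch (i - d)) * eis_cnj (ch (c - i + d))))" .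
  qed
  also have "\<dots> = (\<Sum>i\<in>R. \<Sum>c\<in>R. \<Sum>d\<in>R. ch i * ch (c - i) * (eis_cnj (ch (i - d)) * eis_cnj (ch (c - i + d))))"
    by (rule sum.swap)
  also have "\<dots> = (\<Sum>i\<in>R. \<Sum>d\<in>R. \<Sum>c\<in>R. ch i * ch (c - i) * (eis_cnj (ch (i - d)) * eis_cnj (ch (c - i + d))))"
    by (rule sum.cong[OF refl], rule sum.swap)
  also have "\<dots> = (\<Sum>i\<in>R. \<Sum>d\<in>R. ch i * eis_cnj (ch (i - d)) * A (- d))"
  proof (rule sum.cong[OF refl], rule sum.cong[OF refl])
    fix i d
    have "(\<Sum>c\<in>R. ch i * ch (c - i) * (eis_cnj (ch (i - d)) * eis_cnj (ch (c - i + d)))) =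
        (\<Sum>c\<in>R. ch i * eis_cnj (ch (i - d)) * (ch (c + - i) * eis_cnj (ch (c + - i - - d))))"
      by (rule sum.cong[OF refl]) (simp only: mult_ac diff_minus_eq_add add_uminus_conv_diff)
    also have "\<dots> = ch i * eis_cnj (ch (i - d)) * (\<Sum>c\<in>R. ch (c + - i) * eis_cnj (ch (c + - i - - d)))"
      by (simp only: sum_distrib_left)
    also have "(\<Sum>c\<in>R. ch (c + - i) * eis_cnj (ch (c + - i - - d))) = A (- d)"
      unfolding A_def by (rule sum_residues_shift[of "\<lambda>c. ch c * eis_cnj (ch (c - - d))"]) (simp only: ch_mod ch_mod_shift)
    finally show "(\<Sum>c\<in>R. ch i * ch (c - i) * (eis_cnj (ch (i - d)) * eis_cnj (ch (c - i + d)))) =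
        ch i * eis_cnj (ch (i - d)) * A (- d)" .
  qed
  also have "\<dots> = (\<Sum>d\<in>R. \<Sum>i\<in>R. ch i * eis_cnj (ch (i - d)) * A (- d))" by (rule sum.swap)
  also have "\<dots> = (\<Sum>d\<in>R. A d * A (- d))" unfolding A_def[of d for d] by (simp only: sum_distrib_right)
  finally show ?thesis .
qed

text \<open>|Jc c| = |J| for each of the p - 1 nonzero c, and \<open>Jc 0\<close> vanishes;
  \<open>A\<close> is p - 1 at 0 and -1 elsewhere. So (p - 1) |J|^2 = (p - 1)^2 + (p - 1).\<close>

lemma J_norm: "eis_norm J = int p"
proof -
  have "of_nat (p - 1) * (J * eis_cnj J) = (\<Sum>c\<in>R. Jc c * eis_cnj (Jc c))"
  proof -
    have "(\<Sum>c\<in>R - {0}. Jc c * eis_cnj (Jc c)) = (\<Sum>c\<in>R - {0}. J * eis_cnj J)"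
      by (rule sum.cong[OF refl]) (use Jc_norm R_nonzero in blast)
    then show ?thesis
      unfolding R_split[of "\<lambda>c. Jc c * eis_cnj (Jc c)"]
      by (simp only: Jc_0 mult_zero_left add_0_left sum_constant card_R_nonzero)
  qed
  also have "\<dots> = (\<Sum>d\<in>R. A d * A (- d))" by (rule sum_Jc_norm)
  also have "\<dots> = of_nat (p - 1) * of_nat (p - 1) + of_nat (p - 1)"
  proof -
    have "(\<Sum>d\<in>R - {0}. A d * A (- d)) = (\<Sum>d\<in>R - {0}. 1)"
    proof (rule sum.cong[OF refl])
      fix d assume "d \<in> R - {0}"
      then have "\<not> int p dvd d" "\<not> int p dvd - d" using R_nonzero by auto
      then show "A d * A (- d) = 1" by (simp add: A_scale A_1)
    qed
    then show ?thesis
      unfolding R_split[of "\<lambda>d. A d * A (- d)"]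
      by (simp only: A_0 minus_zero dvd_0_right sum_constant card_R_nonzero mult_1_right)
  qed
  also have "\<dots> = of_nat (p - 1) * (of_nat (p - 1) + 1)" by (simp only: distrib_left mult_1_right)
  also have "of_nat (p - 1) + 1 = (of_nat p :: eis)" using p_gt by (simp add: of_nat_eis one_eis_def)
  finally have "of_nat (p - 1) * (J * eis_cnj J) = of_nat (p - 1) * (of_nat p :: eis)" .
  moreover have "(of_nat (p - 1) :: eis) \<noteq> 0" using p_gt by (simp add: of_nat_eis)
  ultimately have "J * eis_cnj J = of_nat p" by (simp only: mult_cancel_left simp_thms)
  then have "(of_int (eis_norm J) :: eis) = of_int (int p)" unfolding eis_mult_cnj by simp
  then show ?thesis by (simp add: of_int_eis)
qed

section \<open>The Jacobi sum modulo 3\<close>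

definition inv1 :: "int \<Rightarrow> int" where "inv1 x = (1 - x) ^ (p - 2) mod int p"

lemma inv1: "\<not> int p dvd 1 - x \<Longrightarrow> int p dvd inv1 x * (1 - x) - 1"
proof -
  assume x: "\<not> int p dvd 1 - x"
  have e: "p - 1 = Suc (p - 2)" using p_gt by simp
  have "int p dvd (1 - x) ^ (p - 2) * (1 - x) - 1" using fermat_int[OF x] unfolding e by (simp only: power_Suc2)
  then have "((1 - x) ^ (p - 2) * (1 - x)) mod int p = 1 mod int p" by (simp only: mod_eq_dvd_iff)
  then have "(inv1 x * (1 - x)) mod int p = 1 mod int p" unfolding inv1_def by (simp only: mod_mult_left_eq)
  then show ?thesis by (simp only: mod_eq_dvd_iff)
qed

lemma R_eqI: "x \<in> R \<Longrightarrow> y \<in> R \<Longrightarrow> int p dvd x - y \<Longrightarrow> x = y"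
  by (metis atLeastLessThan_iff mod_eq_dvd_iff mod_pos_pos_trivial)

text \<open>The map x -> 1/(1 - x) has order three on the residues other than 0 and 1. It preserves
  the summand, since clearing denominators costs the factor ch(1 - x)^3 = 1. Free orbits contribute
  multiples of 3. The fixed points are the two roots of x^2 - x + 1, where x (1 - x) = 1 and the
  summand is 1, so \<open>J\<close> is 2 modulo 3.\<close>

lemma J_mod_3: "3 dvd J + 1"
proof -
  define S where "S = {2..<int p}"
  define f where "f = (\<lambda>i. ch i * ch (1 - i))"
  have nd: "\<not> int p dvd x" "\<not> int p dvd 1 - x" if "x \<in> S" for x
    using that zdvd_imp_le[of "int p" x] zdvd_imp_le[of "int p" "x - 1"] by (auto simp: S_def dvd_diff_commute)
  have SR: "S \<subseteq> R" by (auto simp: S_def)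
  have inS: "x \<in> S" if "x \<in> R" "\<not> int p dvd x" "\<not> int p dvd 1 - x" for x
  proof -
    have "x \<noteq> 0" "x \<noteq> 1" using that by auto
    then show ?thesis using that by (auto simp: S_def)
  qed
  have inR: "inv1 x \<in> R" for x using p_gt by (simp add: inv1_def)
  have step: "inv1 x \<in> S" "int p dvd (1 - inv1 x) * (1 - x) + x" if x: "x \<in> S" for x
  proof -
    have i: "int p dvd inv1 x * (1 - x) - 1" by (rule inv1) (rule nd[OF x])
    have "(1 - inv1 x) * (1 - x) + x = - (inv1 x * (1 - x) - 1)" by (simp add: algebra_simps)
    then show d: "int p dvd (1 - inv1 x) * (1 - x) + x" using i by (simp only: dvd_minus_iff)
    show "inv1 x \<in> S"
    proof (rule inS[OF inR])
      show "\<not> int p dvd inv1 x"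
      proof
        assume "int p dvd inv1 x"
        from dvd_diff[OF dvd_mult2[OF this, of "1 - x"] i]
        have "int p dvd inv1 x * (1 - x) - (inv1 x * (1 - x) - 1)" .
        then show False using p_gt by (simp add: zdvd1_eq)
      qed
      show "\<not> int p dvd 1 - inv1 x"
      proof
        assume "int p dvd 1 - inv1 x"
        then have "int p dvd (1 - inv1 x) * (1 - x) + x - (1 - inv1 x) * (1 - x)" using d by (intro dvd_diff) auto
        then show False using nd[OF x] by simp
      qed
    qed
  qed
  have inv3: "inv1 (inv1 (inv1 x)) = x" if x: "x \<in> S" for x
  proof -
    define y z u where "y = inv1 x" and "z = inv1 y" and "u = inv1 z"
    have S: "y \<in> S" "z \<in> S" "u \<in> S" using x step(1) by (auto simp: y_def z_def u_def)
    obtain a where a: "y * (1 - x) - 1 = int p * a" using inv1[OF nd(2)[OF x]] by (auto simp: y_def dvd_def)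
    obtain b where b: "z * (1 - y) - 1 = int p * b" using inv1[OF nd(2)[OF S(1)]] by (auto simp: z_def dvd_def)
    obtain c where c: "u * (1 - z) - 1 = int p * c" using inv1[OF nd(2)[OF S(2)]] by (auto simp: u_def dvd_def)
    \<comment> \<open>Elimination of y and z: each bracket on the right is one of the three defining
      congruences.\<close>
    have "u - x = x * (u * (1 - z) - 1) - u * (z * (y * (1 - x) - 1) + (1 - x) * (z * (1 - y) - 1))"
      by (simp add: algebra_simps)
    also have "\<dots> = int p * (x * c - u * (z * a + (1 - x) * b))" unfolding a b c by (simp add: algebra_simps)
    finally have "int p dvd u - x" by simp
    then have "u = x" using S(3) x SR by (intro R_eqI) auto
    then show ?thesis by (simp add: u_def z_def y_def)
  qed
  have finv: "f (inv1 x) = f x" if x: "x \<in> S" for x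
  proof -
    have 1: "ch (inv1 x) * ch (1 - x) = 1"
      using ch_cong[OF inv1[OF nd(2)[OF x]]] by (simp add: ch_mult ch_1)
    have "ch ((1 - inv1 x) * (1 - x)) = ch (- x)" by (rule ch_cong) (use step(2)[OF x] in simp)
    then have 2: "ch (1 - inv1 x) * ch (1 - x) = ch x" by (simp only: ch_mult ch_uminus)
    have "f (inv1 x) = f (inv1 x) * ch (1 - x) ^ 3" using ch_cube[OF nd(2)[OF x]] by simp
    also have "\<dots> = (ch (inv1 x) * ch (1 - x)) * (ch (1 - inv1 x) * ch (1 - x)) * ch (1 - x)"
      by (simp only: f_def power3_eq_cube mult_ac)
    finally show ?thesis unfolding 1 2 by (simp add: f_def)
  qed
  let ?Fix = "{x \<in> S. inv1 x = x}" and ?S' = "{x \<in> S. inv1 x \<noteq> x}"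
  have three: "3 dvd sum f ?S'"
  proof (rule three_dvd_orbit_sum[where \<sigma> = inv1])
    fix x assume "x \<in> ?S'"
    then have x: "x \<in> S" "inv1 x \<noteq> x" by auto
    have "inv1 (inv1 x) \<noteq> inv1 x" using inv3[OF x(1)] x(2) by metis
    then show "inv1 x \<in> ?S'" using step(1)[OF x(1)] by simp
  next
    show "finite ?S'" by (rule finite_subset[of _ S]) (auto simp: S_def)
  qed (use inv3 finv in auto)
  \<comment> \<open>A residue of \<omega>, which is a primitive sixth root of unity, provides one
    fixed point; 1 - r is the other.\<close>
  obtain r0 where r0: "q dvd Eis 0 1 - of_int r0" using congruent_to_int by blast
  define r where "r = r0 mod int p"
  have r: "int p dvd r\<^sup>2 - r + 1"
  proof -
    have "of_int (r0\<^sup>2 - r0 + 1) = (Eis 0 1 - of_int r0) * (1 - of_int r0 - Eis 0 1)"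
      by (simp add: of_int_eis one_eis_def power2_eq_square algebra_simps)
    then have "q dvd of_int (r0\<^sup>2 - r0 + 1)" using r0 by (simp only: dvd_mult2)
    then have "int p dvd r0\<^sup>2 - r0 + 1" by (simp only: q_dvd_of_int_iff)
    moreover have "int p dvd (r - r0) * (r + r0 - 1)"
      unfolding r_def by (rule dvd_mult2) (metis mod_eq_dvd_iff mod_mod_trivial)
    moreover have "r\<^sup>2 - r + 1 = (r0\<^sup>2 - r0 + 1) + (r - r0) * (r + r0 - 1)"
      by (simp add: power2_eq_square algebra_simps)
    ultimately show ?thesis by (simp only: dvd_add)
  qed
  define r' where "r' = (1 - r) mod int p"
  have rR: "r \<in> R" "r' \<in> R" using p_gt by (auto simp: r_def r'_def)
  have r'd: "int p dvd r' - (1 - r)" unfolding r'_def by (metis mod_eq_dvd_iff mod_mod_trivial)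
  have ne: "r \<noteq> r'"
  proof
    assume "r = r'"
    then have "int p dvd 2 * r - 1" using r'd by simp
    from dvd_diff[OF dvd_mult[OF r, of 4] dvd_mult2[OF this, of "2 * r - 1"]]
    have "int p dvd 4 * (r\<^sup>2 - r + 1) - (2 * r - 1) * (2 * r - 1)" .
    then have "int p dvd 3" by (simp add: power2_eq_square algebra_simps)
    then have "int p \<le> 3" by (rule zdvd_imp_le) simp
    then show False using p_gt by simp
  qed
  have fix_iff: "inv1 x = x \<longleftrightarrow> int p dvd x\<^sup>2 - x + 1" if x: "x \<in> S" for x
  proof
    assume "inv1 x = x"
    then have "int p dvd x * (1 - x) - 1" using inv1[OF nd(2)[OF x]] by simp
    moreover have "x * (1 - x) - 1 = - (x\<^sup>2 - x + 1)" by (simp add: power2_eq_square algebra_simps)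
    ultimately show "int p dvd x\<^sup>2 - x + 1" by (simp only: dvd_minus_iff)
  next
    assume d: "int p dvd x\<^sup>2 - x + 1"
    have "(inv1 x - x) * (1 - x) = (inv1 x * (1 - x) - 1) + (x\<^sup>2 - x + 1)" by (simp add: power2_eq_square algebra_simps)
    then have "int p dvd (inv1 x - x) * (1 - x)" using dvd_add[OF inv1[OF nd(2)[OF x]] d] by simp
    then have "int p dvd inv1 x - x" using nd(2)[OF x] by (simp only: p_dvd_mult_iff simp_thms)
    then show "inv1 x = x" using inR x SR by (intro R_eqI) auto
  qed
  have root_S: "x \<in> S" if "x \<in> R" "int p dvd x\<^sup>2 - x + 1" for x
  proof -
    have "x \<noteq> 0" "x \<noteq> 1" using that p_gt by (auto simp: zdvd1_eq)
    then show ?thesis using that by (auto simp: S_def)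
  qed
  have rr': "int p dvd r'\<^sup>2 - r' + 1"
  proof -
    have "r'\<^sup>2 - r' + 1 = (r' - (1 - r)) * (r' - r) + (r\<^sup>2 - r + 1)" by (simp add: power2_eq_square algebra_simps)
    then show ?thesis using dvd_add[OF dvd_mult2[OF r'd] r] by metis
  qed
  have "?Fix = {r, r'}"
  proof (intro equalityI subsetI)
    fix x assume "x \<in> ?Fix"
    then have x: "x \<in> S" "int p dvd x\<^sup>2 - x + 1" using fix_iff by auto
    have "(x - r) * (x - r' + (r' - (1 - r))) = (x\<^sup>2 - x + 1) - (r\<^sup>2 - r + 1)" by (simp add: power2_eq_square algebra_simps)
    then have "int p dvd (x - r) * (x - r' + (r' - (1 - r)))" using dvd_diff[OF x(2) r] by metis
    then have "int p dvd x - r \<or> int p dvd x - r' + (r' - (1 - r))" by (simp only: p_dvd_mult_iff)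
    then have "int p dvd x - r \<or> int p dvd x - r'" using r'd dvd_add_left_iff by blast
    then show "x \<in> {r, r'}" using R_eqI rR x SR by auto
  next
    fix x assume "x \<in> {r, r'}"
    then have "x \<in> S" "int p dvd x\<^sup>2 - x + 1" using root_S rR r rr' by auto
    then show "x \<in> ?Fix" using fix_iff by simp
  qed
  moreover have "f x = 1" if "x \<in> ?Fix" for x
  proof -
    have "int p dvd x * (1 - x) - 1" using that inv1[OF nd(2), of x] by auto
    from ch_cong[OF this] show ?thesis by (simp add: f_def ch_mult ch_1)
  qed
  ultimately have "sum f ?Fix = 2" using ne by simp
  moreover have "J = sum f ?Fix + sum f ?S'"
  proof -
    have "J = sum f S"
      unfolding J_def f_def
    proof (rule sum.mono_neutral_right)
      show "\<forall>i\<in>R - S. ch i * ch (1 - i) = 0"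
      proof
        fix i assume "i \<in> R - S"
        then have "i = 0 \<or> i = 1" by (auto simp: S_def)
        then show "ch i * ch (1 - i) = 0" using ch_0[of 0] by auto
      qed
    qed (use SR in auto)
    also have "S = ?Fix \<union> ?S'" by auto
    also have "sum f (?Fix \<union> ?S') = sum f ?Fix + sum f ?S'"
      by (rule sum.union_disjoint) (use finite_subset[OF SR] in auto)
    finally show ?thesis .
  qed
  ultimately have "J + 1 = 3 + sum f ?S'" by simp
  then show ?thesis using three by simp
qed

text \<open>\<open>J\<close> is a multiple of \<open>q\<close> of the same norm, and the congruences
  modulo 3 force J = -q. Therefore the conjugate of \<open>q\<close> is congruent modulo
  \<open>q\<close> to the binomial coefficient C of 2m over m. Wilson's theorem gives C (m!)^3 = -1
  modulo p, so C is a cube, and with it the conjugate.\<close>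

lemma cnj_q_is_cube:
  assumes "3 dvd q - 1"
  shows "q dvd eis_cnj q ^ m - 1"
proof -
  obtain u where u: "J = q * u" using q_dvd_J by (auto simp: dvd_def)
  have "int p * eis_norm u = int p * 1" using J_norm Nq by (simp add: u eis_norm_mult)
  then have un: "is_unit u" using p_gt by (simp add: eis_unit_iff_norm)
  have "3 dvd (J + 1) - (q - 1) * u" using J_mod_3 assms by (intro dvd_diff) auto
  then have u3: "3 dvd u + 1" by (simp add: u algebra_simps)
  have "u = - 1"
  proof -
    have "of_int 3 dvd u + 1" using u3 by simp
    then show ?thesis using un unfolding of_int_dvd_eis_iff eis_units by (auto simp: one_eis_def)
  qed
  then have Jq: "J = - q" by (simp add: u)
  define C where "C = int (2 * m choose m)"
  have "q dvd of_int C - eis_cnj q" using q_dvd_cnj_J unfolding Jq C_def by simp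
  then have 1: "q dvd of_int C ^ m - eis_cnj q ^ m" using diff_dvd_power_diff dvd_trans by blast
  have "int p dvd C ^ m - 1"
  proof -
    define F where "F = (fact m :: int)"
    have "fact m * fact (2 * m - m) * (2 * m choose m) = (fact (2 * m) :: nat)" by (rule binomial_fact_lemma) simp
    then have "int (fact m * fact (2 * m - m) * (2 * m choose m)) = int (fact (2 * m))" by (rule arg_cong)
    moreover have "2 * m - m = m" by simp
    ultimately have "fact (2 * m) = C * F * F" unfolding C_def F_def by (simp only: of_nat_mult of_nat_fact mult_ac)
    have w: "int p dvd fact (p - 1) + 1" using wilson_theorem[OF p] by (simp add: cong_iff_dvd_diff)
    \<comment> \<open>As p = 3m + 1, the factors 2m + 1, ..., 3m are the negatives of m, ..., 1
      modulo p; the induction transfers them one by one.\<close>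
    have tail: "int p dvd fact (3 * m) - fact (2 * m) * ((- 1) ^ m * F)"
    proof -
      have gen: "int p dvd fact (2 * m + j) * fact (m - j) - fact (2 * m) * ((- 1) ^ j * F)" if "j \<le> m" for j
        using that
      proof (induction j)
        case (Suc j)
        have e: "m - j = Suc (m - Suc j)" using Suc.prems by simp
        have f1: "fact (2 * m + Suc j) = (int (2 * m + j + 1)) * (fact (2 * m + j) :: int)" by simp
        have f2: "(fact (m - j) :: int) = int (m - j) * fact (m - Suc j)" unfolding e by simp
        have s: "int (2 * m + j + 1) = int p - int (m - j)" using pm Suc.prems by simp
        have "fact (2 * m + Suc j) * fact (m - Suc j) - fact (2 * m) * ((- 1) ^ Suc j * F) =
            int p * (fact (2 * m + j) * fact (m - Suc j)) -
            (fact (2 * m + j) * fact (m - j) - fact (2 * m) * ((- 1) ^ j * F))"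
          unfolding f1 f2 s by (simp add: algebra_simps)
        moreover have "int p dvd int p * (fact (2 * m + j) * fact (m - Suc j)) -
            (fact (2 * m + j) * fact (m - j) - fact (2 * m) * ((- 1) ^ j * F))"
          by (rule dvd_diff[OF dvd_triv_left]) (use Suc in simp)
        ultimately show ?case by metis
      qed (simp add: F_def)
      from gen[of m] show ?thesis by (simp add: mult_2[symmetric] add.commute)
    qed
    have "int p dvd (fact (3 * m) + 1) - (fact (3 * m) - fact (2 * m) * ((- 1) ^ m * F))"
      using w tail unfolding p_minus_1 by (rule dvd_diff)
    then have cf: "int p dvd C * F ^ 3 - (- 1)"
      using m_even unfolding \<open>fact (2 * m) = C * F * F\<close> by (simp add: power3_eq_cube mult_ac add.commute)
    then have "int p dvd (C * F ^ 3) ^ m - (- 1) ^ m" using diff_dvd_power_diff dvd_trans by blast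
    then have a: "int p dvd C ^ m * F ^ (p - 1) - 1"
      using m_even unfolding p_minus_1 by (simp add: power_mult_distrib power_mult)
    have "\<not> int p dvd F"
    proof
      assume "int p dvd F"
      then have "int p dvd C * F ^ 3" by (simp add: power3_eq_cube)
      from dvd_diff[OF this cf] have "int p dvd C * F ^ 3 - (C * F ^ 3 - (- 1))" .
      then show False using p_gt by (simp add: zdvd1_eq)
    qed
    then have b: "int p dvd C ^ m * (F ^ (p - 1) - 1)" using fermat_int by simp
    have "C ^ m * F ^ (p - 1) - 1 - C ^ m * (F ^ (p - 1) - 1) = C ^ m - 1" by (simp add: algebra_simps)
    then show ?thesis using dvd_diff[OF a b] by metis
  qed
  then have 2: "q dvd of_int (C ^ m - 1)" by (simp only: q_dvd_of_int_iff)
  have "of_int (C ^ m - 1) - (of_int C ^ m - eis_cnj q ^ m) = eis_cnj q ^ m - 1" by simp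
  then show ?thesis using dvd_diff[OF 2 1] by metis
qed

end

section \<open>Ideals of \<open>\<int>[\<mu>\<^sub>6]\<close>\<close>

text \<open>The embedding whose range is the carrier of \<open>Zmu6\<close>. Along it the ideals of
  the statement are translated into divisibility in \<open>eis\<close>.\<close>

definition toc :: "eis \<Rightarrow> complex" where
  "toc x = of_int (eis_fst x) + of_int (eis_snd x) * cis (pi / 3)"

lemma cis_pi_3: "cis (pi / 3) = Complex (1 / 2) (sqrt 3 / 2)"
  by (simp add: cis.ctr cos_60 sin_60)

lemma toc_0 [simp]: "toc 0 = 0" and toc_1 [simp]: "toc 1 = 1"
  by (simp_all add: toc_def)

lemma toc_add [simp]: "toc (x + y) = toc x + toc y"
  and toc_diff [simp]: "toc (x - y) = toc x - toc y"
  and toc_uminus [simp]: "toc (- x) = - toc x"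
  by (simp_all add: toc_def algebra_simps)

lemma toc_mult [simp]: "toc (x * y) = toc x * toc y"
proof -
  obtain a b c d where "x = Eis a b" "y = Eis c d" by (cases x, cases y)
  then show ?thesis
    by (simp add: toc_def cis_pi_3 complex_eq_iff) (simp add: algebra_simps)
qed

lemma toc_of_int [simp]: "toc (of_int n) = of_int n"
  by (simp add: toc_def of_int_eis)

lemma toc_of_nat [simp]: "toc (of_nat n) = of_nat n"
  using toc_of_int[of "int n"] by simp

lemma toc_power [simp]: "toc (x ^ n) = toc x ^ n"
  by (induction n) simp_all

lemma cnj_toc: "cnj (toc x) = toc (eis_cnj x)"
  by (cases x) (simp add: toc_def eis_cnj_def cis_pi_3 complex_eq_iff)

lemma toc_inject [simp]: "toc x = toc y \<longleftrightarrow> x = y"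
proof
  assume "toc x = toc y"
  then show "x = y" by (cases x; cases y) (auto simp: toc_def cis_pi_3 complex_eq_iff)
qed simp

lemma toc_eq_0_iff [simp]: "toc x = 0 \<longleftrightarrow> x = 0"
  using toc_inject[of x 0] by (simp del: toc_inject)

lemma carrier_Zmu6: "carrier Zmu6 = range toc"
proof (intro equalityI subsetI)
  fix z assume "z \<in> carrier Zmu6"
  then obtain a b :: int where "z = of_int a + of_int b * cis (pi / 3)" by (auto simp: Zmu6_def)
  then have "z = toc (Eis a b)" by (simp add: toc_def)
  then show "z \<in> range toc" by blast
qed (auto simp: Zmu6_def toc_def)

lemma Zmu6_simps [simp]:
  "x \<otimes>\<^bsub>Zmu6\<^esub> y = x * y" "x \<oplus>\<^bsub>Zmu6\<^esub> y = x + y" "\<zero>\<^bsub>Zmu6\<^esub> = 0" "\<one>\<^bsub>Zmu6\<^esub> = 1"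
  by (simp_all add: Zmu6_def)

lemma toc_in_carrier [simp]: "toc x \<in> carrier Zmu6"
  by (simp add: carrier_Zmu6)

lemma cring_Zmu6: "cring Zmu6"
proof (rule cringI)
  show "abelian_group Zmu6"
  proof (rule abelian_groupI)
    fix x assume "x \<in> carrier Zmu6"
    then obtain a where "x = toc a" by (auto simp: carrier_Zmu6)
    then show "\<exists>y\<in>carrier Zmu6. y \<oplus>\<^bsub>Zmu6\<^esub> x = \<zero>\<^bsub>Zmu6\<^esub>"
      by (intro bexI[of _ "toc (- a)"] toc_in_carrier) simp
  qed (auto simp: carrier_Zmu6 simp flip: toc_add intro: range_eqI[of _ toc 0])
  show "comm_monoid Zmu6"
    by (rule comm_monoidI) (auto simp: carrier_Zmu6 simp flip: toc_mult intro: range_eqI[of _ toc 1])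
qed (simp add: algebra_simps)

interpretation Zmu6: cring Zmu6
  by (rule cring_Zmu6)

lemma princ_toc: "princ (toc x) = toc ` {y. x dvd y}"
proof -
  have "princ (toc x) = {z * toc x | z. z \<in> carrier Zmu6}"
    unfolding princ_def using Zmu6.cgenideal_eq_genideal[of "toc x"] by (simp add: cgenideal_def)
  also have "\<dots> = (\<lambda>k. toc (k * x)) ` UNIV" by (auto simp: carrier_Zmu6)
  also have "\<dots> = toc ` ((\<lambda>k. k * x) ` UNIV)" by (simp only: image_image)
  also have "(\<lambda>k. k * x) ` UNIV = {y. x dvd y}" by (auto simp: dvd_def mult.commute)
  finally show ?thesis .
qed

lemma toc_in_princ [simp]: "toc y \<in> princ (toc x) \<longleftrightarrow> x dvd y"
  by (auto simp: princ_toc)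

lemma ideal_princ: "ideal (princ (toc x)) Zmu6"
  unfolding princ_def by (rule Zmu6.genideal_ideal) simp

lemma princ_eq_iff: "princ (toc x) = princ (toc y) \<longleftrightarrow> x dvd y \<and> y dvd x"
proof
  assume "princ (toc x) = princ (toc y)"
  then show "x dvd y \<and> y dvd x" by (metis dvd_refl toc_in_princ)
next
  assume "x dvd y \<and> y dvd x"
  then have "{z. x dvd z} = {z. y dvd z}" using dvd_trans by blast
  then show "princ (toc x) = princ (toc y)" by (simp only: princ_toc)
qed

lemma nz_ideal_princ: "nz_ideal (princ (toc x)) \<longleftrightarrow> x \<noteq> 0"
proof -
  have "princ (toc x) = {0} \<longleftrightarrow> x = 0"
  proof
    assume "princ (toc x) = {0}"
    then have "toc x \<in> {0}" by (metis dvd_refl toc_in_princ)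
    then show "x = 0" by simp
  next
    have "princ (toc 0) = {0}" unfolding princ_toc by auto
    then show "princ (toc x) = {0}" if "x = 0" using that by simp
  qed
  then show ?thesis by (simp add: nz_ideal_def ideal_princ)
qed

lemma nz_ideal_principal:
  assumes "nz_ideal I"
  obtains x where "x \<noteq> 0" "I = princ (toc x)"
proof -
  have I: "ideal I Zmu6" "I \<noteq> {0}" using assms by (auto simp: nz_ideal_def)
  interpret ideal I Zmu6 by (rule I)
  have sub: "I \<subseteq> range toc" using a_subset by (simp add: carrier_Zmu6)
  have zero: "0 \<in> I" using zero_closed by simp
  have mult: "toc (y * x) \<in> I" if "toc x \<in> I" for x y
    using I_l_closed[OF that toc_in_carrier[of y]] by simp
  have diff: "toc (y - x) \<in> I" if "toc y \<in> I" "toc x \<in> I" for x y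
  proof -
    have "toc (- 1 * x) \<in> I" by (rule mult[OF that(2)])
    from a_closed[OF that(1) this] show ?thesis by simp
  qed
  obtain z0 where "z0 \<in> I" "z0 \<noteq> 0" using I(2) zero by blast
  then obtain x0 where x0: "toc x0 \<in> I" "x0 \<noteq> 0" using sub by fastforce
  define P where "P = (\<lambda>x. toc x \<in> I \<and> x \<noteq> 0)"
  obtain x where x: "P x" "\<And>y. P y \<Longrightarrow> euclidean_size x \<le> euclidean_size y"
    using ex_has_least_nat[of P x0 euclidean_size] x0 by (auto simp: P_def)
  have xI: "toc x \<in> I" "x \<noteq> 0" using x(1) by (auto simp: P_def)
  have "I = princ (toc x)"
  proof (intro equalityI subsetI)
    fix z assume "z \<in> I"
    then obtain y where y: "z = toc y" using sub by blast
    have "toc (y - y div x * x) \<in> I" by (rule diff) (use \<open>z \<in> I\<close> y mult[OF xI(1)] in auto)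
    then have m: "toc (y mod x) \<in> I" by (simp only: minus_div_mult_eq_mod)
    have "y mod x = 0"
    proof (rule ccontr)
      assume "y mod x \<noteq> 0"
      then have "euclidean_size x \<le> euclidean_size (y mod x)" using m by (intro x(2)) (simp add: P_def)
      then show False using mod_size_less[OF xI(2), of y] by simp
    qed
    then show "z \<in> princ (toc x)" by (simp add: y mod_eq_0_iff_dvd)
  next
    fix z assume "z \<in> princ (toc x)"
    then obtain y where y: "x dvd y" "z = toc y" by (auto simp: princ_toc)
    obtain k where "y = k * x" using y(1) by (metis dvdE mult.commute)
    then show "z \<in> I" unfolding y(2) using mult[OF xI(1)] by blast
  qed
  then show ?thesis using that xI(2) by blast
qed

lemma nz_prime_princ:
  assumes "prime_elem x" shows "nz_prime (princ (toc x))"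
  unfolding nz_prime_def
proof
  show "primeideal (princ (toc x)) Zmu6"
  proof (rule primeidealI[OF ideal_princ cring_Zmu6])
    show "carrier Zmu6 \<noteq> princ (toc x)"
    proof
      assume "carrier Zmu6 = princ (toc x)"
      then have "toc 1 \<in> princ (toc x)" using toc_in_carrier by metis
      then show False using assms by (simp only: toc_in_princ) auto
    qed
    fix a b assume "a \<in> carrier Zmu6" "b \<in> carrier Zmu6" "a \<otimes>\<^bsub>Zmu6\<^esub> b \<in> princ (toc x)"
    moreover then obtain c d where "a = toc c" "b = toc d" by (auto simp: carrier_Zmu6)
    ultimately show "a \<in> princ (toc x) \<or> b \<in> princ (toc x)"
      using prime_elem_dvd_mult_iff[OF assms] by (simp flip: toc_mult)
  qed
  show "princ (toc x) \<noteq> {0}" using nz_ideal_princ[of x] assms by (auto simp: nz_ideal_def)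
qed

lemma ideal_prod_princ:
  "ideal_prod Zmu6 (princ (toc x)) (princ (toc y)) = princ (toc (x * y))"
proof -
  have P: "princ (toc a) = PIdl\<^bsub>Zmu6\<^esub> (toc a)" for a
    unfolding princ_def by (rule Zmu6.cgenideal_eq_genideal[symmetric]) simp
  have e: "princ (toc x) <#>\<^bsub>Zmu6\<^esub> princ (toc y) = princ (toc (x * y))"
    unfolding P using Zmu6.cgenideal_prod[of "toc x" "toc y"] by (simp only: toc_in_carrier Zmu6_simps toc_mult simp_thms)
  have 1: "ideal_prod Zmu6 (princ (toc x)) (princ (toc y)) = princ (toc x) <#>\<^bsub>Zmu6\<^esub> princ (toc y)"
  proof (intro equalityI subsetI)
    fix z assume "z \<in> ideal_prod Zmu6 (princ (toc x)) (princ (toc y))"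
    then show "z \<in> princ (toc x) <#>\<^bsub>Zmu6\<^esub> princ (toc y)"
    proof (induction rule: ideal_prod.induct)
      case (prod i j)
      then show ?case by (auto simp: set_mult_def)
    next
      case (sum s1 s2)
      interpret ideal "princ (toc (x * y))" Zmu6 by (rule ideal_princ)
      show ?case using sum a_closed unfolding e by simp
    qed
  next
    fix z assume "z \<in> princ (toc x) <#>\<^bsub>Zmu6\<^esub> princ (toc y)"
    then show "z \<in> ideal_prod Zmu6 (princ (toc x)) (princ (toc y))"
      by (auto simp: set_mult_def intro: ideal_prod.prod[of _ _ _ _ Zmu6, simplified])
  qed
  show ?thesis unfolding 1 by (rule e)
qed

lemma idl_coprime_princ:
  assumes "u * x + v * y = 1" shows "idl_coprime (princ (toc x)) (princ (toc y))"
  unfolding idl_coprime_def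
proof (intro equalityI subsetI)
  fix z assume "z \<in> carrier Zmu6"
  then obtain c where c: "z = toc c" by (auto simp: carrier_Zmu6)
  have "c = c * u * x + c * v * y" using assms by (metis distrib_left mult.assoc mult.right_neutral)
  then have "z = toc (c * u * x) + toc (c * v * y)" unfolding c by (metis toc_add)
  moreover have "toc (c * u * x) \<in> princ (toc x)" "toc (c * v * y) \<in> princ (toc y)"
    by (simp_all only: toc_in_princ dvd_triv_right)
  ultimately show "z \<in> princ (toc x) <+>\<^bsub>Zmu6\<^esub> princ (toc y)" unfolding set_add_def' by (simp only: Zmu6_simps) blast
qed (auto simp: set_add_def' princ_toc carrier_Zmu6 simp flip: toc_add)

section \<open>Residue systems and prime elements\<close>

text \<open>One representative for each class, so the cardinality is the index of the ideal and can
  be computed by induction over prime factors.\<close>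

definition residue_system :: "eis \<Rightarrow> eis set \<Rightarrow> bool" where
  "residue_system x R \<longleftrightarrow> finite R \<and> (\<forall>y. \<exists>!r. r \<in> R \<and> x dvd y - r)"

lemma idl_norm_residue_system:
  assumes "residue_system x R" shows "idl_norm (princ (toc x)) = card R"
proof -
  let ?I = "princ (toc x)"
  have coset: "?I +>\<^bsub>Zmu6\<^esub> toc a = toc ` {y. x dvd y - a}" for a
  proof -
    have "?I +>\<^bsub>Zmu6\<^esub> toc a = (\<lambda>h. h + toc a) ` ?I" by (auto simp: a_r_coset_def')
    also have "\<dots> = toc ` ((\<lambda>h. h + a) ` {y. x dvd y})" by (simp only: princ_toc image_image toc_add)
    also have "(\<lambda>h. h + a) ` {y. x dvd y} = {y. x dvd y - a}"
    proof (intro equalityI subsetI)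
      fix y assume "y \<in> {y. x dvd y - a}"
      then show "y \<in> (\<lambda>h. h + a) ` {y. x dvd y}" by (intro image_eqI[of _ _ "y - a"]) auto
    qed auto
    finally show ?thesis .
  qed
  have R: "finite R" "\<And>y. \<exists>!r. r \<in> R \<and> x dvd y - r" using assms by (auto simp: residue_system_def)
  have car: "carrier (Zmu6 Quot ?I) = (\<lambda>a. ?I +>\<^bsub>Zmu6\<^esub> toc a) ` UNIV"
    by (auto simp: FactRing_def A_RCOSETS_def' carrier_Zmu6)
  have eq: "?I +>\<^bsub>Zmu6\<^esub> toc a = ?I +>\<^bsub>Zmu6\<^esub> toc b" if "x dvd a - b" for a b
  proof -
    have "x dvd y - a \<longleftrightarrow> x dvd y - b" for y
    proof -
      have "y - b = (y - a) + (a - b)" by simp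
      then show ?thesis using that dvd_add_left_iff by metis
    qed
    then show ?thesis by (simp only: coset)
  qed
  have "bij_betw (\<lambda>a. ?I +>\<^bsub>Zmu6\<^esub> toc a) R (carrier (Zmu6 Quot ?I))"
    unfolding bij_betw_def
  proof
    show "inj_on (\<lambda>a. ?I +>\<^bsub>Zmu6\<^esub> toc a) R"
    proof (rule inj_onI)
      fix a b assume ab: "a \<in> R" "b \<in> R" "?I +>\<^bsub>Zmu6\<^esub> toc a = ?I +>\<^bsub>Zmu6\<^esub> toc b"
      have "toc a \<in> toc ` {y. x dvd y - a}" by simp
      then have "toc a \<in> toc ` {y. x dvd y - b}" using ab(3) by (simp only: coset)
      then have "x dvd a - b" by auto
      then show "a = b" using R(2)[of a] ab by (metis diff_self dvd_0_right)
    qed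
    show "(\<lambda>a. ?I +>\<^bsub>Zmu6\<^esub> toc a) ` R = carrier (Zmu6 Quot ?I)"
    proof (intro equalityI subsetI)
      fix C assume "C \<in> carrier (Zmu6 Quot ?I)"
      then obtain a where a: "C = ?I +>\<^bsub>Zmu6\<^esub> toc a" unfolding car by blast
      obtain r where "r \<in> R" "x dvd a - r" using R(2)[of a] by blast
      then show "C \<in> (\<lambda>a. ?I +>\<^bsub>Zmu6\<^esub> toc a) ` R" using eq a by blast
    qed (auto simp: car)
  qed
  then show ?thesis unfolding idl_norm_def by (metis bij_betw_same_card)
qed

text \<open>An expansion with two digits: a remainder modulo x, then the quotient modulo y.\<close>

lemma residue_system_mult:
  assumes "residue_system x R" "residue_system y S" "x \<noteq> 0"
  shows "\<exists>T. residue_system (x * y) T \<and> card T = card R * card S"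
proof -
  have R: "finite R" "\<And>z. \<exists>!r. r \<in> R \<and> x dvd z - r" using assms by (auto simp: residue_system_def)
  have S: "finite S" "\<And>z. \<exists>!r. r \<in> S \<and> y dvd z - r" using assms by (auto simp: residue_system_def)
  let ?g = "\<lambda>(r, s). r + x * s"
  have uniq: "r = r' \<and> s = s'"
    if "r \<in> R" "r' \<in> R" "s \<in> S" "s' \<in> S" "x * y dvd (r + x * s) - (r' + x * s')" for r r' s s'
  proof -
    have "x dvd (r + x * s) - (r' + x * s')" using that(5) dvd_mult_left by blast
    moreover have "(r + x * s) - (r' + x * s') = (r - r') + x * (s - s')" by (simp add: algebra_simps)
    ultimately have "x dvd r - r'" by (metis dvd_add_left_iff dvd_triv_left)
    then have r: "r = r'" using R(2)[of r] that by (metis diff_self dvd_0_right)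
    then have "x * y dvd x * (s - s')" using that(5) by (simp add: algebra_simps)
    then have "y dvd s - s'" using assms(3) by simp
    then have "s = s'" using S(2)[of s] that by (metis diff_self dvd_0_right)
    with r show ?thesis by simp
  qed
  have inj: "inj_on ?g (R \<times> S)"
  proof (rule inj_onI)
    fix a b assume ab: "a \<in> R \<times> S" "b \<in> R \<times> S" "?g a = ?g b"
    obtain r s r' s' where e: "a = (r, s)" "b = (r', s')" by (cases a, cases b)
    have "x * y dvd (r + x * s) - (r' + x * s')" using ab(3) e by simp
    then show "a = b" using uniq[of r r' s s'] ab e by auto
  qed
  have "residue_system (x * y) (?g ` (R \<times> S))"
    unfolding residue_system_def
  proof (intro conjI allI)
    show "finite (?g ` (R \<times> S))" using R S by simp
    fix z
    obtain r where r: "r \<in> R" "x dvd z - r" using R(2) by blast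
    obtain c where c: "z - r = x * c" using r(2) by (auto simp: dvd_def)
    obtain s where s: "s \<in> S" "y dvd c - s" using S(2) by blast
    have "z - (r + x * s) = x * (c - s)" using c by (simp add: algebra_simps)
    then have d: "x * y dvd z - (r + x * s)" using s by (simp add: mult_dvd_mono)
    show "\<exists>!t. t \<in> ?g ` (R \<times> S) \<and> x * y dvd z - t"
    proof (rule ex1I[of _ "r + x * s"])
      show "r + x * s \<in> ?g ` (R \<times> S) \<and> x * y dvd z - (r + x * s)" using r s d by force
      fix t assume t: "t \<in> ?g ` (R \<times> S) \<and> x * y dvd z - t"
      then obtain r' s' where t': "t = r' + x * s'" "r' \<in> R" "s' \<in> S" by auto
      from dvd_diff[OF conjunct2[OF t] d] have "x * y dvd (z - t) - (z - (r + x * s))" .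
      moreover have "(z - t) - (z - (r + x * s)) = (r + x * s) - (r' + x * s')" by (simp add: t'(1) algebra_simps)
      ultimately have "x * y dvd (r + x * s) - (r' + x * s')" by metis
      then show "t = r + x * s" using uniq r s t' by blast
    qed
  qed
  moreover have "card (?g ` (R \<times> S)) = card R * card S" by (simp add: card_image[OF inj] card_cartesian_product)
  ultimately show ?thesis by blast
qed

text \<open>A prime element divides its norm, hence some rational prime p, so its norm divides p^2.
  If the norm is p^2, the cofactor has norm 1 and is a unit.\<close>

lemma prime_elem_eis_cases:
  assumes x: "prime_elem (x :: eis)"
  obtains p where "prime p" "eis_norm x = int p"
  | p u where "prime p" "eis_norm x = (int p)\<^sup>2" "is_unit u" "x = u * of_nat p"
proof -
  define n where "n = nat (eis_norm x)"
  have "eis_norm x > 0" using x by (simp only: eis_norm_pos) auto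
  then have n0: "n \<noteq> 0" unfolding n_def by linarith
  have "x dvd of_nat n" using eis_dvd_norm[of x] by (simp add: n_def)
  also have "of_nat n = (of_nat (\<Prod>p\<in>#prime_factorization n. p) :: eis)"
    using n0 by (simp add: prod_mset_prime_factorization_nat)
  also have "\<dots> = (\<Prod>p\<in>#prime_factorization n. of_nat p)"
  proof -
    have "(of_nat (\<Prod>p\<in>#M. p) :: eis) = (\<Prod>p\<in>#M. of_nat p)" for M :: "nat multiset"
      by (induction M) simp_all
    then show ?thesis .
  qed
  finally have "x dvd (\<Prod>p\<in>#prime_factorization n. of_nat p)" .
  then obtain p where p: "p \<in># prime_factorization n" "x dvd of_nat p"
    using prime_elem_dvd_prod_msetE[OF x] by (metis (no_types, lifting) imageE set_image_mset)
  have pp: "prime p" using p(1) by (auto simp: in_prime_factors_iff)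
  obtain y where y: "of_nat p = x * y" using p(2) by (auto simp: dvd_def)
  have "eis_norm x * eis_norm y = (int p)\<^sup>2" 
    using arg_cong[OF y, of eis_norm] by (simp add: eis_norm_mult of_nat_eis eis_norm_Eis)
  then have d: "nat (eis_norm x) dvd p ^ 2"
    by (metis dvd_triv_left eis_norm_nonneg int_dvd_int_iff int_nat_eq of_nat_power)
  have ne1: "nat (eis_norm x) \<noteq> 1"
    using x eis_unit_iff_norm[of x] eis_norm_nonneg[of x] by (auto simp: prime_elem_def nat_eq_iff)
  obtain i where i: "i \<le> 2" "nat (eis_norm x) = p ^ i" using d divides_primepow_nat[OF pp] by blast
  have "i = 1 \<or> i = 2" using i ne1 by (cases i) (auto simp: le_Suc_eq)
  then show ?thesis
  proof
    assume "i = 1"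
    then have "eis_norm x = int p" using i eis_norm_nonneg[of x] by (simp add: nat_eq_iff)
    then show ?thesis using that(1) pp by blast
  next
    assume "i = 2"
    then have N: "eis_norm x = (int p)\<^sup>2" using i eis_norm_nonneg[of x] by (simp add: nat_eq_iff)
    then have "eis_norm y = 1" using \<open>eis_norm x * eis_norm y = (int p)\<^sup>2\<close> pp by simp
    then have "y * eis_cnj y = 1" by (simp add: eis_mult_cnj)
    then have "x = eis_cnj y * of_nat p" unfolding y by (simp add: mult_ac)
    moreover have "is_unit (eis_cnj y)" using \<open>eis_norm y = 1\<close> by (simp add: eis_unit_iff_norm)
    ultimately show ?thesis using that(2) pp N by blast
  qed
qed

text \<open>Induction over the factorisation. A prime of norm p has the representatives 0, ..., p -
  1, and one associated to p has the square box of side p.\<close>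

lemma residue_system_exists:
  assumes "x \<noteq> 0" shows "\<exists>R. residue_system x R \<and> card R = nat (eis_norm x)"
  using assms
proof (induction x rule: prime_divisors_induct)
  case (unit u)
  have "residue_system u {0}"
    using unit by (auto simp: residue_system_def unit_imp_dvd)
  then show ?case using unit by (intro exI[of _ "{0}"]) (simp add: eis_unit_iff_norm)
next
  case (factor q y)
  then have y: "y \<noteq> 0" by auto
  have "prime_elem q" using factor by auto
  then have "\<exists>R. residue_system q R \<and> card R = nat (eis_norm q)"
  proof (cases rule: prime_elem_eis_cases)
    case (1 p)
    note pq = prime_norm_congruent_to_int[OF 1]
    have dd: "q dvd of_int a - of_int b \<longleftrightarrow> int p dvd a - b" for a b using pq(2)[of "a - b"] by simp
    have "residue_system q (of_int ` {0..<int p})"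
      unfolding residue_system_def
    proof (intro conjI allI)
      fix z
      obtain a where a: "q dvd z - of_int a" using pq(1) by blast
      have "q dvd of_int a - of_int (a mod int p)" unfolding dd by (metis mod_eq_dvd_iff mod_mod_trivial)
      from dvd_add[OF a this] have b: "q dvd z - of_int (a mod int p)" by simp
      show "\<exists>!r. r \<in> of_int ` {0..<int p} \<and> q dvd z - r"
      proof (rule ex1I[of _ "of_int (a mod int p)"])
        show "of_int (a mod int p) \<in> of_int ` {0..<int p} \<and> q dvd z - of_int (a mod int p)"
          using b prime_gt_0_nat[OF 1(1)] by auto
        fix r assume r: "r \<in> of_int ` {0..<int p} \<and> q dvd z - r"
        then obtain i where i: "r = of_int i" "i \<in> {0..<int p}" by auto
        from dvd_diff[OF b conjunct2[OF r]] have "q dvd (z - of_int (a mod int p)) - (z - r)" .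
        then have "q dvd of_int i - of_int (a mod int p)" by (simp add: i)
        then have "i mod int p = (a mod int p) mod int p" unfolding dd by (simp only: mod_eq_dvd_iff)
        then show "r = of_int (a mod int p)" using i by simp
      qed
    qed simp
    moreover have "card (of_int ` {0..<int p} :: eis set) = p"
      by (subst card_image) (auto simp: inj_on_def of_int_eis)
    ultimately show ?thesis using 1(2) by (intro exI[of _ "of_int ` {0..<int p}"]) simp
  next
    case (2 p u)
    have "residue_system q (eis_residues p)"
      unfolding residue_system_def
    proof (intro conjI allI)
      have qd: "q dvd z \<longleftrightarrow> of_nat p dvd z" for z using 2(3,4) by (simp add: mult_unit_dvd_iff')
      fix z
      show "\<exists>!r. r \<in> eis_residues p \<and> q dvd z - r"
      proof (rule ex1I[of _ "eis_mod p z"])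
        show "eis_mod p z \<in> eis_residues p \<and> q dvd z - eis_mod p z"
          using prime_gt_0_nat[OF 2(1)] eis_mod_dvd[of p z] by (simp add: qd)
        fix r assume "r \<in> eis_residues p \<and> q dvd z - r"
        then show "r = eis_mod p z" using eis_mod_eq_iff[of p z r] eis_mod_residue[of r p] by (simp add: qd)
      qed
    qed simp
    moreover have "card (eis_residues p) = p\<^sup>2"
      unfolding eis_residues_def
      by (subst card_image) (auto simp: inj_on_def card_cartesian_product power2_eq_square)
    ultimately show ?thesis using 2(2) by (intro exI[of _ "eis_residues p"]) (simp add: nat_power_eq)
  qed
  then obtain R where R: "residue_system q R" "card R = nat (eis_norm q)" by blast
  obtain S where S: "residue_system y S" "card S = nat (eis_norm y)" using factor.IH y by blast
  have "q \<noteq> 0" using factor by auto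
  from residue_system_mult[OF R(1) S(1) this] R(2) S(2) show ?case
    by (simp add: eis_norm_mult nat_mult_distrib)
qed simp

lemma idl_norm_princ: "x \<noteq> 0 \<Longrightarrow> idl_norm (princ (toc x)) = nat (eis_norm x)"
  using residue_system_exists[of x] idl_norm_residue_system by metis

lemma eis_fermat:
  assumes q: "prime_elem q" and x: "\<not> q dvd x"
  shows "q dvd x ^ (nat (eis_norm q) - 1) - 1"
proof -
  have q0: "q \<noteq> 0" using q by auto
  obtain R where R: "residue_system q R" "card R = nat (eis_norm q)" using residue_system_exists[OF q0] by blast
  have fin: "finite R" and ex: "\<And>y. \<exists>!r. r \<in> R \<and> q dvd y - r" using R(1) by (auto simp: residue_system_def)
  define red where "red = (\<lambda>y. THE r. r \<in> R \<and> q dvd y - r)"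
  have red: "red y \<in> R" "q dvd y - red y" for y using theI'[OF ex[of y]] by (auto simp: red_def)
  have req: "r = s" if "r \<in> R" "s \<in> R" "q dvd r - s" for r s using ex[of r] that by (metis diff_self dvd_0_right)
  define U where "U = {r \<in> R. \<not> q dvd r}"
  have finU: "finite U" using fin by (simp add: U_def)
  have "R = insert (red 0) U"
  proof (intro equalityI subsetI)
    fix r assume r: "r \<in> R"
    show "r \<in> insert (red 0) U"
    proof (cases "q dvd r")
      case True
      have "q dvd r + (0 - red 0)" using True red(2)[of 0] by (rule dvd_add)
      then have "r = red 0" using req[OF r red(1)] by simp
      then show ?thesis by simp
    qed (use r in \<open>simp add: U_def\<close>)
  qed (use red in \<open>auto simp: U_def\<close>)
  moreover have "red 0 \<notin> U" using red(2)[of 0] by (simp add: U_def)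
  ultimately have cardU: "card U = nat (eis_norm q) - 1" using R(2) finU by (metis card_insert_disjoint diff_Suc_1)
  let ?g = "\<lambda>r. red (x * r)"
  have gU: "?g r \<in> U" if "r \<in> U" for r
  proof -
    have "\<not> q dvd x * r" using x that prime_elem_dvd_mult_iff[OF q] by (auto simp: U_def)
    then have "\<not> q dvd red (x * r)" using red(2)[of "x * r"] dvd_diffD1 by (metis dvd_add diff_add_cancel)
    then show ?thesis using red(1) by (simp add: U_def)
  qed
  have inj: "inj_on ?g U"
  proof (rule inj_onI)
    fix r s assume rs: "r \<in> U" "s \<in> U" "?g r = ?g s"
    have "q dvd (x * r - red (x * r)) - (x * s - red (x * s))" by (rule dvd_diff[OF red(2) red(2)])
    then have "q dvd x * (r - s)" using rs(3) by (simp add: algebra_simps)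
    then have "q dvd r - s" using x prime_elem_dvd_mult_iff[OF q] by blast
    then show "r = s" using req rs by (auto simp: U_def)
  qed
  have img: "?g ` U = U" by (rule endo_inj_surj[OF finU _ inj]) (use gU in auto)
  have "(\<Prod>r\<in>U. r) = (\<Prod>r\<in>?g ` U. r)" by (simp only: img)
  also have "\<dots> = (\<Prod>r\<in>U. ?g r)" using prod.reindex[OF inj, of "\<lambda>r. r"] by simp
  finally have P: "(\<Prod>r\<in>U. ?g r) = (\<Prod>r\<in>U. r)" by simp
  have "q dvd (\<Prod>r\<in>V. x * r) - (\<Prod>r\<in>V. ?g r)" if "finite V" for V
    using that
  proof (induction V rule: finite_induct)
    case (insert r V)
    have "(\<Prod>r\<in>insert r V. x * r) - (\<Prod>r\<in>insert r V. ?g r) =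
        (x * r) * ((\<Prod>r\<in>V. x * r) - (\<Prod>r\<in>V. ?g r)) + (x * r - ?g r) * (\<Prod>r\<in>V. ?g r)"
      using insert.hyps by (simp add: algebra_simps)
    then show ?case using insert.IH red(2)[of "x * r"] by (simp add: dvd_add)
  qed simp
  from this[OF finU] have "q dvd (\<Prod>r\<in>U. x * r) - (\<Prod>r\<in>U. r)" by (simp only: P)
  also have "(\<Prod>r\<in>U. x * r) - (\<Prod>r\<in>U. r) = (x ^ card U - 1) * (\<Prod>r\<in>U. r)"
    by (simp add: prod.distrib left_diff_distrib)
  finally have "q dvd x ^ card U - 1 \<or> q dvd (\<Prod>r\<in>U. r)" using prime_elem_dvd_mult_iff[OF q] by blast
  moreover have "\<not> q dvd (\<Prod>r\<in>V. r)" if "finite V" "V \<subseteq> U" for V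
    using that
  proof (induction V rule: finite_induct)
    case empty
    then show ?case using q by (simp add: prime_elem_def)
  next
    case (insert r V)
    then show ?case using prime_elem_dvd_mult_iff[OF q] by (auto simp: U_def)
  qed
  then have "\<not> q dvd (\<Prod>r\<in>U. r)" using finU by blast
  ultimately show ?thesis by (simp add: cardU)
qed

section \<open>Sextic symbols and primary generators\<close>

lemma eis_unit_power_6: "is_unit (u :: eis) \<Longrightarrow> u ^ 6 = 1"
  unfolding eis_units by (auto simp: one_eis_def numeral_eq_Suc)

lemma eis_unit_diff: "is_unit (u :: eis) \<Longrightarrow> is_unit v \<Longrightarrow> u \<noteq> v \<Longrightarrow> eis_norm (u - v) \<le> 4"
  unfolding eis_units by (auto simp: one_eis_def eis_norm_Eis)

lemma eis_unit_cnj: "is_unit u \<Longrightarrow> u * eis_cnj u = 1"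
  by (simp add: eis_mult_cnj eis_unit_iff_norm)

lemma sixth_root_of_unity:
  fixes z :: complex
  assumes "z ^ 6 = 1" obtains u where "is_unit u" "z = toc u"
proof -
  define W where "W = toc (Eis 0 1)"
  have "Eis 0 1 * Eis 0 1 = Eis 0 1 - 1" by (simp add: one_eis_def)
  then have W: "W * W = W - 1" unfolding W_def by (metis toc_mult toc_diff toc_1)
  have "(z - W) * (z - (1 - W)) = z * z - z + (W - W * W)" by (simp add: algebra_simps)
  then have 1: "(z - W) * (z - (1 - W)) = z * z - z + 1" unfolding W by simp
  have "(z + W) * (z + (1 - W)) = z * z + z + (W - W * W)" by (simp add: algebra_simps)
  then have 2: "(z + W) * (z + (1 - W)) = z * z + z + 1" unfolding W by simp
  have "(z - 1) * (z + 1) * ((z - W) * (z - (1 - W))) * ((z + W) * (z + (1 - W))) = z ^ 6 - 1"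
    unfolding 1 2 by (simp add: numeral_eq_Suc algebra_simps)
  then have "(z - 1) * (z + 1) * ((z - W) * (z - (1 - W))) * ((z + W) * (z + (1 - W))) = 0" using assms by simp
  then have "z = 1 \<or> z = - 1 \<or> z = W \<or> z = 1 - W \<or> z = - W \<or> z = - (1 - W)"
    by (simp only: mult_eq_0_iff eq_iff_diff_eq_0[of z] diff_minus_eq_add disj_assoc)
  then have "z = toc 1 \<or> z = toc (- 1) \<or> z = toc (Eis 0 1) \<or> z = toc (1 - Eis 0 1) \<or> z = toc (- Eis 0 1) \<or>
      z = toc (- (1 - Eis 0 1))" 
    unfolding W_def by (simp only: toc_1 toc_uminus toc_diff)
  moreover have "is_unit (1 :: eis)" "is_unit (- 1 :: eis)" "is_unit (Eis 0 1)" "is_unit (1 - Eis 0 1)"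
    "is_unit (- Eis 0 1)" "is_unit (- (1 - Eis 0 1))"
    unfolding eis_unit_iff_norm by (simp_all add: one_eis_def eis_norm_Eis)
  ultimately show ?thesis using that by metis
qed

lemma eis_norm_mod_3: "eis_norm x mod 3 = ((eis_fst x - eis_snd x)\<^sup>2) mod 3"
proof -
  have "eis_norm x = (eis_fst x - eis_snd x)\<^sup>2 + 3 * (eis_fst x * eis_snd x)"
    by (simp add: eis_norm_def power2_eq_square algebra_simps)
  then show ?thesis by simp
qed

lemma square_mod_3: "(a :: int)\<^sup>2 mod 3 \<noteq> 2" and square_mod_3_eq: "\<not> 3 dvd a \<Longrightarrow> a\<^sup>2 mod 3 = 1"
proof -
  define r where "r = a mod 3"
  have "r = 0 \<or> r = 1 \<or> r = 2" unfolding r_def by presburger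
  moreover have "a\<^sup>2 mod 3 = r\<^sup>2 mod 3" unfolding r_def by (rule power_mod[symmetric])
  ultimately show "a\<^sup>2 mod 3 \<noteq> 2" "\<not> 3 dvd a \<Longrightarrow> a\<^sup>2 mod 3 = 1" by (auto simp: dvd_eq_mod_eq_0 r_def[symmetric])
qed

text \<open>The norm is a square modulo 3, hence never 2, which settles norm p. In the inert case p
  is 1 or 5 modulo 6, with square 1. So the sextic symbol makes sense at every prime not dividing
  6.\<close>

lemma eis_prime_norm_mod_6:
  assumes x: "prime_elem x" and 6: "\<not> x dvd 6"
  shows "nat (eis_norm x) mod 6 = 1"
proof -
  have no: "p \<noteq> 2" "p \<noteq> 3" if "x dvd of_nat p" for p :: nat
  proof -
    have "\<not> x dvd 2" "\<not> x dvd 3" using 6 dvd_mult2[of x 2 3] dvd_mult2[of x 3 2] by auto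
    then show "p \<noteq> 2" "p \<noteq> 3" using that by auto
  qed
  have res: "p mod 2 = 1" "p mod 3 = 1 \<or> p mod 3 = 2" if "prime p" "p \<noteq> 2" "p \<noteq> 3" for p :: nat
  proof -
    have "\<not> 2 dvd p" "\<not> 3 dvd p" 
      using that primes_dvd_imp_eq[of 2 p] primes_dvd_imp_eq[of 3 p] by auto
    then show "p mod 2 = 1" "p mod 3 = 1 \<or> p mod 3 = 2" by presburger+
  qed
  from x show ?thesis
  proof (cases rule: prime_elem_eis_cases)
    case (1 p)
    have "x dvd of_nat p" using eis_dvd_norm[of x] 1(2) by simp
    note p = no[OF this] res[OF 1(1) no[OF this]]
    have "int p mod 3 \<noteq> 2" using eis_norm_mod_3[of x] square_mod_3 1(2) by metis
    then have "p mod 3 \<noteq> 2" by presburger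
    then have "p mod 6 = 1" using p by presburger
    then show ?thesis using 1(2) by simp
  next
    case (2 p u)
    have "x dvd of_nat p" using 2(3,4) by (simp add: mult_unit_dvd_iff')
    note p = res[OF 2(1) no[OF this]]
    define r where "r = p mod 6"
    have "r = 1 \<or> r = 5" using p unfolding r_def by presburger
    moreover have "p\<^sup>2 mod 6 = r\<^sup>2 mod 6" unfolding r_def by (rule power_mod[symmetric])
    ultimately have "p\<^sup>2 mod 6 = 1" by auto
    then show ?thesis using 2(2) by (simp add: nat_power_eq)
  qed
qed

definition sextic_exp :: "eis \<Rightarrow> nat" where "sextic_exp x = (nat (eis_norm x) - 1) div 6"

text \<open>Distinct units differ by an element of norm at most 4, while the norm of such a prime is
  at least 7.\<close>

lemma sextic_unit_unique:
  fixes x u v :: eis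
  assumes x: "prime_elem x" "\<not> x dvd 6" and u: "is_unit u" "is_unit v" "x dvd u - v"
  shows "u = v"
proof (rule ccontr)
  assume ne: "u \<noteq> v"
  have "nat (eis_norm x) mod 6 = 1" by (rule eis_prime_norm_mod_6[OF x])
  moreover have "eis_norm x > 1"
  proof -
    have "eis_norm x > 0" using x(1) by (simp only: eis_norm_pos) auto
    moreover have "eis_norm x \<noteq> 1" using x(1) eis_unit_iff_norm by (auto simp: prime_elem_def)
    ultimately show ?thesis by linarith
  qed
  moreover have "n \<ge> 7" if "n mod 6 = 1" "n > 1" for n :: nat using that by presburger
  ultimately have "nat (eis_norm x) \<ge> 7" by simp
  then have "eis_norm x \<ge> 7" by simp
  moreover have "eis_norm x \<le> eis_norm (u - v)"
    using eis_norm_dvd[OF u(3)] ne by (intro zdvd_imp_le) auto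
  ultimately show False using eis_unit_diff[OF u(1,2) ne] by simp
qed

text \<open>The sixth powers of A and B are 1 by Fermat, and A^6 - B^6 is the product of A - u B
  over the six units u.\<close>

lemma sextic_unit_exists:
  assumes x: "prime_elem x" "\<not> x dvd 6" and ab: "\<not> x dvd a" "\<not> x dvd b"
  shows "\<exists>u. is_unit u \<and> x dvd a ^ sextic_exp x - u * b ^ sextic_exp x"
proof -
  let ?t = "sextic_exp x"
  have N: "nat (eis_norm x) - 1 = ?t * 6" 
  proof -
    have "n - 1 = (n - 1) div 6 * 6" if "n mod 6 = 1" for n :: nat using that by presburger
    then show ?thesis using eis_prime_norm_mod_6[OF x] unfolding sextic_exp_def by blast
  qed
  define A B where "A = a ^ ?t" and "B = b ^ ?t"
  have A6: "x dvd A ^ 6 - 1" using eis_fermat[OF x(1) ab(1)] unfolding N A_def by (simp only: power_mult)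
  have B6: "x dvd B ^ 6 - 1" using eis_fermat[OF x(1) ab(2)] unfolding N B_def by (simp only: power_mult)
  define W V where "W = Eis 0 1" and "V = Eis 1 (-1)"
  have WV: "W + V = 1" "W * V = 1" by (simp_all add: W_def V_def one_eis_def)
  have "(A - W * B) * (A - V * B) = A * A - (W + V) * (A * B) + (W * V) * (B * B)" by (simp add: algebra_simps)
  then have 1: "(A - W * B) * (A - V * B) = A * A - A * B + B * B" unfolding WV by simp
  have "(A - - W * B) * (A - - V * B) = A * A + (W + V) * (A * B) + (W * V) * (B * B)" by (simp add: algebra_simps)
  then have 2: "(A - - W * B) * (A - - V * B) = A * A + A * B + B * B" unfolding WV by simp
  have "(A - 1 * B) * (A - - 1 * B) * ((A - W * B) * (A - V * B)) * ((A - - W * B) * (A - - V * B)) = (A ^ 6 - 1) - (B ^ 6 - 1)"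
    unfolding 1 2 by (simp add: numeral_eq_Suc algebra_simps)
  then have "x dvd (A - 1 * B) * (A - - 1 * B) * ((A - W * B) * (A - V * B)) * ((A - - W * B) * (A - - V * B))"
    using dvd_diff[OF A6 B6] by metis
  then have "x dvd A - 1 * B \<or> x dvd A - - 1 * B \<or> x dvd A - W * B \<or> x dvd A - V * B \<or> x dvd A - - W * B \<or> x dvd A - - V * B"
    by (simp only: prime_elem_dvd_mult_iff[OF x(1)] disj_assoc)
  moreover have "is_unit (1 :: eis)" "is_unit (- 1 :: eis)" "is_unit W" "is_unit V" "is_unit (- W)" "is_unit (- V)"
    unfolding eis_unit_iff_norm by (simp_all add: one_eis_def eis_norm_Eis W_def V_def)
  ultimately show ?thesis unfolding A_def B_def by metis
qed

text \<open>\<open>sextic\<close> accepts every representation of its argument as a fraction whose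
  denominator is prime to x. Cross multiplication shows that two representations yield units
  congruent modulo x, hence equal ones.\<close>

lemma sextic_eqI:
  assumes x: "prime_elem x" "\<not> x dvd 6" and ab: "\<not> x dvd b"
    and u: "is_unit u" "x dvd a ^ sextic_exp x - u * b ^ sextic_exp x"
  shows "sextic (toc a / toc b) (princ (toc x)) = toc u"
proof -
  let ?t = "sextic_exp x"
  have x0: "x \<noteq> 0" using x by auto
  have t: "(idl_norm (princ (toc x)) - 1) div 6 = ?t" by (simp add: idl_norm_princ[OF x0] sextic_exp_def)
  have b0: "b \<noteq> 0" using ab by auto
  show ?thesis unfolding sextic_def t
  proof (rule the_equality)
    have "toc u ^ 6 = 1" using eis_unit_power_6[OF u(1)] by (metis toc_1 toc_power)
    moreover have "toc a ^ ?t - toc u * toc b ^ ?t \<in> princ (toc x)"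
      using u(2) toc_in_princ[of "a ^ ?t - u * b ^ ?t" x] by simp
    moreover have "toc b \<notin> princ (toc x)" using ab by simp
    ultimately show "toc u ^ 6 = 1 \<and> (\<exists>a'\<in>carrier Zmu6. \<exists>b'\<in>carrier Zmu6. b' \<notin> princ (toc x) \<and>
        toc a / toc b = a' / b' \<and> a' ^ ?t - toc u * b' ^ ?t \<in> princ (toc x))"
      using toc_in_carrier by blast
    fix z assume z: "z ^ 6 = 1 \<and> (\<exists>a'\<in>carrier Zmu6. \<exists>b'\<in>carrier Zmu6. b' \<notin> princ (toc x) \<and>
        toc a / toc b = a' / b' \<and> a' ^ ?t - z * b' ^ ?t \<in> princ (toc x))"
    obtain v where v: "is_unit v" "z = toc v" using sixth_root_of_unity z by metis
    obtain a' b' where ab': "b' \<notin> princ (toc x)" "toc a / toc b = a' / b'" "a' ^ ?t - z * b' ^ ?t \<in> princ (toc x)"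
      "a' \<in> carrier Zmu6" "b' \<in> carrier Zmu6" using z by blast
    obtain c d where cd: "a' = toc c" "b' = toc d" using ab'(4,5) by (auto simp: carrier_Zmu6)
    have d: "\<not> x dvd d" using ab'(1) cd by simp
    then have "d \<noteq> 0" by auto
    then have "toc (a * d) = toc (c * b)" using ab'(2) b0 cd by (simp add: field_simps)
    then have e: "a * d = c * b" by (simp only: toc_inject)
    have c: "x dvd c ^ ?t - v * d ^ ?t"
      using ab'(3) toc_in_princ[of "c ^ ?t - v * d ^ ?t" x] by (simp add: cd v)
    have "(v - u) * (b ^ ?t * d ^ ?t) = d ^ ?t * (a ^ ?t - u * b ^ ?t) - b ^ ?t * (c ^ ?t - v * d ^ ?t)"
      using e by (simp add: algebra_simps flip: power_mult_distrib)
    then have "x dvd (v - u) * (b ^ ?t * d ^ ?t)" using u(2) c by (simp add: dvd_diff)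
    moreover have "\<not> x dvd b ^ ?t" "\<not> x dvd d ^ ?t" using ab d x(1) prime_elem_dvd_power by blast+
    ultimately have "x dvd v - u" using prime_elem_dvd_mult_iff[OF x(1)] by blast
    then show "z = toc u" using sextic_unit_unique[OF x v(1) u(1)] v by simp
  qed
qed

text \<open>There are six classes prime to 3 modulo 3, and the six units represent them. The classes
  with equal coordinates modulo 3 are excluded: they are divisible by 1 + \<omega>, of norm
  3.\<close>

lemma primary_exists:
  assumes "coprime (x :: eis) 3" shows "\<exists>u. is_unit u \<and> 3 dvd u * x - 1"
proof -
  obtain a b where x: "x = Eis a b" by (cases x)
  have "\<not> 3 dvd b - a"
  proof
    assume "3 dvd b - a"
    then obtain d where d: "b - a = 3 * d" by (auto simp: dvd_def)
    then have "x = Eis 1 1 * Eis (a + d) d" by (simp add: x)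
    moreover have "3 = Eis 1 1 * Eis 2 (-1)" by (simp add: numeral_eis)
    ultimately have "is_unit (Eis 1 1)" using assms by (metis coprime_def dvd_triv_left)
    then show False by (simp add: eis_unit_iff_norm eis_norm_Eis)
  qed
  have three: "3 dvd y \<longleftrightarrow> 3 dvd eis_fst y \<and> 3 dvd eis_snd y" for y :: eis
    using of_int_dvd_eis_iff[of 3 y] by simp
  have U: "is_unit (Eis 1 0)" "is_unit (Eis (-1) 0)" "is_unit (Eis 1 (-1))" "is_unit (Eis (-1) 1)" "is_unit (Eis 0 1)" "is_unit (Eis 0 (-1))"
    unfolding eis_unit_iff_norm by (simp_all add: eis_norm_Eis)
  consider "3 dvd a - 1" "3 dvd b" | "3 dvd a + 1" "3 dvd b" | "3 dvd a" "3 dvd b - 1" | "3 dvd a" "3 dvd b + 1"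
    | "3 dvd a - 1" "3 dvd b + 1" | "3 dvd a + 1" "3 dvd b - 1"
  proof -
    have "(3 dvd a - 1 \<and> 3 dvd b) \<or> (3 dvd a + 1 \<and> 3 dvd b) \<or> (3 dvd a \<and> 3 dvd b - 1) \<or> (3 dvd a \<and> 3 dvd b + 1) \<or>
        (3 dvd a - 1 \<and> 3 dvd b + 1) \<or> (3 dvd a + 1 \<and> 3 dvd b - 1)"
      using \<open>\<not> 3 dvd b - a\<close> by presburger
    then show thesis using that by blast
  qed
  then show ?thesis
  proof cases
    case 1
    then have "3 dvd Eis 1 0 * x - 1" by (simp add: three x)
    then show ?thesis using U by blast
  next
    case 2
    then have "3 dvd Eis (-1) 0 * x - 1" by (simp add: three x) presburger
    then show ?thesis using U by blast
  next
    case 3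
    then have "3 dvd Eis 1 (-1) * x - 1" by (simp add: three x) presburger
    then show ?thesis using U by blast
  next
    case 4
    then have "3 dvd Eis (-1) 1 * x - 1" by (simp add: three x) presburger
    then show ?thesis using U by blast
  next
    case 5
    then have "3 dvd Eis 0 1 * x - 1" by (simp add: three x) presburger
    then show ?thesis using U by blast
  next
    case 6
    then have "3 dvd Eis 0 (-1) * x - 1" by (simp add: three x) presburger
    then show ?thesis using U by blast
  qed
qed

lemma primary_unique:
  assumes "coprime (x :: eis) 3" "is_unit u" "is_unit v" "3 dvd u * x - 1" "3 dvd v * x - 1"
  shows "u = v"
proof (rule ccontr)
  assume ne: "u \<noteq> v"
  have "3 dvd (u * x - 1) - (v * x - 1)" by (rule dvd_diff[OF assms(4,5)])
  then have "3 dvd (u - v) * x" by (simp add: algebra_simps)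
  then have "3 dvd u - v" using assms(1) by (simp add: coprime_dvd_mult_left_iff coprime_commute)
  then have "eis_norm 3 dvd eis_norm (u - v)" by (rule eis_norm_dvd)
  then have "9 dvd eis_norm (u - v)" by (simp add: numeral_eis eis_norm_Eis)
  then have "9 \<le> eis_norm (u - v)" using ne by (intro zdvd_imp_le) auto
  then show False using eis_unit_diff[OF assms(2,3) ne] by simp
qed

text \<open>The generator of (x) that is congruent to 1 modulo 3, meaningful for x prime to 3. As a
  function on elements, it allows multiplicativity and conjugation to be stated without
  ideals.\<close>

definition primary :: "eis \<Rightarrow> eis" where
  "primary x = (SOME u. is_unit u \<and> 3 dvd u * x - 1) * x"

lemma primary:
  assumes "coprime x 3"
  obtains u where "is_unit u" "primary x = u * x" "3 dvd primary x - 1"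
  using someI_ex[OF primary_exists[OF assms]] that unfolding primary_def by blast

lemma primary_eqI:
  assumes "coprime x 3" "is_unit u" "3 dvd u * x - 1" shows "primary x = u * x"
proof (rule primary[OF assms(1)])
  fix v assume v: "is_unit v" "primary x = v * x" "3 dvd primary x - 1"
  then show "primary x = u * x" using primary_unique[OF assms(1) v(1) assms(2)] assms(3) by simp
qed

lemma primary_id: "3 dvd x - 1 \<Longrightarrow> primary x = x"
proof -
  assume x: "3 dvd x - 1"
  have "coprime x 3"
  proof (rule coprimeI)
    fix c assume "c dvd x" "c dvd 3"
    then have "c dvd x - (x - 1)" using x dvd_trans by (metis dvd_diff)
    then show "is_unit c" by simp
  qed
  from primary_eqI[OF this, of 1] x show ?thesis by simp
qed

lemma primary_mult:
  assumes "coprime x 3" "coprime y 3" shows "primary (x * y) = primary x * primary y"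
proof -
  obtain u where u: "is_unit u" "primary x = u * x" "3 dvd primary x - 1" by (rule primary[OF assms(1)])
  obtain v where v: "is_unit v" "primary y = v * y" "3 dvd primary y - 1" by (rule primary[OF assms(2)])
  have "(u * v) * (x * y) - 1 = u * x * (v * y - 1) + (u * x - 1)" by (simp add: algebra_simps)
  moreover have "3 dvd u * x * (v * y - 1) + (u * x - 1)" using u v by (intro dvd_add dvd_mult) auto
  ultimately have "3 dvd (u * v) * (x * y) - 1" by metis
  then have "primary (x * y) = (u * v) * (x * y)" using u v assms by (intro primary_eqI) auto
  then show ?thesis by (simp add: u v mult_ac)
qed

lemma primary_cnj: "coprime x 3 \<Longrightarrow> primary (eis_cnj x) = eis_cnj (primary x)"
proof -
  assume x: "coprime x 3"
  obtain u where u: "is_unit u" "primary x = u * x" "3 dvd primary x - 1" by (rule primary[OF x])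
  have c3: "eis_cnj 3 = 3" by (simp add: numeral_eis eis_cnj_def)
  have "coprime (eis_cnj x) 3"
  proof (rule coprimeI)
    fix c assume "c dvd eis_cnj x" "c dvd 3"
    then have "eis_cnj c dvd x" "eis_cnj c dvd 3" using eis_cnj_dvd_iff[of "eis_cnj c"] c3 by (metis eis_cnj_simps(7))+
    then have "is_unit (eis_cnj c)" using x coprime_common_divisor by blast
    then show "is_unit c" by (simp add: eis_unit_iff_norm)
  qed
  moreover have "is_unit (eis_cnj u)" using u by (simp add: eis_unit_iff_norm)
  moreover have "3 dvd eis_cnj u * eis_cnj x - 1"
    using eis_cnj_dvd_iff[of 3 "u * x - 1"] u c3 by simp
  ultimately have "primary (eis_cnj x) = eis_cnj u * eis_cnj x" by (rule primary_eqI)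
  then show ?thesis by (simp add: u)
qed

lemma psi_princ:
  assumes "coprime x 3" shows "psi (princ (toc x)) = toc (primary x)"
proof -
  obtain u where u: "is_unit u" "primary x = u * x" "3 dvd primary x - 1" by (rule primary[OF assms])
  have three: "princ 3 = princ (toc 3)" using toc_of_nat[of 3] by simp
  show ?thesis unfolding psi_def three
  proof (rule the_equality)
    have "princ (toc x) = princ (toc (primary x))" unfolding princ_eq_iff u(2) using u(1) by (simp add: mult_unit_dvd_iff')
    moreover have "toc (primary x) - 1 \<in> princ (toc 3)" using u(3) toc_in_princ[of "primary x - 1" 3] by simp
    ultimately show "toc (primary x) \<in> carrier Zmu6 \<and> princ (toc x) = princ (toc (primary x)) \<and> toc (primary x) - 1 \<in> princ (toc 3)"
      by simp
    fix z assume z: "z \<in> carrier Zmu6 \<and> princ (toc x) = princ z \<and> z - 1 \<in> princ (toc 3)"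
    then obtain y where y: "z = toc y" by (auto simp: carrier_Zmu6)
    then have "x dvd y" "y dvd x" using z by (auto simp: princ_eq_iff)
    then obtain v where v: "is_unit v" "y = v * x" by (metis associated_iff_dvd associatedE1 mult.commute associated_unit unit_factor_mult_normalize normalize_idem dvd_normalize_iff associatedI)
    have "toc (y - 1) \<in> princ (toc 3)" using z y by simp
    then have "3 dvd y - 1" by (simp only: toc_in_princ)
    then have "primary x = v * x" using assms v by (intro primary_eqI) auto
    then show "z = toc (primary x)" by (simp add: y v)
  qed
qed

section \<open>The two cubic characters\<close>

lemma coprime_shift: "coprime (f * y + x) (f :: eis) \<longleftrightarrow> coprime x f"
proof -
  have "c dvd f * y + x \<longleftrightarrow> c dvd x" if "c dvd f" for c using that by (simp add: dvd_add_right_iff)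
  then show ?thesis unfolding coprime_def by blast
qed

lemma cubic_character_mult:
  assumes "cubic_character f \<eta>" "cubic_character f \<theta>"
  shows "cubic_character f (\<lambda>x. \<eta> x * \<theta> x)"
  using assms unfolding cubic_character_def by (simp add: power_mult_distrib mult_ac)

abbreviation omega3 :: complex where "omega3 \<equiv> toc eis_omega"

lemma omega3_cube: "omega3 ^ 3 = 1"
proof -
  have "eis_omega ^ 3 = 1" by (simp add: eis_cube_eq_1_iff)
  then show ?thesis by (metis toc_1 toc_power)
qed

lemma omega3_power_eq: "n mod 3 = n' mod 3 \<Longrightarrow> omega3 ^ n = omega3 ^ n'"
proof -
  have "omega3 ^ n = omega3 ^ (n mod 3)" for n
  proof -
    have "omega3 ^ (3 * (n div 3) + n mod 3) = omega3 ^ (n mod 3)"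
      unfolding power_add power_mult omega3_cube by simp
    then show ?thesis by simp
  qed
  then show "n mod 3 = n' mod 3 \<Longrightarrow> omega3 ^ n = omega3 ^ n'" by metis
qed

lemma omega3_power_eq_1_iff: "omega3 ^ n = 1 \<longleftrightarrow> 3 dvd n"
proof -
  have ne: "omega3 \<noteq> 1" "omega3\<^sup>2 \<noteq> 1"
  proof -
    have "eis_omega \<noteq> 1" "eis_omega\<^sup>2 \<noteq> 1" by (simp_all add: power2_eq_square)
    then show "omega3 \<noteq> 1" "omega3\<^sup>2 \<noteq> 1" by (metis toc_1 toc_inject, metis toc_1 toc_inject toc_power)
  qed
  define r where "r = n mod 3"
  have r: "r = 0 \<or> r = 1 \<or> r = 2" unfolding r_def by presburger
  have "omega3 ^ n = omega3 ^ r" by (rule omega3_power_eq) (simp add: r_def)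
  moreover have "3 dvd n \<longleftrightarrow> r = 0" by (simp add: r_def dvd_eq_mod_eq_0)
  ultimately show ?thesis using r ne by auto
qed

lemma coprime_3_norm:
  assumes "coprime (x :: eis) 3" shows "eis_norm x mod 3 = 1"
proof -
  obtain u where u: "is_unit u" "3 dvd u * x - 1" using primary_exists[OF assms] by blast
  obtain a b where y: "u * x = Eis a b" by (cases "u * x")
  have "3 dvd a - 1" "3 dvd b" using u(2) of_int_dvd_eis_iff[of 3 "u * x - 1"] by (simp_all add: y)
  then have "\<not> 3 dvd a - b" by presburger
  then have "(a - b)\<^sup>2 mod 3 = 1" by (rule square_mod_3_eq)
  then have "eis_norm (u * x) mod 3 = 1" using eis_norm_mod_3[of "u * x"] by (simp add: y)
  then show ?thesis using u(1) by (simp add: eis_norm_mult eis_unit_iff_norm)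
qed

text \<open>For f divisible by 9 the exponent records the norm modulo 9. At an unramified prime of
  norm p the value is 1 exactly when p is 1 modulo 9.\<close>

definition chi1 :: "nat \<Rightarrow> eis \<Rightarrow> complex" where
  "chi1 f x = (if coprime x (of_nat f) then omega3 ^ nat ((eis_norm x - 1) div 3) else 0)"

lemma of_int_dvd_of_int_eis: "a dvd b \<Longrightarrow> (of_int a :: eis) dvd of_int b"
  by (auto simp: dvd_def)

text \<open>On norms congruent to 1 modulo 3, the map N -> (N - 1)/3 modulo 3 turns products into
  sums. The norm modulo 9 depends only on the element modulo 9, which gives the period.\<close>

lemma chi1_cubic_character:
  assumes f: "f > 0" "9 dvd f"
  shows "cubic_character f (chi1 f)"
  unfolding cubic_character_def
proof (intro conjI allI impI)
  have "3 dvd int f" using f by presburger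
  from of_int_dvd_of_int_eis[OF this] have three: "(3 :: eis) dvd of_nat f"
    by (simp only: of_int_numeral of_int_of_nat_eq)
  have co3: "coprime (x :: eis) 3" if "coprime x (of_nat f)" for x
    by (rule coprime_divisors[OF dvd_refl three that])
  have N: "\<exists>i. eis_norm x = 3 * int i + 1" if "coprime x (of_nat f)" for x :: eis
  proof -
    have "eis_norm x mod 3 = 1" by (rule coprime_3_norm[OF co3[OF that]])
    then have "eis_norm x = 3 * (eis_norm x div 3) + 1" using mult_div_mod_eq[of 3 "eis_norm x"] by linarith
    moreover have "eis_norm x div 3 = int (nat (eis_norm x div 3))"
      using eis_norm_nonneg[of x] by (simp add: pos_imp_zdiv_nonneg_iff)
    ultimately have "eis_norm x = 3 * int (nat (eis_norm x div 3)) + 1" by metis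
    then show ?thesis by blast
  qed
  show "f > 0" by (rule f)
  show "chi1 f (x * y) = chi1 f x * chi1 f y" for x y
  proof (cases "coprime x (of_nat f) \<and> coprime y (of_nat f)")
    case True
    obtain i where i: "eis_norm x = 3 * int i + 1" using N True by blast
    obtain j where j: "eis_norm y = 3 * int j + 1" using N True by blast
    define n where "n = 3 * (i * j) + (i + j)"
    have "eis_norm (x * y) - 1 = 3 * int n" by (simp add: n_def eis_norm_mult i j algebra_simps)
    then have "nat ((eis_norm (x * y) - 1) div 3) = n" by simp
    then have "chi1 f (x * y) = omega3 ^ n" using True by (simp add: chi1_def)
    also have "\<dots> = omega3 ^ (i + j)" by (rule omega3_power_eq) (simp add: n_def)
    finally show ?thesis using True by (simp add: chi1_def i j power_add)
  qed (auto simp: chi1_def)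
  show "chi1 f u = 1" if "is_unit u" for u
    using is_unit_left_imp_coprime[OF that, of "of_nat f"] that by (simp add: chi1_def eis_unit_iff_norm)
  show "chi1 f x ^ 3 = 1" if "coprime x (of_nat f)" for x
  proof -
    have "(omega3 ^ n) ^ 3 = (omega3 ^ 3) ^ n" for n by (simp add: power_mult[symmetric] mult.commute)
    then show ?thesis using that by (simp add: chi1_def omega3_cube)
  qed
  show "chi1 f x = 0" if "\<not> coprime x (of_nat f)" for x using that by (simp add: chi1_def)
  show "chi1 f (of_nat f * y + x) = chi1 f x" for x y
  proof (cases "coprime x (of_nat f)")
    case True
    then have c: "coprime (of_nat f * y + x) (of_nat f)" by (simp add: coprime_shift)
    obtain i where i: "eis_norm x = 3 * int i + 1" using N True by blast
    obtain j where j: "eis_norm (of_nat f * y + x) = 3 * int j + 1" using N c by blast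
    obtain g where g: "int f = 9 * g" using f(2) by (metis dvdE int_dvd_int_iff of_nat_numeral)
    obtain a b c' d where abcd: "x = Eis a b" "y = Eis c' d" by (cases x, cases y)
    have "eis_norm (of_nat f * y + x) - eis_norm x =
        9 * (g * (9 * g * (c'\<^sup>2 + c' * d + d\<^sup>2) + 2 * a * c' + 2 * b * d + a * d + b * c'))"
      by (simp add: abcd of_nat_eis g eis_norm_Eis power2_eq_square algebra_simps)
    then have "9 dvd eis_norm (of_nat f * y + x) - eis_norm x" by simp
    then have "9 dvd 3 * int j - 3 * int i" by (simp add: i j)
    then have "omega3 ^ j = omega3 ^ i" by (intro omega3_power_eq) presburger
    then show ?thesis using c True by (simp add: chi1_def i j)
  qed (simp add: chi1_def coprime_shift)
qed

lemma floor_approx: "(\<lambda>n. real_of_int \<lfloor>real n * a\<rfloor> / real n) \<longlonglongrightarrow> a"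
proof (rule tendsto_sandwich[of "\<lambda>n. a - 1 / real n" _ _ "\<lambda>n. a"])
  show "\<forall>\<^sub>F n in sequentially. a - 1 / real n \<le> real_of_int \<lfloor>real n * a\<rfloor> / real n"
    using eventually_gt_at_top[of 0]
  proof eventually_elim
    case (elim n)
    have "real n * a - 1 \<le> real_of_int \<lfloor>real n * a\<rfloor>" by linarith
    then have "(real n * a - 1) / real n \<le> real_of_int \<lfloor>real n * a\<rfloor> / real n" by (rule divide_right_mono) simp
    then show ?case using elim by (simp add: diff_divide_distrib)
  qed
  show "\<forall>\<^sub>F n in sequentially. real_of_int \<lfloor>real n * a\<rfloor> / real n \<le> a"
    using eventually_gt_at_top[of 0]
  proof eventually_elim
    case (elim n)
    have "real_of_int \<lfloor>real n * a\<rfloor> \<le> real n * a" by linarith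
    then show ?case using elim by (simp add: field_simps)
  qed
  show "(\<lambda>n. a - 1 / real n) \<longlonglongrightarrow> a" by real_asymp
qed simp

text \<open>The quotients of elements congruent to 1 modulo \<open>f\<close> are dense, so \<open>G\<^sup>3 = 1\<close> everywhere; now take
  cube roots of the argument.\<close>

lemma finite_order_character_trivial:
  fixes G :: "complex \<Rightarrow> complex"
  assumes f: "f > 1" and mult: "\<And>z w. z \<noteq> 0 \<Longrightarrow> w \<noteq> 0 \<Longrightarrow> G (z * w) = G z * G w"
    and cont: "\<And>z. z \<noteq> 0 \<Longrightarrow> isCont G z"
    and fin: "\<And>y. of_nat f dvd y - 1 \<Longrightarrow> G (toc y) ^ 3 = 1"
    and z: "z \<noteq> 0"
  shows "G z = 1"
proof -
  have cube: "G z ^ 3 = 1" if z: "z \<noteq> 0" for z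
  proof -
    define b a where "b = Im z / (sqrt 3 / 2)" and "a = Re z - b / 2"
    have zab: "z = of_real a + of_real b * cis (pi / 3)"
      by (simp add: complex_eq_iff cis_pi_3 a_def b_def)
    define X where "X = (\<lambda>n. 1 + of_nat f * Eis \<lfloor>real n * a\<rfloor> \<lfloor>real n * b\<rfloor>)"
    define Y where "Y = (\<lambda>n :: nat. 1 + of_nat f * (of_nat n :: eis))"
    have nz: "toc y \<noteq> 0" if "of_nat f dvd y - 1" for y
    proof
      assume "toc y = 0"
      then have "of_nat f dvd (1 :: eis)" using that by simp
      then have "is_unit (of_int (int f) :: eis)" by simp
      then have "(int f)\<^sup>2 = 1" unfolding eis_unit_iff_norm eis_norm_of_int .
      then show False using f by (simp add: power2_eq_1_iff)
    qed
    have XY: "of_nat f dvd X n - 1" "of_nat f dvd Y n - 1" for n by (simp_all add: X_def Y_def)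
    have lim: "(\<lambda>n. toc (X n) / toc (Y n)) \<longlonglongrightarrow> z"
    proof -
      have "(\<lambda>n. (of_real (1 / real n) + of_nat f * (of_real (real_of_int \<lfloor>real n * a\<rfloor> / real n) +
            of_real (real_of_int \<lfloor>real n * b\<rfloor> / real n) * cis (pi / 3))) / (of_real (1 / real n) + of_nat f)) \<longlonglongrightarrow>
          (of_real 0 + of_nat f * (of_real a + of_real b * cis (pi / 3))) / (of_real 0 + of_nat f)"
        by (intro tendsto_intros floor_approx lim_1_over_n) (use f in auto)
      also have "(of_real 0 + of_nat f * (of_real a + of_real b * cis (pi / 3))) / (of_real 0 + of_nat f) = z"
        unfolding zab[symmetric] using f by simp
      finally show ?thesis
      proof (rule Lim_transform_eventually)
        show "\<forall>\<^sub>F n in sequentially. (of_real (1 / real n) + of_nat f * (of_real (real_of_int \<lfloor>real n * a\<rfloor> / real n) +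
            of_real (real_of_int \<lfloor>real n * b\<rfloor> / real n) * cis (pi / 3))) / (of_real (1 / real n) + of_nat f) = toc (X n) / toc (Y n)"
          using eventually_gt_at_top[of 0]
        proof eventually_elim
          case (elim n)
          define c where "c = complex_of_real (1 / real n)"
          have cn: "c * of_nat n = 1" using elim by (simp add: c_def)
          have c0: "c \<noteq> 0" using elim by (simp add: c_def)
          have e1: "of_real (1 / real n) + of_nat f * (of_real (real_of_int \<lfloor>real n * a\<rfloor> / real n) +
            of_real (real_of_int \<lfloor>real n * b\<rfloor> / real n) * cis (pi / 3)) = c * toc (X n)"
            by (simp add: X_def c_def toc_def[of "Eis i j" for i j] algebra_simps add_divide_distrib)
          have e2: "of_real (1 / real n) + of_nat f = c * toc (Y n)"
            using cn by (simp add: Y_def c_def distrib_left mult.left_commute)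
          show ?case unfolding e1 e2 using c0 by simp
        qed
      qed
    qed
    have G1: "G (toc (X n) / toc (Y n)) ^ 3 = 1" for n
    proof -
      have x: "toc (X n) \<noteq> 0" and y: "toc (Y n) \<noteq> 0" using nz XY by blast+
      have "G (toc (X n) / toc (Y n) * toc (Y n)) = G (toc (X n) / toc (Y n)) * G (toc (Y n))"
        by (rule mult) (use x y in auto)
      then have "G (toc (X n)) ^ 3 = G (toc (X n) / toc (Y n)) ^ 3 * G (toc (Y n)) ^ 3"
        using y by (simp add: power_mult_distrib)
      then show ?thesis using fin[OF XY(1)] fin[OF XY(2)] by simp
    qed
    have "(\<lambda>n. G (toc (X n) / toc (Y n)) ^ 3) \<longlonglongrightarrow> G z ^ 3"
      by (intro tendsto_intros isCont_tendsto_compose[OF cont[OF z] lim])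
    then show ?thesis unfolding G1 using LIMSEQ_unique tendsto_const by blast
  qed
  define c where "c = exp (Ln z / 3)"
  have "c ^ 3 = exp (Ln z)" unfolding c_def by (simp flip: exp_of_nat_mult)
  then have c3: "c * (c * c) = z" using z by (simp add: power3_eq_cube mult.assoc)
  have c0: "c \<noteq> 0" by (simp add: c_def)
  have "G z = G c * (G c * G c)" unfolding c3[symmetric] using c0 by (simp add: mult)
  also have "\<dots> = G c ^ 3" by (simp add: power3_eq_cube mult.assoc)
  finally show ?thesis using cube[OF c0] by simp
qed

section \<open>The character attached to \<alpha>, extracted from the Hecke character\<close>

locale psi_twist =
  fixes k :: nat and \<alpha> :: rat and h :: "complex set \<Rightarrow> complex" and y0 :: eis
  assumes k: "k \<ge> 2" and \<alpha>: "\<alpha> \<noteq> 0" and y0: "y0 \<noteq> 0"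
    and H: "hecke_character (princ (toc y0)) h"
    and P: "\<And>Q. nz_prime Q \<Longrightarrow> of_int (6 * rat_supp \<alpha>) \<notin> Q \<Longrightarrow>
       h Q = psi Q ^ (k - 1) * sextic (- 1) Q ^ (k - 1) * sextic (of_rat \<alpha>) Q"
begin

definition na :: int where "na = fst (quotient_of \<alpha>)"
definition nb :: int where "nb = snd (quotient_of \<alpha>)"
text \<open>One rational modulus for both characters. The 18 supplies 9 for \<open>chi1\<close> and
  the primes 2 and 3, \<open>na * nb\<close> supplies the primes of \<alpha>, and the norm of
  \<open>y0\<close> is a multiple of the generator \<open>y0\<close> of the Hecke modulus.\<close>

definition f :: nat where "f = 18 * nat \<bar>na * nb\<bar> * nat (eis_norm y0)"

lemma nb_pos: "nb > 0" and alpha_eq: "\<alpha> = of_int na / of_int nb"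
proof -
  have q: "quotient_of \<alpha> = (na, nb)" by (simp add: na_def nb_def)
  show "nb > 0" by (rule quotient_of_denom_pos[OF q])
  show "\<alpha> = of_int na / of_int nb" by (rule quotient_of_div[OF q])
qed

lemma na_nonzero: "na \<noteq> 0"
  using alpha_eq \<alpha> by (metis div_0 of_int_0)

lemma rat_supp_eq: "rat_supp \<alpha> = na * nb"
  by (simp add: rat_supp_def na_def nb_def)

lemma of_rat_alpha: "(of_rat \<alpha> :: complex) = toc (of_int na) / toc (of_int nb)"
proof -
  have "(of_rat \<alpha> :: complex) = of_rat (of_int na / of_int nb)" by (rule arg_cong[OF alpha_eq])
  then show ?thesis by (simp only: of_rat_divide of_rat_of_int_eq toc_of_int)
qed

lemma f_gt: "f > 1" and nine_dvd_f: "9 dvd f"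
proof -
  have "na * nb \<noteq> 0" using na_nonzero nb_pos by simp
  then have a: "nat \<bar>na * nb\<bar> \<ge> 1" by linarith
  have "eis_norm y0 > 0" using y0 by simp
  then have b: "nat (eis_norm y0) \<ge> 1" by linarith
  have "1 * 1 \<le> nat \<bar>na * nb\<bar> * nat (eis_norm y0)" using a b by (rule mult_le_mono)
  moreover have "f = 18 * (nat \<bar>na * nb\<bar> * nat (eis_norm y0))" by (simp add: f_def)
  ultimately show "f > 1" by linarith
  have "f = 9 * (2 * nat \<bar>na * nb\<bar> * nat (eis_norm y0))" by (simp add: f_def)
  then show "9 dvd f" by (rule dvdI)
qed

lemma dvd_f: "na dvd int f" "nb dvd int f" "6 * (na * nb) dvd int f" "3 dvd int f" "6 dvd int f" "eis_norm y0 dvd int f"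
proof -
  have "int f = 18 * \<bar>na * nb\<bar> * eis_norm y0" by (simp add: f_def)
  moreover have "na * nb dvd \<bar>na * nb\<bar>" by simp
  then obtain c where "\<bar>na * nb\<bar> = na * nb * c" by (auto simp: dvd_def)
  ultimately have e: "int f = 18 * (na * nb * c) * eis_norm y0" by simp
  show "na dvd int f" "nb dvd int f" "3 dvd int f" "6 dvd int f" "eis_norm y0 dvd int f" unfolding e by simp_all
  have "int f = 6 * (na * nb) * (3 * c * eis_norm y0)" unfolding e by simp
  then show "6 * (na * nb) dvd int f" by (rule dvdI)
qed

lemma of_int_dvd_f: "a dvd int f \<Longrightarrow> (of_int a :: eis) dvd of_nat f"
  using of_int_dvd_of_int_eis[of a "int f"] by simp

lemma coprime_f_not_dvd: "prime_elem (x :: eis) \<Longrightarrow> coprime x (of_nat f) \<Longrightarrow> y dvd of_nat f \<Longrightarrow> \<not> x dvd y"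
  by (metis coprime_common_divisor dvd_refl dvd_trans prime_elem_not_unit)

lemma coprime_f_3: "coprime (x :: eis) (of_nat f) \<Longrightarrow> coprime x 3"
  using of_int_dvd_f[OF dvd_f(4)] coprime_divisors[of x x 3 "of_nat f"] by simp

lemma prime_coprime_f:
  assumes "prime_elem (x :: eis)" "coprime x (of_nat f)"
  shows "\<not> x dvd 6" "\<not> x dvd of_int na" "\<not> x dvd of_int nb" "\<not> x dvd of_int (6 * (na * nb))"
proof -
  note nd = coprime_f_not_dvd[OF assms of_int_dvd_f]
  show "\<not> x dvd 6" using nd[OF dvd_f(5)] by simp
  show "\<not> x dvd of_int na" by (rule nd[OF dvd_f(1)])
  show "\<not> x dvd of_int nb" by (rule nd[OF dvd_f(2)])
  show "\<not> x dvd of_int (6 * (na * nb))" by (rule nd[OF dvd_f(3)])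
qed

lemma h_mult: "x \<noteq> 0 \<Longrightarrow> y \<noteq> 0 \<Longrightarrow> h (princ (toc (x * y))) = h (princ (toc x)) * h (princ (toc y))"
  using H unfolding hecke_character_def by (metis ideal_prod_princ nz_ideal_princ)

lemma h_1: "h (princ (toc 1)) = 1"
proof -
  obtain u s where "\<And>x. x \<in> carrier Zmu6 \<Longrightarrow> x \<noteq> 0 \<Longrightarrow> x - 1 \<in> princ (toc y0) \<Longrightarrow>
      h (princ x) = sgn x powi u * complex_of_real (norm x) powr s"
    using H unfolding hecke_character_def by blast
  from this[of "toc 1"] show ?thesis using toc_in_carrier[of 1] toc_in_princ[of 0 y0] by simp
qed

text \<open>The sextic symbol of \<alpha> as an element of \<open>eis\<close>, with the denominator
  cleared, so that divisibility arguments apply.\<close>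

definition sextic_unit :: "eis \<Rightarrow> eis" where
  "sextic_unit x = (SOME u. is_unit u \<and> x dvd of_int na ^ sextic_exp x - u * of_int nb ^ sextic_exp x)"

lemma sextic_unit:
  assumes "prime_elem x" "coprime x (of_nat f)"
  shows "is_unit (sextic_unit x)" "x dvd of_int na ^ sextic_exp x - sextic_unit x * of_int nb ^ sextic_exp x"
  using someI_ex[OF sextic_unit_exists[OF assms(1) prime_coprime_f(1-3)[OF assms]]] unfolding sextic_unit_def by auto

lemma h_prime:
  assumes x: "prime_elem x" "coprime x (of_nat f)"
  shows "h (princ (toc x)) = toc (primary x ^ (k - 1) * ((- 1) ^ sextic_exp x) ^ (k - 1) * sextic_unit x)"
proof -
  note nd = prime_coprime_f[OF x]
  have "of_int (6 * rat_supp \<alpha>) = toc (of_int (6 * (na * nb)))" by (simp only: toc_of_int rat_supp_eq)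
  then have "of_int (6 * rat_supp \<alpha>) \<notin> princ (toc x)" using nd(4) by (simp only: toc_in_princ not_False_eq_True)
  from P[OF nz_prime_princ[OF x(1)] this]
  have "h (princ (toc x)) = psi (princ (toc x)) ^ (k - 1) * sextic (- 1) (princ (toc x)) ^ (k - 1) * sextic (of_rat \<alpha>) (princ (toc x))" .
  also have "psi (princ (toc x)) = toc (primary x)" by (rule psi_princ[OF coprime_f_3[OF x(2)]])
  also have "sextic (of_rat \<alpha>) (princ (toc x)) = toc (sextic_unit x)"
    unfolding of_rat_alpha by (rule sextic_eqI[OF x(1) nd(1) nd(3) sextic_unit[OF x]])
  also have "sextic (- 1) (princ (toc x)) = toc ((- 1) ^ sextic_exp x)"
  proof -
    have "sextic (toc (- 1) / toc 1) (princ (toc x)) = toc ((- 1) ^ sextic_exp x)"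
      by (rule sextic_eqI[OF x(1) nd(1)]) (use x(1) in \<open>auto simp: prime_elem_def is_unit_power_iff\<close>)
    then show ?thesis by simp
  qed
  finally show ?thesis by simp
qed

text \<open>The cubic residue symbol of \<open>\<alpha>\<close>, expressed through \<open>h\<close>: periodicity then follows from that of the
  Hecke character, and no reciprocity law is needed.\<close>

definition chi2 :: "eis \<Rightarrow> complex" where
  "chi2 x = (if coprime x (of_nat f) then (h (princ (toc x)))\<^sup>2 / toc (primary x) ^ (2 * (k - 1)) else 0)"

lemma primary_nonzero: "coprime x (of_nat f) \<Longrightarrow> primary x \<noteq> 0"
proof
  assume x: "coprime x (of_nat f)" and "primary x = 0"
  obtain u where u: "is_unit u" "primary x = u * x" "3 dvd primary x - 1" by (rule primary[OF coprime_f_3[OF x]])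
  then have "3 dvd (- 1 :: eis)" using \<open>primary x = 0\<close> by simp
  then have "is_unit (3 :: eis)" by simp
  then show False by (simp add: eis_unit_iff_norm numeral_eis eis_norm_Eis)
qed

text \<open>Squaring removes the sign that comes from the symbol of -1, and turns the sextic symbol
  of \<alpha> into the cubic one.\<close>

lemma chi2_prime:
  assumes x: "prime_elem x" "coprime x (of_nat f)" shows "chi2 x = toc ((sextic_unit x)\<^sup>2)"
proof -
  have "(h (princ (toc x)))\<^sup>2 = toc (primary x) ^ (2 * (k - 1)) * toc ((((- 1) ^ sextic_exp x) ^ (k - 1))\<^sup>2) * toc ((sextic_unit x)\<^sup>2)"
    unfolding h_prime[OF x] by (simp add: power_mult_distrib power_mult[symmetric] mult.commute)
  also have "(((- 1 :: eis) ^ sextic_exp x) ^ (k - 1))\<^sup>2 = 1" by (simp add: power_mult[symmetric])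
  finally show ?thesis using x(2) primary_nonzero[OF x(2)] by (simp add: chi2_def)
qed

lemma coprime_f_nonzero: "coprime (x :: eis) (of_nat f) \<Longrightarrow> x \<noteq> 0"
proof
  assume "coprime x (of_nat f)" "x = 0"
  then have "is_unit (of_int (int f) :: eis)" by simp
  then have "(int f)\<^sup>2 = 1" unfolding eis_unit_iff_norm eis_norm_of_int .
  then show False using f_gt by (simp add: power2_eq_1_iff)
qed

lemma chi2_mult: "chi2 (x * y) = chi2 x * chi2 y"
proof (cases "coprime x (of_nat f) \<and> coprime y (of_nat f)")
  case True
  then have "x \<noteq> 0" "y \<noteq> 0" using coprime_f_nonzero by auto
  moreover have "primary (x * y) = primary x * primary y" using True coprime_f_3 by (intro primary_mult) auto
  then have "toc (primary (x * y)) = toc (primary x) * toc (primary y)" by simp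
  ultimately show ?thesis using True
    by (simp only: chi2_def h_mult coprime_mult_left_iff if_True simp_thms power_mult_distrib times_divide_times_eq)
qed (auto simp: chi2_def)

lemma chi2_unit: "is_unit u \<Longrightarrow> chi2 u = 1"
proof -
  assume u: "is_unit u"
  then have c: "coprime u (of_nat f)" by (simp add: is_unit_left_imp_coprime)
  have "princ (toc u) = princ (toc 1)" unfolding princ_eq_iff using u by simp
  moreover have "primary u = eis_cnj u * u"
    by (rule primary_eqI) (use u eis_unit_cnj[OF u] coprime_f_3[OF c] in \<open>auto simp: eis_unit_iff_norm mult.commute\<close>)
  then have "primary u = 1" using eis_unit_cnj[OF u] by (simp add: mult.commute)
  ultimately show ?thesis using c h_1 by (simp add: chi2_def)
qed

text \<open>The Hecke character is explicit at primes only. There the value is the square of a sixth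
  root of unity, and multiplicativity does the rest.\<close>

lemma chi2_cube: "coprime x (of_nat f) \<Longrightarrow> chi2 x ^ 3 = 1"
proof (induction x rule: prime_divisors_induct)
  case zero
  then show ?case using coprime_f_nonzero by blast
next
  case (unit u)
  then show ?case by (simp add: chi2_unit)
next
  case (factor q y)
  have q: "prime_elem q" "coprime q (of_nat f)" "coprime y (of_nat f)" using factor by auto
  have "chi2 q ^ 3 = toc (sextic_unit q ^ 6)" unfolding chi2_prime[OF q(1,2)] by (simp add: power_mult[symmetric])
  also have "\<dots> = 1" using eis_unit_power_6[OF sextic_unit(1)[OF q(1,2)]] by simp
  finally show ?case using factor.IH[OF q(3)] by (simp add: chi2_mult power_mult_distrib)
qed

lemma coprime_congruent_1: "of_nat f dvd (y :: eis) - 1 \<Longrightarrow> coprime y (of_nat f)"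
proof -
  assume "of_nat f dvd y - 1"
  then obtain z where "y - 1 = of_nat f * z" by (auto simp: dvd_def)
  then have "y = of_nat f * z + 1" by (simp only: diff_eq_eq)
  then show ?thesis by (simp add: coprime_shift)
qed

text \<open>For y congruent to 1 modulo f, \<open>h\<close> is given by its infinity type and y is
  its own primary generator. So \<open>chi2\<close> is there the restriction of a continuous
  homomorphism \<open>G\<close> on the nonzero complex numbers, and having cube roots of unity as
  values forces \<open>G\<close> to be trivial.\<close>

lemma chi2_congruent_1:
  assumes y: "of_nat f dvd y - 1" shows "chi2 y = 1"
proof -
  obtain u s where us: "\<And>x. x \<in> carrier Zmu6 \<Longrightarrow> x \<noteq> 0 \<Longrightarrow> x - 1 \<in> princ (toc y0) \<Longrightarrow>
      h (princ x) = sgn x powi u * complex_of_real (norm x) powr s"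
    using H unfolding hecke_character_def by blast
  define G where "G = (\<lambda>z. (sgn z powi u * complex_of_real (norm z) powr s)\<^sup>2 / z ^ (2 * (k - 1)))"
  have Gchi: "chi2 y = G (toc y)" if y: "of_nat f dvd y - 1" for y
  proof -
    have c: "coprime y (of_nat f)" by (rule coprime_congruent_1[OF y])
    have "y0 dvd of_nat f" using eis_dvd_norm[of y0] of_int_dvd_f[OF dvd_f(6)] dvd_trans by blast
    then have "toc (y - 1) \<in> princ (toc y0)" unfolding toc_in_princ using y dvd_trans by blast
    then have "h (princ (toc y)) = sgn (toc y) powi u * complex_of_real (norm (toc y)) powr s"
      using us[of "toc y"] coprime_f_nonzero[OF c] by simp
    moreover have "primary y = y"
    proof (rule primary_id)
      have "(3 :: eis) dvd of_nat f" using of_int_dvd_f[OF dvd_f(4)] by simp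
      then show "3 dvd y - 1" using y dvd_trans by blast
    qed
    ultimately show ?thesis using c by (simp add: chi2_def G_def)
  qed
  have "toc y \<noteq> 0" using coprime_f_nonzero[OF coprime_congruent_1[OF y]] by simp
  then have "G (toc y) = 1"
  proof (rule finite_order_character_trivial[OF f_gt, of G, rotated 3])
    show "G (toc y) ^ 3 = 1" if "of_nat f dvd y - 1" for y
      using chi2_cube[OF coprime_congruent_1[OF that]] by (simp add: Gchi[OF that])
    show "G (z * w) = G z * G w" if "z \<noteq> 0" "w \<noteq> 0" for z w
    proof -
      have "complex_of_real (norm z * norm w) powr s = complex_of_real (norm z) powr s * complex_of_real (norm w) powr s"
        unfolding of_real_mult by (rule powr_times_real) auto
      then show ?thesis by (simp add: G_def sgn_mult power_int_mult_distrib norm_mult power_mult_distrib)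
    qed
    show "isCont G z" if "z \<noteq> 0" for z
      unfolding G_def sgn_div_norm scaleR_conv_of_real isCont_def
      by (intro tendsto_intros tendsto_power_int) (use that in auto)
  qed
  then show ?thesis by (simp add: Gchi[OF y])
qed

lemma chi2_cubic_character: "cubic_character f chi2"
  unfolding cubic_character_def
proof (intro conjI allI impI)
  show "f > 0" using f_gt by simp
  show "chi2 (x * y) = chi2 x * chi2 y" for x y by (rule chi2_mult)
  show "chi2 u = 1" if "is_unit u" for u by (rule chi2_unit[OF that])
  show "chi2 x ^ 3 = 1" if "coprime x (of_nat f)" for x by (rule chi2_cube[OF that])
  show "chi2 x = 0" if "\<not> coprime x (of_nat f)" for x using that by (simp add: chi2_def)
  show "chi2 (of_nat f * y + x) = chi2 x" for x y
  proof (cases "coprime x (of_nat f)")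
    case True
    \<comment> \<open>An inverse u of x modulo f makes both u x and u (f y + x) congruent to 1,
      which reduces periodicity to \<open>chi2_congruent_1\<close>.\<close>
    define u v where "u = fst (bezout_coefficients x (of_nat f))" and "v = snd (bezout_coefficients x (of_nat f))"
    have uv: "u * x + v * of_nat f = 1"
      using True bezout_coefficients_fst_snd[of x "of_nat f"] by (simp add: u_def v_def coprime_iff_gcd_eq_1)
    have "u * x - 1 = of_nat f * (- v)" using uv by (simp add: algebra_simps eq_diff_eq diff_eq_eq)
    then have 1: "chi2 u * chi2 x = 1" by (metis chi2_congruent_1 chi2_mult dvd_triv_left)
    have "u * (of_nat f * y + x) - 1 = of_nat f * (u * y - v)" using uv by (simp add: algebra_simps eq_diff_eq diff_eq_eq)
    then have 2: "chi2 u * chi2 (of_nat f * y + x) = 1" by (metis chi2_congruent_1 chi2_mult dvd_triv_left)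
    show ?thesis using 1 2 by (metis mult_cancel_left mult_zero_left zero_neq_one)
  qed (simp add: chi2_def coprime_shift)
qed

lemma coprime_cnj_f: "coprime (eis_cnj x) (of_nat f) \<longleftrightarrow> coprime x (of_nat f)"
proof -
  have "coprime (eis_cnj x) (of_nat f)" if "coprime x (of_nat f)" for x
  proof (rule coprimeI)
    fix c assume "c dvd eis_cnj x" "c dvd of_nat f"
    then have "eis_cnj c dvd x" "eis_cnj c dvd of_nat f"
      using eis_cnj_dvd_iff[of c "eis_cnj x"] eis_cnj_dvd_iff[of c "of_nat f"] eis_cnj_simps(8)[of "int f"] by simp_all
    then have "is_unit (eis_cnj c)" using that coprime_common_divisor by blast
    then show "is_unit c" by (simp add: eis_unit_iff_norm)
  qed
  from this[of x] this[of "eis_cnj x"] show ?thesis by auto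
qed

lemma prime_elem_cnj: "prime_elem q \<Longrightarrow> prime_elem (eis_cnj q)"
proof (rule prime_elemI)
  assume q: "prime_elem q"
  show "eis_cnj q \<noteq> 0" using q eis_cnj_eq_iff[of q 0] by auto
  show "\<not> is_unit (eis_cnj q)" using q by (auto simp: eis_unit_iff_norm prime_elem_def)
  fix a b assume "eis_cnj q dvd a * b"
  then have "q dvd eis_cnj a * eis_cnj b" using eis_cnj_dvd_iff[of q "eis_cnj (a * b)"] by simp
  then have "q dvd eis_cnj a \<or> q dvd eis_cnj b" using q by (simp add: prime_elem_dvd_mult_iff)
  then show "eis_cnj q dvd a \<or> eis_cnj q dvd b" using eis_cnj_dvd_iff[of q "eis_cnj a"] eis_cnj_dvd_iff[of q "eis_cnj b"] by simp
qed

text \<open>The defining congruence involves \<alpha> only through the integers \<open>na\<close>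
  and \<open>nb\<close>, which conjugation fixes.\<close>

lemma sextic_unit_cnj:
  assumes x: "prime_elem x" "coprime x (of_nat f)" shows "sextic_unit (eis_cnj x) = eis_cnj (sextic_unit x)"
proof -
  have x': "prime_elem (eis_cnj x)" "coprime (eis_cnj x) (of_nat f)" using x prime_elem_cnj coprime_cnj_f by auto
  let ?t = "sextic_exp x"
  have t: "sextic_exp (eis_cnj x) = ?t" by (simp add: sextic_exp_def)
  have "eis_cnj x dvd eis_cnj (of_int na ^ ?t - sextic_unit x * of_int nb ^ ?t)" using sextic_unit(2)[OF x] eis_cnj_dvd_iff by blast
  then have 1: "eis_cnj x dvd of_int na ^ ?t - eis_cnj (sextic_unit x) * of_int nb ^ ?t" by simp
  have 2: "eis_cnj x dvd of_int na ^ ?t - sextic_unit (eis_cnj x) * of_int nb ^ ?t" using sextic_unit(2)[OF x'] by (simp add: t)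
  from dvd_diff[OF 1 2] have "eis_cnj x dvd (sextic_unit (eis_cnj x) - eis_cnj (sextic_unit x)) * of_int nb ^ ?t" by (simp add: algebra_simps)
  moreover have "\<not> eis_cnj x dvd of_int nb ^ ?t" using prime_elem_dvd_power[OF x'(1)] prime_coprime_f(3)[OF x'] by blast
  ultimately have "eis_cnj x dvd sextic_unit (eis_cnj x) - eis_cnj (sextic_unit x)" using prime_elem_dvd_mult_iff[OF x'(1)] by blast
  then show ?thesis
    using sextic_unit_unique[OF x'(1) prime_coprime_f(1)[OF x'] sextic_unit(1)[OF x'], of "eis_cnj (sextic_unit x)"] sextic_unit(1)[OF x]
    by (simp add: eis_unit_iff_norm)
qed

lemma chi2_cnj: "coprime x (of_nat f) \<Longrightarrow> chi2 (eis_cnj x) = cnj (chi2 x)"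
proof (induction x rule: prime_divisors_induct)
  case zero
  then show ?case using coprime_f_nonzero by blast
next
  case (unit u)
  then have "is_unit (eis_cnj u)" by (simp add: eis_unit_iff_norm)
  then show ?case using unit by (simp add: chi2_unit)
next
  case (factor q y)
  have q: "prime_elem q" "coprime q (of_nat f)" "coprime y (of_nat f)" using factor by auto
  have q': "prime_elem (eis_cnj q)" "coprime (eis_cnj q) (of_nat f)" using q prime_elem_cnj coprime_cnj_f by auto
  have "chi2 (eis_cnj q) = cnj (chi2 q)" unfolding chi2_prime[OF q(1,2)] chi2_prime[OF q'] sextic_unit_cnj[OF q(1,2)]
    by (simp only: cnj_toc eis_cnj_power)
  then show ?case using factor.IH[OF q(3)] by (simp add: chi2_mult)
qed

text \<open>An integer is its own conjugate, so the value is a real cube root of unity.\<close>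

lemma chi2_int: "coprime (of_int n) (of_nat f :: eis) \<Longrightarrow> chi2 (of_int n) = 1"
proof -
  assume c: "coprime (of_int n) (of_nat f :: eis)"
  let ?z = "chi2 (of_int n)"
  have "?z = cnj ?z" using chi2_cnj[OF c] by simp
  moreover have "?z\<^sup>2 = cnj ?z" by (rule cube_root_of_unity(4)[OF chi2_cube[OF c]])
  ultimately have "?z * ?z = ?z * 1" by (simp add: power2_eq_square)
  moreover have "?z \<noteq> 0" using chi2_cube[OF c] by auto
  ultimately show ?thesis by (simp only: mult_cancel_left simp_thms)
qed

end

section \<open>Primes above split primes\<close>

text \<open>For a root t modulo p, t^2 + t + 1 splits over \<int>[\<omega>] into conjugate factors
  with a coordinate 1 or -1. A prime associated to p would divide one of them, which is
  impossible.\<close>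

lemma split_prime_exists:
  assumes p: "prime p" "p mod 3 = 1"
  shows "\<exists>q. eis_norm q = int p"
proof -
  obtain t where t: "int p dvd t\<^sup>2 + t + 1" using cube_root_of_unity_mod[OF p] by blast
  have "eis_norm (of_nat p) = (int p)\<^sup>2" by (simp add: of_nat_eis eis_norm_Eis)
  then have Np: "eis_norm (of_nat p) \<noteq> 1" "(of_nat p :: eis) \<noteq> 0"
    using prime_gt_1_nat[OF p(1)] by (auto simp: power2_eq_1_iff of_nat_eis)
  then have "\<not> is_unit (of_nat p :: eis)" by (simp add: eis_unit_iff_norm)
  then obtain x :: eis where x: "prime x" "x dvd of_nat p" using prime_divisor_exists[of "of_nat p :: eis"] Np by blast
  have "eis_norm x dvd (int p)\<^sup>2" using eis_norm_dvd[OF x(2)] \<open>eis_norm (of_nat p) = (int p)\<^sup>2\<close> by simp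
  have pe: "prime_elem x" using x by auto
  then show ?thesis
  proof (cases rule: prime_elem_eis_cases)
    case (1 r)
    then have "int r dvd (int p)\<^sup>2" using \<open>eis_norm x dvd (int p)\<^sup>2\<close> by simp
    then have "int r dvd int p" using 1(1) prime_dvd_power[of "int r" "int p" 2] by simp
    then have "r = p" using 1(1) p(1) by (simp add: primes_dvd_imp_eq)
    then show ?thesis using 1 by blast
  next
    case (2 r u)
    then have "(int r)\<^sup>2 dvd (int p)\<^sup>2" using \<open>eis_norm x dvd (int p)\<^sup>2\<close> by simp
    then have "int r dvd (int p)\<^sup>2" by (metis dvd_mult_left power2_eq_square)
    then have "int r dvd int p" using 2(1) prime_dvd_power[of "int r" "int p" 2] by simp
    then have rp: "r = p" using 2(1) p(1) by (simp add: primes_dvd_imp_eq)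
    have xd: "x dvd y \<longleftrightarrow> of_int (int p) dvd y" for y using 2(3,4) rp by (simp add: mult_unit_dvd_iff')
    have "of_int (t\<^sup>2 + t + 1) = (of_int t - eis_omega) * (of_int t - Eis 0 (-1))"
      by (simp add: of_int_eis power2_eq_square algebra_simps)
    moreover have "x dvd of_int (t\<^sup>2 + t + 1)" using xd of_int_dvd_of_int_eis[OF t] by blast
    ultimately have "x dvd of_int t - eis_omega \<or> x dvd of_int t - Eis 0 (-1)"
      using prime_elem_dvd_mult_iff[OF pe] by metis
    then have "int p dvd 1 \<or> int p dvd - 1" unfolding xd of_int_dvd_eis_iff by (auto simp: of_int_eis)
    then show ?thesis using p(1) by auto
  qed
qed

definition prime_above :: "nat \<Rightarrow> eis" where "prime_above p = normalize (SOME q. eis_norm q = int p)"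

lemma eis_norm_normalize [simp]: "eis_norm (normalize x) = eis_norm x"
proof (cases "x = 0")
  case False
  have "eis_norm x = eis_norm (unit_factor x) * eis_norm (normalize x)" by (simp flip: eis_norm_mult)
  moreover have "eis_norm (unit_factor x) = 1" using False eis_unit_iff_norm[of "unit_factor x"] by simp
  ultimately show ?thesis by simp
qed simp

lemma prime_above:
  assumes "prime p" "p mod 3 = 1"
  shows "eis_norm (prime_above p) = int p" "normalize (prime_above p) = prime_above p" "prime (prime_above p)" "prime (normalize (eis_cnj (prime_above p)))"
proof -
  show N: "eis_norm (prime_above p) = int p" using someI_ex[OF split_prime_exists[OF assms]] by (simp add: prime_above_def)
  show n: "normalize (prime_above p) = prime_above p" by (simp add: prime_above_def)
  have pe: "prime_elem q" if "eis_norm q = int p" for q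
  proof -
    interpret split_prime p q by standard (use assms that in auto)
    show ?thesis by (rule prime_elem_q)
  qed
  show "prime (prime_above p)" using pe[OF N] n by (simp add: prime_def)
  have "prime_elem (eis_cnj (prime_above p))" by (rule pe) (simp add: N)
  then show "prime (normalize (eis_cnj (prime_above p)))" by (simp add: prime_def)
qed

lemma split_primes_of_norm:
  assumes p: "prime p" "p mod 3 = 1" and x: "eis_norm x = int p" and y: "eis_norm y = int p"
  shows "(x dvd y \<and> y dvd x) \<or> (x dvd eis_cnj y \<and> eis_cnj y dvd x)"
proof -
  interpret x: split_prime p x by standard (use p x in auto)
  have "x dvd y * eis_cnj y" unfolding eis_mult_cnj y using x.q_dvd_p by simp
  then have "x dvd y \<or> x dvd eis_cnj y" by (simp only: x.q_dvd_mult_iff)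
  moreover have "z dvd x" if z: "x dvd z" "eis_norm z = int p" for z
  proof -
    obtain c where c: "z = x * c" using z(1) by (elim dvdE)
    have "int p * eis_norm c = int p * 1" using z(2) x by (simp add: c eis_norm_mult)
    then have "is_unit c" using prime_gt_0_nat[OF p(1)] by (simp add: eis_unit_iff_norm)
    then show ?thesis by (simp add: c)
  qed
  ultimately show ?thesis using y eis_cnj_simps(9) by metis
qed

text \<open>Otherwise q divides the trace 2a + b, and 4p = (2a + b)^2 + 3b^2 makes p divide b, then
  a, so that p^2 divides p.\<close>

lemma not_dvd_cnj:
  assumes p: "prime p" "p mod 3 = 1" and q: "eis_norm q = int p"
  shows "\<not> q dvd eis_cnj q"
proof
  assume d: "q dvd eis_cnj q"
  interpret split_prime p q by standard (use p q in auto)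
  obtain a b where ab: "q = Eis a b" by (cases q)
  have s: "q + eis_cnj q = of_int (2 * a + b)" by (simp add: ab eis_cnj_def of_int_eis)
  have "q dvd q + eis_cnj q" using d by simp
  then have p1: "int p dvd 2 * a + b" unfolding s q_dvd_of_int_iff .
  have N: "a\<^sup>2 + a * b + b\<^sup>2 = int p" using q ab by (simp add: eis_norm_Eis)
  have "4 * int p = (2 * a + b) * (2 * a + b) + 3 * (b * b)" unfolding N[symmetric] by (simp add: power2_eq_square algebra_simps)
  then have "3 * (b * b) = 4 * int p - (2 * a + b) * (2 * a + b)" by simp
  moreover have "int p dvd 4 * int p - (2 * a + b) * (2 * a + b)" using p1 by (intro dvd_diff) auto
  ultimately have "int p dvd 3 * (b * b)" by metis
  moreover have "\<not> int p dvd 3" using p_gt zdvd_imp_le[of "int p" 3] by auto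
  ultimately have b: "int p dvd b" by (simp only: p_dvd_mult_iff simp_thms)
  have "int p dvd (2 * a + b) - b" by (rule dvd_diff[OF p1 b])
  then have "int p dvd 2 * a" by simp
  moreover have "\<not> int p dvd 2" using p_gt zdvd_imp_le[of "int p" 2] by auto
  ultimately have a: "int p dvd a" by (simp only: p_dvd_mult_iff simp_thms)
  obtain a' b' where "a = int p * a'" "b = int p * b'" using a b by (auto simp: dvd_def)
  then have "int p * (int p * (a'\<^sup>2 + a' * b' + b'\<^sup>2)) = int p * 1" using N by (simp add: power2_eq_square algebra_simps)
  then have "int p * (a'\<^sup>2 + a' * b' + b'\<^sup>2) = 1" using p_gt by simp
  then have "int p dvd 1" by (metis dvd_triv_left)
  then show False using p_gt by simp
qed

section \<open>From primes of \<int>[\<omega>] to rational primes\<close>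

abbreviation split_primes :: "nat set" where "split_primes \<equiv> {p. prime p \<and> p mod 3 = 1}"

text \<open>Above each p congruent to 1 modulo 3 there are two normalised primes, conjugate and of
  norm p, with equal weights. The others have norm 3, finitely many, or norm p^2, where the sum is
  dominated by that of n^-2.\<close>

lemma eis_prime_sum_split:
  fixes w :: "eis \<Rightarrow> real" and v :: "nat \<Rightarrow> real"
  assumes bound: "\<And>q. \<bar>w q\<bar> \<le> 1"
    and w: "\<And>p q. prime p \<Longrightarrow> p mod 3 = 1 \<Longrightarrow> eis_norm q = int p \<Longrightarrow> w q = v p"
  obtains C where "\<And>s. 1 < s \<Longrightarrow> s < 2 \<Longrightarrow>
    \<bar>eis_prime_sum w s - 2 * infsum (\<lambda>p. v p * real p powr - s) split_primes\<bar> \<le> C"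
proof -
  define Q1 where "Q1 = prime_above ` split_primes"
  define Q2 where "Q2 = (\<lambda>p. normalize (eis_cnj (prime_above p))) ` split_primes"
  define R where "R = {q. prime q} - (Q1 \<union> Q2)"
  have inj1: "inj_on prime_above split_primes"
  proof (rule inj_onI)
    fix p p' assume p: "p \<in> split_primes" "p' \<in> split_primes" and e: "prime_above p = prime_above p'"
    have "eis_norm (prime_above p) = int p" "eis_norm (prime_above p') = int p'" using p prime_above(1) by auto
    then have "int p = int p'" using e by metis
    then show "p = p'" by simp
  qed
  have inj2: "inj_on (\<lambda>p. normalize (eis_cnj (prime_above p))) split_primes"
  proof (rule inj_onI)
    fix p p' assume p: "p \<in> split_primes" "p' \<in> split_primes"
      and e: "normalize (eis_cnj (prime_above p)) = normalize (eis_cnj (prime_above p'))"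
    have "eis_norm (normalize (eis_cnj (prime_above p))) = int p" "eis_norm (normalize (eis_cnj (prime_above p'))) = int p'"
      using p prime_above(1) by auto
    then have "int p = int p'" using e by metis
    then show "p = p'" by simp
  qed
  have sub: "Q1 \<subseteq> {q. prime q}" "Q2 \<subseteq> {q. prime q}" using prime_above by (auto simp: Q1_def Q2_def)
  have disj: "Q1 \<inter> Q2 = {}"
  proof (rule ccontr)
    assume "Q1 \<inter> Q2 \<noteq> {}"
    then obtain p p' where p: "p \<in> split_primes" "p' \<in> split_primes" "prime_above p = normalize (eis_cnj (prime_above p'))"
      by (auto simp: Q1_def Q2_def)
    have "eis_norm (prime_above p) = int p" "eis_norm (normalize (eis_cnj (prime_above p'))) = int p'" using p(1,2) prime_above(1) by auto
    then have "int p = int p'" using p(3) by metis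
    then have "p' = p" by simp
    then have "prime_above p = normalize (eis_cnj (prime_above p))" using p(3) by (simp only:)
    then have "prime_above p dvd eis_cnj (prime_above p)" by (metis dvd_refl normalize_dvd_iff)
    then show False using not_dvd_cnj[of p "prime_above p"] prime_above(1)[of p] p(1) by simp
  qed
  have R: "eis_norm q = 3 \<or> (\<exists>p. prime p \<and> eis_norm q = (int p)\<^sup>2 \<and> q = normalize (of_nat p))" if "q \<in> R" for q
  proof -
    have q: "prime q" "q \<notin> Q1" "q \<notin> Q2" using that by (auto simp: R_def)
    then have "prime_elem q" by auto
    then show ?thesis
    proof (cases rule: prime_elem_eis_cases)
      case (1 p)
      have "int p mod 3 \<noteq> 2" using eis_norm_mod_3[of q] square_mod_3 1(2) by metis
      moreover have "p mod 3 \<noteq> 1"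
      proof
        assume p3: "p mod 3 = 1"
        from split_primes_of_norm[OF 1(1) p3 1(2) prime_above(1)[OF 1(1) p3]]
        have "normalize q = normalize (prime_above p) \<or> normalize q = normalize (eis_cnj (prime_above p))"
          using associatedI by blast
        then have "q = prime_above p \<or> q = normalize (eis_cnj (prime_above p))"
          using q(1) prime_above(2)[OF 1(1) p3] by (simp add: prime_def)
        then show False using q 1(1) p3 by (auto simp: Q1_def Q2_def)
      qed
      ultimately have "3 dvd p" by presburger
      then have "p = 3" using 1(1) primes_dvd_imp_eq[of 3 p] by simp
      then show ?thesis using 1(2) by simp
    next
      case (2 p u)
      have "normalize q = normalize (of_nat p)" using 2(3,4) by (simp add: normalize_mult_unit_left)
      then have "q = normalize (of_nat p)" using normalize_prime[OF q(1)] by metis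
      then show ?thesis using 2(1,2) by blast
    qed
  qed
  define R1 where "R1 = {q \<in> R. eis_norm q = 3}"
  define R2 where "R2 = R - R1"
  have R2: "\<exists>p. prime p \<and> eis_norm q = (int p)\<^sup>2 \<and> q = normalize (of_nat p)" if "q \<in> R2" for q
    using R[of q] that by (auto simp: R2_def R1_def)
  have fin1: "finite R1"
  proof (rule finite_subset[OF _ finite_eis_box[of 2]])
    show "R1 \<subseteq> {x. eis_max x \<le> 2}"
    proof
      fix q assume "q \<in> R1"
      then have "3 * (int (eis_max q))\<^sup>2 \<le> 12" using eis_norm_ge_max[of q] by (simp add: R1_def)
      then have "(int (eis_max q))\<^sup>2 \<le> 2\<^sup>2" by simp
      then have "int (eis_max q) \<le> 2" by (rule power2_le_imp_le) simp
      then show "q \<in> {x. eis_max x \<le> 2}" by simp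
    qed
  qed
  obtain pp where pp: "\<And>q. q \<in> R2 \<Longrightarrow> prime (pp q) \<and> eis_norm q = (int (pp q))\<^sup>2 \<and> q = normalize (of_nat (pp q))"
    using R2 by metis
  have injp: "inj_on pp R2" by (rule inj_onI) (metis pp)
  define C where "C = real (card R1) + infsum (\<lambda>n. real n powr - 2) {1..}"
  have "\<bar>eis_prime_sum w s - 2 * infsum (\<lambda>p. v p * real p powr - s) split_primes\<bar> \<le> C" if s: "1 < s" "s < 2" for s
  proof -
    let ?g = "\<lambda>q. w q * eis_pow s q"
    have summ: "?g summable_on {q. prime q}" by (rule eis_prime_sum_summable[where B = 1]) (use s bound in auto)
    have s1: "?g summable_on Q1" "?g summable_on Q2" "?g summable_on (Q1 \<union> Q2)" "?g summable_on R"
      by (rule summable_on_subset_banach[OF summ]; use sub in \<open>auto simp: R_def\<close>)+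
    have "{q. prime q} = (Q1 \<union> Q2) \<union> R" using sub by (auto simp: R_def)
    then have "eis_prime_sum w s = infsum ?g ((Q1 \<union> Q2) \<union> R)" by (simp add: eis_prime_sum_def)
    also have "\<dots> = infsum ?g (Q1 \<union> Q2) + infsum ?g R"
      by (rule infsum_Un_disjoint) (use s1 in \<open>auto simp: R_def\<close>)
    also have "infsum ?g (Q1 \<union> Q2) = infsum ?g Q1 + infsum ?g Q2"
      by (rule infsum_Un_disjoint) (use s1 disj in auto)
    also have "infsum ?g Q1 = infsum (\<lambda>p. v p * real p powr - s) split_primes"
      unfolding Q1_def infsum_reindex[OF inj1] o_def
      by (rule infsum_cong) (use w[OF _ _ prime_above(1)] prime_above(1) in auto)
    also have "infsum ?g Q2 = infsum (\<lambda>p. v p * real p powr - s) split_primes"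
      unfolding Q2_def infsum_reindex[OF inj2] o_def
    proof (rule infsum_cong)
      fix p assume p: "p \<in> split_primes"
      then have "eis_norm (normalize (eis_cnj (prime_above p))) = int p" using prime_above(1)[of p] by simp
      then show "w (normalize (eis_cnj (prime_above p))) * eis_pow s (normalize (eis_cnj (prime_above p))) = v p * real p powr - s"
        using w[of p "normalize (eis_cnj (prime_above p))"] p by simp
    qed
    finally have e: "eis_prime_sum w s - 2 * infsum (\<lambda>p. v p * real p powr - s) split_primes = infsum ?g R" by simp
    have zs: "eis_pow s summable_on {q. prime q}" using eis_prime_sum_summable[of s "\<lambda>_. 1" 1] s by simp
    have zR: "eis_pow s summable_on R1" "eis_pow s summable_on R2" "eis_pow s summable_on R"
      by (rule summable_on_subset_banach[OF zs]; auto simp: R_def R1_def R2_def)+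
    have "\<bar>infsum ?g R\<bar> \<le> infsum (eis_pow s) R"
    proof -
      have "norm (infsum ?g R) \<le> infsum (eis_pow s) R"
      proof (rule norm_infsum_le[OF has_sum_infsum[OF s1(4)] has_sum_infsum[OF zR(3)]])
        show "norm (?g q) \<le> eis_pow s q" for q
          using mult_right_mono[OF bound[of q], of "eis_pow s q"] by (simp add: abs_mult)
      qed
      then show ?thesis by simp
    qed
    also have "infsum (eis_pow s) R = infsum (eis_pow s) R1 + infsum (eis_pow s) R2"
    proof -
      have "R = R1 \<union> R2" by (auto simp: R1_def R2_def)
      then show ?thesis using infsum_Un_disjoint[OF zR(1,2)] by (simp add: R2_def)
    qed
    also have "infsum (eis_pow s) R1 \<le> real (card R1)"
    proof -
      have "infsum (eis_pow s) R1 = sum (eis_pow s) R1" using fin1 by simp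
      also have "\<dots> \<le> (\<Sum>q\<in>R1. 1)"
      proof (rule sum_mono)
        fix q assume "q \<in> R1"
        then have "eis_pow s q = 3 powr - s" by (simp add: R1_def)
        also have "\<dots> \<le> 3 powr 0" by (rule powr_mono) (use s in auto)
        finally show "eis_pow s q \<le> 1" by simp
      qed
      finally show ?thesis by simp
    qed
    also have "infsum (eis_pow s) R2 \<le> infsum (\<lambda>n. real n powr - 2) {1..}"
    proof -
      have z2: "(\<lambda>n. real n powr - 2) summable_on {1..}" using nat_zeta_bounds(1)[of 2] by simp
      have psub: "pp ` R2 \<subseteq> {1..}" using pp prime_ge_1_nat by fastforce
      have z3: "(\<lambda>n. real n powr - 2) summable_on pp ` R2" by (rule summable_on_subset_banach[OF z2 psub])
      have z4: "((\<lambda>n. real n powr - 2) \<circ> pp) summable_on R2" using summable_on_reindex[OF injp] z3 by blast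
      have "infsum (eis_pow s) R2 \<le> infsum ((\<lambda>n. real n powr - 2) \<circ> pp) R2"
      proof (rule infsum_mono[OF zR(2) z4])
        fix q assume q: "q \<in> R2"
        have p1: "real (pp q) \<ge> 1" using pp[OF q] prime_ge_1_nat by auto
        have "real_of_int (eis_norm q) = (real (pp q))\<^sup>2" using pp[OF q] by simp
        moreover have "(real (pp q))\<^sup>2 \<ge> 1" using p1 by simp
        ultimately have "eis_pow s q \<le> ((real (pp q))\<^sup>2) powr - 1" using s by (simp only:) (intro powr_mono, auto)
        also have "\<dots> = real (pp q) powr - 2"
          using powr_realpow[of "real (pp q)" 2] powr_powr[of "real (pp q)" 2 "- 1"] p1 by simp
        finally show "eis_pow s q \<le> ((\<lambda>n. real n powr - 2) \<circ> pp) q" by simp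
      qed
      also have "\<dots> = infsum (\<lambda>n. real n powr - 2) (pp ` R2)" by (rule infsum_reindex[OF injp, symmetric])
      also have "\<dots> \<le> infsum (\<lambda>n. real n powr - 2) {1..}"
        by (rule infsum_mono2[OF z3 z2 psub]) simp
      finally show ?thesis .
    qed
    finally have "\<bar>infsum ?g R\<bar> \<le> C" by (simp add: C_def)
    then show ?thesis using e by simp
  qed
  then show ?thesis using that by blast
qed

text \<open>The two primes above each p in \<open>S\<close> account for the division by 2.\<close>

lemma log_density_of_weights:
  assumes bound: "\<And>q. \<bar>w q\<bar> \<le> 1" and S: "S \<subseteq> split_primes"
    and w: "\<And>p q. prime p \<Longrightarrow> p mod 3 = 1 \<Longrightarrow> eis_norm q = int p \<Longrightarrow> w q = (if p \<in> S then 1 else 0)"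
    and sum: "\<And>s. 1 < s \<Longrightarrow> s < 2 \<Longrightarrow> \<bar>eis_prime_sum w s - d * ln (1 / (s - 1))\<bar> \<le> C"
  shows "log_density S (d / 2)"
proof -
  obtain C' where C': "\<And>s. 1 < s \<Longrightarrow> s < 2 \<Longrightarrow>
    \<bar>eis_prime_sum w s - 2 * infsum (\<lambda>p. (if p \<in> S then 1 else 0) * real p powr - s) split_primes\<bar> \<le> C'"
    using eis_prime_sum_split[of w "\<lambda>p. if p \<in> S then 1 else 0", OF bound w] by blast
  have "\<bar>prime_sum S s - d / 2 * ln (1 / (s - 1))\<bar> \<le> (C + C') / 2" if s: "1 < s" "s < 2" for s
  proof -
    have e: "infsum (\<lambda>p. (if p \<in> S then 1 else 0) * real p powr - s) split_primes = prime_sum S s"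
      unfolding prime_sum_def by (rule infsum_cong_neutral) (use S in auto)
    define L where "L = d * ln (1 / (s - 1))"
    have L: "d / 2 * ln (1 / (s - 1)) = L / 2" by (simp add: L_def)
    have "\<bar>eis_prime_sum w s - 2 * prime_sum S s\<bar> \<le> C'" using C'[OF s] unfolding e .
    moreover have "\<bar>eis_prime_sum w s - L\<bar> \<le> C" using sum[OF s] unfolding L_def .
    ultimately have "eis_prime_sum w s - 2 * prime_sum S s \<le> C'" "2 * prime_sum S s - eis_prime_sum w s \<le> C'"
      "eis_prime_sum w s - L \<le> C" "L - eis_prime_sum w s \<le> C"
      by (simp_all only: abs_le_iff minus_diff_eq)
    then have "2 * prime_sum S s - L \<le> C + C'" "- (2 * prime_sum S s - L) \<le> C + C'" by linarith+
    then have "\<bar>2 * prime_sum S s - L\<bar> / 2 \<le> (C + C') / 2" by (intro divide_right_mono) (simp_all only: abs_le_iff)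
    moreover have "\<bar>prime_sum S s - L / 2\<bar> = \<bar>2 * prime_sum S s - L\<bar> / 2" by (simp add: abs_if)
    ultimately show ?thesis unfolding L by (simp only:)
  qed
  then show ?thesis unfolding log_density_def by blast
qed

lemma log_density_split_primes: "log_density split_primes (1 / 2)"
proof -
  obtain C where "\<And>s. 1 < s \<Longrightarrow> s < 2 \<Longrightarrow> \<bar>eis_prime_sum (\<lambda>q. 1) s - ln (1 / (s - 1))\<bar> \<le> C"
    using eis_prime_sum_one by blast
  then show ?thesis using log_density_of_weights[of "\<lambda>_. 1" split_primes 1 C] by simp
qed

section \<open>The coefficients at split primes\<close>

lemma cube_root_power_eq_1_iff:
  fixes z :: "'a :: monoid_mult"
  assumes "z ^ 3 = 1" shows "z ^ t = 1 \<longleftrightarrow> 3 dvd t \<or> z = 1"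
proof -
  define r where "r = t mod 3"
  have e: "z ^ t = z ^ r"
  proof -
    have "z ^ (3 * (t div 3) + t mod 3) = z ^ (t mod 3)" unfolding power_add power_mult assms by simp
    then show ?thesis by (simp add: r_def)
  qed
  have d: "3 dvd t \<longleftrightarrow> r = 0" by (simp add: r_def dvd_eq_mod_eq_0)
  have "z = 1" if "z ^ 2 = 1"
  proof -
    have "z ^ 3 = z ^ 2 * z" by (simp add: power3_eq_cube power2_eq_square)
    then show ?thesis using that assms by simp
  qed
  moreover have "r = 0 \<or> r = 1 \<or> r = 2" unfolding r_def by presburger
  ultimately show ?thesis unfolding e d by auto
qed

lemma eis_trace: "x + eis_cnj x = of_int (2 * eis_fst x + eis_snd x)"
  by (cases x) (simp add: eis_cnj_def of_int_eis)

lemma idl_coprime_of_coprime: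
  "coprime x y \<Longrightarrow> idl_coprime (princ (toc x)) (princ (toc y))"
  by (rule idl_coprime_princ[of "fst (bezout_coefficients x y)" _ "snd (bezout_coefficients x y)"])
     (simp add: bezout_coefficients_fst_snd coprime_iff_gcd_eq_1)

lemma coprime_of_int_eis:
  assumes "coprime a b" shows "coprime (of_int a) (of_int b :: eis)"
proof (rule coprimeI)
  fix c :: eis assume c: "c dvd of_int a" "c dvd of_int b"
  define u v where "u = fst (bezout_coefficients a b)" and "v = snd (bezout_coefficients a b)"
  have "u * a + v * b = 1"
    using assms bezout_coefficients_fst_snd[of a b] by (simp add: u_def v_def coprime_iff_gcd_eq_1)
  then have e: "of_int u * of_int a + of_int v * of_int b = (1 :: eis)" by (metis of_int_1 of_int_add of_int_mult)
  have "c dvd of_int u * of_int a + of_int v * of_int b" by (rule dvd_add[OF dvd_mult[OF c(1)] dvd_mult[OF c(2)]])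
  then show "is_unit c" unfolding e .
qed

lemma rat_cong_of_int:
  assumes p: "prime p" shows "rat_cong p (of_int a) y \<longleftrightarrow> int p dvd a - y"
proof
  assume "rat_cong p (of_int a) y"
  then obtain b c where bc: "\<not> int p dvd c" "(of_int a :: complex) = of_int b / of_int c" "[b = c * y] (mod int p)"
    unfolding rat_cong_def by blast
  have "c \<noteq> 0" using bc(1) by auto
  then have "(of_int (a * c) :: complex) = of_int b" using bc(2) by simp
  then have "a * c = b" by (simp only: of_int_eq_iff)
  then have "int p dvd a * c - c * y" using bc(3) by (simp add: cong_iff_dvd_diff)
  then have "int p dvd c * (a - y)" by (simp add: algebra_simps)
  then show "int p dvd a - y" using bc(1) p by (simp add: prime_dvd_mult_iff)
next
  assume "int p dvd a - y"
  then have "[a = 1 * y] (mod int p)" by (simp add: cong_iff_dvd_diff)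
  moreover have "\<not> int p dvd 1" using p by auto
  ultimately show "rat_cong p (of_int a) y" unfolding rat_cong_def by (intro exI[of _ a] exI[of _ 1]) simp
qed

locale twist_split = psi_twist k \<alpha> h y0 + split_prime p q for k \<alpha> h y0 p q +
  assumes pf: "\<not> p dvd f"
begin

lemma not_dvd_divisor_f: "a dvd int f \<Longrightarrow> \<not> int p dvd a"
  using pf dvd_trans int_dvd_int_iff by blast

lemma coprime_q: "coprime q (of_nat f)"
proof -
  have "\<not> q dvd of_int (int f)" unfolding q_dvd_of_int_iff using pf by simp
  then have "\<not> q dvd of_nat f" by simp
  then show ?thesis by (rule prime_elem_imp_coprime[OF prime_elem_q])
qed

lemma three_supp_dvd_f: "3 * (na * nb) dvd int f"
proof -
  have "6 * (na * nb) = 3 * (na * nb) * 2" by simp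
  then have "3 * (na * nb) dvd 6 * (na * nb)" by (rule dvdI)
  then show ?thesis using dvd_f(3) by (rule dvd_trans)
qed

lemma coprime_p_supp: "coprime (int p) (3 * rat_supp \<alpha>)"
  unfolding rat_supp_eq using not_dvd_divisor_f[OF three_supp_dvd_f] p by (intro prime_imp_coprime) auto

text \<open>The ideals of norm p are the two conjugate primes above p; \<open>not_dvd_cnj\<close>
  keeps them distinct, so that the sum really has two terms.\<close>

lemma g_coeff_split: "g_coeff \<alpha> h p = h (princ (toc q)) + h (princ (toc (eis_cnj q)))"
proof -
  let ?M = "princ (of_int (3 * rat_supp \<alpha>))"
  have M: "?M = princ (toc (of_int (3 * (na * nb))))" by (simp only: toc_of_int rat_supp_eq)
  have ideal: "princ (toc y) \<in> {I. nz_ideal I \<and> idl_norm I = p \<and> idl_coprime I ?M}"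
    if y: "eis_norm y = int p" "coprime y (of_nat f)" for y
  proof -
    have y_nz: "y \<noteq> 0" using y(1) p_gt by auto
    have "coprime y (of_int (3 * (na * nb)))"
      by (rule coprime_divisors[OF dvd_refl of_int_dvd_f[OF three_supp_dvd_f] y(2)])
    then have "idl_coprime (princ (toc y)) ?M" unfolding M by (rule idl_coprime_of_coprime)
    moreover have "idl_norm (princ (toc y)) = p" using idl_norm_princ[OF y_nz] y(1) by simp
    ultimately show ?thesis using y_nz nz_ideal_princ by blast
  qed
  have "{I. nz_ideal I \<and> idl_norm I = p \<and> idl_coprime I ?M} = {princ (toc q), princ (toc (eis_cnj q))}"
  proof (intro equalityI subsetI)
    fix I assume "I \<in> {I. nz_ideal I \<and> idl_norm I = p \<and> idl_coprime I ?M}"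
    then have I: "nz_ideal I" "idl_norm I = p" by auto
    obtain x where x: "x \<noteq> 0" "I = princ (toc x)" by (rule nz_ideal_principal[OF I(1)])
    have "nat (eis_norm x) = p" using I(2) idl_norm_princ[OF x(1)] x(2) by simp
    then have N: "eis_norm x = int p" using eis_norm_nonneg[of x] by linarith
    have "princ (toc x) = princ (toc q) \<or> princ (toc x) = princ (toc (eis_cnj q))"
      unfolding princ_eq_iff by (rule split_primes_of_norm[OF p p1 N Nq])
    then show "I \<in> {princ (toc q), princ (toc (eis_cnj q))}" unfolding x(2) by blast
  next
    fix I assume "I \<in> {princ (toc q), princ (toc (eis_cnj q))}"
    then have "I = princ (toc q) \<or> I = princ (toc (eis_cnj q))" by blast
    moreover have "eis_norm (eis_cnj q) = int p" using Nq by simp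
    moreover have "coprime (eis_cnj q) (of_nat f)" using coprime_q by (simp only: coprime_cnj_f)
    ultimately show "I \<in> {I. nz_ideal I \<and> idl_norm I = p \<and> idl_coprime I ?M}"
      using ideal[OF Nq coprime_q] ideal[of "eis_cnj q"] by metis
  qed
  then have "g_coeff \<alpha> h p = sum h {princ (toc q), princ (toc (eis_cnj q))}" unfolding g_coeff_def by (rule arg_cong)
  moreover have "princ (toc q) \<noteq> princ (toc (eis_cnj q))"
    unfolding princ_eq_iff using not_dvd_cnj[OF p p1 Nq] by blast
  moreover have "sum h {I, J} = h I + h J" if "I \<noteq> J" for I J using that by simp
  ultimately show ?thesis by metis
qed

lemma m_eq: "m = 2 * sextic_exp q"
proof -
  obtain t where t: "m = 2 * t" using m_even by (elim evenE)
  have "nat (eis_norm q) - 1 = 6 * t" using p_minus_1 by (simp add: Nq t)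
  then show ?thesis by (simp add: sextic_exp_def t)
qed

lemma chi1_q: "chi1 f q = 1 \<longleftrightarrow> 3 dvd sextic_exp q"
proof -
  have "(int p - 1) div 3 = int m" using pm by simp
  then have "chi1 f q = omega3 ^ m" using coprime_q by (simp add: chi1_def Nq)
  then have "chi1 f q = 1 \<longleftrightarrow> 3 dvd m" by (simp only: omega3_power_eq_1_iff)
  also have "\<dots> \<longleftrightarrow> 3 dvd sextic_exp q" unfolding m_eq by presburger
  finally show ?thesis .
qed

lemma chi2_q: "chi2 q = 1 \<longleftrightarrow> (sextic_unit q)\<^sup>2 = 1"
proof -
  have "chi2 q = 1 \<longleftrightarrow> toc ((sextic_unit q)\<^sup>2) = toc 1" unfolding chi2_prime[OF prime_elem_q coprime_q] by (simp only: toc_1)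
  then show ?thesis by (simp only: toc_inject)
qed

lemma unit_eq_iff: "is_unit u \<Longrightarrow> is_unit v \<Longrightarrow> q dvd u - v \<longleftrightarrow> u = v"
  using sextic_unit_unique[OF prime_elem_q prime_coprime_f(1)[OF prime_elem_q coprime_q], of u v]
  by (metis diff_self dvd_0_right)

lemma is_unit_sextic_unit: "is_unit (sextic_unit q)"
  by (rule sextic_unit(1)[OF prime_elem_q coprime_q])

text \<open>As m is twice the sextic exponent, the square of the sextic congruence says that na^m is
  congruent to u^2 nb^m, where u is the sextic unit. So the condition means that the m-th power of
  \<alpha> is 1 modulo p, as in Euler's criterion.\<close>

lemma chi2_q_iff: "chi2 q = 1 \<longleftrightarrow> int p dvd na ^ m - nb ^ m"
proof -
  let ?t = "sextic_exp q"
  define a b :: eis where "a = of_int na ^ ?t" and "b = of_int nb ^ ?t"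
  have "q dvd a - sextic_unit q * b" using sextic_unit(2)[OF prime_elem_q coprime_q] by (simp only: a_def b_def)
  then have "q dvd (a - sextic_unit q * b) * (a + sextic_unit q * b)" by (rule dvd_mult2)
  also have "(a - sextic_unit q * b) * (a + sextic_unit q * b) = a\<^sup>2 - (sextic_unit q)\<^sup>2 * b\<^sup>2" by (simp add: power2_eq_square algebra_simps)
  finally have 1: "q dvd a\<^sup>2 - (sextic_unit q)\<^sup>2 * b\<^sup>2" .
  have ab: "of_int (na ^ m - nb ^ m) = a\<^sup>2 - b\<^sup>2"
    by (simp add: a_def b_def m_eq mult.commute flip: power_mult)
  have b: "\<not> q dvd b\<^sup>2"
    unfolding b_def power_mult[symmetric] using prime_elem_dvd_power[OF prime_elem_q] prime_coprime_f(3)[OF prime_elem_q coprime_q] by blast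
  have "int p dvd na ^ m - nb ^ m \<longleftrightarrow> q dvd a\<^sup>2 - b\<^sup>2" unfolding q_dvd_of_int_iff[symmetric] ab ..
  also have "\<dots> \<longleftrightarrow> q dvd ((sextic_unit q)\<^sup>2 - 1) * b\<^sup>2"
  proof -
    have "a\<^sup>2 - b\<^sup>2 = (a\<^sup>2 - (sextic_unit q)\<^sup>2 * b\<^sup>2) + ((sextic_unit q)\<^sup>2 - 1) * b\<^sup>2" by (simp add: algebra_simps)
    then show ?thesis using dvd_add_right_iff[OF 1] by metis
  qed
  also have "\<dots> \<longleftrightarrow> q dvd (sextic_unit q)\<^sup>2 - 1" using b by (simp only: q_dvd_mult_iff simp_thms)
  also have "\<dots> \<longleftrightarrow> (sextic_unit q)\<^sup>2 = 1" by (rule unit_eq_iff) (simp_all add: is_unit_sextic_unit is_unit_power_iff)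
  finally show ?thesis using chi2_q by blast
qed

lemma coefficient:
  obtains a where "g_coeff \<alpha> h p = of_int a" "\<not> int p dvd a"
    "(\<exists>x. int p dvd x ^ 3 - a) \<longleftrightarrow> chi1 f q = 1 \<or> chi2 q = 1"
proof -
  define r t e where "r = primary q" and "t = sextic_exp q" and "e = (((- 1) ^ t) ^ (k - 1) :: eis)"
  define H' where "H' = r ^ (k - 1) * e * sextic_unit q"
  have co3: "coprime q 3" by (rule coprime_f_3[OF coprime_q])
  obtain u where u: "is_unit u" "r = u * q" "3 dvd r - 1" unfolding r_def by (rule primary[OF co3])
  have r_dvd: "r dvd x \<longleftrightarrow> q dvd x" for x using u by (simp add: mult_unit_dvd_iff')
  have Nr: "eis_norm r = int p" using u Nq by (simp add: eis_norm_mult eis_unit_iff_norm)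
  interpret r: split_prime p r by standard (use p p1 Nr in auto)
  have cnj_q: "prime_elem (eis_cnj q)" "coprime (eis_cnj q) (of_nat f)"
    using prime_elem_cnj[OF prime_elem_q] coprime_q by (simp_all only: coprime_cnj_f)
  have "sextic_exp (eis_cnj q) = t" by (simp add: sextic_exp_def t_def)
  then have "h (princ (toc (eis_cnj q))) = toc (eis_cnj r ^ (k - 1) * e * eis_cnj (sextic_unit q))"
    unfolding h_prime[OF cnj_q] primary_cnj[OF co3] sextic_unit_cnj[OF prime_elem_q coprime_q] by (simp only: r_def e_def)
  moreover have "eis_cnj e = e" by (simp add: e_def)
  ultimately have h2: "h (princ (toc (eis_cnj q))) = toc (eis_cnj H')" by (simp add: H'_def)
  have h1: "h (princ (toc q)) = toc H'" unfolding h_prime[OF prime_elem_q coprime_q] by (simp only: H'_def r_def e_def t_def)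
  define a where "a = 2 * eis_fst H' + eis_snd H'"
  have Ha: "of_int a = H' + eis_cnj H'" unfolding eis_trace a_def ..
  have "g_coeff \<alpha> h p = toc H' + toc (eis_cnj H')" unfolding g_coeff_split h1 h2 ..
  also have "\<dots> = toc (of_int a)" unfolding Ha by (simp only: toc_add)
  finally have g: "g_coeff \<alpha> h p = of_int a" by (simp only: toc_of_int)
  \<comment> \<open>Weight at least 2 puts the Hecke value at \<open>q\<close> into the ideal of
    \<open>q\<close>, so that modulo \<open>q\<close> the coefficient is the conjugate value
    alone.\<close>
  have "k - 1 > 0" using k by simp
  then have "r dvd H'" unfolding H'_def mult.assoc by (intro dvd_mult2 dvd_power) simp
  then have q_a: "q dvd of_int a - eis_cnj H'" unfolding Ha r_dvd by simp
  have e_cases: "e = 1 \<or> e = - 1" unfolding e_def by (simp add: power_mult[symmetric] minus_one_power_iff)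
  have unit_e: "is_unit e" using e_cases by auto
  have unit_cnj: "is_unit (eis_cnj (sextic_unit q))" using is_unit_sextic_unit by (simp add: eis_unit_iff_norm)
  have cH: "eis_cnj H' = eis_cnj r ^ (k - 1) * (e * eis_cnj (sextic_unit q))"
    using \<open>eis_cnj e = e\<close> by (simp add: H'_def mult.assoc)
  have "\<not> q dvd eis_cnj H'"
  proof
    assume "q dvd eis_cnj H'"
    then have "q dvd eis_cnj r ^ (k - 1)" unfolding cH by (simp only: dvd_mult_unit_iff[OF unit_prod[OF unit_e unit_cnj]])
    then have "r dvd eis_cnj r" unfolding r_dvd by (rule prime_elem_dvd_power[OF prime_elem_q])
    then show False using not_dvd_cnj[OF p p1 Nr] by blast
  qed
  then have a: "\<not> int p dvd a"
    unfolding q_dvd_of_int_iff[symmetric] using q_a dvd_diffD1 dvd_diff by (metis add_diff_cancel_left' diff_diff_eq2 dvd_diff_right_iff)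
  have "(\<exists>x. int p dvd x ^ 3 - a) \<longleftrightarrow> q dvd of_int (a ^ m - 1)" unfolding q_dvd_of_int_iff by (rule cube_iff[OF a])
  also have "of_int (a ^ m - 1) = (of_int a ^ m - 1 :: eis)" by simp
  also have "q dvd of_int a ^ m - 1 \<longleftrightarrow> q dvd eis_cnj (sextic_unit q) ^ m - 1"
  proof -
    have 1: "q dvd of_int a ^ m - eis_cnj H' ^ m" using q_a diff_dvd_power_diff dvd_trans by blast
    \<comment> \<open>In the m-th power the sign disappears because m is even, and the conjugate
      generator because it is a cube modulo \<open>q\<close>, whatever the weight. Only the sextic
      unit is left.\<close>
    have "e ^ m = 1" using e_cases m_even by auto
    then have "eis_cnj H' ^ m = (eis_cnj r ^ m) ^ (k - 1) * eis_cnj (sextic_unit q) ^ m"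
      unfolding cH by (simp add: power_mult_distrib mult.commute flip: power_mult)
    moreover have "q dvd (eis_cnj r ^ m) ^ (k - 1) - 1"
    proof -
      have "q dvd eis_cnj r ^ m - 1" using r.cnj_q_is_cube[OF u(3)] unfolding r_dvd .
      moreover have "eis_cnj r ^ m - 1 dvd (eis_cnj r ^ m) ^ (k - 1) - 1" using diff_dvd_power_diff[of _ 1 "k - 1"] by simp
      ultimately show ?thesis by (rule dvd_trans)
    qed
    ultimately have 2: "q dvd eis_cnj H' ^ m - eis_cnj (sextic_unit q) ^ m"
      by (metis dvd_mult2 left_diff_distrib mult_1)
    have "of_int a ^ m - 1 = ((of_int a ^ m - eis_cnj H' ^ m) + (eis_cnj H' ^ m - eis_cnj (sextic_unit q) ^ m)) + (eis_cnj (sextic_unit q) ^ m - 1)" by simp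
    then show ?thesis using dvd_add_right_iff[OF dvd_add[OF 1 2]] by metis
  qed
  also have "\<dots> \<longleftrightarrow> eis_cnj (sextic_unit q) ^ m = 1" by (rule unit_eq_iff) (simp_all add: unit_cnj is_unit_power_iff)
  also have "\<dots> \<longleftrightarrow> eis_cnj (sextic_unit q ^ m) = eis_cnj 1" by (simp only: eis_cnj_power eis_cnj_simps)
  \<comment> \<open>Since m = 2t, the power is the t-th power of a cube root of unity. It is 1 if 3
    divides t, which by p = 6t + 1 means p congruent to 1 modulo 9, or if the cube root itself is
    1.\<close>
  also have "\<dots> \<longleftrightarrow> ((sextic_unit q)\<^sup>2) ^ t = 1" unfolding eis_cnj_eq_iff m_eq t_def by (simp only: power_mult)
  also have "\<dots> \<longleftrightarrow> 3 dvd t \<or> (sextic_unit q)\<^sup>2 = 1"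
    by (rule cube_root_power_eq_1_iff) (simp add: eis_unit_power_6[OF is_unit_sextic_unit] flip: power_mult)
  also have "\<dots> \<longleftrightarrow> chi1 f q = 1 \<or> chi2 q = 1" unfolding chi1_q chi2_q t_def ..
  finally have "(\<exists>x. int p dvd x ^ 3 - a) \<longleftrightarrow> chi1 f q = 1 \<or> chi2 q = 1" .
  from that[OF g a this] show ?thesis .
qed

lemma coefficient_nonzero: "\<not> rat_cong p (g_coeff \<alpha> h p) 0"
  using coefficient rat_cong_of_int[OF p] by (metis diff_zero)

lemma coefficient_cube:
  "(\<exists>x. \<not> int p dvd x \<and> rat_cong p (g_coeff \<alpha> h p) (x ^ 3)) \<longleftrightarrow> chi1 f q = 1 \<or> chi2 q = 1"
proof (rule coefficient)
  fix a assume a: "g_coeff \<alpha> h p = of_int a" "\<not> int p dvd a"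
    "(\<exists>x. int p dvd x ^ 3 - a) \<longleftrightarrow> chi1 f q = 1 \<or> chi2 q = 1"
  have "\<not> int p dvd x" if x: "int p dvd a - x ^ 3" for x
  proof
    assume "int p dvd x"
    then have "int p dvd x ^ 3" by (simp add: power3_eq_cube)
    from dvd_add[OF x this] show False using a(2) by simp
  qed
  then have "(\<exists>x. \<not> int p dvd x \<and> rat_cong p (g_coeff \<alpha> h p) (x ^ 3)) \<longleftrightarrow> (\<exists>x. int p dvd a - x ^ 3)"
    unfolding a(1) rat_cong_of_int[OF p] by blast
  also have "\<dots> \<longleftrightarrow> (\<exists>x. int p dvd x ^ 3 - a)" by (simp only: dvd_diff_commute)
  finally show ?thesis using a(3) by simp
qed

text \<open>The integer na nb^2 equals \<alpha> nb^3 and so represents \<alpha> modulo cubes; the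
  bound for primes modulo which an integer is a cube then applies.\<close>

lemma chi2_trivial_imp_cube:
  assumes "chi2 q = 1" shows "\<exists>x. int p dvd x ^ 3 - na * nb\<^sup>2"
proof -
  have nb: "\<not> int p dvd nb" and na: "\<not> int p dvd na" using not_dvd_divisor_f dvd_f by blast+
  have "\<not> int p dvd na * nb\<^sup>2" using na nb by (simp add: power2_eq_square p_dvd_mult_iff)
  moreover have "int p dvd (na * nb\<^sup>2) ^ m - 1"
  proof -
    have "nb ^ (p - 1) = nb ^ m * (nb\<^sup>2) ^ m" unfolding p_minus_1 by (simp add: power_mult[symmetric] flip: power_add)
    then have "(na * nb\<^sup>2) ^ m - 1 = (na ^ m - nb ^ m) * (nb\<^sup>2) ^ m + (nb ^ (p - 1) - 1)"
      by (simp add: power_mult_distrib algebra_simps)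
    moreover have "int p dvd (na ^ m - nb ^ m) * (nb\<^sup>2) ^ m + (nb ^ (p - 1) - 1)"
      using assms fermat_int[OF nb] by (intro dvd_add dvd_mult2) (simp_all only: chi2_q_iff)
    ultimately show ?thesis by metis
  qed
  ultimately show ?thesis using cube_iff by blast
qed

text \<open>The relation na d^3 = c^3 nb shows that p divides neither c nor d. After that Fermat
  makes the m-th powers of both cubes equal to 1.\<close>

lemma chi2_of_cube:
  assumes "\<alpha> = \<beta> ^ 3" shows "chi2 q = 1"
proof -
  obtain c d where cd: "quotient_of \<beta> = (c, d)" by (cases "quotient_of \<beta>")
  have d: "d > 0" "coprime c d" "\<beta> = of_int c / of_int d"
    using quotient_of_denom_pos[OF cd] quotient_of_coprime[OF cd] quotient_of_div[OF cd] .
  have "of_int na / of_int nb = (of_int c / of_int d :: rat) ^ 3" using trans[OF alpha_eq[symmetric] assms] d(3) by metis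
  then have "(of_int (na * d ^ 3) :: rat) = of_int (c ^ 3 * nb)"
    using nb_pos d(1) by (simp add: power_divide field_simps)
  then have e: "na * d ^ 3 = c ^ 3 * nb" by (simp only: of_int_eq_iff)
  have nb: "\<not> int p dvd nb" and na: "\<not> int p dvd na" using not_dvd_divisor_f dvd_f by blast+
  have cube: "int p dvd x ^ 3 \<longleftrightarrow> int p dvd x" for x by (simp add: power3_eq_cube p_dvd_mult_iff)
  have "int p dvd na * d ^ 3 \<longleftrightarrow> int p dvd c ^ 3 * nb" unfolding e ..
  then have "int p dvd d \<longleftrightarrow> int p dvd c" using na nb by (simp only: p_dvd_mult_iff cube simp_thms)
  moreover have "\<not> (int p dvd c \<and> int p dvd d)" using d(2) p by (metis coprime_common_divisor not_prime_unit prime_nat_int_transfer)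
  ultimately have nd: "\<not> int p dvd c" "\<not> int p dvd d" by blast+
  have x3: "(x ^ 3) ^ m = x ^ (p - 1)" for x :: int unfolding p_minus_1 by (rule power_mult[symmetric])
  have "(na * d ^ 3) ^ m = (c ^ 3 * nb) ^ m" unfolding e ..
  then have e': "na ^ m * d ^ (p - 1) = c ^ (p - 1) * nb ^ m" unfolding power_mult_distrib x3 .
  have "na ^ m - nb ^ m = (c ^ (p - 1) - 1) * nb ^ m - (d ^ (p - 1) - 1) * na ^ m"
    using e' by (simp add: algebra_simps)
  moreover have "int p dvd (c ^ (p - 1) - 1) * nb ^ m - (d ^ (p - 1) - 1) * na ^ m"
    by (rule dvd_diff[OF dvd_mult2[OF fermat_int[OF nd(1)]] dvd_mult2[OF fermat_int[OF nd(2)]]])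
  ultimately show ?thesis unfolding chi2_q_iff by metis
qed

end

section \<open>Densities\<close>

text \<open>The analogue of \<open>log_density\<close> for weights on primes of \<int>[\<omega>].
  Boundedness of the weight is included because linear combinations need summability.\<close>

definition eis_log_sum :: "(eis \<Rightarrow> real) \<Rightarrow> real \<Rightarrow> bool" where
  "eis_log_sum w d \<longleftrightarrow> (\<exists>B. \<forall>q. \<bar>w q\<bar> \<le> B) \<and>
     (\<exists>C. \<forall>s. 1 < s \<longrightarrow> s < 2 \<longrightarrow> \<bar>eis_prime_sum w s - d * ln (1 / (s - 1))\<bar> \<le> C)"

lemma eis_log_sum_one: "eis_log_sum (\<lambda>q. 1) 1"
proof -
  obtain C where "\<And>s. 1 < s \<Longrightarrow> s < 2 \<Longrightarrow> \<bar>eis_prime_sum (\<lambda>q. 1) s - ln (1 / (s - 1))\<bar> \<le> C"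
    using eis_prime_sum_one by blast
  then show ?thesis unfolding eis_log_sum_def by (intro conjI exI[of _ 1] exI[of _ C]) auto
qed

lemma eis_log_sum_character:
  assumes "cubic_character f \<eta>" "coprime y (of_nat f)" "\<eta> y \<noteq> 1"
  shows "eis_log_sum (\<lambda>q. Re (\<eta> q)) 0"
proof -
  obtain C where "\<And>s. 1 < s \<Longrightarrow> s < 2 \<Longrightarrow> \<bar>eis_prime_sum (\<lambda>q. Re (\<eta> q)) s\<bar> \<le> C"
    using cubic_character_prime_sum[OF assms] by blast
  moreover have "\<bar>Re (\<eta> q)\<bar> \<le> 1" for q using abs_Re_le_cmod cubic_character_norm[OF assms(1)] by (rule order_trans)
  ultimately show ?thesis unfolding eis_log_sum_def by (intro conjI exI[of _ 1] exI[of _ C]) auto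
qed

lemma eis_log_sum_add:
  assumes "eis_log_sum w d" "eis_log_sum w' d'"
  shows "eis_log_sum (\<lambda>q. w q + c * w' q) (d + c * d')"
proof -
  obtain B B' where B: "\<And>q. \<bar>w q\<bar> \<le> B" "\<And>q. \<bar>w' q\<bar> \<le> B'" using assms unfolding eis_log_sum_def by blast
  obtain C C' where C: "\<And>s. 1 < s \<Longrightarrow> s < 2 \<Longrightarrow> \<bar>eis_prime_sum w s - d * ln (1 / (s - 1))\<bar> \<le> C"
    "\<And>s. 1 < s \<Longrightarrow> s < 2 \<Longrightarrow> \<bar>eis_prime_sum w' s - d' * ln (1 / (s - 1))\<bar> \<le> C'"
    using assms unfolding eis_log_sum_def by blast
  have "\<bar>w q + c * w' q\<bar> \<le> B + \<bar>c\<bar> * B'" for q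
    using abs_triangle_ineq[of "w q" "c * w' q"] B(1)[of q] mult_left_mono[OF B(2)[of q], of "\<bar>c\<bar>"] by (simp add: abs_mult)
  moreover have "\<bar>eis_prime_sum (\<lambda>q. w q + c * w' q) s - (d + c * d') * ln (1 / (s - 1))\<bar> \<le> C + \<bar>c\<bar> * C'"
    if s: "1 < s" "s < 2" for s
  proof -
    define L where "L = ln (1 / (s - 1))"
    have sw: "(\<lambda>q. w q * eis_pow s q) summable_on {q. prime q}" "(\<lambda>q. w' q * eis_pow s q) summable_on {q. prime q}"
      using eis_prime_sum_summable[where B = B] eis_prime_sum_summable[where B = B'] s B by simp_all
    have "eis_prime_sum (\<lambda>q. w q + c * w' q) s = infsum (\<lambda>q. w q * eis_pow s q + c * (w' q * eis_pow s q)) {q. prime q}"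
      unfolding eis_prime_sum_def by (rule infsum_cong) (simp add: algebra_simps)
    also have "\<dots> = eis_prime_sum w s + c * eis_prime_sum w' s"
      unfolding eis_prime_sum_def using sw
      by (simp only: infsum_add summable_on_cmult_right infsum_cmult_right)
    finally have "eis_prime_sum (\<lambda>q. w q + c * w' q) s - (d + c * d') * L = (eis_prime_sum w s - d * L) + c * (eis_prime_sum w' s - d' * L)"
      by (simp add: algebra_simps)
    moreover have "\<bar>(eis_prime_sum w s - d * L) + c * (eis_prime_sum w' s - d' * L)\<bar> \<le> C + \<bar>c\<bar> * C'"
      using abs_triangle_ineq[of "eis_prime_sum w s - d * L" "c * (eis_prime_sum w' s - d' * L)"]
        C(1)[OF s] mult_left_mono[OF C(2)[OF s], of "\<bar>c\<bar>"] unfolding L_def by (simp add: abs_mult)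
    ultimately show ?thesis unfolding L_def by simp
  qed
  ultimately show ?thesis unfolding eis_log_sum_def by blast
qed

lemma eis_log_sum_finite:
  assumes fin: "finite {q. prime q \<and> w q \<noteq> 0}" and B: "\<And>q. \<bar>w q\<bar> \<le> B"
  shows "eis_log_sum w 0"
proof -
  define A where "A = {q. prime q \<and> w q \<noteq> 0}"
  have "\<bar>eis_prime_sum w s - 0 * ln (1 / (s - 1))\<bar> \<le> real (card A) * B" if s: "1 < s" "s < 2" for s
  proof -
    have "eis_prime_sum w s = infsum (\<lambda>q. w q * eis_pow s q) A"
      unfolding eis_prime_sum_def by (rule infsum_cong_neutral) (auto simp: A_def)
    also have "\<dots> = (\<Sum>q\<in>A. w q * eis_pow s q)" using fin by (simp add: A_def)
    finally have "\<bar>eis_prime_sum w s\<bar> \<le> (\<Sum>q\<in>A. \<bar>w q * eis_pow s q\<bar>)" by simp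
    also have "\<dots> \<le> (\<Sum>q\<in>A. B)"
    proof (rule sum_mono)
      fix q assume "q \<in> A"
      then have "eis_norm q \<ge> 2" using eis_prime_norm_ge_2 by (simp add: A_def)
      moreover from this have "q \<noteq> 0" by auto
      ultimately have "eis_pow s q \<le> 1" using powr_mono[of "- s" 0 "real_of_int (eis_norm q)"] s by simp
      then have "\<bar>w q\<bar> * eis_pow s q \<le> B * 1" using B[of q] by (intro mult_mono) auto
      then show "\<bar>w q * eis_pow s q\<bar> \<le> B" by (simp add: abs_mult)
    qed
    finally show ?thesis by simp
  qed
  then show ?thesis unfolding eis_log_sum_def using B by blast
qed

lemma finite_eis_norm_le: "finite {x. eis_norm x \<le> n}"
proof (rule finite_subset[OF _ finite_eis_box[of "nat (2 * n)"]])
  show "{x. eis_norm x \<le> n} \<subseteq> {x. eis_max x \<le> nat (2 * n)}"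
  proof
    fix x assume "x \<in> {x. eis_norm x \<le> n}"
    then have "3 * (int (eis_max x))\<^sup>2 \<le> 4 * n" using eis_norm_ge_max[of x] by simp
    moreover have "int (eis_max x) * 1 \<le> int (eis_max x) * int (eis_max x)" if "eis_max x \<noteq> 0"
      using that by (intro mult_left_mono) (auto simp: Suc_le_eq)
    then have "int (eis_max x) \<le> (int (eis_max x))\<^sup>2" by (cases "eis_max x = 0") (simp_all add: power2_eq_square Suc_le_eq)
    ultimately have "int (eis_max x) \<le> 2 * n" by linarith
    then have "nat (int (eis_max x)) \<le> nat (2 * n)" by (rule nat_mono)
    then show "x \<in> {x. eis_max x \<le> nat (2 * n)}" by simp
  qed
qed

text \<open>The coefficients are the Fourier coefficients on \<open>\<mu>\<^sub>3 \<times> \<mu>\<^sub>3\<close>; the constant one is the density 5/9.\<close>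

lemma cube_roots_indicator:
  fixes z1 z2 :: complex
  assumes "z1 ^ 3 = 1" "z2 ^ 3 = 1"
  shows "5 / 9 + 4 / 9 * Re z1 + 4 / 9 * Re z2 - 2 / 9 * Re (z1 * z2) - 2 / 9 * Re (z1 * (z2 * z2)) =
    (if z1 = 1 \<or> z2 = 1 then 1 else 0)"
proof -
  have "z2 * z2 = cnj z2" using cube_root_of_unity(4)[OF assms(2)] by (simp add: power2_eq_square)
  then have "Re (z1 * z2) + Re (z1 * (z2 * z2)) = 2 * (Re z1 * Re z2)" by simp
  then have e: "5 / 9 + 4 / 9 * Re z1 + 4 / 9 * Re z2 - 2 / 9 * Re (z1 * z2) - 2 / 9 * Re (z1 * (z2 * z2)) =
    5 / 9 + 4 / 9 * Re z1 + 4 / 9 * Re z2 - 4 / 9 * (Re z1 * Re z2)" by linarith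
  show ?thesis unfolding e using cube_root_of_unity(2)[OF assms(1)] cube_root_of_unity(2)[OF assms(2)]
    by (cases "z1 = 1"; cases "z2 = 1") auto
qed

context psi_twist
begin

section \<open>Nontrivial characters and the resulting densities\<close>

lemma twist_splitI:
  assumes "prime p" "p mod 3 = 1" "\<not> p dvd f" "eis_norm q = int p"
  shows "twist_split k \<alpha> h y0 p q"
  by (intro twist_split.intro twist_split_axioms.intro psi_twist_axioms split_prime.intro assms)

lemma large_prime_not_dvd_f: "p > f \<Longrightarrow> \<not> p dvd f"
  using f_gt by (auto dest: dvd_imp_le)

text \<open>The element is a rational integer, so \<open>chi2\<close> is 1 there. Let g be the part
  of f prime to 3. Then n = 1 + 3g is prime to 3 and to g, and its norm n^2 = 1 + 3 (2g + 3g^2) has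
  exponent 2g modulo 3, which is nonzero.\<close>

lemma test_element:
  obtains n where "coprime (of_int n) (of_nat f :: eis)" "chi1 f (of_int n) \<noteq> 1" "chi2 (of_int n) = 1"
proof -
  have "f \<noteq> 0" "\<not> is_unit (3 :: nat)" using f_gt by simp_all
  then obtain g where g: "f = 3 ^ multiplicity 3 f * g" "\<not> 3 dvd g" by (rule multiplicity_decompose')
  define n where "n = 1 + 3 * int g"
  have "coprime n (3 * int g)"
  proof (rule coprimeI)
    fix c assume "c dvd n" "c dvd 3 * int g"
    then have "c dvd n - 3 * int g" by (rule dvd_diff)
    then show "is_unit c" by (simp add: n_def)
  qed
  then have "coprime n 3" "coprime n (int g)" by simp_all
  then have "coprime n (3 ^ multiplicity 3 f * int g)" by simp
  moreover have "3 ^ multiplicity 3 f * int g = int f" using arg_cong[OF g(1), of int] by (simp only: of_nat_mult of_nat_power of_nat_numeral)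
  ultimately have "coprime n (int f)" by (simp only:)
  from coprime_of_int_eis[OF this] have c: "coprime (of_int n) (of_nat f :: eis)" by simp
  define i where "i = 2 * g + 3 * (g * g)"
  have "n\<^sup>2 - 1 = 3 * int i" by (simp add: n_def i_def power2_eq_square algebra_simps)
  then have "chi1 f (of_int n) = omega3 ^ i" using c by (simp add: chi1_def)
  moreover have "\<not> 3 dvd i" using g(2) unfolding i_def by presburger
  ultimately have "chi1 f (of_int n) \<noteq> 1" by (simp only: omega3_power_eq_1_iff not_False_eq_True)
  from that[OF c this chi2_int[OF c]] show ?thesis .
qed

lemma log_density_unramified: "log_density {p \<in> split_primes. \<not> p dvd f} (1 / 2)"
  by (rule log_density_cong[OF log_density_split_primes, of f]) (use large_prime_not_dvd_f in auto)

lemma chi2_nontrivial: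
  assumes noncube: "\<nexists>\<beta> :: rat. \<alpha> = \<beta> ^ 3"
  obtains x where "coprime x (of_nat f)" "chi2 x \<noteq> 1"
proof -
  have "\<exists>x. coprime x (of_nat f) \<and> chi2 x \<noteq> 1"
  proof (rule ccontr)
    assume "\<not> ?thesis"
    then have triv: "chi2 x = 1" if "coprime x (of_nat f)" for x using that by blast
    have nc: "\<nexists>\<beta> :: rat. of_int (na * nb\<^sup>2) = \<beta> ^ 3"
    proof
      assume "\<exists>\<beta> :: rat. of_int (na * nb\<^sup>2) = \<beta> ^ 3"
      then obtain \<beta> :: rat where b: "of_int (na * nb\<^sup>2) = \<beta> ^ 3" by blast
      have "(\<beta> / of_int nb) ^ 3 = of_int na / of_int nb"
        unfolding power_divide b[symmetric] using nb_pos by (simp add: power2_eq_square power3_eq_cube)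
      from trans[OF alpha_eq this[symmetric]] show False using noncube by blast
    qed
    have "(1 / 2 :: real) \<le> 1 / 3"
    proof (rule cube_mod_primes_density[OF nc log_density_unramified])
      fix p assume "p \<in> {p \<in> split_primes. \<not> p dvd f}"
      then have pp: "prime p" "p mod 3 = 1" "\<not> p dvd f" by auto
      obtain q where q: "eis_norm q = int p" using split_prime_exists[OF pp(1,2)] by blast
      interpret T: twist_split k \<alpha> h y0 p q by (rule twist_splitI[OF pp q])
      obtain x where x: "int p dvd x ^ 3 - na * nb\<^sup>2" using T.chi2_trivial_imp_cube[OF triv[OF T.coprime_q]] by blast
      obtain t where t: "int p dvd t\<^sup>2 + t + 1" using cube_root_of_unity_mod[OF pp(1,2)] by blast
      have "\<not> int p dvd na * nb\<^sup>2"
        using T.not_dvd_divisor_f[OF dvd_f(1)] T.not_dvd_divisor_f[OF dvd_f(2)] by (simp add: power2_eq_square T.p_dvd_mult_iff)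
      then show "\<exists>\<rho>. \<rho> \<subseteq> {0..<int p} \<and> card \<rho> = 3 \<and> (\<forall>r\<in>\<rho>. int p dvd r ^ 3 - na * nb\<^sup>2)"
        using three_roots[OF _ _ t x] pp(1) T.p_gt by simp
    qed
    then show False by simp
  qed
  then show ?thesis using that by blast
qed

abbreviation cube_coefficients :: "nat set" where
  "cube_coefficients \<equiv> {p \<in> split_primes. \<not> p dvd f \<and> (\<exists>x. \<not> int p dvd x \<and> rat_cong p (g_coeff \<alpha> h p) (x ^ 3))}"

lemma log_density_cube_coefficients:
  assumes noncube: "\<nexists>\<beta> :: rat. \<alpha> = \<beta> ^ 3"
  shows "log_density cube_coefficients (5 / 18)"
proof -
  have f0: "f > 0" using f_gt by simp
  note c1 = chi1_cubic_character[OF f0 nine_dvd_f] and c2 = chi2_cubic_character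
  note c3 = cubic_character_mult[OF c1 c2] and c4 = cubic_character_mult[OF c1 cubic_character_mult[OF c2 c2]]
  obtain n where n: "coprime (of_int n) (of_nat f :: eis)" "chi1 f (of_int n) \<noteq> 1" "chi2 (of_int n) = 1"
    by (rule test_element)
  obtain y where y: "coprime y (of_nat f)" "chi2 y \<noteq> 1" by (rule chi2_nontrivial[OF noncube])
  \<comment> \<open>Both characters vanish at the finitely many primes dividing f, where the Fourier
    expansion would leave its constant term 5/9. Subtracting 5/9 times \<open>w0\<close> removes it
    at bounded cost.\<close>
  define w0 where "w0 = (\<lambda>q :: eis. if coprime q (of_nat f) then 0 else 1 :: real)"
  define w where "w = (\<lambda>q. if coprime q (of_nat f) \<and> (chi1 f q = 1 \<or> chi2 q = 1) then 1 else 0 :: real)"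
  have "finite {q. prime q \<and> w0 q \<noteq> 0}"
  proof (rule finite_subset[OF _ finite_eis_norm_le[of "(int f)\<^sup>2"]])
    show "{q. prime q \<and> w0 q \<noteq> 0} \<subseteq> {x. eis_norm x \<le> (int f)\<^sup>2}"
    proof
      fix q assume "q \<in> {q. prime q \<and> w0 q \<noteq> 0}"
      then have q: "prime q" "\<not> coprime q (of_nat f)" by (auto simp: w0_def split: if_splits)
      then have "q dvd of_int (int f)" using prime_imp_coprime[of q "of_nat f"] by auto
      then have "eis_norm q dvd (int f)\<^sup>2" using eis_norm_dvd eis_norm_of_int by metis
      then show "q \<in> {x. eis_norm x \<le> (int f)\<^sup>2}" using zdvd_imp_le f0 by simp
    qed
  qed
  then have s0: "eis_log_sum w0 0" by (rule eis_log_sum_finite[where B = 1]) (simp add: w0_def)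
  have s1: "eis_log_sum (\<lambda>q. Re (chi1 f q)) 0" by (rule eis_log_sum_character[OF c1 n(1,2)])
  have s2: "eis_log_sum (\<lambda>q. Re (chi2 q)) 0" by (rule eis_log_sum_character[OF c2 y])
  \<comment> \<open>The same integer is a witness for both products: \<open>chi2\<close> is 1 there,
    so each product takes the value of \<open>chi1\<close>.\<close>
  have s3: "eis_log_sum (\<lambda>q. Re (chi1 f q * chi2 q)) 0"
    by (rule eis_log_sum_character[OF c3 n(1)]) (use n in simp)
  have s4: "eis_log_sum (\<lambda>q. Re (chi1 f q * (chi2 q * chi2 q))) 0"
    by (rule eis_log_sum_character[OF c4 n(1)]) (use n in simp)
  have zero: "eis_log_sum (\<lambda>q. 0) 0" by (rule eis_log_sum_finite[where B = 0]) simp_all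
  note eis_log_sum_add[OF eis_log_sum_add[OF eis_log_sum_add[OF eis_log_sum_add[OF eis_log_sum_add[OF eis_log_sum_add[OF zero
    eis_log_sum_one, of "5 / 9"] s1, of "4 / 9"] s2, of "4 / 9"] s3, of "- 2 / 9"] s4, of "- 2 / 9"] s0, of "- 5 / 9"]
  moreover have "(\<lambda>q. 0 + 5 / 9 * 1 + 4 / 9 * Re (chi1 f q) + 4 / 9 * Re (chi2 q) + - 2 / 9 * Re (chi1 f q * chi2 q) +
      - 2 / 9 * Re (chi1 f q * (chi2 q * chi2 q)) + - 5 / 9 * w0 q) = w"
  proof
    fix q
    show "0 + 5 / 9 * 1 + 4 / 9 * Re (chi1 f q) + 4 / 9 * Re (chi2 q) + - 2 / 9 * Re (chi1 f q * chi2 q) +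
      - 2 / 9 * Re (chi1 f q * (chi2 q * chi2 q)) + - 5 / 9 * w0 q = w q"
    proof (cases "coprime q (of_nat f)")
      case True
      then have "chi1 f q ^ 3 = 1" "chi2 q ^ 3 = 1" using c1 c2 unfolding cubic_character_def by blast+
      from cube_roots_indicator[OF this] show ?thesis using True by (simp add: w_def w0_def)
    next
      case False
      then have "chi1 f q = 0" "chi2 q = 0" using c1 c2 unfolding cubic_character_def by blast+
      then show ?thesis using False by (simp add: w_def w0_def)
    qed
  qed
  ultimately have "eis_log_sum w (5 / 9)" by (simp only:) simp
  then obtain C where "\<And>s. 1 < s \<Longrightarrow> s < 2 \<Longrightarrow> \<bar>eis_prime_sum w s - 5 / 9 * ln (1 / (s - 1))\<bar> \<le> C"
    unfolding eis_log_sum_def by blast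
  then have "log_density cube_coefficients (5 / 9 / 2)"
  proof (rule log_density_of_weights[rotated 3])
    show "\<bar>w q\<bar> \<le> 1" for q by (simp add: w_def)
    show "cube_coefficients \<subseteq> split_primes" by blast
    fix p q assume pq: "prime p" "p mod 3 = 1" "eis_norm q = int p"
    show "w q = (if p \<in> cube_coefficients then 1 else 0)"
    proof (cases "p dvd f")
      case True
      interpret split_prime p q by standard (use pq in auto)
      have "q dvd of_int (int f)" unfolding q_dvd_of_int_iff using True by simp
      then have "\<not> coprime q (of_nat f)" using coprime_f_not_dvd[OF prime_elem_q, of "of_nat f"] by auto
      then show ?thesis using True by (simp add: w_def)
    next
      case False
      interpret T: twist_split k \<alpha> h y0 p q by (rule twist_splitI[OF pq(1,2) False pq(3)])
      have "p \<in> cube_coefficients \<longleftrightarrow> chi1 f q = 1 \<or> chi2 q = 1"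
        unfolding T.coefficient_cube[symmetric] using pq(1,2) False by blast
      then show ?thesis using T.coprime_q by (simp only: w_def simp_thms)
    qed
  qed
  then show ?thesis by simp
qed

text \<open>Primes up to f are finite in number and do not change densities. The quotients are
  (1/2)/(1/2) = 1 and (5/18)/(1/2) = 5/9.\<close>

lemma has_delta_newform:
  assumes qc: "\<And>n. coprime (int n) (3 * rat_supp \<alpha>) \<Longrightarrow> qcoeff F n = g_coeff \<alpha> h n"
  shows "\<exists>\<beta> :: rat. \<alpha> = \<beta> ^ 3 \<Longrightarrow> has_delta 3 F 1" "\<nexists>\<beta> :: rat. \<alpha> = \<beta> ^ 3 \<Longrightarrow> has_delta 3 F (5 / 9)"
proof -
  let ?D1 = "{p. prime p \<and> [p = 1] (mod 3) \<and> (\<exists>x. \<not> int p dvd x \<and> rat_cong p (qcoeff F p) (x ^ 3))}"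
  let ?D2 = "{p. prime p \<and> [p = 1] (mod 3) \<and> \<not> rat_cong p (qcoeff F p) 0}"
  have cong: "[p = 1] (mod 3) \<longleftrightarrow> p mod 3 = 1" for p :: nat by (simp add: cong_def)
  have qp: "qcoeff F p = g_coeff \<alpha> h p \<and> \<not> rat_cong p (g_coeff \<alpha> h p) 0 \<and>
      ((\<exists>\<beta> :: rat. \<alpha> = \<beta> ^ 3) \<longrightarrow> (\<exists>x. \<not> int p dvd x \<and> rat_cong p (g_coeff \<alpha> h p) (x ^ 3)))"
    if pp: "prime p" "p mod 3 = 1" "\<not> p dvd f" for p
  proof -
    obtain q where q: "eis_norm q = int p" using split_prime_exists[OF pp(1,2)] by blast
    interpret T: twist_split k \<alpha> h y0 p q by (rule twist_splitI[OF pp q])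
    show ?thesis using qc[OF T.coprime_p_supp] T.coefficient_nonzero T.chi2_of_cube unfolding T.coefficient_cube by blast
  qed
  have "log_density ?D2 (1 / 2)"
  proof (rule log_density_cong[OF log_density_unramified])
    fix p assume "prime p" "p > f"
    then show "p \<in> {p \<in> split_primes. \<not> p dvd f} \<longleftrightarrow> p \<in> ?D2" using qp[of p] large_prime_not_dvd_f[of p] unfolding cong by auto
  qed
  then have D2: "has_dirichlet_density ?D2 (1 / 2)" by (rule log_density_imp_dirichlet_density)
  have delta: "has_delta 3 F (d / (1 / 2))" if "log_density ?D1 d" for d
    unfolding has_delta_def using log_density_imp_dirichlet_density[OF that] D2 by (intro exI[of _ d] exI[of _ "1 / 2"]) simp
  show "has_delta 3 F 1" if b: "\<exists>\<beta> :: rat. \<alpha> = \<beta> ^ 3"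
  proof -
    have "log_density ?D1 (1 / 2)"
    proof (rule log_density_cong[OF log_density_unramified])
      fix p assume "prime p" "p > f"
      then show "p \<in> {p \<in> split_primes. \<not> p dvd f} \<longleftrightarrow> p \<in> ?D1"
        using qp[of p] large_prime_not_dvd_f[of p] b unfolding cong by auto
    qed
    from delta[OF this] show ?thesis by simp
  qed
  show "has_delta 3 F (5 / 9)" if b: "\<nexists>\<beta> :: rat. \<alpha> = \<beta> ^ 3"
  proof -
    have "log_density ?D1 (5 / 18)"
    proof (rule log_density_cong[OF log_density_cube_coefficients[OF b]])
      fix p assume "prime p" "p > f"
      then show "p \<in> cube_coefficients \<longleftrightarrow> p \<in> ?D1" using qp[of p] large_prime_not_dvd_f[of p] unfolding cong by auto
    qed
    from delta[OF this] show ?thesis by simp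
  qed
qed

end

theorem theorem4p2:
  fixes k :: nat and \<alpha> :: rat and f :: "complex \<Rightarrow> complex"
  assumes "k \<ge> 2" and "\<alpha> \<noteq> 0" and "is_f k \<alpha> f"
  shows "((\<exists>\<beta>::rat. \<alpha> = \<beta> ^ 3) \<longrightarrow> has_delta 3 f 1) \<and>
         (\<not> (\<exists>\<beta>::rat. \<alpha> = \<beta> ^ 3) \<longrightarrow> has_delta 3 f (5 / 9))"
proof -
  obtain h where h: "is_psi_twist k \<alpha> h" and qc: "\<And>n. coprime (int n) (3 * rat_supp \<alpha>) \<Longrightarrow> qcoeff f n = g_coeff \<alpha> h n"
    using assms(3) unfolding is_f_def by blast
  obtain M where M: "hecke_character M h" using h unfolding is_psi_twist_def by blast
  then have "nz_ideal M" by (simp add: hecke_character_def)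
  then obtain y0 where y0: "y0 \<noteq> 0" "M = princ (toc y0)" by (rule nz_ideal_principal)
  interpret psi_twist k \<alpha> h y0
  proof
    show "hecke_character (princ (toc y0)) h" using M y0(2) by simp
    show "h Q = psi Q ^ (k - 1) * sextic (- 1) Q ^ (k - 1) * sextic (of_rat \<alpha>) Q"
      if "nz_prime Q" "of_int (6 * rat_supp \<alpha>) \<notin> Q" for Q
      using h that unfolding is_psi_twist_def by blast
  qed (use assms y0 in auto)
  show ?thesis using has_delta_newform[OF qc] by blast
qed

end
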